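(* Infinite horizon. There is a unique $v\in\mathcal A_d$ such that for all $x\in\mathbb R^d$ $$v(x)=\sup_{\tau\in\mathcal T}\mathsf E_x\left[e^{-r\tau}\max\{\varphi(X_\tau),(\Lambda v)(X_\tau)\}\right].$$ Moreover, the stopping time $\tau_*=\inf\{s\ge 0:\ v(X_s)=\max[\varphi(X_s),(\Lambda v)(X_s)]\}$ is optimal (attains the supremum) in this problem; and for any $x\in\mathbb R^d$ the process $t\mapsto e^{-rt}v(X_t)$, $t\in[0,\infty]$, is a right-continuous non-negative $\mathsf P_x$-supermartingale and the process $t\mapsto e^{-r(t\wedge\tau_* )}v(X_{t\wedge\tau_*})$, $t\in[0,\infty)$, is a right-continuous non-negative $\mathsf P_x$-martingale. Finite horizon. The same holds in the finite-horizon case: there is a unique $v\in\mathcal A_d$ such that for all $z=(t,x)\in[0,T]\times\mathbb R^{d-1}$, $v(z)=\sup_{\tau}\mathsf E_z[e^{-r\tau}\max\{\varphi(X_\tau),(\Lambda v)(X_\tau)\}]$, the supremum being over stopping times $\tau\le T-t$; the stopping time $\tau_*=\inf\{s\in[0,T-t]:\ v(X_s)=\max[\varphi(X_s),(\Lambda v)(X_s)]\}$ is optimal; and for every such $z$, $s\mapsto e^{-rs}v(X_s)$ and $s\mapsto e^{-r(s\wedge\tau_* )}v(X_{s\wedge\tau_*})$, $s\in[0,T-t]$, are respectively a right-continuous non-negative $\mathsf P_z$-supermartingale and a right-continuous non-negative $\mathsf P_z$-martingale.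
   Context: Common setting. $(\Omega,\mathcal F,\mathsf P)$ is a probability space with a right-continuous complete filtration $\mathbb F=(\mathcal F_t)_{t\ge 0}$, $\mathcal F_\infty=\bigvee_{t\ge0}\mathcal F_t=\mathcal F$. $X=(X_t)_{t\ge0}$ is a right-continuous, quasi left-continuous (left-continuous over stopping times) strong Markov process with respect to $\mathbb F$, with values in $\mathbb R^d$, realised as a stochastic flow $(t,x)\mapsto X^x_t$ with $X^x_0=x$ a.s. One writes $\mathsf P_x(\cdot)=\mathsf P(\cdot|X_0=x)$, $\mathsf E_x[f(X_\cdot)]=\mathsf E[f(X^x_\cdot)]$, and $\mathsf E_{X_\tau}[f(X_\cdot)]=\mathsf E[f(X_{\tau+\cdot})|\mathcal F_\tau]$ for stopping times $\tau$. $|\cdot|_d$ is the Euclidean norm on $\mathbb R^d$. $r>0$ and $p\in(0,1)$ are constants; $F$ is the cumulative distribution function of a non-negative random variable $\vartheta$ (integrals against $F(\mathrm dt)$ include a possible atom at $0$). Infinite-horizon case. $\mathcal T$ is the set of $\mathbb F$-stopping times with values in $[0,\infty]$. Convention: $f(X_\tau)\mathbf 1_{\{\tau=\infty\}}=\limsup_{t\to\infty}f(X_t)\mathbf 1_{\{\tau=\infty\}}$, with $e^{-r\cdot\infty}=0$ and $0\cdot\infty=0$. $\mathcal A_d$ is the Banach space of continuous $f:\mathbb R^d\to[0,\infty)$ with $\|f\|_{\mathcal A_d}<\infty$, where $\|f\|_{\mathcal A_d}^2=\sup_{x\in\mathbb R^d}|f(x)|^2/(1+|x|_d^2)$ (norm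 of differences defined likewise). Standing assumptions: the flow $x\mapsto X^x_t$ is a.s. continuous for all $t\ge0$; (i) there is $\rho\in(0,1)$ such that $e^{-2r(1-\rho)t}(1+|X_t|_d^2)$, $t\ge0$, is a $\mathsf P_x$-supermartingale for every $x$; (ii) $\sup_{x\in K}\mathsf E_x[\sup_{t\ge0}e^{-rt}|X_t|_d]<\infty$ for every compact $K\subset\mathbb R^d$; (iii) if $x_n\to x$ then $\mathsf E[\sup_{t\ge0}e^{-rt}|X^{x_n}_t-X^x_t|_d]\to0$; (iv) $\varphi,\psi\in\mathcal A_d$ and $\varphi\le\psi$. For continuous $f:\mathbb R^d\to[0,\infty)$, $$(\Lambda f)(x)=\int_0^\infty e^{-rt}\,\mathsf E_x[p\psi(X_t)+(1-p)f(X_t)]\,F(\mathrm dt).$$ Finite-horizon case. Fix $T<\infty$. The first coordinate of $X$ is time: for $z=(t,x)\in[0,T]\times\mathbb R^{d-1}$, under $\mathsf P_z$, $X_s=(t+s,X^1_s,\dots,X^{d-1}_s)$. Admissible stopping times satisfy $\tau\in[0,T-t]$, $\mathsf P_z$-a.s. $\mathcal A_d$ is the set of continuous $f:[0,T]\times\mathbb R^{d-1}\to[0,\infty)$ with $\|f\|^2_{\mathcal A_d}=\sup_{(t,x)}|f(t,x)|^2/(1+|x|^2_{d-1})<\infty$. Assumptions (flow continuity, (i)-(iv)) hold with time parameter restricted to $[0,T]$ and initial points in $[0,T]\times\mathbb R^{d-1}$, (i) being required only for the spatial part $(X^1,\dots,X^{d-1})$ in place of $X$. In addition $F$ is continuous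 on $[0,T]$, with $F(0)>0$ allowed (an atom at $0$). For continuous $f:[0,T]\times\mathbb R^{d-1}\to[0,\infty)$ and $z=(t,x)$, $$(\Lambda f)(z)=\int_0^{T-t}e^{-rs}\,\mathsf E_z[p\psi(X_s)+(1-p)f(X_s)]\,F(\mathrm ds).$$ *)

theory Defs
  imports "HOL-Probability.Probability"
begin

section \<open>Martingales in time \<open>[0,\<infinity>]\<close>\<close>

text \<open>
  Time is \<^typ>\<open>ennreal\<close>, so that stopping times may take the value \<open>\<infinity>\<close>. Only the underlying
  \<open>\<sigma>\<close>-algebra of each measure \<^term>\<open>F t\<close> matters.
\<close>

definition supermartingale_on ::
  "'a measure \<Rightarrow> (ennreal \<Rightarrow> 'a measure) \<Rightarrow> ennreal set \<Rightarrow> (ennreal \<Rightarrow> 'a \<Rightarrow> real) \<Rightarrow> bool"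
  where "supermartingale_on M F I Y \<longleftrightarrow>
    (\<forall>t\<in>I. Y t \<in> borel_measurable (F t) \<and> integrable M (Y t)) \<and>
    (\<forall>s\<in>I. \<forall>t\<in>I. s \<le> t \<longrightarrow> (AE \<omega> in M. real_cond_exp M (F s) (Y t) \<omega> \<le> Y s \<omega>))"

definition martingale_on ::
  "'a measure \<Rightarrow> (ennreal \<Rightarrow> 'a measure) \<Rightarrow> ennreal set \<Rightarrow> (ennreal \<Rightarrow> 'a \<Rightarrow> real) \<Rightarrow> bool"
  where "martingale_on M F I Y \<longleftrightarrow>
    (\<forall>t\<in>I. Y t \<in> borel_measurable (F t) \<and> integrable M (Y t)) \<and>
    (\<forall>s\<in>I. \<forall>t\<in>I. s \<le> t \<longrightarrow> (AE \<omega> in M. real_cond_exp M (F s) (Y t) \<omega> = Y s \<omega>))"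

definition right_continuous_on ::
  "'a measure \<Rightarrow> ennreal set \<Rightarrow> (ennreal \<Rightarrow> 'a \<Rightarrow> real) \<Rightarrow> bool"
  where "right_continuous_on M I Y \<longleftrightarrow>
    (AE \<omega> in M. \<forall>t\<in>I. continuous (at t within {t<..} \<inter> I) (\<lambda>s. Y s \<omega>))"

definition nonneg_on :: "'a measure \<Rightarrow> ennreal set \<Rightarrow> (ennreal \<Rightarrow> 'a \<Rightarrow> real) \<Rightarrow> bool"
  where "nonneg_on M I Y \<longleftrightarrow> (AE \<omega> in M. \<forall>t\<in>I. 0 \<le> Y t \<omega>)"


section \<open>The Markov flow\<close>

text \<open>
  \<open>X t x \<omega>\<close> is the position at time \<open>t \<ge> 0\<close> of the flow started at \<open>x\<close>; negative \<open>t\<close> are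
  irrelevant. An expectation under \<open>P\<^sub>x\<close> of a functional of the process is the expectation under
  \<open>M\<close> of that functional of \<open>X _ x\<close>. The strong Markov property is stated for bounded measurable
  functionals \<open>f\<close> of the whole path, on the event that the stopping time is finite.
\<close>

locale markov_flow = prob_space M + filtration "space M" F
  for M :: "'a measure" and F :: "ennreal \<Rightarrow> 'a measure" +
  fixes X :: "real \<Rightarrow> real^'d \<Rightarrow> 'a \<Rightarrow> real^'d"
  assumes F_complete: "\<And>N A. N \<in> null_sets M \<Longrightarrow> A \<subseteq> N \<Longrightarrow> A \<in> sets (F 0)"
    and F_right_continuous: "\<And>t. t < \<infinity> \<Longrightarrow> sets (F t) = (\<Inter>s\<in>{t<..}. sets (F s))"
    and F_infinity: "sets (F \<infinity>) = sigma_sets (space M) (\<Union>t\<in>{..<\<infinity>}. sets (F t))"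
    and F_infinity_eq: "sets (F \<infinity>) = sets M"
    and X_adapted: "\<And>t x. 0 \<le> t \<Longrightarrow> X t x \<in> borel_measurable (F (ennreal t))"
    and X_start: "\<And>x. AE \<omega> in M. X 0 x \<omega> = x"
    and X_right_continuous:
      "\<And>x. AE \<omega> in M. \<forall>t\<ge>0. continuous (at_right t) (\<lambda>s. X s x \<omega>)"
    and X_quasi_left_continuous:
      "\<And>x \<tau>. (\<And>n::nat. stopping_time F (\<tau> n)) \<Longrightarrow> (\<And>\<omega>. incseq (\<lambda>n. \<tau> n \<omega>)) \<Longrightarrow>
        AE \<omega> in M. (SUP n. \<tau> n \<omega>) < \<infinity> \<longrightarrow>
          (\<lambda>n. X (enn2real (\<tau> n \<omega>)) x \<omega>) \<longlonglongrightarrow> X (enn2real (SUP n. \<tau> n \<omega>)) x \<omega>"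
    and X_strong_markov:
      "\<And>x \<tau> f. stopping_time F \<tau> \<Longrightarrow>
        f \<in> borel_measurable (\<Pi>\<^sub>M s\<in>{0::real..}. (borel :: (real^'d) measure)) \<Longrightarrow>
        bounded (range f) \<Longrightarrow>
        AE \<omega> in M.
          real_cond_exp M (pre_sigma \<tau>)
            (\<lambda>\<omega>. indicator {\<omega>. \<tau> \<omega> < \<infinity>} \<omega> * f (\<lambda>s\<in>{0..}. X (enn2real (\<tau> \<omega>) + s) x \<omega>)) \<omega>
          = indicator {\<omega>. \<tau> \<omega> < \<infinity>} \<omega>
            * expectation (\<lambda>\<omega>'. f (\<lambda>s\<in>{0..}. X s (X (enn2real (\<tau> \<omega>)) x \<omega>) \<omega>'))"

text \<open>
  \<open>D\<close> is the law of the non-negative random variable whose distribution function is \<open>F = cdf D\<close>;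
  an integral against \<open>F(dt)\<close> is an integral with respect to \<open>D\<close>.
\<close>

locale stopping_setting = markov_flow M F X + law: real_distribution D
  for M :: "'a measure" and F :: "ennreal \<Rightarrow> 'a measure"
    and X :: "real \<Rightarrow> real^'d \<Rightarrow> 'a \<Rightarrow> real^'d" and D :: "real measure" +
  fixes r p :: real
  assumes D_nonneg: "AE t in D. 0 \<le> t"
    and r_pos: "0 < r"
    and p_pos: "0 < p"
    and p_less_1: "p < 1"


section \<open>Function space, discounted evaluation and the stopping problem\<close>

text \<open>
  Functions on \<open>S\<close> are represented as extensional functions, so that equality of two of them
  means equality on \<open>S\<close>. Boundedness says that the norm of \<open>f\<close> is finite; \<open>nrm\<close> is the norm on
  \<open>\<real>\<^sup>d\<close>, or the norm of the spatial part.
\<close>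

definition A_space :: "'s::topological_space set \<Rightarrow> ('s \<Rightarrow> real) \<Rightarrow> ('s \<Rightarrow> real) set"
  where "A_space S nrm =
    {f \<in> S \<rightarrow>\<^sub>E {0..}. continuous_on S f \<and> bdd_above ((\<lambda>x. \<bar>f x\<bar>\<^sup>2 / (1 + (nrm x)\<^sup>2)) ` S)}"

text \<open>
  \<open>disc_eval r f w t\<close> is \<open>exp (-r t) f(w(t))\<close> for \<open>t \<in> [0,\<infinity>]\<close>, where \<open>f(w(\<infinity>))\<close> is the upper
  limit of \<open>f(w(s))\<close> as \<open>s\<close> tends to infinity, \<open>exp (-r \<infinity>) = 0\<close>, and \<open>0 \<cdot> \<infinity> = 0\<close> as in
  \<^typ>\<open>ereal\<close>. The product is always finite.
\<close>

definition discount :: "real \<Rightarrow> ennreal \<Rightarrow> ereal"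
  where "discount r t = (if t = \<infinity> then 0 else ereal (exp (- r * enn2real t)))"

definition path_eval :: "('s \<Rightarrow> real) \<Rightarrow> (real \<Rightarrow> 's) \<Rightarrow> ennreal \<Rightarrow> ereal"
  where "path_eval f w t =
    (if t = \<infinity> then Limsup at_top (\<lambda>s. ereal (f (w s))) else ereal (f (w (enn2real t))))"

definition disc_eval :: "real \<Rightarrow> ('s \<Rightarrow> real) \<Rightarrow> (real \<Rightarrow> 's) \<Rightarrow> ennreal \<Rightarrow> real"
  where "disc_eval r f w t = real_of_ereal (discount r t * path_eval f w t)"

lemma disc_eval_infinity [simp]: "disc_eval r f w \<infinity> = 0"
  by (simp add: disc_eval_def discount_def)

lemma disc_eval_finite:
  "t < \<infinity> \<Longrightarrow> disc_eval r f w t = exp (- r * enn2real t) * f (w (enn2real t))"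
  by (simp add: disc_eval_def discount_def path_eval_def)

text \<open>\<open>J x\<close> is the set of times available from \<open>x\<close>: \<open>[0,\<infinity>)\<close>, or \<open>[0, T - t]\<close> if \<open>x\<close> has time
  coordinate \<open>t\<close>.\<close>

definition Lambda ::
  "'a measure \<Rightarrow> (real \<Rightarrow> 's \<Rightarrow> 'a \<Rightarrow> 's) \<Rightarrow> real measure \<Rightarrow> real \<Rightarrow> real \<Rightarrow> ('s \<Rightarrow> real) \<Rightarrow>
    ('s \<Rightarrow> real set) \<Rightarrow> ('s \<Rightarrow> real) \<Rightarrow> 's \<Rightarrow> real"
  where "Lambda M X D r p \<psi> J f x =
    (LINT s:J x|D. exp (- r * s) * (LINT \<omega>|M. p * \<psi> (X s x \<omega>) + (1 - p) * f (X s x \<omega>)))"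

definition obstacle ::
  "'a measure \<Rightarrow> (real \<Rightarrow> 's \<Rightarrow> 'a \<Rightarrow> 's) \<Rightarrow> real measure \<Rightarrow> real \<Rightarrow> real \<Rightarrow> ('s \<Rightarrow> real) \<Rightarrow>
    ('s \<Rightarrow> real) \<Rightarrow> ('s \<Rightarrow> real set) \<Rightarrow> ('s \<Rightarrow> real) \<Rightarrow> 's \<Rightarrow> real"
  where "obstacle M X D r p \<phi> \<psi> J v x = max (\<phi> x) (Lambda M X D r p \<psi> J v x)"

text \<open>The rewards in use are non-negative, so their expectations are taken in \<open>[0,\<infinity>]\<close>.\<close>

definition stop_reward ::
  "'a measure \<Rightarrow> (real \<Rightarrow> 's \<Rightarrow> 'a \<Rightarrow> 's) \<Rightarrow> real \<Rightarrow> ('s \<Rightarrow> real) \<Rightarrow> 's \<Rightarrow> ('a \<Rightarrow> ennreal) \<Rightarrow> ennreal"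
  where "stop_reward M X r g x \<tau> = (\<integral>\<^sup>+ \<omega>. ennreal (disc_eval r g (\<lambda>s. X s x \<omega>) (\<tau> \<omega>)) \<partial>M)"

definition optimal_in ::
  "'a measure \<Rightarrow> (real \<Rightarrow> 's \<Rightarrow> 'a \<Rightarrow> 's) \<Rightarrow> real \<Rightarrow> ('s \<Rightarrow> real) \<Rightarrow> 's \<Rightarrow> ('a \<Rightarrow> ennreal) set \<Rightarrow>
    ('a \<Rightarrow> ennreal) \<Rightarrow> bool"
  where "optimal_in M X r g x \<T> \<tau> \<longleftrightarrow>
    \<tau> \<in> \<T> \<and> stop_reward M X r g x \<tau> = (SUP \<sigma>\<in>\<T>. stop_reward M X r g x \<sigma>)"

definition tau_star ::
  "(real \<Rightarrow> 's \<Rightarrow> 'a \<Rightarrow> 's) \<Rightarrow> ('s \<Rightarrow> real) \<Rightarrow> ('s \<Rightarrow> real) \<Rightarrow> ('s \<Rightarrow> real set) \<Rightarrow> 's \<Rightarrow> 'a \<Rightarrow> ennreal"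
  where "tau_star X v g J x \<omega> = Inf (ennreal ` {s \<in> J x. v (X s x \<omega>) = g (X s x \<omega>)})"


section \<open>Infinite horizon\<close>

abbreviation J_inf :: "real^'d \<Rightarrow> real set"
  where "J_inf \<equiv> \<lambda>x. {0..}"

abbreviation A_inf :: "(real^'d \<Rightarrow> real) set"
  where "A_inf \<equiv> A_space UNIV norm"

abbreviation stops_inf :: "(ennreal \<Rightarrow> 'a measure) \<Rightarrow> ('a \<Rightarrow> ennreal) set"
  where "stops_inf F \<equiv> {\<tau>. stopping_time F \<tau>}"

locale infinite_horizon = stopping_setting M F X D r p
  for M :: "'a measure" and F :: "ennreal \<Rightarrow> 'a measure"
    and X :: "real \<Rightarrow> real^'d \<Rightarrow> 'a \<Rightarrow> real^'d" and D :: "real measure" and r p :: real +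
  fixes \<phi> \<psi> :: "real^'d \<Rightarrow> real"
  assumes flow_continuous: "\<And>t. 0 \<le> t \<Longrightarrow> AE \<omega> in M. continuous_on UNIV (\<lambda>x. X t x \<omega>)"
    and growth_supermartingale:
      "\<exists>\<rho>\<in>{0<..<1}. \<forall>x. supermartingale_on M F {..<\<infinity>}
        (\<lambda>t \<omega>. exp (- 2 * r * (1 - \<rho>) * enn2real t) * (1 + (norm (X (enn2real t) x \<omega>))\<^sup>2))"
    and sup_integrable:
      "\<And>K. compact K \<Longrightarrow>
        (SUP x\<in>K. \<integral>\<^sup>+ \<omega>. (SUP t\<in>{0..}. ennreal (exp (- r * t) * norm (X t x \<omega>))) \<partial>M) < \<infinity>"
    and flow_L1_continuous:
      "\<And>xs x. xs \<longlonglongrightarrow> x \<Longrightarrow>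
        (\<lambda>n. \<integral>\<^sup>+ \<omega>. (SUP t\<in>{0..}. ennreal (exp (- r * t) * norm (X t (xs n) \<omega> - X t x \<omega>))) \<partial>M)
          \<longlonglongrightarrow> 0"
    and phi_in: "\<phi> \<in> A_inf"
    and psi_in: "\<psi> \<in> A_inf"
    and phi_le_psi: "\<And>x. \<phi> x \<le> \<psi> x"

definition value_eq_inf ::
  "'a measure \<Rightarrow> (ennreal \<Rightarrow> 'a measure) \<Rightarrow> (real \<Rightarrow> real^'d \<Rightarrow> 'a \<Rightarrow> real^'d) \<Rightarrow> real measure \<Rightarrow>
    real \<Rightarrow> real \<Rightarrow> (real^'d \<Rightarrow> real) \<Rightarrow> (real^'d \<Rightarrow> real) \<Rightarrow> (real^'d \<Rightarrow> real) \<Rightarrow> bool"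
  where "value_eq_inf M F X D r p \<phi> \<psi> v \<longleftrightarrow>
    (\<forall>x. ennreal (v x) =
      (SUP \<tau>\<in>stops_inf F. stop_reward M X r (obstacle M X D r p \<phi> \<psi> J_inf v) x \<tau>))"


section \<open>Finite horizon\<close>

text \<open>
  The time coordinate of \<open>\<real>\<^sup>d\<close> is the one with index \<open>i\<close>, the others are spatial. This covers
  \<open>d = 1\<close>, where there are none.
\<close>

definition spatial_norm :: "'d::finite \<Rightarrow> real^'d \<Rightarrow> real"
  where "spatial_norm i z = L2_set (\<lambda>j. z $ j) (UNIV - {i})"

definition strip :: "real \<Rightarrow> 'd::finite \<Rightarrow> (real^'d) set"
  where "strip T i = {z. 0 \<le> z $ i \<and> z $ i \<le> T}"

abbreviation J_fin :: "real \<Rightarrow> 'd::finite \<Rightarrow> real^'d \<Rightarrow> real set"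
  where "J_fin T i \<equiv> \<lambda>z. {0..T - z $ i}"

abbreviation A_fin :: "real \<Rightarrow> 'd::finite \<Rightarrow> (real^'d \<Rightarrow> real) set"
  where "A_fin T i \<equiv> A_space (strip T i) (spatial_norm i)"

abbreviation stops_fin ::
  "'a measure \<Rightarrow> (ennreal \<Rightarrow> 'a measure) \<Rightarrow> real \<Rightarrow> 'd::finite \<Rightarrow> real^'d \<Rightarrow> ('a \<Rightarrow> ennreal) set"
  where "stops_fin M F T i z \<equiv>
    {\<tau>. stopping_time F \<tau> \<and> (AE \<omega> in M. \<tau> \<omega> \<le> ennreal (T - z $ i))}"

locale finite_horizon = stopping_setting M F X D r p
  for M :: "'a measure" and F :: "ennreal \<Rightarrow> 'a measure"
    and X :: "real \<Rightarrow> real^'d \<Rightarrow> 'a \<Rightarrow> real^'d" and D :: "real measure" and r p :: real +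
  fixes \<phi> \<psi> :: "real^'d \<Rightarrow> real" and T :: real and i :: 'd
  assumes T_nonneg: "0 \<le> T"
    and time_coordinate:
      "\<And>z. z \<in> strip T i \<Longrightarrow> AE \<omega> in M. \<forall>s\<ge>0. X s z \<omega> $ i = z $ i + s"
    and flow_continuous:
      "\<And>s. 0 \<le> s \<Longrightarrow> s \<le> T \<Longrightarrow> AE \<omega> in M. continuous_on (strip T i) (\<lambda>z. X s z \<omega>)"
    and growth_supermartingale:
      "\<exists>\<rho>\<in>{0<..<1}. \<forall>z\<in>strip T i. supermartingale_on M F {..ennreal T}
        (\<lambda>s \<omega>. exp (- 2 * r * (1 - \<rho>) * enn2real s)
          * (1 + (spatial_norm i (X (enn2real s) z \<omega>))\<^sup>2))"
    and sup_integrable: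
      "\<And>K. compact K \<Longrightarrow> K \<subseteq> strip T i \<Longrightarrow>
        (SUP z\<in>K. \<integral>\<^sup>+ \<omega>. (SUP s\<in>{0..T}. ennreal (exp (- r * s) * norm (X s z \<omega>))) \<partial>M) < \<infinity>"
    and flow_L1_continuous:
      "\<And>zs z. (\<And>n. zs n \<in> strip T i) \<Longrightarrow> z \<in> strip T i \<Longrightarrow> zs \<longlonglongrightarrow> z \<Longrightarrow>
        (\<lambda>n. \<integral>\<^sup>+ \<omega>. (SUP s\<in>{0..T}. ennreal (exp (- r * s) * norm (X s (zs n) \<omega> - X s z \<omega>))) \<partial>M)
          \<longlonglongrightarrow> 0"
    and phi_in: "\<phi> \<in> A_fin T i"
    and psi_in: "\<psi> \<in> A_fin T i"
    and phi_le_psi: "\<And>z. z \<in> strip T i \<Longrightarrow> \<phi> z \<le> \<psi> z"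
    and cdf_continuous: "continuous_on {0..T} (cdf D)"

definition value_eq_fin ::
  "'a measure \<Rightarrow> (ennreal \<Rightarrow> 'a measure) \<Rightarrow> (real \<Rightarrow> real^'d \<Rightarrow> 'a \<Rightarrow> real^'d) \<Rightarrow> real measure \<Rightarrow>
    real \<Rightarrow> real \<Rightarrow> (real^'d \<Rightarrow> real) \<Rightarrow> (real^'d \<Rightarrow> real) \<Rightarrow> real \<Rightarrow> 'd::finite \<Rightarrow>
    (real^'d \<Rightarrow> real) \<Rightarrow> bool"
  where "value_eq_fin M F X D r p \<phi> \<psi> T i v \<longleftrightarrow>
    (\<forall>z\<in>strip T i. ennreal (v z) =
      (SUP \<tau>\<in>stops_fin M F T i z.
        stop_reward M X r (obstacle M X D r p \<phi> \<psi> (J_fin T i) v) z \<tau>))"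

end

theory Submission
  imports Defs
begin

text \<open>
  For a fixed obstacle \<open>g\<close> of at most linear growth, the value function \<open>V\<close> of optimal stopping is the
  increasing limit of continuous functions obtained by backward induction on time grids, each of which
  stays below \<open>V\<close> because its values can be attained by stopping times. So \<open>V\<close> is lower
  semicontinuous and \<open>exp (- r t) V(X\<^sub>t)\<close> is a supermartingale; upper semicontinuity comes from the
  continuity of the flow. For \<open>e > 0\<close> a nearly optimal stopping time cannot stop much before
  the first time at which \<open>V < g + e\<close>, so nothing is lost by waiting until then. As \<open>e\<close> tends to \<open>0\<close> these times
  increase, and quasi left-continuity makes their limit the first time at which \<open>V = g\<close>; this
  first time is therefore optimal and the stopped process is a martingale.

  The map from \<open>v\<close> to the value function with obstacle \<open>max \<phi> (\<Lambda> v)\<close> is a contraction with factor \<open>1 - p\<close> in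
  the norm weighted by \<open>w(x) = sqrt (1 + |x|\<^sup>2)\<close>, because the growth assumption bounds
  \<open>E\<^sub>x (exp (- r \<tau>) w(X\<^sub>\<tau>))\<close> by \<open>w(x)\<close>.

  The finite-horizon problem is the infinite-horizon one for the flow absorbed at time \<open>T\<close>.
\<close>

section \<open>Stopped processes over a complete right-continuous filtration\<close>

text \<open>A value function is a supremum over uncountably many stopping times, so neither the
  measurability of \<open>V (X t x)\<close> nor the inequality
  \<open>exp (- r s) P s V \<le> V\<close> is available at the outset. Pasting nearly optimal
  stopping times chosen state by state would call for a measurable selection. The grid
  approximations avoid it: each is continuous, and the inequality for \<open>V\<close> is a limit of
  statements about them. The growth assumption enters through its square root, with rate \<kappa> =
  r (1 - \<rho>) < r. The gap r - \<kappa> makes late rewards decay exponentially, uniformly in the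
  stopping time. This yields uniform integrability of discounted rewards, and it prevents mass from
  escaping to infinite time when the contact time is approached from below. With a finite horizon
  the moment of absorption depends on the starting point, so comparing two flows also requires
  control of the motion between two absorption times. Quasi left-continuity provides it on the left
  and right-continuity on the right; the law of the recursion time must not charge a moving positive
  end point, which is where continuity of its distribution function enters.\<close>

lemma continuous_at_right_min:
  fixes y :: "real \<Rightarrow> 'b::topological_space"
  assumes y: "\<And>t. 0 \<le> t \<Longrightarrow> continuous (at_right t) y" and t: "0 \<le> t"
  shows "continuous (at_right t) (\<lambda>s. y (min s a))"
proof (cases "t < a")
  case True
  have ev: "eventually (\<lambda>s. y s = y (min s a)) (at_right t)"
    using eventually_at_right[OF True] True by (auto intro!: exI[of _ a])
  have "(y \<longlongrightarrow> y t) (at_right t)" using y[OF t] by (simp add: continuous_within)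
  then have "((\<lambda>s. y (min s a)) \<longlongrightarrow> y t) (at_right t)" by (rule Lim_transform_eventually[OF _ ev])
  with True show ?thesis by (simp add: continuous_within)
next
  case False
  have "eventually (\<lambda>s. y a = y (min s a)) (at_right t)"
    using eventually_at_right_less[of t] by eventually_elim (use False in auto)
  then have "((\<lambda>s. y (min s a)) \<longlongrightarrow> y a) (at_right t)" by (rule Lim_transform_eventually[OF tendsto_const])
  moreover have "min t a = a" using False by simp
  ultimately show ?thesis by (simp only: continuous_within)
qed

text \<open>The \<open>Suc\<close> moves the grid point strictly to the right of \<open>t\<close>,
  even when \<open>t\<close> lies on the grid. Right-continuity says nothing about approximation
  from the left, so time is always rounded up in this strict way.\<close>

lemma floor_grid_filterlim:
  fixes t :: real
  assumes "0 \<le> t"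
  shows "filterlim (\<lambda>n. real (Suc (nat \<lfloor>real (Suc n) * t\<rfloor>)) / real (Suc n)) (at_right t) sequentially"
proof (rule tendsto_imp_filterlim_at_right)
  define k where "k n = nat \<lfloor>real (Suc n) * t\<rfloor>" for n
  have 1: "real (k n) \<le> real (Suc n) * t" "real (Suc n) * t < real (k n) + 1" for n
    unfolding k_def using assms by (auto simp del: of_nat_Suc)
  have gr: "t < real (Suc (k n)) / real (Suc n)" for n
    using 1[of n] by (simp add: pos_less_divide_eq mult.commute add.commute)
  have 2: "real (Suc (k n)) / real (Suc n) \<le> t + 1 / real (Suc n)" for n
  proof -
    have "real (Suc (k n)) / real (Suc n) \<le> (real (Suc n) * t + 1) / real (Suc n)"
      using 1[of n] by (intro divide_right_mono) auto
    also have "\<dots> = t + 1 / real (Suc n)"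
      by (simp add: add_divide_distrib del: of_nat_Suc)
    finally show ?thesis .
  qed
  show "eventually (\<lambda>n. t < real (Suc (nat \<lfloor>real (Suc n) * t\<rfloor>)) / real (Suc n)) sequentially"
    using gr unfolding k_def by (intro always_eventually allI)
  show "(\<lambda>n. real (Suc (nat \<lfloor>real (Suc n) * t\<rfloor>)) / real (Suc n)) \<longlonglongrightarrow> t"
  proof (fold k_def, rule tendsto_sandwich[OF _ _ tendsto_const])
    have "(\<lambda>n. t + 1 / real (Suc n)) \<longlonglongrightarrow> t + 0"
      by (intro tendsto_intros LIMSEQ_Suc[OF lim_1_over_n])
    then show "(\<lambda>n. t + 1 / real (Suc n)) \<longlonglongrightarrow> t" by simp
  qed (use 2 less_imp_le[OF gr] in auto)
qed

text \<open>Pointwise limit of step functions that read \<open>h\<close> at the next grid point.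
  Times are clipped by \<open>max 0\<close> because nothing is known about \<open>h\<close> on the
  negative axis.\<close>

lemma borel_measurable_right_continuous:
  fixes h :: "real \<Rightarrow> real"
  assumes "\<And>t. 0 \<le> t \<Longrightarrow> continuous (at_right t) h"
  shows "(\<lambda>t. h (max 0 t)) \<in> borel_measurable borel"
proof (rule borel_measurable_LIMSEQ_real)
  let ?k = "\<lambda>n t. nat \<lfloor>real (Suc n) * max 0 t\<rfloor>"
  show "(\<lambda>n. h (real (Suc (?k n t)) / real (Suc n))) \<longlonglongrightarrow> h (max 0 t)" for t
    using assms[of "max 0 t"] floor_grid_filterlim[of "max 0 t"]
    by (auto simp: continuous_within intro: filterlim_compose)
  show "(\<lambda>t. h (real (Suc (?k n t)) / real (Suc n))) \<in> borel_measurable borel" for n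
    by (rule measurable_compose_countable[where f="\<lambda>i _. h (real (Suc i) / real (Suc n))" and g="?k n"]) measurable
qed

section \<open>Consequences of completeness and right-continuity of the filtration\<close>

locale complete_filtration = prob_space M + filtration "space M" F
  for M :: "'a measure" and F :: "ennreal \<Rightarrow> 'a measure" +
  assumes null_in_F: "\<And>N A. N \<in> null_sets M \<Longrightarrow> A \<subseteq> N \<Longrightarrow> A \<in> sets (F 0)"
    and F_right: "\<And>t. t < \<infinity> \<Longrightarrow> sets (F t) = (\<Inter>s\<in>{t<..}. sets (F s))"
    and F_top: "sets (F \<infinity>) = sets M"
begin

lemma sets_F_subset: "sets (F t) \<subseteq> sets M"
  using sets_F_mono[of t \<infinity>] F_top by simp

lemma subalgebra_F: "subalgebra M (F t)"
  by (simp add: subalgebra_def space_F sets_F_subset)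

lemma measurable_F_M: "f \<in> borel_measurable (F t) \<Longrightarrow> f \<in> borel_measurable M"
  using measurable_from_subalg[OF subalgebra_F] .

lemma measurable_F_mono:
  assumes "f \<in> borel_measurable (F s)" "s \<le> t" shows "f \<in> borel_measurable (F t)"
  by (rule measurable_from_subalg[OF _ assms(1)]) (simp add: subalgebra_def space_F sets_F_mono assms(2))

lemma measurable_F_top: "measurable (F \<infinity>) N = measurable M N"
  by (rule measurable_cong_sets) (use F_top in simp_all)

lemma null_in_F_any: "N \<in> null_sets M \<Longrightarrow> A \<subseteq> N \<Longrightarrow> A \<in> sets (F t)"
  using null_in_F[of N A] sets_F_mono[of 0 t] by auto

text \<open>Completeness puts every subset of a null set into each \<open>F t\<close>, so a change
  on a null set costs no measurability. Limits and compositions that are correct only almost surely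
  are handled through this.\<close>

lemma measurable_AE_eq:
  assumes f: "f \<in> borel_measurable (F t)" and eq: "AE \<omega> in M. f \<omega> = g \<omega>"
  shows "g \<in> borel_measurable (F t)"
proof (rule measurableI)
  from eq obtain N where N: "{\<omega>\<in>space M. \<not> f \<omega> = g \<omega>} \<subseteq> N" "N \<in> null_sets M"
    by (auto elim!: AE_E simp: null_sets_def)
  fix B :: "'b set" assume B: "B \<in> sets borel"
  have "g -` B \<inter> space (F t) =
      (f -` B \<inter> space (F t) - N) \<union> (g -` B \<inter> space M \<inter> N)"
    using N(1) by (auto simp: space_F)
  moreover have "f -` B \<inter> space (F t) \<in> sets (F t)"
    using f B by (rule measurable_sets)
  moreover have "N \<in> sets (F t)" "g -` B \<inter> space M \<inter> N \<in> sets (F t)"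
    using null_in_F_any[OF N(2)] by auto
  ultimately show "g -` B \<inter> space (F t) \<in> sets (F t)"
    by auto
qed auto

lemma measurable_AE_eq_M:
  "f \<in> borel_measurable M \<Longrightarrow> AE \<omega> in M. f \<omega> = g \<omega> \<Longrightarrow> g \<in> borel_measurable M"
  using measurable_AE_eq[of f "\<infinity>" g] unfolding measurable_F_top .

lemma sets_AE_eq:
  assumes "A \<in> sets (F t)" "AE \<omega> in M. \<omega> \<in> A \<longleftrightarrow> \<omega> \<in> B" "B \<subseteq> space M"
  shows "B \<in> sets (F t)"
proof -
  have "(indicator A :: 'a \<Rightarrow> real) \<in> borel_measurable (F t)"
    using assms(1) by simp
  then have "(indicator B :: 'a \<Rightarrow> real) \<in> borel_measurable (F t)"
    by (rule measurable_AE_eq) (use assms(2) in \<open>eventually_elim, auto simp: indicator_def\<close>)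
  then have "B \<inter> space (F t) \<in> sets (F t)"
    by (simp add: borel_measurable_indicator_iff)
  with assms(3) show ?thesis
    by (simp add: space_F Int_absorb2)
qed

lemma pred_F_iff: "Measurable.pred (F t) P \<longleftrightarrow> {\<omega>\<in>space M. P \<omega>} \<in> sets (F t)"
  by (simp add: pred_def space_F)

lemma stopping_time_AE_eq:
  assumes "stopping_time F \<tau>" "AE \<omega> in M. \<tau> \<omega> = \<sigma> \<omega>"
  shows "stopping_time F \<sigma>"
proof (rule stopping_timeI)
  fix t
  have "{\<omega>\<in>space M. \<tau> \<omega> \<le> t} \<in> sets (F t)"
    using stopping_timeD[OF assms(1)] by (simp add: pred_F_iff)
  then have "{\<omega>\<in>space M. \<sigma> \<omega> \<le> t} \<in> sets (F t)"
    by (rule sets_AE_eq) (use assms(2) in \<open>auto\<close>)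
  then show "Measurable.pred (F t) (\<lambda>\<omega>. \<sigma> \<omega> \<le> t)"
    by (simp add: pred_F_iff)
qed

lemma stopping_measurable_M: "stopping_time F \<tau> \<Longrightarrow> \<tau> \<in> borel_measurable M"
  by (rule measurable_stopping_time[of F]) (use sets_F_subset in \<open>auto simp: space_F\<close>)

text \<open>Right-continuity of the filtration: \<open>{\<tau> \<le> t}\<close> is the intersection
  of events \<open>{\<tau> < u}\<close> with \<open>u\<close> decreasing to \<open>t\<close>, and
  for any prescribed \<open>s > t\<close> these can be kept inside \<open>F s\<close>.\<close>

lemma stopping_time_right_limit:
  assumes "\<And>t. 0 < t \<Longrightarrow> t < \<infinity> \<Longrightarrow> {\<omega>\<in>space M. \<tau> \<omega> < t} \<in> sets (F t)"
  shows "stopping_time F \<tau>"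
proof (rule stopping_timeI)
  fix t :: ennreal
  show "Measurable.pred (F t) (\<lambda>\<omega>. \<tau> \<omega> \<le> t)"
  proof (cases "t = \<infinity>")
    case True then show ?thesis by simp
  next
    case False
    then obtain t' where t': "0 \<le> t'" "t = ennreal t'" by (cases t) auto
    have "{\<omega>\<in>space M. \<tau> \<omega> \<le> t} \<in> sets (F s)" if ts: "t < s" for s
    proof -
      \<comment> \<open>The cap at \<open>s\<close> keeps every event \<open>{\<tau> < u n}\<close>
        inside \<open>F s\<close>.\<close>
      define u where "u n = min s (t + ennreal (1 / Suc n))" for n
      have tu: "t < u n" for n
      proof -
        have "0 < ennreal (1 / Suc n)" by simp
        then have "t + 0 < t + ennreal (1 / Suc n)"
          using t' by (simp add: ennreal_add_left_cancel_less)
        with ts show ?thesis by (simp add: u_def)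
      qed
      have u_fin: "u n < \<infinity>" for n
        using t' by (simp add: u_def min_less_iff_disj)
      have "{\<omega>\<in>space M. \<tau> \<omega> \<le> t} = (\<Inter>n. {\<omega>\<in>space M. \<tau> \<omega> < u n})"
      proof (intro set_eqI iffI)
        fix \<omega> assume "\<omega> \<in> {\<omega>\<in>space M. \<tau> \<omega> \<le> t}"
        then show "\<omega> \<in> (\<Inter>n. {\<omega>\<in>space M. \<tau> \<omega> < u n})"
          using tu le_less_trans by blast
      next
        fix \<omega> assume *: "\<omega> \<in> (\<Inter>n. {\<omega>\<in>space M. \<tau> \<omega> < u n})"
        have "\<tau> \<omega> \<le> t + ennreal e" if e: "0 < e" for e
        proof -
          obtain n :: nat where n: "1 / real (Suc n) < e" using nat_approx_posE[OF e] by blast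
          have "\<tau> \<omega> < u n" using * by blast
          also have "u n \<le> t + ennreal (1 / Suc n)" by (simp add: u_def)
          also have "\<dots> \<le> t + ennreal e" using n by (intro add_left_mono ennreal_leI) simp
          finally show ?thesis by simp
        qed
        then have "\<tau> \<omega> \<le> t" by (rule ennreal_le_epsilon)
        with * show "\<omega> \<in> {\<omega>\<in>space M. \<tau> \<omega> \<le> t}" by blast
      qed
      moreover have "{\<omega>\<in>space M. \<tau> \<omega> < u n} \<in> sets (F s)" for n
      proof -
        have "0 < u n" using tu[of n] by (metis le_less_trans zero_le)
        from assms[OF this u_fin] show ?thesis
          using sets_F_mono[of "u n" s] by (auto simp: u_def)
      qed
      ultimately show ?thesis by (simp add: sets.countable_INT image_subset_iff)
    qed
    then have "{\<omega>\<in>space M. \<tau> \<omega> \<le> t} \<in> (\<Inter>s\<in>{t<..}. sets (F s))" by blast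
    moreover have "t < \<infinity>" using t' by simp
    ultimately show ?thesis
      unfolding pred_F_iff using F_right[of t] by blast
  qed
qed

section \<open>Values of right-continuous processes at stopping times\<close>

definition rc_process :: "(real \<Rightarrow> 'a \<Rightarrow> real) \<Rightarrow> bool" where
  "rc_process Y \<longleftrightarrow> (\<forall>t\<ge>0. Y t \<in> borel_measurable (F (ennreal t))) \<and>
     (AE \<omega> in M. \<forall>t\<ge>0. continuous (at_right t) (\<lambda>s. Y s \<omega>))"

text \<open>The default \<open>0\<close> at infinite times encodes the convention that a discounted
  reward vanishes there; it agrees with \<open>disc_eval\<close>.\<close>

definition stopval :: "(real \<Rightarrow> 'a \<Rightarrow> real) \<Rightarrow> ('a \<Rightarrow> ennreal) \<Rightarrow> 'a \<Rightarrow> real" where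
  "stopval Y \<tau> \<omega> = (if \<tau> \<omega> = \<infinity> then 0 else Y (enn2real (\<tau> \<omega>)) \<omega>)"

lemma rc_process_measurable:
  assumes "rc_process Y" "0 \<le> u" "ennreal u \<le> t"
  shows "Y u \<in> borel_measurable (F t)"
  by (rule measurable_F_mono[OF _ assms(3)]) (use assms(1,2) in \<open>simp add: rc_process_def\<close>)

lemma rc_process_rc:
  "rc_process Y \<Longrightarrow> AE \<omega> in M. \<forall>t\<ge>0. continuous (at_right t) (\<lambda>s. Y s \<omega>)"
  by (simp add: rc_process_def)

text \<open>\<open>\<sigma>\<close> is rounded up to a grid, where evaluation is a countable case
  distinction, and right-continuity recovers the value in the limit. Since rounding up looks past
  \<open>\<sigma>\<close>, measurability with respect to the one \<open>F t\<close> is demanded at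
  all times \<open>u\<close>.\<close>

lemma measurable_eval:
  fixes Y :: "real \<Rightarrow> 'a \<Rightarrow> real" and \<sigma> :: "'a \<Rightarrow> real"
  assumes Y: "\<And>u. 0 \<le> u \<Longrightarrow> Y u \<in> borel_measurable (F t)"
    and rc: "AE \<omega> in M. \<forall>u\<ge>0. continuous (at_right u) (\<lambda>s. Y s \<omega>)"
    and \<sigma>: "\<sigma> \<in> borel_measurable (F t)" and nn: "\<And>\<omega>. 0 \<le> \<sigma> \<omega>"
  shows "(\<lambda>\<omega>. Y (\<sigma> \<omega>) \<omega>) \<in> borel_measurable (F t)"
proof -
  define k where "k n \<omega> = nat \<lfloor>real (Suc n) * \<sigma> \<omega>\<rfloor>" for n \<omega>
  define g where "g n \<omega> = Y (real (Suc (k n \<omega>)) / real (Suc n)) \<omega>" for n \<omega>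
  have g: "g n \<in> borel_measurable (F t)" for n
    unfolding g_def[abs_def]
  proof (rule measurable_compose_countable[where g="k n" and f="\<lambda>i. Y (real (Suc i) / real (Suc n))"])
    show "k n \<in> measurable (F t) (count_space UNIV)"
      unfolding k_def[abs_def] using \<sigma> by measurable
    show "Y (real (Suc i) / real (Suc n)) \<in> borel_measurable (F t)" for i
      by (rule Y) simp
  qed
  have "AE \<omega> in M. (\<lambda>n. g n \<omega>) \<longlonglongrightarrow> Y (\<sigma> \<omega>) \<omega>"
    using rc
  proof eventually_elim
    case (elim \<omega>)
    then have "((\<lambda>s. Y s \<omega>) \<longlongrightarrow> Y (\<sigma> \<omega>) \<omega>) (at_right (\<sigma> \<omega>))"
      using nn[of \<omega>] by (simp add: continuous_within)
    moreover have "filterlim (\<lambda>n. real (Suc (k n \<omega>)) / real (Suc n)) (at_right (\<sigma> \<omega>)) sequentially"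
      unfolding k_def by (rule floor_grid_filterlim[OF nn])
    ultimately show ?case
      unfolding g_def by (rule filterlim_compose)
  qed
  then have "AE \<omega> in M. lim (\<lambda>n. g n \<omega>) = Y (\<sigma> \<omega>) \<omega>"
    by eventually_elim (rule limI)
  moreover have "(\<lambda>\<omega>. lim (\<lambda>n. g n \<omega>)) \<in> borel_measurable (F t)"
    using g by (rule borel_measurable_lim_metric)
  ultimately show ?thesis
    by (rule measurable_AE_eq[rotated])
qed

lemma stopping_min_measurable:
  assumes "stopping_time F \<tau>"
  shows "(\<lambda>\<omega>. min t (\<tau> \<omega>)) \<in> borel_measurable (F t)"
proof (rule borel_measurableI_le)
  fix s
  have "{\<omega> \<in> space (F t). min t (\<tau> \<omega>) \<le> s} =
    (if t \<le> s then space (F t) else {\<omega> \<in> space M. \<tau> \<omega> \<le> s})"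
    by (auto simp: space_F min_le_iff_disj)
  also have "\<dots> \<in> sets (F t)"
  proof (cases "t \<le> s")
    case False
    have "{\<omega> \<in> space M. \<tau> \<omega> \<le> s} \<in> sets (F s)"
      using stopping_timeD[OF assms, of s] by (simp only: pred_F_iff)
    then show ?thesis
      using False sets_F_mono[of s t] by (simp add: less_imp_le subset_iff)
  qed simp
  finally show "{\<omega> \<in> space (F t). min t (\<tau> \<omega>) \<le> s} \<in> sets (F t)" .
qed

lemma rc_process_stopped:
  assumes Y: "rc_process Y" and a: "0 \<le> a" shows "rc_process (\<lambda>t. Y (min t a))"
  unfolding rc_process_def
proof (intro conjI allI impI)
  show "Y (min t a) \<in> borel_measurable (F (ennreal t))" if "0 \<le> t" for t
    using that a by (intro rc_process_measurable[OF Y]) (auto intro!: ennreal_leI)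
  show "AE \<omega> in M. \<forall>t\<ge>0. continuous (at_right t) (\<lambda>s. Y (min s a) \<omega>)"
    using rc_process_rc[OF Y]
    by eventually_elim (use continuous_at_right_min[where y="\<lambda>s. Y s _"] in blast)
qed

lemma stopval_min_measurable:
  assumes Y: "rc_process Y" and \<tau>: "stopping_time F \<tau>" and t: "0 \<le> t"
  shows "stopval Y (\<lambda>\<omega>. min (ennreal t) (\<tau> \<omega>)) \<in> borel_measurable (F (ennreal t))"
proof -
  define \<sigma> where "\<sigma> \<omega> = enn2real (min (ennreal t) (\<tau> \<omega>))" for \<omega>
  have \<sigma>: "\<sigma> \<in> borel_measurable (F (ennreal t))"
    unfolding \<sigma>_def[abs_def] using stopping_min_measurable[OF \<tau>] by measurable
  have le: "0 \<le> \<sigma> \<omega>" "\<sigma> \<omega> \<le> t" for \<omega>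
    using t by (auto simp: \<sigma>_def min_def enn2real_leI)
  \<comment> \<open>Freezing \<open>Y\<close> at time \<open>t\<close> does not change the value, as
    \<open>\<sigma> \<le> t\<close>, but it makes the values read at grid points beyond
    \<open>t\<close> measurable with respect to \<open>F (ennreal t)\<close>.\<close>
  have "(\<lambda>\<omega>. Y (min (\<sigma> \<omega>) t) \<omega>) \<in> borel_measurable (F (ennreal t))"
  proof (rule measurable_eval[where Y="\<lambda>u. Y (min u t)" and \<sigma>=\<sigma>])
    show "Y (min u t) \<in> borel_measurable (F (ennreal t))" if "0 \<le> u" for u
      using that t by (intro rc_process_measurable[OF Y]) (auto intro!: ennreal_leI)
    show "AE \<omega> in M. \<forall>u\<ge>0. continuous (at_right u) (\<lambda>s. Y (min s t) \<omega>)"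
      by (rule rc_process_rc[OF rc_process_stopped[OF Y t]])
  qed (use \<sigma> le in auto)
  moreover have "stopval Y (\<lambda>\<omega>. min (ennreal t) (\<tau> \<omega>)) = (\<lambda>\<omega>. Y (min (\<sigma> \<omega>) t) \<omega>)"
    using le by (auto simp: stopval_def \<sigma>_def fun_eq_iff min_def)
  ultimately show ?thesis by simp
qed

lemma stopval_measurable:
  assumes Y: "rc_process Y" and \<tau>: "stopping_time F \<tau>"
  shows "stopval Y \<tau> \<in> borel_measurable M"
proof -
  have "(\<lambda>\<omega>. Y (enn2real (\<tau> \<omega>)) \<omega>) \<in> borel_measurable (F \<infinity>)"
  proof (rule measurable_eval[where Y=Y and \<sigma>="\<lambda>\<omega>. enn2real (\<tau> \<omega>)"])
    show "Y u \<in> borel_measurable (F \<infinity>)" if "0 \<le> u" for u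
      using that by (intro rc_process_measurable[OF Y]) auto
    show "(\<lambda>\<omega>. enn2real (\<tau> \<omega>)) \<in> borel_measurable (F \<infinity>)"
      unfolding measurable_F_top using stopping_measurable_M[OF \<tau>] by measurable
  qed (use Y in \<open>auto simp: rc_process_def\<close>)
  then have [measurable]: "(\<lambda>\<omega>. Y (enn2real (\<tau> \<omega>)) \<omega>) \<in> borel_measurable M"
    unfolding measurable_F_top .
  have [measurable]: "\<tau> \<in> borel_measurable M" by (rule stopping_measurable_M[OF \<tau>])
  show ?thesis unfolding stopval_def by measurable
qed

text \<open>A right-continuous path that takes a negative value before \<open>t'\<close> stays
  negative for a moment, hence is negative at a rational time before \<open>t'\<close>. This decides
  only \<open>{\<tau> < t}\<close>, so the right-limit criterion is called for.\<close>

lemma stopping_time_hit: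
  assumes Z: "rc_process Z"
  shows "stopping_time F (\<lambda>\<omega>. Inf (ennreal ` {t. 0 \<le> t \<and> Z t \<omega> < 0}))" (is "stopping_time F ?\<tau>")
proof (rule stopping_time_right_limit)
  fix t :: ennreal assume "0 < t" "t < \<infinity>"
  then obtain t' where t': "0 < t'" "t = ennreal t'" by (cases t) auto
  let ?Q = "\<rat> \<inter> {0..<t'}"
  have m: "(\<Union>q\<in>?Q. {\<omega>\<in>space M. Z q \<omega> < 0}) \<in> sets (F t)"
  proof (rule sets.countable_UN'')
    show "countable ?Q" by (rule countable_Int1[OF countable_rat])
    show "{\<omega>\<in>space M. Z q \<omega> < 0} \<in> sets (F t)" if q: "q \<in> ?Q" for q
    proof -
      have Zq: "Z q \<in> borel_measurable (F t)"
        using q t' by (intro rc_process_measurable[OF Z]) (auto intro!: ennreal_leI)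
      have "{\<omega>\<in>space (F t). Z q \<omega> < 0} \<in> sets (F t)"
        using borel_measurable_less[OF Zq borel_measurable_const] .
      then show ?thesis by (simp only: space_F)
    qed
  qed
  show "{\<omega>\<in>space M. ?\<tau> \<omega> < t} \<in> sets (F t)"
  proof (rule sets_AE_eq[OF m])
    show "AE \<omega> in M. \<omega> \<in> (\<Union>q\<in>?Q. {\<omega>\<in>space M. Z q \<omega> < 0}) \<longleftrightarrow> \<omega> \<in> {\<omega>\<in>space M. ?\<tau> \<omega> < t}"
      using rc_process_rc[OF Z] AE_space
    proof eventually_elim
      case (elim \<omega>)
      have "?\<tau> \<omega> < t \<longleftrightarrow> (\<exists>s. 0 \<le> s \<and> s < t' \<and> Z s \<omega> < 0)"
        unfolding t'(2) Inf_less_iff by (force simp: ennreal_less_iff)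
      also have "\<dots> \<longleftrightarrow> (\<exists>q\<in>?Q. Z q \<omega> < 0)"
      proof
        assume "\<exists>s. 0 \<le> s \<and> s < t' \<and> Z s \<omega> < 0"
        then obtain s where s: "0 \<le> s" "s < t'" "Z s \<omega> < 0" by auto
        have "((\<lambda>u. Z u \<omega>) \<longlongrightarrow> Z s \<omega>) (at_right s)"
          using elim s by (auto simp: continuous_within)
        from order_tendstoD(2)[OF this s(3)] obtain b where b: "s < b" "\<And>u. s < u \<Longrightarrow> u < b \<Longrightarrow> Z u \<omega> < 0"
          by (auto simp: eventually_at_right_field)
        have "s < min b t'" using s b by auto
        from Rats_dense_in_real[OF this] obtain q where "q \<in> \<rat>" "s < q" "q < min b t'" by auto
        then show "\<exists>q\<in>?Q. Z q \<omega> < 0" using s b by (intro bexI[of _ q]) auto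
      qed auto
      finally show ?case using elim by auto
    qed
  qed auto
qed

section \<open>Optional stopping through discrete time grids\<close>

text \<open>Telescoping: the difference of the two stopped values is the sum of the increments
  \<open>N (Suc j) - N j\<close> over the events \<open>\<mu> \<le> j < \<nu>\<close>. The
  supermartingale inequality is stated on exactly these events, so no filtration has to be
  mentioned.\<close>

lemma discrete_optional_stopping:
  fixes N :: "nat \<Rightarrow> 'a \<Rightarrow> real" and \<mu> \<nu> :: "'a \<Rightarrow> nat"
  assumes int: "\<And>j. integrable M (N j)"
    and [measurable]: "\<mu> \<in> measurable M (count_space UNIV)" "\<nu> \<in> measurable M (count_space UNIV)"
    and le: "\<And>\<omega>. \<mu> \<omega> \<le> \<nu> \<omega>" "\<And>\<omega>. \<nu> \<omega> \<le> K"
    and super: "\<And>j. j < K \<Longrightarrow>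
      (\<integral>\<omega>. indicator {\<omega>\<in>space M. \<mu> \<omega> \<le> j \<and> j < \<nu> \<omega>} \<omega> * N (Suc j) \<omega> \<partial>M) \<le>
      (\<integral>\<omega>. indicator {\<omega>\<in>space M. \<mu> \<omega> \<le> j \<and> j < \<nu> \<omega>} \<omega> * N j \<omega> \<partial>M)"
  shows "integrable M (\<lambda>\<omega>. N (\<mu> \<omega>) \<omega>)" "integrable M (\<lambda>\<omega>. N (\<nu> \<omega>) \<omega>)"
    "(\<integral>\<omega>. N (\<nu> \<omega>) \<omega> \<partial>M) \<le> (\<integral>\<omega>. N (\<mu> \<omega>) \<omega> \<partial>M)"
proof -
  have [measurable]: "N j \<in> borel_measurable M" for j using int by auto
  have I: "integrable M (\<lambda>\<omega>. N (\<kappa> \<omega>) \<omega>)"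
    if [measurable]: "\<kappa> \<in> measurable M (count_space UNIV)" and "\<And>\<omega>. \<kappa> \<omega> \<le> K" for \<kappa> :: "'a \<Rightarrow> nat"
  proof (rule Bochner_Integration.integrable_bound)
    show "integrable M (\<lambda>\<omega>. \<Sum>j\<le>K. \<bar>N j \<omega>\<bar>)" using int by auto
    show "AE \<omega> in M. norm (N (\<kappa> \<omega>) \<omega>) \<le> norm (\<Sum>j\<le>K. \<bar>N j \<omega>\<bar>)"
    proof (rule AE_I2)
      fix \<omega>
      have "\<bar>N (\<kappa> \<omega>) \<omega>\<bar> \<le> (\<Sum>j\<le>K. \<bar>N j \<omega>\<bar>)"
        using that(2)[of \<omega>] by (intro member_le_sum) auto
      then show "norm (N (\<kappa> \<omega>) \<omega>) \<le> norm (\<Sum>j\<le>K. \<bar>N j \<omega>\<bar>)" by (simp add: sum_nonneg)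
    qed
    show "(\<lambda>\<omega>. N (\<kappa> \<omega>) \<omega>) \<in> borel_measurable M"
      by (rule measurable_compose_countable[where f=N and g=\<kappa>]) auto
  qed
  show i1: "integrable M (\<lambda>\<omega>. N (\<mu> \<omega>) \<omega>)"
    by (rule I) (measurable, rule order_trans[OF le])
  show i2: "integrable M (\<lambda>\<omega>. N (\<nu> \<omega>) \<omega>)"
    by (rule I) (measurable, rule le)
  let ?A = "\<lambda>j. {\<omega>\<in>space M. \<mu> \<omega> \<le> j \<and> j < \<nu> \<omega>}"
  have A: "?A j \<in> sets M" for j by measurable
  have iA: "integrable M (\<lambda>\<omega>. indicator (?A j) \<omega> * N k \<omega>)" for j k
    using integrable_mult_indicator[OF A int] by simp
  have "N (\<nu> \<omega>) \<omega> - N (\<mu> \<omega>) \<omega> = (\<Sum>j<K. indicator (?A j) \<omega> * (N (Suc j) \<omega> - N j \<omega>))" if "\<omega> \<in> space M" for \<omega>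
  proof -
    have "(\<Sum>j<K. indicator (?A j) \<omega> * (N (Suc j) \<omega> - N j \<omega>))
        = (\<Sum>j\<in>{\<mu> \<omega>..<\<nu> \<omega>}. N (Suc j) \<omega> - N j \<omega>)"
      using le[of \<omega>] that by (intro sum.mono_neutral_cong_right) (auto simp: indicator_def)
    also have "\<dots> = N (\<nu> \<omega>) \<omega> - N (\<mu> \<omega>) \<omega>"
      by (rule sum_Suc_diff') (rule le)
    finally show ?thesis by simp
  qed
  then have "(\<integral>\<omega>. N (\<nu> \<omega>) \<omega> - N (\<mu> \<omega>) \<omega> \<partial>M) = (\<integral>\<omega>. (\<Sum>j<K. indicator (?A j) \<omega> * (N (Suc j) \<omega> - N j \<omega>)) \<partial>M)"
    by (intro Bochner_Integration.integral_cong) auto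
  also have "\<dots> = (\<Sum>j<K. (\<integral>\<omega>. indicator (?A j) \<omega> * N (Suc j) \<omega> \<partial>M) - (\<integral>\<omega>. indicator (?A j) \<omega> * N j \<omega> \<partial>M))"
    using iA by (simp add: right_diff_distrib)
  also have "\<dots> \<le> 0"
    using super by (intro sum_nonpos) auto
  finally show "(\<integral>\<omega>. N (\<nu> \<omega>) \<omega> \<partial>M) \<le> (\<integral>\<omega>. N (\<mu> \<omega>) \<omega> \<partial>M)"
    using i1 i2 by simp
qed

text \<open>Index of the first grid point strictly after \<open>t\<close>, for mesh
  \<open>1 / (n + 1)\<close>. The cap \<open>(n + 1)^2\<close> corresponds to time
  \<open>n + 1\<close>; it keeps the index bounded, and all later times, including infinity, are
  sent there.\<close>

definition grid :: "nat \<Rightarrow> ennreal \<Rightarrow> nat" where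
  "grid n t = (LEAST j. j = (Suc n)\<^sup>2 \<or> t < ennreal (real j / real (Suc n)))"

lemma grid_le: "grid n t \<le> (Suc n)\<^sup>2"
  unfolding grid_def by (rule Least_le) simp

text \<open>Whether to continue past index \<open>j\<close> is decided by information up to time
  \<open>j / (n + 1)\<close>. This is what makes the rounded time a stopping time along the
  grid.\<close>

lemma less_grid_iff:
  assumes "j < (Suc n)\<^sup>2"
  shows "j < grid n t \<longleftrightarrow> ennreal (real j / real (Suc n)) \<le> t"
proof
  assume "j < grid n t"
  then have "\<not> (j = (Suc n)\<^sup>2 \<or> t < ennreal (real j / real (Suc n)))"
    unfolding grid_def by (rule not_less_Least)
  then show "ennreal (real j / real (Suc n)) \<le> t" by auto
next
  assume *: "ennreal (real j / real (Suc n)) \<le> t"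
  have "grid n t = (Suc n)\<^sup>2 \<or> t < ennreal (real (grid n t) / real (Suc n))"
    unfolding grid_def by (rule LeastI[of _ "(Suc n)\<^sup>2"]) simp
  then show "j < grid n t"
  proof
    assume "t < ennreal (real (grid n t) / real (Suc n))"
    with * have "ennreal (real j / real (Suc n)) < ennreal (real (grid n t) / real (Suc n))" by simp
    then show ?thesis
      by (simp add: ennreal_less_iff divide_less_cancel del: of_nat_Suc)
  qed (use assms in simp)
qed

lemma grid_mono: "s \<le> t \<Longrightarrow> grid n s \<le> grid n t"
  using less_grid_iff[of "grid n t" n s] less_grid_iff[of "grid n t" n t] grid_le[of n s] grid_le[of n t]
  by (meson leI less_le_trans order_less_irrefl order_trans)

lemma grid_infinity [simp]: "grid n \<infinity> = (Suc n)\<^sup>2"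
  using less_grid_iff[of "grid n \<infinity>" n \<infinity>] grid_le[of n \<infinity>] by fastforce

text \<open>The condition on \<open>n\<close> keeps the cap strictly beyond \<open>t\<close>. The
  upper estimate comes from the preceding index, whose grid time is at most
  \<open>t\<close>.\<close>

lemma grid_real:
  assumes t: "0 \<le> t" and n: "t + 1 \<le> real (Suc n)"
  shows "t < real (grid n (ennreal t)) / real (Suc n)"
    "real (grid n (ennreal t)) / real (Suc n) \<le> t + 1 / real (Suc n)"
proof -
  have *: "grid n (ennreal t) = (Suc n)\<^sup>2 \<or> ennreal t < ennreal (real (grid n (ennreal t)) / real (Suc n))"
    unfolding grid_def by (rule LeastI[of _ "(Suc n)\<^sup>2"]) simp
  have "real ((Suc n)\<^sup>2) / real (Suc n) = real (Suc n)"
    by (simp add: power2_eq_square del: of_nat_Suc mult_Suc mult_Suc_right)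
  with * n t show 1: "t < real (grid n (ennreal t)) / real (Suc n)"
    by (auto simp: ennreal_less_iff simp del: of_nat_Suc of_nat_power)
  obtain j where j: "grid n (ennreal t) = Suc j"
    using 1 t by (cases "grid n (ennreal t)") auto
  then have "j < grid n (ennreal t)" "j < (Suc n)\<^sup>2" using grid_le[of n "ennreal t"] by auto
  then have "ennreal (real j / real (Suc n)) \<le> ennreal t"
    using less_grid_iff by blast
  then have "real j / real (Suc n) \<le> t" using t by (simp add: ennreal_le_iff del: of_nat_Suc)
  moreover have "real (Suc j) / real (Suc n) = real j / real (Suc n) + 1 / real (Suc n)"
    unfolding of_nat_Suc[of j] by (simp add: add_divide_distrib del: of_nat_Suc)
  ultimately show "real (grid n (ennreal t)) / real (Suc n) \<le> t + 1 / real (Suc n)"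
    unfolding j by linarith
qed

lemma grid_filterlim:
  assumes "0 \<le> t"
  shows "filterlim (\<lambda>n. real (grid n (ennreal t)) / real (Suc n)) (at_right t) sequentially"
proof (rule tendsto_imp_filterlim_at_right)
  obtain m :: nat where "t + 1 \<le> real m" using real_arch_simple by blast
  then have ev: "eventually (\<lambda>n. t + 1 \<le> real (Suc n)) sequentially"
    by (auto intro!: eventually_sequentiallyI[of m])
  show "eventually (\<lambda>n. t < real (grid n (ennreal t)) / real (Suc n)) sequentially"
    using ev by eventually_elim (rule grid_real[OF assms])
  have l: "(\<lambda>n. t + 1 / real (Suc n)) \<longlonglongrightarrow> t + 0"
    by (intro tendsto_intros LIMSEQ_Suc[OF lim_1_over_n])
  show "(\<lambda>n. real (grid n (ennreal t)) / real (Suc n)) \<longlonglongrightarrow> t"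
  proof (rule tendsto_sandwich[OF _ _ tendsto_const])
    show "(\<lambda>n. t + 1 / real (Suc n)) \<longlonglongrightarrow> t" using l by simp
    show "eventually (\<lambda>n. t \<le> real (grid n (ennreal t)) / real (Suc n)) sequentially"
      using ev by eventually_elim (use grid_real[OF assms] less_imp_le in blast)
    show "eventually (\<lambda>n. real (grid n (ennreal t)) / real (Suc n) \<le> t + 1 / real (Suc n)) sequentially"
      using ev by eventually_elim (use grid_real[OF assms] in blast)
  qed
qed

lemma grid_less_sets:
  assumes "stopping_time F \<tau>" "j < (Suc n)\<^sup>2"
  shows "{\<omega>\<in>space M. j < grid n (\<tau> \<omega>)} \<in> sets (F (ennreal (real j / real (Suc n))))"
proof -
  let ?t = "ennreal (real j / real (Suc n))"
  have "Measurable.pred (F ?t) (\<lambda>\<omega>. \<tau> \<omega> < ?t)"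
    by (rule stopping_time_less_const[OF assms(1)])
  then have "Measurable.pred (F ?t) (\<lambda>\<omega>. \<not> \<tau> \<omega> < ?t)"
    by (rule pred_intros_logic)
  then show ?thesis
    using less_grid_iff[OF assms(2)] by (simp only: pred_F_iff not_less)
qed

lemma grid_measurable:
  assumes "stopping_time F \<tau>"
  shows "(\<lambda>\<omega>. grid n (\<tau> \<omega>)) \<in> measurable M (count_space UNIV)"
proof (rule measurable_count_space_eq_countable[THEN iffD2], simp, safe)
  fix i
  have B: "{\<omega>\<in>space M. j < grid n (\<tau> \<omega>)} \<in> sets M" for j
  proof (cases "j < (Suc n)\<^sup>2")
    case True
    then show ?thesis using grid_less_sets[OF assms True] sets_F_subset by blast
  next
    case False
    then have "{\<omega>\<in>space M. j < grid n (\<tau> \<omega>)} = {}"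
      using grid_le[of n] by (auto simp: not_less dest: order_trans leD)
    then show ?thesis by (simp only: sets.empty_sets)
  qed
  have "(\<lambda>\<omega>. grid n (\<tau> \<omega>)) -` {i} \<inter> space M =
     (if i = 0 then space M else {\<omega>\<in>space M. i - 1 < grid n (\<tau> \<omega>)}) - {\<omega>\<in>space M. i < grid n (\<tau> \<omega>)}"
    by auto
  also have "\<dots> \<in> sets M" using B by auto
  finally show "(\<lambda>\<omega>. grid n (\<tau> \<omega>)) -` {i} \<inter> space M \<in> sets M" .
qed simp

text \<open>The supermartingale inequality is tested against events instead of being written with
  conditional expectations: in this form the Markov property delivers it and discrete optional
  stopping consumes it.\<close>

definition super_process :: "(real \<Rightarrow> 'a \<Rightarrow> real) \<Rightarrow> bool" where
  "super_process Y \<longleftrightarrow> rc_process Y \<and> (\<forall>t\<ge>0. integrable M (Y t)) \<and>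
    (AE \<omega> in M. \<forall>t\<ge>0. 0 \<le> Y t \<omega>) \<and>
    (\<forall>s t. \<forall>A\<in>sets (F (ennreal s)). 0 \<le> s \<longrightarrow> s \<le> t \<longrightarrow>
      (\<integral>\<omega>. indicator A \<omega> * Y t \<omega> \<partial>M) \<le> (\<integral>\<omega>. indicator A \<omega> * Y s \<omega> \<partial>M))"

lemma grid_optional_stopping:
  assumes Y: "super_process Y" and a: "stopping_time F a" and b: "stopping_time F b"
    and ab: "\<And>\<omega>. a \<omega> \<le> b \<omega>"
  defines "T \<equiv> \<lambda>n t. real (grid n t) / real (Suc n)"
  shows "integrable M (\<lambda>\<omega>. Y (T n (b \<omega>)) \<omega>)"
    "(\<integral>\<omega>. Y (T n (b \<omega>)) \<omega> \<partial>M) \<le> (\<integral>\<omega>. Y (T n (a \<omega>)) \<omega> \<partial>M)"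
    "(\<integral>\<omega>. Y (T n (b \<omega>)) \<omega> \<partial>M) \<le> (\<integral>\<omega>. Y 0 \<omega> \<partial>M)"
proof -
  define N where "N j = Y (real j / real (Suc n))" for j
  have int: "integrable M (N j)" for j
    using Y unfolding super_process_def N_def by simp
  have sup: "(\<integral>\<omega>. indicator A \<omega> * N (Suc j) \<omega> \<partial>M) \<le> (\<integral>\<omega>. indicator A \<omega> * N j \<omega> \<partial>M)"
    if "A \<in> sets (F (ennreal (real j / real (Suc n))))" for A j
    using Y that unfolding super_process_def N_def by (auto simp: divide_right_mono)
  have A: "{\<omega>\<in>space M. grid n (a \<omega>) \<le> j \<and> j < grid n (b \<omega>)} \<in> sets (F (ennreal (real j / real (Suc n))))"
    if "j < (Suc n)\<^sup>2" for j
  proof -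
    have "{\<omega>\<in>space M. grid n (a \<omega>) \<le> j \<and> j < grid n (b \<omega>)} =
      {\<omega>\<in>space M. j < grid n (b \<omega>)} - {\<omega>\<in>space M. j < grid n (a \<omega>)}"
      by auto
    then show ?thesis
      using grid_less_sets[OF a that] grid_less_sets[OF b that] by (simp add: sets.Diff)
  qed
  note 1 = discrete_optional_stopping[where N=N and \<mu>="\<lambda>\<omega>. grid n (a \<omega>)" and \<nu>="\<lambda>\<omega>. grid n (b \<omega>)" and K="(Suc n)\<^sup>2",
      OF int grid_measurable[OF a] grid_measurable[OF b] grid_mono[OF ab] grid_le sup[OF A]]
  \<comment> \<open>Taking \<open>\<mu> = 0\<close> compares with the initial value.\<close>
  note 2 = discrete_optional_stopping[where N=N and \<mu>="\<lambda>\<omega>. 0" and \<nu>="\<lambda>\<omega>. grid n (b \<omega>)" and K="(Suc n)\<^sup>2",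
      OF int _ grid_measurable[OF b] _ grid_le sup]
  show "integrable M (\<lambda>\<omega>. Y (T n (b \<omega>)) \<omega>)"
    "(\<integral>\<omega>. Y (T n (b \<omega>)) \<omega> \<partial>M) \<le> (\<integral>\<omega>. Y (T n (a \<omega>)) \<omega> \<partial>M)"
    using 1 unfolding N_def T_def by auto
  show "(\<integral>\<omega>. Y (T n (b \<omega>)) \<omega> \<partial>M) \<le> (\<integral>\<omega>. Y 0 \<omega> \<partial>M)"
    using 2(3) grid_less_sets[OF b] unfolding N_def T_def by simp
qed

lemma grid_stopval_tendsto:
  assumes Y: "rc_process Y"
  shows "AE \<omega> in M. \<tau> \<omega> < \<infinity> \<longrightarrow>
    (\<lambda>n. Y (real (grid n (\<tau> \<omega>)) / real (Suc n)) \<omega>) \<longlonglongrightarrow> stopval Y \<tau> \<omega>"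
  using rc_process_rc[OF Y]
proof eventually_elim
  case (elim \<omega>)
  show ?case
  proof
    assume "\<tau> \<omega> < \<infinity>"
    then obtain t where t: "0 \<le> t" "\<tau> \<omega> = ennreal t" by (cases "\<tau> \<omega>") auto
    have "((\<lambda>s. Y s \<omega>) \<longlongrightarrow> Y t \<omega>) (at_right t)"
      using elim t by (simp add: continuous_within)
    from filterlim_compose[OF this grid_filterlim[OF t(1)]]
    show "(\<lambda>n. Y (real (grid n (\<tau> \<omega>)) / real (Suc n)) \<omega>) \<longlonglongrightarrow> stopval Y \<tau> \<omega>"
      using t by (simp add: stopval_def)
  qed
qed

text \<open>Fatou's lemma along the rounded-up times; non-negativity takes the place of domination.
  This form applies to the squared weight, whose running supremum is not assumed integrable.\<close>

lemma super_process_stopval_le: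
  assumes Y: "super_process Y" and \<tau>: "stopping_time F \<tau>"
  shows "(\<integral>\<^sup>+\<omega>. ennreal (stopval Y \<tau> \<omega>) \<partial>M) \<le> ennreal (\<integral>\<omega>. Y 0 \<omega> \<partial>M)"
proof -
  let ?Z = "\<lambda>n \<omega>. Y (real (grid n (\<tau> \<omega>)) / real (Suc n)) \<omega>"
  have rc: "rc_process Y" and nn: "AE \<omega> in M. \<forall>t\<ge>0. 0 \<le> Y t \<omega>"
    using Y by (auto simp: super_process_def)
  note Z = grid_optional_stopping[OF Y \<tau> \<tau> order_refl]
  have nnZ: "AE \<omega> in M. 0 \<le> ?Z n \<omega>" for n
    using nn by eventually_elim simp
  have "(\<integral>\<^sup>+\<omega>. ennreal (stopval Y \<tau> \<omega>) \<partial>M) \<le> (\<integral>\<^sup>+\<omega>. liminf (\<lambda>n. ennreal (?Z n \<omega>)) \<partial>M)"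
  proof (rule nn_integral_mono_AE)
    show "AE \<omega> in M. ennreal (stopval Y \<tau> \<omega>) \<le> liminf (\<lambda>n. ennreal (?Z n \<omega>))"
      using grid_stopval_tendsto[OF rc, of \<tau>]
    proof eventually_elim
      case (elim \<omega>)
      show ?case
      proof (cases "\<tau> \<omega> < \<infinity>")
        case True
        then have "(\<lambda>n. ennreal (?Z n \<omega>)) \<longlonglongrightarrow> ennreal (stopval Y \<tau> \<omega>)"
          using elim by (intro tendsto_ennrealI) simp
        then show ?thesis by (simp add: lim_imp_Liminf)
      qed (simp add: stopval_def less_top[symmetric])
    qed
  qed
  also have "\<dots> \<le> liminf (\<lambda>n. \<integral>\<^sup>+\<omega>. ennreal (?Z n \<omega>) \<partial>M)"
    by (rule nn_integral_liminf) (use Z(1) in auto)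
  also have "\<dots> \<le> liminf (\<lambda>n. ennreal (\<integral>\<omega>. Y 0 \<omega> \<partial>M))"
  proof (intro Liminf_mono always_eventually allI)
    fix n
    have "(\<integral>\<^sup>+\<omega>. ennreal (?Z n \<omega>) \<partial>M) = ennreal (\<integral>\<omega>. ?Z n \<omega> \<partial>M)"
      using Z(1) nnZ by (rule nn_integral_eq_integral)
    also have "\<dots> \<le> ennreal (\<integral>\<omega>. Y 0 \<omega> \<partial>M)"
      by (rule ennreal_leI) (rule Z(3))
    finally show "(\<integral>\<^sup>+\<omega>. ennreal (?Z n \<omega>) \<partial>M) \<le> ennreal (\<integral>\<omega>. Y 0 \<omega> \<partial>M)" .
  qed
  also have "\<dots> = ennreal (\<integral>\<omega>. Y 0 \<omega> \<partial>M)" by (simp add: Liminf_const)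
  finally show ?thesis .
qed

lemma stopval_dominated:
  assumes "AE \<omega> in M. \<forall>t\<ge>0. \<bar>Y t \<omega>\<bar> \<le> B \<omega>"
  shows "AE \<omega> in M. \<bar>stopval Y \<tau> \<omega>\<bar> \<le> B \<omega>"
  using assms
proof eventually_elim
  case (elim \<omega>)
  from elim have "0 \<le> B \<omega>" using abs_ge_zero[of "Y 0 \<omega>"] by fastforce
  with elim show ?case by (auto simp: stopval_def)
qed

lemma stopval_integrable:
  assumes "rc_process Y" "stopping_time F \<tau>" "integrable M B" "AE \<omega> in M. \<forall>t\<ge>0. \<bar>Y t \<omega>\<bar> \<le> B \<omega>"
  shows "integrable M (stopval Y \<tau>)"
  by (rule Bochner_Integration.integrable_bound[OF assms(3) stopval_measurable[OF assms(1,2)]])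
    (use stopval_dominated[OF assms(4), of \<tau>] in \<open>eventually_elim, auto\<close>)

text \<open>Dominated convergence. The indicator matters: where \<open>\<tau>\<close> is infinite
  the rounded time is \<open>n + 1\<close>, so the discretised value need not tend to the
  \<open>0\<close> prescribed by \<open>stopval\<close>.\<close>

lemma grid_stopval_integral:
  assumes rc: "rc_process Y" and \<tau>: "stopping_time F \<tau>" and B: "integrable M B"
    and dom: "AE \<omega> in M. \<forall>t\<ge>0. \<bar>Y t \<omega>\<bar> \<le> B \<omega>"
  shows "(\<lambda>n. \<integral>\<omega>. indicator {\<omega>\<in>space M. \<tau> \<omega> < \<infinity>} \<omega> * Y (real (grid n (\<tau> \<omega>)) / real (Suc n)) \<omega> \<partial>M)
      \<longlonglongrightarrow> (\<integral>\<omega>. stopval Y \<tau> \<omega> \<partial>M)"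
    and "\<And>n. (\<lambda>\<omega>. Y (real (grid n (\<tau> \<omega>)) / real (Suc n)) \<omega>) \<in> borel_measurable M"
proof -
  have [measurable]: "\<tau> \<in> borel_measurable M" by (rule stopping_measurable_M[OF \<tau>])
  show m[measurable]: "(\<lambda>\<omega>. Y (real (grid n (\<tau> \<omega>)) / real (Suc n)) \<omega>) \<in> borel_measurable M" for n
  proof (rule measurable_compose_countable[where f="\<lambda>j. Y (real j / real (Suc n))" and g="\<lambda>\<omega>. grid n (\<tau> \<omega>)"])
    show "Y (real j / real (Suc n)) \<in> borel_measurable M" for j
      by (rule measurable_F_M[OF rc_process_measurable[OF rc _ order_refl]]) simp
  qed (rule grid_measurable[OF \<tau>])
  show "(\<lambda>n. \<integral>\<omega>. indicator {\<omega>\<in>space M. \<tau> \<omega> < \<infinity>} \<omega> * Y (real (grid n (\<tau> \<omega>)) / real (Suc n)) \<omega> \<partial>M)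
      \<longlonglongrightarrow> (\<integral>\<omega>. stopval Y \<tau> \<omega> \<partial>M)"
  proof (rule integral_dominated_convergence[where w=B])
    show "stopval Y \<tau> \<in> borel_measurable M" by (rule stopval_measurable[OF rc \<tau>])
    show "AE \<omega> in M. (\<lambda>n. indicator {\<omega>\<in>space M. \<tau> \<omega> < \<infinity>} \<omega> * Y (real (grid n (\<tau> \<omega>)) / real (Suc n)) \<omega>)
        \<longlonglongrightarrow> stopval Y \<tau> \<omega>"
      using grid_stopval_tendsto[OF rc, of \<tau>] AE_space
      by eventually_elim (auto simp: indicator_def stopval_def less_top[symmetric])
    show "AE \<omega> in M. norm (indicator {\<omega>\<in>space M. \<tau> \<omega> < \<infinity>} \<omega> * Y (real (grid n (\<tau> \<omega>)) / real (Suc n)) \<omega>) \<le> B \<omega>" for n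
      using dom
    proof eventually_elim
      case (elim \<omega>)
      from elim have "0 \<le> B \<omega>" using abs_ge_zero[of "Y 0 \<omega>"] by fastforce
      with elim show ?case by (auto simp: indicator_def)
    qed
    show "(\<lambda>\<omega>. indicator {\<omega>\<in>space M. \<tau> \<omega> < \<infinity>} \<omega> * Y (real (grid n (\<tau> \<omega>)) / real (Suc n)) \<omega>) \<in> borel_measurable M" for n
      using m[of n] by measurable
  qed (rule B)
qed

lemma super_process_optional_stopping:
  assumes Y: "super_process Y" and a: "stopping_time F a" and b: "stopping_time F b"
    and ab: "\<And>\<omega>. a \<omega> \<le> b \<omega>"
    and B: "integrable M B" and dom: "AE \<omega> in M. \<forall>t\<ge>0. \<bar>Y t \<omega>\<bar> \<le> B \<omega>"
    and vanish: "(\<lambda>n::nat. \<integral>\<omega>. Y (real n) \<omega> \<partial>M) \<longlonglongrightarrow> 0"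
  shows "(\<integral>\<omega>. stopval Y b \<omega> \<partial>M) \<le> (\<integral>\<omega>. stopval Y a \<omega> \<partial>M)"
proof -
  define T where "T n t = real (grid n t) / real (Suc n)" for n t
  have rc: "rc_process Y" and nn: "AE \<omega> in M. \<forall>t\<ge>0. 0 \<le> Y t \<omega>" and iY: "\<And>t. 0 \<le> t \<Longrightarrow> integrable M (Y t)"
    using Y by (auto simp: super_process_def)
  have [measurable]: "a \<in> borel_measurable M" "b \<in> borel_measurable M"
    using stopping_measurable_M a b by auto
  have ia: "integrable M (\<lambda>\<omega>. Y (T n (a \<omega>)) \<omega>)" and ib: "integrable M (\<lambda>\<omega>. Y (T n (b \<omega>)) \<omega>)" for n
    using grid_optional_stopping(1)[OF Y a a] grid_optional_stopping(1)[OF Y b b] by (auto simp: T_def)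
  let ?I = "\<lambda>\<tau>. {\<omega>\<in>space M. \<tau> \<omega> < (\<infinity>::ennreal)}"
  have ind: "integrable M (\<lambda>\<omega>. indicator (?I \<tau>) \<omega> * Y (T n (\<tau> \<omega>)) \<omega>)"
    if "integrable M (\<lambda>\<omega>. Y (T n (\<tau> \<omega>)) \<omega>)" and [measurable]: "\<tau> \<in> borel_measurable M" for \<tau> n
  proof -
    have "?I \<tau> \<in> sets M" by measurable
    from integrable_mult_indicator[OF this that(1)] show ?thesis by simp
  qed
  have "(\<integral>\<omega>. indicator (?I b) \<omega> * Y (T n (b \<omega>)) \<omega> \<partial>M) \<le>
      (\<integral>\<omega>. indicator (?I a) \<omega> * Y (T n (a \<omega>)) \<omega> \<partial>M) + (\<integral>\<omega>. Y (real (Suc n)) \<omega> \<partial>M)" for n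
  proof -
    have "(\<integral>\<omega>. indicator (?I b) \<omega> * Y (T n (b \<omega>)) \<omega> \<partial>M) \<le> (\<integral>\<omega>. Y (T n (b \<omega>)) \<omega> \<partial>M)"
    proof (rule integral_mono_AE[OF ind[OF ib] ib])
      show "AE \<omega> in M. indicator (?I b) \<omega> * Y (T n (b \<omega>)) \<omega> \<le> Y (T n (b \<omega>)) \<omega>"
        using nn by eventually_elim (auto simp: indicator_def T_def)
    qed auto
    also have "\<dots> \<le> (\<integral>\<omega>. Y (T n (a \<omega>)) \<omega> \<partial>M)"
      unfolding T_def by (rule grid_optional_stopping(2)[OF Y a b ab])
    \<comment> \<open>Where \<open>a\<close> is infinite the grid reads \<open>Y\<close> at time
      \<open>n + 1\<close>; the hypothesis \<open>vanish\<close> removes this extra term in the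
      limit.\<close>
    also have "\<dots> \<le> (\<integral>\<omega>. indicator (?I a) \<omega> * Y (T n (a \<omega>)) \<omega> + Y (real (Suc n)) \<omega> \<partial>M)"
    proof (rule integral_mono_AE[OF ia Bochner_Integration.integrable_add[OF ind[OF ia] iY]])
      show "AE \<omega> in M. Y (T n (a \<omega>)) \<omega> \<le> indicator (?I a) \<omega> * Y (T n (a \<omega>)) \<omega> + Y (real (Suc n)) \<omega>"
        using nn AE_space
      proof eventually_elim
        case (elim \<omega>)
        have "T n \<infinity> = real (Suc n)"
          unfolding T_def grid_infinity
          by (simp add: power2_eq_square del: of_nat_Suc mult_Suc mult_Suc_right)
        with elim show ?case
          by (auto simp: indicator_def less_top[symmetric])
      qed
    qed auto
    also have "\<dots> = (\<integral>\<omega>. indicator (?I a) \<omega> * Y (T n (a \<omega>)) \<omega> \<partial>M) + (\<integral>\<omega>. Y (real (Suc n)) \<omega> \<partial>M)"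
      by (rule Bochner_Integration.integral_add[OF ind[OF ia] iY]) auto
    finally show ?thesis .
  qed
  moreover have "(\<lambda>n. (\<integral>\<omega>. indicator (?I a) \<omega> * Y (T n (a \<omega>)) \<omega> \<partial>M) + (\<integral>\<omega>. Y (real (Suc n)) \<omega> \<partial>M))
      \<longlonglongrightarrow> (\<integral>\<omega>. stopval Y a \<omega> \<partial>M) + 0"
    unfolding T_def by (intro tendsto_add grid_stopval_integral[OF rc a B dom] LIMSEQ_Suc[OF vanish])
  moreover have "(\<lambda>n. \<integral>\<omega>. indicator (?I b) \<omega> * Y (T n (b \<omega>)) \<omega> \<partial>M) \<longlonglongrightarrow> (\<integral>\<omega>. stopval Y b \<omega> \<partial>M)"
    unfolding T_def by (rule grid_stopval_integral[OF rc b B dom])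
  ultimately have "(\<integral>\<omega>. stopval Y b \<omega> \<partial>M) \<le> (\<integral>\<omega>. stopval Y a \<omega> \<partial>M) + 0"
    by (intro LIMSEQ_le) auto
  then show ?thesis by simp
qed

end

section \<open>Right-continuous Markov flows with a weight\<close>

text \<open>Common frame of both horizons: the original flow on the whole space, and the absorbed
  flow on the time strip. In both cases \<open>w\<close> is the square root of
  \<open>1 + |x|^2\<close> (with the spatial norm in the second) and
  \<open>\<kappa> = r (1 - \<rho>)\<close>. Discounting at rate \<open>r\<close> against growth at
  rate \<open>\<kappa> < r\<close> leaves the decay \<open>exp (- (r - \<kappa>) t)\<close>.\<close>

locale weighted_flow = complete_filtration M F
  for M :: "'a measure" and F :: "ennreal \<Rightarrow> 'a measure" +
  fixes X :: "real \<Rightarrow> 's::euclidean_space \<Rightarrow> 'a \<Rightarrow> 's" and S :: "'s set"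
    and w :: "'s \<Rightarrow> real" and r \<kappa> :: real
  assumes closed_S: "closed S"
    and continuous_w: "continuous_on S w"
    and w_ge_1: "\<And>x. x \<in> S \<Longrightarrow> 1 \<le> w x"
    and w_lipschitz: "\<And>x y. x \<in> S \<Longrightarrow> y \<in> S \<Longrightarrow> \<bar>w x - w y\<bar> \<le> dist x y"
    and w_bounded_levels: "\<And>R. bounded {x\<in>S. w x \<le> R}"
    and \<kappa>_nonneg: "0 \<le> \<kappa>" and \<kappa>_less: "\<kappa> < r"
    and X_adapted: "\<And>x t. x \<in> S \<Longrightarrow> 0 \<le> t \<Longrightarrow> X t x \<in> borel_measurable (F (ennreal t))"
    and X_start: "\<And>x. x \<in> S \<Longrightarrow> AE \<omega> in M. X 0 x \<omega> = x"
    and X_in_S: "\<And>x. x \<in> S \<Longrightarrow> AE \<omega> in M. \<forall>t\<ge>0. X t x \<omega> \<in> S"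
    and X_rc: "\<And>x. x \<in> S \<Longrightarrow> AE \<omega> in M. \<forall>t\<ge>0. continuous (at_right t) (\<lambda>s. X s x \<omega>)"
    and X_qlc: "\<And>x \<tau>. x \<in> S \<Longrightarrow> (\<And>n::nat. stopping_time F (\<tau> n)) \<Longrightarrow> (\<And>\<omega>. incseq (\<lambda>n. \<tau> n \<omega>)) \<Longrightarrow>
        AE \<omega> in M. (SUP n. \<tau> n \<omega>) < \<infinity> \<longrightarrow>
          (\<lambda>n. X (enn2real (\<tau> n \<omega>)) x \<omega>) \<longlonglongrightarrow> X (enn2real (SUP n. \<tau> n \<omega>)) x \<omega>"
    and X_markov: "\<And>x t s A f. x \<in> S \<Longrightarrow> 0 \<le> t \<Longrightarrow> 0 \<le> s \<Longrightarrow> A \<in> sets (F (ennreal t)) \<Longrightarrow>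
        f \<in> borel_measurable borel \<Longrightarrow>
        (\<integral>\<^sup>+\<omega>. indicator A \<omega> * f (X (t + s) x \<omega>) \<partial>M)
        = (\<integral>\<^sup>+\<omega>. indicator A \<omega> * (\<integral>\<^sup>+\<omega>'. f (X s (X t x \<omega>) \<omega>') \<partial>M) \<partial>M)"
    and dominated: "\<And>x. x \<in> S \<Longrightarrow>
        \<exists>B. integrable M B \<and> (AE \<omega> in M. \<forall>t\<ge>0. exp (- r * t) * w (X t x \<omega>) \<le> B \<omega>)"
    and growth: "\<And>x \<tau>. x \<in> S \<Longrightarrow> stopping_time F \<tau> \<Longrightarrow>
        (\<integral>\<^sup>+\<omega>. ennreal (stopval (\<lambda>t \<omega>. exp (- \<kappa> * t) * w (X t x \<omega>)) \<tau> \<omega>) \<partial>M) \<le> ennreal (w x)"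
begin

lemma r_positive: "0 < r"
  using \<kappa>_nonneg \<kappa>_less by simp

lemma w_pos: "x \<in> S \<Longrightarrow> 0 < w x" "x \<in> S \<Longrightarrow> 0 \<le> w x"
  using w_ge_1[of x] by auto

section \<open>Admissible functions, rewards and transition operators\<close>

text \<open>For the weights in use this is membership in the function space of the theorem, except
  that values outside \<open>S\<close> are arbitrary.\<close>

definition adm :: "('s \<Rightarrow> real) \<Rightarrow> bool" where
  "adm f \<longleftrightarrow> continuous_on S f \<and> (\<forall>x\<in>S. 0 \<le> f x) \<and> (\<exists>C. \<forall>x\<in>S. f x \<le> C * w x)"

definition disc :: "('s \<Rightarrow> real) \<Rightarrow> 's \<Rightarrow> real \<Rightarrow> 'a \<Rightarrow> real" where
  "disc f x t \<omega> = exp (- r * t) * f (X t x \<omega>)"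

definition reward :: "('s \<Rightarrow> real) \<Rightarrow> 's \<Rightarrow> ('a \<Rightarrow> ennreal) \<Rightarrow> real" where
  "reward f x \<tau> = (\<integral>\<omega>. stopval (disc f x) \<tau> \<omega> \<partial>M)"

definition P :: "real \<Rightarrow> ('s \<Rightarrow> real) \<Rightarrow> 's \<Rightarrow> real" where
  "P s f x = (\<integral>\<omega>. f (X s x \<omega>) \<partial>M)"

lemma adm_bound:
  assumes "adm f" obtains C where "0 \<le> C" "\<And>x. x \<in> S \<Longrightarrow> f x \<le> C * w x"
proof -
  obtain C where C: "\<forall>x\<in>S. f x \<le> C * w x" using assms by (auto simp: adm_def)
  have "f x \<le> max 0 C * w x" if "x \<in> S" for x
    using C that w_pos[OF that] by (meson max.cobounded2 mult_right_mono order_trans)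
  then show ?thesis using that[of "max 0 C"] by auto
qed

lemma adm_w: "adm w"
  unfolding adm_def using continuous_w w_pos by (auto intro!: exI[of _ 1])

lemma adm_cont: "adm f \<Longrightarrow> continuous_on S f" and adm_nonneg: "adm f \<Longrightarrow> x \<in> S \<Longrightarrow> 0 \<le> f x"
  by (auto simp: adm_def)

lemma admI:
  "continuous_on S f \<Longrightarrow> (\<And>x. x \<in> S \<Longrightarrow> 0 \<le> f x) \<Longrightarrow> (\<And>x. x \<in> S \<Longrightarrow> f x \<le> C * w x) \<Longrightarrow> adm f"
  by (auto simp: adm_def)

lemma adm_add:
  assumes "adm f" "adm g" shows "adm (\<lambda>x. f x + g x)"
proof -
  obtain C where C: "\<And>x. x \<in> S \<Longrightarrow> f x \<le> C * w x" using adm_bound[OF assms(1)] by metis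
  obtain D where D: "\<And>x. x \<in> S \<Longrightarrow> g x \<le> D * w x" using adm_bound[OF assms(2)] by metis
  show ?thesis
    by (rule admI[where C="C + D"])
      (use assms C D in \<open>auto intro!: continuous_on_add add_nonneg_nonneg add_mono simp: adm_cont adm_nonneg distrib_right\<close>)
qed

lemma adm_cmult:
  assumes "adm f" "0 \<le> c" shows "adm (\<lambda>x. c * f x)"
proof -
  obtain C where C: "\<And>x. x \<in> S \<Longrightarrow> f x \<le> C * w x" using adm_bound[OF assms(1)] by metis
  show ?thesis
    by (rule admI[where C="c * C"])
      (use assms C in \<open>auto intro!: continuous_on_mult mult_nonneg_nonneg mult_left_mono simp: adm_cont adm_nonneg mult.assoc\<close>)
qed

lemma adm_max:
  assumes "adm f" "adm g" shows "adm (\<lambda>x. max (f x) (g x))"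
proof -
  obtain C where C: "\<And>x. x \<in> S \<Longrightarrow> f x \<le> C * w x" "0 \<le> C" using adm_bound[OF assms(1)] by metis
  obtain D where D: "\<And>x. x \<in> S \<Longrightarrow> g x \<le> D * w x" "0 \<le> D" using adm_bound[OF assms(2)] by metis
  have 1: "max (f x) (g x) \<le> (C + D) * w x" if "x \<in> S" for x
    using C(1)[OF that] D(1)[OF that] mult_nonneg_nonneg[OF C(2) w_pos(2)[OF that]]
      mult_nonneg_nonneg[OF D(2) w_pos(2)[OF that]]
    by (simp add: distrib_right)
  show ?thesis
    by (rule admI[where C="C + D"])
      (use assms 1 in \<open>auto intro!: continuous_on_max simp: adm_cont le_max_iff_disj adm_nonneg\<close>)
qed

lemma measurable_on_S:
  fixes f :: "'s \<Rightarrow> real"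
  assumes f: "continuous_on S f" and x: "x \<in> S" and t: "0 \<le> t"
  shows "(\<lambda>\<omega>. f (X t x \<omega>)) \<in> borel_measurable (F (ennreal t))"
proof -
  have S: "S \<in> sets borel" using closed_S by (rule borel_closed)
  \<comment> \<open>\<open>f\<close> is controlled only on \<open>S\<close>; its extension by
    \<open>0\<close> is Borel on the whole space and agrees with \<open>f\<close> along the flow
    almost surely.\<close>
  have 1: "(\<lambda>y. indicator S y *\<^sub>R f y) \<in> borel_measurable borel"
    by (rule borel_measurable_continuous_on_indicator[OF S f])
  have "(\<lambda>\<omega>. indicator S (X t x \<omega>) *\<^sub>R f (X t x \<omega>)) \<in> borel_measurable (F (ennreal t))"
    using measurable_compose[OF X_adapted[OF x t] 1] .
  then show ?thesis
    by (rule measurable_AE_eq) (use X_in_S[OF x] in \<open>eventually_elim, use t in auto\<close>)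
qed

lemma rc_process_disc_exp:
  fixes f :: "'s \<Rightarrow> real"
  assumes f: "continuous_on S f" and x: "x \<in> S"
  shows "rc_process (\<lambda>t \<omega>. exp (- c * t) * f (X t x \<omega>))"
  unfolding rc_process_def
proof (intro conjI allI impI)
  show "(\<lambda>\<omega>. exp (- c * t) * f (X t x \<omega>)) \<in> borel_measurable (F (ennreal t))" if "0 \<le> t" for t
    using measurable_on_S[OF f x that] by measurable
  show "AE \<omega> in M. \<forall>t\<ge>0. continuous (at_right t) (\<lambda>s. exp (- c * s) * f (X s x \<omega>))"
    using X_rc[OF x] X_in_S[OF x]
  proof eventually_elim
    case (elim \<omega>)
    show ?case
    proof (intro allI impI)
      fix t :: real assume t: "0 \<le> t"
      have ev: "eventually (\<lambda>s. X s x \<omega> \<in> S) (at_right t)"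
        using eventually_at_right_less[of t] by eventually_elim (use elim t in auto)
      have "((\<lambda>s. X s x \<omega>) \<longlongrightarrow> X t x \<omega>) (at_right t)"
        using elim t by (simp add: continuous_within)
      from continuous_on_tendsto_compose[OF f this _ ev]
      have "((\<lambda>s. f (X s x \<omega>)) \<longlongrightarrow> f (X t x \<omega>)) (at_right t)" using elim t by auto
      then show "continuous (at_right t) (\<lambda>s. exp (- c * s) * f (X s x \<omega>))"
        unfolding continuous_within by (intro tendsto_intros)
    qed
  qed
qed

lemma rc_process_disc: "continuous_on S f \<Longrightarrow> x \<in> S \<Longrightarrow> rc_process (disc f x)"
  using rc_process_disc_exp[of f x r] unfolding disc_def[abs_def] .

text \<open>One \<open>B\<close>, depending only on the starting point, serves all functions at
  once: it bounds the discounted weight along the path, and a bound \<open>C * w\<close> on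
  \<open>f\<close> merely rescales it.\<close>

lemma disc_dominated:
  assumes x: "x \<in> S"
  obtains B where "integrable M B"
    "\<And>f C. (\<And>y. y \<in> S \<Longrightarrow> \<bar>f y\<bar> \<le> C * w y) \<Longrightarrow> AE \<omega> in M. \<forall>t\<ge>0. \<bar>disc f x t \<omega>\<bar> \<le> C * B \<omega>"
proof -
  obtain B where B: "integrable M B" "AE \<omega> in M. \<forall>t\<ge>0. exp (- r * t) * w (X t x \<omega>) \<le> B \<omega>"
    using dominated[OF x] by blast
  show ?thesis
  proof (rule that[OF B(1)])
    fix f :: "'s \<Rightarrow> real" and C assume f: "\<And>y. y \<in> S \<Longrightarrow> \<bar>f y\<bar> \<le> C * w y"
    have "0 \<le> C * w x" using f[OF x] by linarith
    then have C: "0 \<le> C" using w_pos[OF x] by (simp add: zero_le_mult_iff)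
    show "AE \<omega> in M. \<forall>t\<ge>0. \<bar>disc f x t \<omega>\<bar> \<le> C * B \<omega>"
      using B(2) X_in_S[OF x]
    proof eventually_elim
      case (elim \<omega>)
      show ?case
      proof (intro allI impI)
        fix t :: real assume t: "0 \<le> t"
        have "\<bar>disc f x t \<omega>\<bar> = exp (- r * t) * \<bar>f (X t x \<omega>)\<bar>"
          by (simp add: disc_def abs_mult)
        also have "\<dots> \<le> exp (- r * t) * (C * w (X t x \<omega>))"
          using f elim t by (intro mult_left_mono) auto
        also have "\<dots> = C * (exp (- r * t) * w (X t x \<omega>))" by simp
        also have "\<dots> \<le> C * B \<omega>" using elim t C by (intro mult_left_mono) auto
        finally show "\<bar>disc f x t \<omega>\<bar> \<le> C * B \<omega>" .
      qed
    qed
  qed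
qed

lemma adm_dominated:
  assumes "adm f" "x \<in> S"
  obtains B where "integrable M B" "AE \<omega> in M. \<forall>t\<ge>0. \<bar>disc f x t \<omega>\<bar> \<le> B \<omega>"
proof -
  obtain C where C: "0 \<le> C" "\<And>x. x \<in> S \<Longrightarrow> f x \<le> C * w x" using adm_bound[OF assms(1)] by metis
  obtain B where B: "integrable M B"
    "\<And>f C. (\<And>y. y \<in> S \<Longrightarrow> \<bar>f y\<bar> \<le> C * w y) \<Longrightarrow> AE \<omega> in M. \<forall>t\<ge>0. \<bar>disc f x t \<omega>\<bar> \<le> C * B \<omega>"
    using disc_dominated[OF assms(2)] by blast
  have "AE \<omega> in M. \<forall>t\<ge>0. \<bar>disc f x t \<omega>\<bar> \<le> C * B \<omega>"
    by (rule B(2)) (use C assms(1) in \<open>auto simp: adm_nonneg\<close>)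
  then show ?thesis using that[of "\<lambda>\<omega>. C * B \<omega>"] B(1) by auto
qed

lemma disc_nonneg:
  assumes "adm f" "x \<in> S" shows "AE \<omega> in M. \<forall>t\<ge>0. 0 \<le> disc f x t \<omega>"
  using X_in_S[OF assms(2)] by eventually_elim (use adm_nonneg[OF assms(1)] in \<open>auto simp: disc_def\<close>)

lemma reward_integrable:
  assumes "adm f" "x \<in> S" "stopping_time F \<tau>"
  shows "integrable M (stopval (disc f x) \<tau>)"
proof -
  obtain B where "integrable M B" "AE \<omega> in M. \<forall>t\<ge>0. \<bar>disc f x t \<omega>\<bar> \<le> B \<omega>"
    using adm_dominated[OF assms(1,2)] by blast
  then show ?thesis
    using stopval_integrable[OF rc_process_disc[OF adm_cont[OF assms(1)] assms(2)] assms(3)] by blast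
qed

lemma stopval_disc_nonneg:
  assumes "adm f" "x \<in> S" shows "AE \<omega> in M. 0 \<le> stopval (disc f x) \<tau> \<omega>"
  using disc_nonneg[OF assms] by eventually_elim (auto simp: stopval_def)

lemma stopval_disc_mono:
  assumes "\<And>y. y \<in> S \<Longrightarrow> f y \<le> g y" "x \<in> S"
  shows "AE \<omega> in M. stopval (disc f x) \<tau> \<omega> \<le> stopval (disc g x) \<tau> \<omega>"
  using X_in_S[OF assms(2)] by eventually_elim (use assms(1) in \<open>auto simp: stopval_def disc_def\<close>)

lemma reward_nonneg: "adm f \<Longrightarrow> x \<in> S \<Longrightarrow> 0 \<le> reward f x \<tau>"
  unfolding reward_def by (rule integral_nonneg_AE[OF stopval_disc_nonneg])

lemma reward_mono:
  assumes "adm f" "adm g" "\<And>y. y \<in> S \<Longrightarrow> f y \<le> g y" "x \<in> S" "stopping_time F \<tau>"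
  shows "reward f x \<tau> \<le> reward g x \<tau>"
  unfolding reward_def
  by (rule integral_mono_AE[OF reward_integrable reward_integrable stopval_disc_mono]) (use assms in auto)

lemma reward_add:
  assumes "adm f" "adm g" "x \<in> S" "stopping_time F \<tau>"
  shows "reward (\<lambda>y. f y + g y) x \<tau> = reward f x \<tau> + reward g x \<tau>"
proof -
  have "stopval (disc (\<lambda>y. f y + g y) x) \<tau> = (\<lambda>\<omega>. stopval (disc f x) \<tau> \<omega> + stopval (disc g x) \<tau> \<omega>)"
    by (auto simp: stopval_def disc_def fun_eq_iff distrib_left)
  then show ?thesis unfolding reward_def
    by (simp add: reward_integrable assms)
qed

lemma reward_cmult: "reward (\<lambda>y. c * f y) x \<tau> = c * reward f x \<tau>"
proof -
  have "stopval (disc (\<lambda>y. c * f y) x) \<tau> = (\<lambda>\<omega>. c * stopval (disc f x) \<tau> \<omega>)"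
    by (auto simp: stopval_def disc_def fun_eq_iff)
  then show ?thesis unfolding reward_def by simp
qed

section \<open>Decay of late rewards and uniform integrability\<close>

text \<open>For \<open>t \<ge> c\<close> the discount satisfies \<open>exp (- r t) \<le> exp (- (r -
  \<kappa>) c) exp (- \<kappa> t)\<close>, and \<open>growth\<close> takes care of the second
  factor. The estimate is uniform over stopping times.\<close>

lemma late_weight:
  assumes x: "x \<in> S" and \<tau>: "stopping_time F \<tau>" and c: "0 \<le> c"
  shows "(\<integral>\<omega>. indicator {\<omega>\<in>space M. ennreal c \<le> \<tau> \<omega>} \<omega> * stopval (disc w x) \<tau> \<omega> \<partial>M) \<le> exp (- (r - \<kappa>) * c) * w x"
proof -
  have [measurable]: "\<tau> \<in> borel_measurable M" by (rule stopping_measurable_M[OF \<tau>])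
  have [measurable]: "stopval (disc w x) \<tau> \<in> borel_measurable M"
    by (rule stopval_measurable[OF rc_process_disc[OF continuous_w x] \<tau>])
  have [measurable]: "stopval (\<lambda>t \<omega>. exp (- \<kappa> * t) * w (X t x \<omega>)) \<tau> \<in> borel_measurable M"
    by (rule stopval_measurable[OF rc_process_disc_exp[OF continuous_w x] \<tau>])
  let ?I = "\<lambda>\<omega>. indicator {\<omega>\<in>space M. ennreal c \<le> \<tau> \<omega>} \<omega> * stopval (disc w x) \<tau> \<omega>"
  have "ennreal (\<integral>\<omega>. ?I \<omega> \<partial>M) = (\<integral>\<^sup>+\<omega>. ennreal (?I \<omega>) \<partial>M)"
  proof (rule nn_integral_eq_integral[symmetric])
    show "integrable M ?I"
      using integrable_mult_indicator[OF _ reward_integrable[OF adm_w x \<tau>], of "{\<omega>\<in>space M. ennreal c \<le> \<tau> \<omega>}"]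
      by simp
    show "AE \<omega> in M. 0 \<le> ?I \<omega>"
      using stopval_disc_nonneg[OF adm_w x, of \<tau>] by eventually_elim simp
  qed
  also have "\<dots> \<le> (\<integral>\<^sup>+\<omega>. ennreal (exp (- (r - \<kappa>) * c)) * ennreal (stopval (\<lambda>t \<omega>. exp (- \<kappa> * t) * w (X t x \<omega>)) \<tau> \<omega>) \<partial>M)"
  proof (rule nn_integral_mono_AE)
    show "AE \<omega> in M. ennreal (?I \<omega>) \<le> ennreal (exp (- (r - \<kappa>) * c)) * ennreal (stopval (\<lambda>t \<omega>. exp (- \<kappa> * t) * w (X t x \<omega>)) \<tau> \<omega>)"
      using X_in_S[OF x]
    proof eventually_elim
      case (elim \<omega>)
      show ?case
      proof (cases "\<tau> \<omega>")
        case (real t)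
        then have wX: "0 \<le> w (X t x \<omega>)" using elim w_pos by auto
        have "disc w x t \<omega> \<le> exp (- (r - \<kappa>) * c) * (exp (- \<kappa> * t) * w (X t x \<omega>))" if "c \<le> t"
        proof -
          have "- r * t \<le> - (r - \<kappa>) * c + - \<kappa> * t"
            using mult_left_mono[OF that, of "r - \<kappa>"] \<kappa>_less by (simp add: algebra_simps)
          then have "exp (- r * t) \<le> exp (- (r - \<kappa>) * c) * exp (- \<kappa> * t)"
            by (simp flip: exp_add)
          from mult_right_mono[OF this wX] show ?thesis by (simp add: disc_def mult.assoc)
        qed
        moreover have "ennreal c \<le> \<tau> \<omega> \<Longrightarrow> c \<le> t" using real by simp
        ultimately have "?I \<omega> \<le> exp (- (r - \<kappa>) * c) * (exp (- \<kappa> * t) * w (X t x \<omega>))"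
          using real wX by (auto simp: stopval_def indicator_def)
        then have "ennreal (?I \<omega>) \<le> ennreal (exp (- (r - \<kappa>) * c) * (exp (- \<kappa> * t) * w (X t x \<omega>)))"
          by (rule ennreal_leI)
        also have "\<dots> = ennreal (exp (- (r - \<kappa>) * c)) * ennreal (exp (- \<kappa> * t) * w (X t x \<omega>))"
          by (rule ennreal_mult) (use wX in auto)
        finally show ?thesis using real by (simp add: stopval_def)
      qed (simp add: stopval_def)
    qed
  qed
  also have "\<dots> = ennreal (exp (- (r - \<kappa>) * c)) * (\<integral>\<^sup>+\<omega>. ennreal (stopval (\<lambda>t \<omega>. exp (- \<kappa> * t) * w (X t x \<omega>)) \<tau> \<omega>) \<partial>M)"
    by (rule nn_integral_cmult) measurable
  also have "\<dots> \<le> ennreal (exp (- (r - \<kappa>) * c)) * ennreal (w x)"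
    by (rule mult_left_mono[OF growth[OF x \<tau>]]) simp
  also have "\<dots> = ennreal (exp (- (r - \<kappa>) * c) * w x)"
    using w_pos[OF x] by (simp add: ennreal_mult)
  finally show ?thesis
    using w_pos[OF x] by (simp add: ennreal_le_iff)
qed

text \<open>The case \<open>c = 0\<close> of \<open>late_weight\<close>. The constant is exactly
  \<open>1\<close>, so optimal stopping will not spoil the contraction factor
  \<open>1 - p\<close>.\<close>

lemma reward_w_le:
  assumes x: "x \<in> S" and \<tau>: "stopping_time F \<tau>"
  shows "reward w x \<tau> \<le> w x"
proof -
  have "reward w x \<tau> = (\<integral>\<omega>. indicator {\<omega>\<in>space M. ennreal 0 \<le> \<tau> \<omega>} \<omega> * stopval (disc w x) \<tau> \<omega> \<partial>M)"
    unfolding reward_def by (intro Bochner_Integration.integral_cong) auto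
  with late_weight[OF x \<tau>, of 0] show ?thesis by simp
qed

lemma reward_le:
  assumes f: "adm f" and C: "0 \<le> C" "\<And>y. y \<in> S \<Longrightarrow> f y \<le> C * w y" and x: "x \<in> S" and \<tau>: "stopping_time F \<tau>"
  shows "reward f x \<tau> \<le> C * w x"
proof -
  have "reward f x \<tau> \<le> reward (\<lambda>y. C * w y) x \<tau>"
    by (rule reward_mono[OF f adm_cmult[OF adm_w C(1)] C(2) x \<tau>])
  also have "\<dots> = C * reward w x \<tau>" by (rule reward_cmult)
  also have "\<dots> \<le> C * w x" by (rule mult_left_mono[OF reward_w_le[OF x \<tau>] C(1)])
  finally show ?thesis .
qed

lemma stopval_const: "0 \<le> t \<Longrightarrow> stopval Y (\<lambda>_. ennreal t) = Y t"
  by (simp add: stopval_def fun_eq_iff)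

lemma reward_const: "0 \<le> t \<Longrightarrow> reward f x (\<lambda>_. ennreal t) = exp (- r * t) * P t f x"
  unfolding reward_def P_def by (simp add: stopval_const disc_def[abs_def])

lemma integrable_X:
  assumes "adm f" "x \<in> S" "0 \<le> t" shows "integrable M (\<lambda>\<omega>. f (X t x \<omega>))"
proof -
  have "integrable M (stopval (disc f x) (\<lambda>_. ennreal t))"
    by (rule reward_integrable[OF assms(1,2) stopping_time_const])
  then have "integrable M (\<lambda>\<omega>. exp (- r * t) * f (X t x \<omega>))"
    using assms(3) by (simp add: stopval_def[abs_def] disc_def)
  then show ?thesis by simp
qed

lemma P_nonneg: "adm f \<Longrightarrow> x \<in> S \<Longrightarrow> 0 \<le> t \<Longrightarrow> 0 \<le> P t f x"
  unfolding P_def using X_in_S[of x]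
  by (intro integral_nonneg_AE) (auto elim!: eventually_mono intro: adm_nonneg)

lemma P_bound:
  assumes f: "adm f" and C: "0 \<le> C" "\<And>y. y \<in> S \<Longrightarrow> f y \<le> C * w y" and x: "x \<in> S" and t: "0 \<le> t"
  shows "exp (- r * t) * P t f x \<le> C * w x"
  using reward_le[OF f C x stopping_time_const, of "ennreal t"] reward_const[OF t] by simp

text \<open>\<open>X_markov\<close> speaks of non-negative Borel functions on the whole space,
  whereas \<open>f\<close> is controlled on \<open>S\<close> only. The cut-off \<open>h\<close>
  bridges the two, and integrability permits the return from \<open>[0,\<infinity>]\<close> to the
  reals.\<close>

lemma markov_adm:
  assumes f: "adm f" and x: "x \<in> S" and t: "0 \<le> t" and s: "0 \<le> s" and A: "A \<in> sets (F (ennreal t))"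
    and Pf: "adm (P s f)"
  shows "(\<integral>\<omega>. indicator A \<omega> * f (X (t + s) x \<omega>) \<partial>M) = (\<integral>\<omega>. indicator A \<omega> * P s f (X t x \<omega>) \<partial>M)"
proof -
  define h where "h y = ennreal (indicator S y *\<^sub>R f y)" for y
  have S: "S \<in> sets borel" using closed_S by (rule borel_closed)
  have h: "h \<in> borel_measurable borel"
    unfolding h_def using borel_measurable_continuous_on_indicator[OF S adm_cont[OF f]] by measurable
  have AM: "A \<in> sets M" using A sets_F_subset by blast
  have i1: "integrable M (\<lambda>\<omega>. indicator A \<omega> * f (X (t + s) x \<omega>))"
    using integrable_mult_indicator[OF AM integrable_X[OF f x, of "t+s"]] t s by simp
  have i2: "integrable M (\<lambda>\<omega>. indicator A \<omega> * P s f (X t x \<omega>))"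
    using integrable_mult_indicator[OF AM integrable_X[OF Pf x t]] by simp
  have hP: "(\<integral>\<^sup>+\<omega>'. h (X s y \<omega>') \<partial>M) = ennreal (P s f y)" if y: "y \<in> S" for y
  proof -
    have "(\<integral>\<^sup>+\<omega>'. h (X s y \<omega>') \<partial>M) = (\<integral>\<^sup>+\<omega>'. ennreal (f (X s y \<omega>')) \<partial>M)"
      by (rule nn_integral_cong_AE) (use X_in_S[OF y] in \<open>eventually_elim, use s in \<open>auto simp: h_def\<close>\<close>)
    also have "\<dots> = ennreal (P s f y)"
      unfolding P_def
      by (rule nn_integral_eq_integral[OF integrable_X[OF f y s]])
        (use X_in_S[OF y] in \<open>eventually_elim, use s f in \<open>auto simp: adm_nonneg\<close>\<close>)
    finally show ?thesis .
  qed
  have "ennreal (\<integral>\<omega>. indicator A \<omega> * f (X (t + s) x \<omega>) \<partial>M) = (\<integral>\<^sup>+\<omega>. ennreal (indicator A \<omega> * f (X (t + s) x \<omega>)) \<partial>M)"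
    by (rule nn_integral_eq_integral[OF i1, symmetric])
      (use X_in_S[OF x] in \<open>eventually_elim, use t s f in \<open>auto simp: adm_nonneg\<close>\<close>)
  also have "\<dots> = (\<integral>\<^sup>+\<omega>. indicator A \<omega> * h (X (t + s) x \<omega>) \<partial>M)"
    by (rule nn_integral_cong_AE)
      (use X_in_S[OF x] in \<open>eventually_elim, use t s in \<open>auto simp: h_def indicator_def\<close>\<close>)
  also have "\<dots> = (\<integral>\<^sup>+\<omega>. indicator A \<omega> * (\<integral>\<^sup>+\<omega>'. h (X s (X t x \<omega>) \<omega>') \<partial>M) \<partial>M)"
    by (rule X_markov[OF x t s A h])
  also have "\<dots> = (\<integral>\<^sup>+\<omega>. ennreal (indicator A \<omega> * P s f (X t x \<omega>)) \<partial>M)"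
    by (rule nn_integral_cong_AE)
      (use X_in_S[OF x] in \<open>eventually_elim, use t hP in \<open>auto simp: indicator_def\<close>\<close>)
  also have "\<dots> = ennreal (\<integral>\<omega>. indicator A \<omega> * P s f (X t x \<omega>) \<partial>M)"
    by (rule nn_integral_eq_integral[OF i2])
      (use X_in_S[OF x] in \<open>eventually_elim, use t Pf in \<open>auto simp: adm_nonneg\<close>\<close>)
  finally have *: "ennreal (\<integral>\<omega>. indicator A \<omega> * f (X (t + s) x \<omega>) \<partial>M) = ennreal (\<integral>\<omega>. indicator A \<omega> * P s f (X t x \<omega>) \<partial>M)" .
  have "0 \<le> (\<integral>\<omega>. indicator A \<omega> * f (X (t + s) x \<omega>) \<partial>M)"
    by (rule integral_nonneg_AE) (use X_in_S[OF x] in \<open>eventually_elim, use t s f in \<open>auto simp: adm_nonneg\<close>\<close>)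
  moreover have "0 \<le> (\<integral>\<omega>. indicator A \<omega> * P s f (X t x \<omega>) \<partial>M)"
    by (rule integral_nonneg_AE) (use X_in_S[OF x] in \<open>eventually_elim, use t Pf in \<open>auto simp: adm_nonneg\<close>\<close>)
  ultimately show ?thesis using * by simp
qed

lemma disc_vanish:
  assumes f: "adm f" and x: "x \<in> S"
  shows "(\<lambda>n::nat. \<integral>\<omega>. disc f x (real n) \<omega> \<partial>M) \<longlonglongrightarrow> 0"
proof -
  obtain C where C: "0 \<le> C" "\<And>y. y \<in> S \<Longrightarrow> f y \<le> C * w y" using adm_bound[OF f] by metis
  have e: "(\<integral>\<omega>. disc f x (real n) \<omega> \<partial>M) = reward f x (\<lambda>_. ennreal (real n))" for n
    unfolding reward_def by (subst stopval_const) simp_all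
  have le: "(\<integral>\<omega>. disc f x (real n) \<omega> \<partial>M) \<le> C * (exp (- (r - \<kappa>) * real n) * w x)" for n
  proof -
    have "(\<integral>\<omega>. disc f x (real n) \<omega> \<partial>M) \<le> reward (\<lambda>y. C * w y) x (\<lambda>_. ennreal (real n))"
      unfolding e by (rule reward_mono[OF f adm_cmult[OF adm_w C(1)] C(2) x stopping_time_const])
    also have "\<dots> = C * reward w x (\<lambda>_. ennreal (real n))" by (rule reward_cmult)
    also have "reward w x (\<lambda>_. ennreal (real n)) = (\<integral>\<omega>. indicator {\<omega>\<in>space M. ennreal (real n) \<le> ennreal (real n)} \<omega> * stopval (disc w x) (\<lambda>_. ennreal (real n)) \<omega> \<partial>M)"
      unfolding reward_def by (intro Bochner_Integration.integral_cong) auto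
    also have "C * \<dots> \<le> C * (exp (- (r - \<kappa>) * real n) * w x)"
      by (rule mult_left_mono[OF late_weight[OF x stopping_time_const] C(1)]) simp
    finally show ?thesis .
  qed
  have ge: "0 \<le> (\<integral>\<omega>. disc f x (real n) \<omega> \<partial>M)" for n
    unfolding e by (rule reward_nonneg[OF f x])
  have "(\<lambda>n. exp (- (r - \<kappa>) * real n)) \<longlonglongrightarrow> 0"
  proof -
    have "(\<lambda>n. exp (- (r - \<kappa>)) ^ n) \<longlonglongrightarrow> 0"
      using \<kappa>_less by (intro LIMSEQ_power_zero) auto
    then show ?thesis by (simp flip: exp_of_nat_mult add: mult.commute)
  qed
  then have "(\<lambda>n. C * (exp (- (r - \<kappa>) * real n) * w x)) \<longlonglongrightarrow> C * (0 * w x)"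
    by (intro tendsto_mult tendsto_const)
  then have lim: "(\<lambda>n. C * (exp (- (r - \<kappa>) * real n) * w x)) \<longlonglongrightarrow> 0" by simp
  show ?thesis
    by (rule tendsto_sandwich[OF _ _ tendsto_const lim]) (use le ge in auto)
qed

text \<open>The hypothesis \<open>super\<close> says that \<open>f\<close> is excessive for the
  discounted semigroup. The Markov property at time \<open>s\<close> turns this into the
  supermartingale inequality on events of \<open>F s\<close>.\<close>

lemma super_process_disc:
  assumes f: "adm f" and x: "x \<in> S" and Pf: "\<And>s. 0 \<le> s \<Longrightarrow> adm (P s f)"
    and super: "\<And>s y. 0 \<le> s \<Longrightarrow> y \<in> S \<Longrightarrow> exp (- r * s) * P s f y \<le> f y"
  shows "super_process (disc f x)"
  unfolding super_process_def
proof (intro conjI allI ballI impI)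
  show "rc_process (disc f x)" by (rule rc_process_disc[OF adm_cont[OF f] x])
  show "integrable M (disc f x t)" if "0 \<le> t" for t
    using integrable_X[OF f x that] unfolding disc_def[abs_def] by simp
  show "AE \<omega> in M. \<forall>t\<ge>0. 0 \<le> disc f x t \<omega>" by (rule disc_nonneg[OF f x])
  fix s t :: real and A assume A: "A \<in> sets (F (ennreal s))" and s: "0 \<le> s" and st: "s \<le> t"
  have AM: "A \<in> sets M" using A sets_F_subset by blast
  have ts: "0 \<le> t - s" using st by simp
  have "(\<integral>\<omega>. indicator A \<omega> * disc f x t \<omega> \<partial>M) = exp (- r * t) * (\<integral>\<omega>. indicator A \<omega> * f (X (s + (t - s)) x \<omega>) \<partial>M)"
  proof -
    have "(\<lambda>\<omega>. indicator A \<omega> * disc f x t \<omega>) = (\<lambda>\<omega>. exp (- r * t) * (indicator A \<omega> * f (X (s + (t - s)) x \<omega>)))"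
      by (auto simp: disc_def fun_eq_iff)
    then show ?thesis by (simp only: integral_mult_right_zero)
  qed
  also have "\<dots> = exp (- r * t) * (\<integral>\<omega>. indicator A \<omega> * P (t - s) f (X s x \<omega>) \<partial>M)"
    using markov_adm[OF f x s ts A Pf[OF ts]] by (simp only:)
  also have "\<dots> = (\<integral>\<omega>. indicator A \<omega> * (exp (- r * t) * P (t - s) f (X s x \<omega>)) \<partial>M)"
    by (simp only: mult.left_commute[of "indicator A _"] integral_mult_right_zero)
  also have "\<dots> \<le> (\<integral>\<omega>. indicator A \<omega> * disc f x s \<omega> \<partial>M)"
  proof (rule integral_mono_AE)
    show "integrable M (\<lambda>\<omega>. indicator A \<omega> * (exp (- r * t) * P (t - s) f (X s x \<omega>)))"
      using integrable_mult_indicator[OF AM, of "\<lambda>\<omega>. exp (- r * t) * P (t - s) f (X s x \<omega>)"] integrable_X[OF Pf x s, of "t-s"] st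
      by simp
    show "integrable M (\<lambda>\<omega>. indicator A \<omega> * disc f x s \<omega>)"
      using integrable_mult_indicator[OF AM, of "disc f x s"] integrable_X[OF f x s] unfolding disc_def[abs_def]
      by simp
    show "AE \<omega> in M. indicator A \<omega> * (exp (- r * t) * P (t - s) f (X s x \<omega>)) \<le> indicator A \<omega> * disc f x s \<omega>"
      using X_in_S[OF x]
    proof eventually_elim
      case (elim \<omega>)
      have "exp (- r * t) = exp (- r * s) * exp (- r * (t - s))"
        by (simp flip: exp_add add: algebra_simps)
      moreover have "exp (- r * (t - s)) * P (t - s) f (X s x \<omega>) \<le> f (X s x \<omega>)"
        using super[of "t-s" "X s x \<omega>"] elim s st by auto
      ultimately show ?case
        unfolding disc_def by (auto simp: mult.assoc intro!: mult_left_mono)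
    qed
  qed
  finally show "(\<integral>\<omega>. indicator A \<omega> * disc f x t \<omega> \<partial>M) \<le> (\<integral>\<omega>. indicator A \<omega> * disc f x s \<omega> \<partial>M)" .
qed

lemma disc_optional_stopping:
  assumes f: "adm f" and x: "x \<in> S" and Pf: "\<And>s. 0 \<le> s \<Longrightarrow> adm (P s f)"
    and super: "\<And>s y. 0 \<le> s \<Longrightarrow> y \<in> S \<Longrightarrow> exp (- r * s) * P s f y \<le> f y"
    and ab: "stopping_time F a" "stopping_time F b" "\<And>\<omega>. a \<omega> \<le> b \<omega>"
  shows "reward f x b \<le> reward f x a"
proof -
  obtain B where "integrable M B" "AE \<omega> in M. \<forall>t\<ge>0. \<bar>disc f x t \<omega>\<bar> \<le> B \<omega>"
    using adm_dominated[OF f x] by blast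
  from super_process_optional_stopping[OF super_process_disc[OF f x Pf super] ab this disc_vanish[OF f x]]
  show ?thesis by (simp add: reward_def)
qed

lemma adm_cut: "0 \<le> R \<Longrightarrow> adm (\<lambda>y. max 0 (w y - R))"
  unfolding adm_def
  by (auto intro!: continuous_intros continuous_w exI[of _ 1] simp: w_pos)

text \<open>Uniform integrability of the discounted weight over all stopping times. After time
  \<open>n\<close>, \<open>late_weight\<close> makes the contribution small. Before time
  \<open>n\<close> the discount factor is at least \<open>c = exp (- r n)\<close>, so the discounted
  excess of \<open>w\<close> over a level \<open>k\<close> is at most the excess of the dominating
  variable over \<open>c k\<close>, which tends to \<open>0\<close> in mean as \<open>k\<close>
  grows.\<close>

lemma tail_weight:
  assumes x: "x \<in> S" and e: "0 < e"
  obtains R where "0 \<le> R" "\<And>\<tau>. stopping_time F \<tau> \<Longrightarrow> reward (\<lambda>y. max 0 (w y - R)) x \<tau> \<le> e"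
proof -
  have "(\<lambda>n. exp (- (r - \<kappa>)) ^ n) \<longlonglongrightarrow> 0"
    using \<kappa>_less by (intro LIMSEQ_power_zero) auto
  then have "(\<lambda>n. exp (- (r - \<kappa>)) ^ n * w x) \<longlonglongrightarrow> 0 * w x"
    by (intro tendsto_mult tendsto_const)
  then have "eventually (\<lambda>n. exp (- (r - \<kappa>)) ^ n * w x < e / 2) sequentially"
    using e by (intro order_tendstoD) auto
  then obtain n where n: "exp (- (r - \<kappa>)) ^ n * w x < e / 2" by (auto simp: eventually_sequentially)
  then have n: "exp (- (r - \<kappa>) * real n) * w x < e / 2" by (simp flip: exp_of_nat_mult add: mult.commute)
  obtain B0 where B0: "integrable M B0"
    "\<And>f C. (\<And>y. y \<in> S \<Longrightarrow> \<bar>f y\<bar> \<le> C * w y) \<Longrightarrow> AE \<omega> in M. \<forall>t\<ge>0. \<bar>disc f x t \<omega>\<bar> \<le> C * B0 \<omega>"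
    using disc_dominated[OF x] by blast
  have B: "AE \<omega> in M. \<forall>t\<ge>0. disc w x t \<omega> \<le> B0 \<omega>"
    using B0(2)[of w 1] w_pos by (auto elim!: eventually_mono)
  define c where "c = exp (- r * real n)"
  have c: "0 < c" by (simp add: c_def)
  have "(\<lambda>k. \<integral>\<omega>. max 0 (B0 \<omega> - c * real k) \<partial>M) \<longlonglongrightarrow> (\<integral>\<omega>. 0 \<partial>M)"
  proof (rule integral_dominated_convergence[where w="\<lambda>\<omega>. \<bar>B0 \<omega>\<bar>"])
    show "AE \<omega> in M. (\<lambda>k. max 0 (B0 \<omega> - c * real k)) \<longlonglongrightarrow> 0"
    proof (rule AE_I2)
      fix \<omega>
      obtain m :: nat where m: "B0 \<omega> / c \<le> real m" using real_arch_simple by blast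
      have "eventually (\<lambda>k. max 0 (B0 \<omega> - c * real k) = 0) sequentially"
      proof (rule eventually_sequentiallyI[of m])
        fix k assume "m \<le> k"
        with m have "B0 \<omega> / c \<le> real k" by linarith
        then show "max 0 (B0 \<omega> - c * real k) = 0" using c by (simp add: pos_divide_le_eq mult.commute)
      qed
      then show "(\<lambda>k. max 0 (B0 \<omega> - c * real k)) \<longlonglongrightarrow> 0" by (rule tendsto_eventually)
    qed
    show "AE \<omega> in M. norm (max 0 (B0 \<omega> - c * real k)) \<le> \<bar>B0 \<omega>\<bar>" for k
      using mult_nonneg_nonneg[OF less_imp_le[OF c], of "real k"] by (intro AE_I2) (auto simp: max_def)
  qed (use B0 in auto)
  then have "eventually (\<lambda>k. (\<integral>\<omega>. max 0 (B0 \<omega> - c * real k) \<partial>M) < e / 2) sequentially"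
    using e by (intro order_tendstoD) auto
  then obtain k :: nat where k: "(\<integral>\<omega>. max 0 (B0 \<omega> - c * real k) \<partial>M) < e / 2" by (auto simp: eventually_sequentially)
  show ?thesis
  proof (rule that[of "real k"])
    show "0 \<le> real k" by simp
    fix \<tau> assume \<tau>: "stopping_time F \<tau>"
    have [measurable]: "\<tau> \<in> borel_measurable M" by (rule stopping_measurable_M[OF \<tau>])
    let ?I = "\<lambda>\<omega>. indicator {\<omega>\<in>space M. ennreal (real n) \<le> \<tau> \<omega>} \<omega> * stopval (disc w x) \<tau> \<omega>"
    have i1: "integrable M ?I"
      using integrable_mult_indicator[OF _ reward_integrable[OF adm_w x \<tau>], of "{\<omega>\<in>space M. ennreal (real n) \<le> \<tau> \<omega>}"]
      by simp
    have i2: "integrable M (\<lambda>\<omega>. max 0 (B0 \<omega> - c * real k))" using B0(1) by auto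
    have "reward (\<lambda>y. max 0 (w y - real k)) x \<tau> \<le> (\<integral>\<omega>. ?I \<omega> + max 0 (B0 \<omega> - c * real k) \<partial>M)"
      unfolding reward_def
    proof (rule integral_mono_AE[OF reward_integrable[OF adm_cut x \<tau>] Bochner_Integration.integrable_add[OF i1 i2]])
      show "AE \<omega> in M. stopval (disc (\<lambda>y. max 0 (w y - real k)) x) \<tau> \<omega> \<le> ?I \<omega> + max 0 (B0 \<omega> - c * real k)"
        using B X_in_S[OF x] AE_space
      proof eventually_elim
        case (elim \<omega>)
        show ?case
        proof (cases "\<tau> \<omega>")
          case (real t)
          have wX: "0 \<le> w (X t x \<omega>)" using elim real w_pos by auto
          show ?thesis
          proof (cases "real n \<le> t")
            case True
            then have "ennreal (real n) \<le> \<tau> \<omega>" using real by (simp add: ennreal_leI)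
            moreover have "max 0 (w (X t x \<omega>) - real k) \<le> w (X t x \<omega>)" using wX by simp
            ultimately show ?thesis using real elim
              by (auto simp: stopval_def disc_def intro!: add_increasing2 mult_left_mono)
          next
            case False
            then have I: "?I \<omega> = 0" using real by (auto simp: ennreal_le_iff indicator_def)
            have "c \<le> exp (- r * t)" using False r_positive by (simp add: c_def)
            then have "c * real k \<le> exp (- r * t) * real k" by (rule mult_right_mono) simp
            moreover have "exp (- r * t) * w (X t x \<omega>) \<le> B0 \<omega>" using elim real by (auto simp: disc_def)
            ultimately have "exp (- r * t) * (w (X t x \<omega>) - real k) \<le> B0 \<omega> - c * real k"
              unfolding right_diff_distrib by linarith
            then have "exp (- r * t) * max 0 (w (X t x \<omega>) - real k) \<le> max 0 (B0 \<omega> - c * real k)"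
              by (simp add: max_def)
            then show ?thesis unfolding I using real by (simp add: stopval_def disc_def)
          qed
        next
          case top
          then show ?thesis by (simp add: stopval_def)
        qed
      qed
    qed simp
    also have "\<dots> = (\<integral>\<omega>. ?I \<omega> \<partial>M) + (\<integral>\<omega>. max 0 (B0 \<omega> - c * real k) \<partial>M)"
      by (rule Bochner_Integration.integral_add[OF i1 i2])
    also have "\<dots> \<le> e"
      using k n late_weight[OF x \<tau>, of "real n"] by simp
    finally show "reward (\<lambda>y. max 0 (w y - real k)) x \<tau> \<le> e" .
  qed
qed

text \<open>A modulus of continuity on the unbounded set \<open>S\<close>: uniform continuity on a
  compact level set of \<open>w\<close> for near pairs, a Lipschitz bound for far pairs, and the
  excess of the weight where \<open>w x\<close> is large. \<open>C\<close> must be fixed before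
  \<open>e\<close> and \<open>R\<close>, since \<open>R\<close> is later chosen in terms of
  \<open>C\<close>.\<close>

lemma adm_modulus:
  assumes g: "adm g"
  obtains C where "0 \<le> C"
    "\<And>e R. 0 < e \<Longrightarrow> 0 \<le> R \<Longrightarrow> \<exists>L\<ge>0. \<forall>x\<in>S. \<forall>y\<in>S. \<bar>g x - g y\<bar> \<le> e + L * dist x y + C * max 0 (w x - R)"
proof -
  obtain C0 where C0: "0 \<le> C0" "\<And>y. y \<in> S \<Longrightarrow> g y \<le> C0 * w y" using adm_bound[OF g] by metis
  have "\<exists>L\<ge>0. \<forall>x\<in>S. \<forall>y\<in>S. \<bar>g x - g y\<bar> \<le> e + L * dist x y + 4 * C0 * max 0 (w x - R)"
    if e: "0 < e" and R: "0 \<le> R" for e R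
  proof -
    \<comment> \<open>The extra \<open>1\<close> leaves room for a neighbour, at distance below
      \<open>d \<le> 1\<close>, of a point with \<open>w x \<le> 2 * R\<close>, as \<open>w\<close>
      is 1-Lipschitz.\<close>
    define K where "K = {y\<in>S. w y \<le> 2 * R + 1}"
    have "K = S \<inter> w -` {..2 * R + 1}" by (auto simp: K_def)
    then have "closed K"
      using continuous_closed_preimage[OF continuous_w closed_S, of "{..2 * R + 1}"] by simp
    then have "compact K"
      using w_bounded_levels[of "2 * R + 1"] by (simp add: compact_eq_bounded_closed K_def)
    moreover have "continuous_on K g"
      by (rule continuous_on_subset[OF adm_cont[OF g]]) (auto simp: K_def)
    ultimately have "uniformly_continuous_on K g" by (rule compact_uniformly_continuous[rotated])
    then obtain d0 where d0: "0 < d0" "\<And>x y. x \<in> K \<Longrightarrow> y \<in> K \<Longrightarrow> dist y x < d0 \<Longrightarrow> dist (g y) (g x) < e"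
      using e unfolding uniformly_continuous_on_def by metis
    define d where "d = min 1 d0"
    have d: "0 < d" "d \<le> 1" "d \<le> d0" using d0 by (auto simp: d_def)
    \<comment> \<open>For \<open>dist x y \<ge> d\<close> and \<open>w x \<le> 2 * R\<close> the
      crude bound \<open>C0 * (2 * w x + dist x y)\<close> is at most
      \<open>L * dist x y\<close>.\<close>
    define L where "L = C0 * (4 * R / d + 1)"
    have L: "0 \<le> L" using C0 R d by (simp add: L_def)
    have "\<bar>g x - g y\<bar> \<le> e + L * dist x y + 4 * C0 * max 0 (w x - R)" if x: "x \<in> S" and y: "y \<in> S" for x y
    proof -
      have wy: "w y \<le> w x + dist x y" using w_lipschitz[OF x y] by linarith
      have "\<bar>g x - g y\<bar> \<le> C0 * w x + C0 * w y"
        using C0(2)[OF x] C0(2)[OF y] adm_nonneg[OF g x] adm_nonneg[OF g y] by linarith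
      also have "\<dots> \<le> C0 * w x + C0 * (w x + dist x y)"
        using wy C0(1) by (intro add_left_mono mult_left_mono) auto
      finally have crude: "\<bar>g x - g y\<bar> \<le> C0 * (2 * w x + dist x y)" by (simp add: algebra_simps)
      have nn: "0 \<le> L * dist x y" "0 \<le> 4 * C0 * max 0 (w x - R)" using C0(1) L by simp_all
      consider "w x \<le> 2 * R" "dist x y < d" | "w x \<le> 2 * R" "d \<le> dist x y" | "2 * R < w x" by linarith
      then show ?thesis
      proof cases
        case 1
        then have "x \<in> K" "y \<in> K" using x y wy d by (auto simp: K_def)
        then have "dist (g x) (g y) < e" using d0(2)[of y x] 1 d by auto
        then show ?thesis using nn by (simp add: dist_real_def)
      next
        case 2
        then have "1 \<le> dist x y / d" using d by simp
        then have "2 * w x \<le> 4 * R * (dist x y / d)"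
          using 2 R mult_left_mono[OF \<open>1 \<le> dist x y / d\<close>, of "4 * R"] by simp
        then have "2 * w x + dist x y \<le> (4 * R / d + 1) * dist x y" by (simp add: algebra_simps)
        from mult_left_mono[OF this C0(1)] crude have "\<bar>g x - g y\<bar> \<le> L * dist x y"
          by (simp add: L_def mult.assoc)
        then show ?thesis using nn e by linarith
      next
        case 3
        \<comment> \<open>From \<open>w x > 2 * R\<close> follows
          \<open>w x \<le> 2 * (w x - R)\<close>; this is the origin of the constant
          \<open>4 * C0\<close>.\<close>
        then have "C0 * (2 * w x) \<le> C0 * (4 * (w x - R))" using C0 by (intro mult_left_mono) auto
        moreover have "max 0 (w x - R) = w x - R" using 3 R by simp
        ultimately have "C0 * (2 * w x) \<le> 4 * C0 * max 0 (w x - R)" by (simp add: algebra_simps)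
        moreover have "C0 * dist x y \<le> L * dist x y"
          unfolding L_def using mult_left_mono[of 1 "4 * R / d + 1" C0] C0(1) R d
          by (intro mult_right_mono) auto
        moreover have "C0 * (2 * w x + dist x y) = C0 * (2 * w x) + C0 * dist x y" by (simp add: distrib_left)
        ultimately show ?thesis using crude e by linarith
      qed
    qed
    then show ?thesis using L by blast
  qed
  then show ?thesis using that[of "4 * C0"] C0(1) by simp
qed

end

section \<open>The value function of an optimal stopping problem\<close>

text \<open>Two stopping times occur in \<open>reward_usc\<close> because in the finite-horizon case flows from different points are
  absorbed at different times.\<close>

locale stopping_flow = weighted_flow M F X S w r \<kappa>
  for M :: "'a measure" and F :: "ennreal \<Rightarrow> 'a measure"
    and X :: "real \<Rightarrow> 's::euclidean_space \<Rightarrow> 'a \<Rightarrow> 's" and S w r \<kappa> +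
  assumes continuous_P: "\<And>f s. adm f \<Longrightarrow> 0 \<le> s \<Longrightarrow> continuous_on S (P s f)"
    and reward_usc: "\<And>g xs x e. adm g \<Longrightarrow> x \<in> S \<Longrightarrow> (\<And>n::nat. xs n \<in> S) \<Longrightarrow> xs \<longlonglongrightarrow> x \<Longrightarrow> 0 < e \<Longrightarrow>
       \<forall>\<^sub>F n in sequentially. \<forall>\<tau>. stopping_time F \<tau> \<longrightarrow>
         (\<exists>\<tau>'. stopping_time F \<tau>' \<and> reward g (xs n) \<tau> \<le> reward g x \<tau>' + e)"
begin

lemma adm_P:
  assumes f: "adm f" and s: "0 \<le> s" shows "adm (P s f)"
proof -
  obtain C where C: "0 \<le> C" "\<And>y. y \<in> S \<Longrightarrow> f y \<le> C * w y" using adm_bound[OF f] by metis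
  show ?thesis
  proof (rule admI[where C="exp (r * s) * C", OF continuous_P[OF f s] P_nonneg[OF f _ s]])
    fix x assume x: "x \<in> S"
    have "exp (r * s) * (exp (- r * s) * P s f x) \<le> exp (r * s) * (C * w x)"
      by (rule mult_left_mono[OF P_bound[OF f C x s]]) simp_all
    then show "P s f x \<le> exp (r * s) * C * w x"
      by (simp add: mult.assoc[symmetric] flip: exp_add)
  qed
qed

end

locale obstacle_problem = stopping_flow M F X S w r \<kappa>
  for M :: "'a measure" and F :: "ennreal \<Rightarrow> 'a measure"
    and X :: "real \<Rightarrow> 's::euclidean_space \<Rightarrow> 'a \<Rightarrow> 's" and S w r \<kappa> +
  fixes g :: "'s \<Rightarrow> real"
  assumes adm_g: "adm g"
begin

section \<open>The value function and attainable lower bounds\<close>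

definition V :: "'s \<Rightarrow> real" where
  "V x = (SUP \<tau>\<in>{\<tau>. stopping_time F \<tau>}. reward g x \<tau>)"

lemma reward_bdd:
  assumes x: "x \<in> S" shows "bdd_above (reward g x ` {\<tau>. stopping_time F \<tau>})"
proof -
  obtain C where "0 \<le> C" "\<And>y. y \<in> S \<Longrightarrow> g y \<le> C * w y" using adm_bound[OF adm_g] by metis
  then show ?thesis using reward_le[OF adm_g _ _ x] by (auto intro!: bdd_aboveI2[where M="C * w x"])
qed

lemma reward_le_V: "x \<in> S \<Longrightarrow> stopping_time F \<tau> \<Longrightarrow> reward g x \<tau> \<le> V x"
  unfolding V_def using reward_bdd by (intro cSUP_upper) auto

lemma V_least: "(\<And>\<tau>. stopping_time F \<tau> \<Longrightarrow> reward g x \<tau> \<le> c) \<Longrightarrow> V x \<le> c"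
  unfolding V_def using stopping_time_const[of F 0] by (intro cSUP_least) auto

lemma reward_0:
  assumes f: "adm f" and x: "x \<in> S" shows "reward f x (\<lambda>_. 0) = f x"
proof -
  have "P 0 f x = (\<integral>\<omega>. f x \<partial>M)"
    unfolding P_def
  proof (rule integral_cong_AE)
    show "(\<lambda>\<omega>. f (X 0 x \<omega>)) \<in> borel_measurable M" using integrable_X[OF f x] by auto
    show "AE \<omega> in M. f (X 0 x \<omega>) = f x" using X_start[OF x] by eventually_elim simp
  qed simp
  then show ?thesis using reward_const[of 0 f x] prob_space by simp
qed

lemma g_le_V: "x \<in> S \<Longrightarrow> g x \<le> V x"
  using reward_le_V[OF _ stopping_time_const, of x 0] reward_0[OF adm_g] by simp

lemma V_nonneg: "x \<in> S \<Longrightarrow> 0 \<le> V x"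
  using g_le_V adm_nonneg[OF adm_g] order_trans by blast

lemma V_bound:
  assumes "0 \<le> C" "\<And>y. y \<in> S \<Longrightarrow> g y \<le> C * w y" "x \<in> S" shows "V x \<le> C * w x"
  by (rule V_least) (rule reward_le[OF adm_g assms])

lemma integrable_indicator_reward:
  assumes "adm f" "x \<in> S" "stopping_time F \<tau>" "A \<in> sets M"
  shows "integrable M (\<lambda>\<omega>. indicator A \<omega> * stopval (disc f x) \<tau> \<omega>)"
  using integrable_mult_indicator[OF assms(4) reward_integrable[OF assms(1-3)]] by simp

lemma integrable_indicator_disc:
  assumes "adm f" "x \<in> S" "0 \<le> t" "A \<in> sets M"
  shows "integrable M (\<lambda>\<omega>. indicator A \<omega> * disc f x t \<omega>)"
  using integrable_indicator_reward[OF assms(1,2) stopping_time_const assms(4), of "ennreal t"] stopval_const[OF assms(3)]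
  by simp

text \<open>Attainability is required from every time \<open>t\<close> on and on every event of \<^term>\<open>F (ennreal t)\<close>. In this form it
  passes to maxima and to \<open>P s\<close>, although the filtration carries no shift operators.\<close>

definition attainable :: "('s \<Rightarrow> real) \<Rightarrow> bool" where
  "attainable f \<longleftrightarrow> adm f \<and> (\<forall>x\<in>S. \<forall>t\<ge>0. \<forall>A\<in>sets (F (ennreal t)). \<forall>e>0. \<exists>\<tau>. stopping_time F \<tau> \<and>
     (\<forall>\<omega>. ennreal t \<le> \<tau> \<omega>) \<and>
     (\<integral>\<omega>. indicator A \<omega> * disc f x t \<omega> \<partial>M) \<le> (\<integral>\<omega>. indicator A \<omega> * stopval (disc g x) \<tau> \<omega> \<partial>M) + e)"

lemma attainable_g: "attainable g"
  unfolding attainable_def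
proof (intro conjI ballI allI impI exI)
  fix x t A and e :: real assume "0 < e" "0 \<le> (t::real)"
  show "stopping_time F (\<lambda>_. ennreal t)" by (rule stopping_time_const)
  show "(\<integral>\<omega>. indicator A \<omega> * disc g x t \<omega> \<partial>M) \<le> (\<integral>\<omega>. indicator A \<omega> * stopval (disc g x) (\<lambda>_. ennreal t) \<omega> \<partial>M) + e"
    using \<open>0 < e\<close> \<open>0 \<le> t\<close> by (simp add: stopval_const)
qed (auto simp: adm_g)

text \<open>Both times are at least \<open>t\<close>, so nothing is decided before the event
  \<open>B\<close> is known.\<close>

lemma stopping_time_If:
  assumes "stopping_time F \<sigma>" "stopping_time F \<tau>" "B \<in> sets (F t)" "\<And>\<omega>. t \<le> \<sigma> \<omega>" "\<And>\<omega>. t \<le> \<tau> \<omega>"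
  shows "stopping_time F (\<lambda>\<omega>. if \<omega> \<in> B then \<sigma> \<omega> else \<tau> \<omega>)"
proof (rule stopping_timeI)
  fix u
  show "Measurable.pred (F u) (\<lambda>\<omega>. (if \<omega> \<in> B then \<sigma> \<omega> else \<tau> \<omega>) \<le> u)"
  proof (cases "t \<le> u")
    case True
    then have B: "B \<in> sets (F u)" using assms(3) sets_F_mono by blast
    have "{\<omega>\<in>space M. (if \<omega> \<in> B then \<sigma> \<omega> else \<tau> \<omega>) \<le> u} =
      (B \<inter> {\<omega>\<in>space M. \<sigma> \<omega> \<le> u}) \<union> ({\<omega>\<in>space M. \<tau> \<omega> \<le> u} - B)"
      using sets.sets_into_space[OF B] by (auto simp: space_F)
    moreover have "{\<omega>\<in>space M. \<sigma> \<omega> \<le> u} \<in> sets (F u)" "{\<omega>\<in>space M. \<tau> \<omega> \<le> u} \<in> sets (F u)"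
      using stopping_timeD[OF assms(1)] stopping_timeD[OF assms(2)] by (simp_all only: pred_F_iff)
    ultimately show ?thesis using B by (simp add: pred_F_iff)
  next
    case False
    then have "\<not> (if \<omega> \<in> B then \<sigma> \<omega> else \<tau> \<omega>) \<le> u" for \<omega>
      using assms(4)[of \<omega>] assms(5)[of \<omega>] by (auto dest: order_trans)
    then show ?thesis by simp
  qed
qed

text \<open>Which of \<open>f1\<close> and \<open>f2\<close> is larger along the path at time
  \<open>t\<close> is known at that time, so \<open>A\<close> can be split accordingly and the two
  nearly attaining stopping times glued; each part spends half of \<open>e\<close>. That the
  definition allows arbitrary events makes this possible.\<close>

lemma attainable_max:
  assumes f1: "attainable f1" and f2: "attainable f2" shows "attainable (\<lambda>x. max (f1 x) (f2 x))"
  unfolding attainable_def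
proof (intro conjI ballI allI impI)
  have a1: "adm f1" and a2: "adm f2" using f1 f2 by (auto simp: attainable_def)
  then show am: "adm (\<lambda>x. max (f1 x) (f2 x))" by (rule adm_max)
  fix x and t e :: real and A assume x: "x \<in> S" and t: "0 \<le> t" and A: "A \<in> sets (F (ennreal t))" and e: "0 < e"
  define B where "B = {\<omega>\<in>space (F (ennreal t)). f2 (X t x \<omega>) \<le> f1 (X t x \<omega>)}"
  have B: "B \<in> sets (F (ennreal t))"
    unfolding B_def using measurable_on_S[OF adm_cont[OF a1] x t] measurable_on_S[OF adm_cont[OF a2] x t]
    by measurable
  have AB: "A \<inter> B \<in> sets (F (ennreal t))" "A - B \<in> sets (F (ennreal t))" using A B by auto
  then have ABM: "A \<inter> B \<in> sets M" "A - B \<in> sets M" using sets_F_subset by blast+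
  have e2: "0 < e / 2" using e by simp
  obtain \<tau>1 where \<tau>1: "stopping_time F \<tau>1" "\<And>\<omega>. ennreal t \<le> \<tau>1 \<omega>"
    "(\<integral>\<omega>. indicator (A \<inter> B) \<omega> * disc f1 x t \<omega> \<partial>M) \<le> (\<integral>\<omega>. indicator (A \<inter> B) \<omega> * stopval (disc g x) \<tau>1 \<omega> \<partial>M) + e / 2"
    using f1 x t AB(1) e2 unfolding attainable_def by blast
  obtain \<tau>2 where \<tau>2: "stopping_time F \<tau>2" "\<And>\<omega>. ennreal t \<le> \<tau>2 \<omega>"
    "(\<integral>\<omega>. indicator (A - B) \<omega> * disc f2 x t \<omega> \<partial>M) \<le> (\<integral>\<omega>. indicator (A - B) \<omega> * stopval (disc g x) \<tau>2 \<omega> \<partial>M) + e / 2"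
    using f2 x t AB(2) e2 unfolding attainable_def by blast
  define \<tau> where "\<tau> \<omega> = (if \<omega> \<in> B then \<tau>1 \<omega> else \<tau>2 \<omega>)" for \<omega>
  have st: "stopping_time F \<tau>"
    unfolding \<tau>_def[abs_def] by (rule stopping_time_If[OF \<tau>1(1) \<tau>2(1) B \<tau>1(2) \<tau>2(2)])
  have "(\<integral>\<omega>. indicator A \<omega> * disc (\<lambda>x. max (f1 x) (f2 x)) x t \<omega> \<partial>M)
    = (\<integral>\<omega>. indicator (A \<inter> B) \<omega> * disc f1 x t \<omega> + indicator (A - B) \<omega> * disc f2 x t \<omega> \<partial>M)"
    by (rule Bochner_Integration.integral_cong) (auto simp: indicator_def disc_def B_def space_F max_def)
  also have "\<dots> = (\<integral>\<omega>. indicator (A \<inter> B) \<omega> * disc f1 x t \<omega> \<partial>M) + (\<integral>\<omega>. indicator (A - B) \<omega> * disc f2 x t \<omega> \<partial>M)"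
    by (rule Bochner_Integration.integral_add[OF integrable_indicator_disc[OF a1 x t ABM(1)] integrable_indicator_disc[OF a2 x t ABM(2)]])
  also have "\<dots> \<le> (\<integral>\<omega>. indicator (A \<inter> B) \<omega> * stopval (disc g x) \<tau>1 \<omega> \<partial>M) + (\<integral>\<omega>. indicator (A - B) \<omega> * stopval (disc g x) \<tau>2 \<omega> \<partial>M) + e"
    using \<tau>1(3) \<tau>2(3) by simp
  also have "(\<integral>\<omega>. indicator (A \<inter> B) \<omega> * stopval (disc g x) \<tau>1 \<omega> \<partial>M) + (\<integral>\<omega>. indicator (A - B) \<omega> * stopval (disc g x) \<tau>2 \<omega> \<partial>M)
    = (\<integral>\<omega>. indicator (A \<inter> B) \<omega> * stopval (disc g x) \<tau>1 \<omega> + indicator (A - B) \<omega> * stopval (disc g x) \<tau>2 \<omega> \<partial>M)"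
    by (rule Bochner_Integration.integral_add[symmetric, OF integrable_indicator_reward[OF adm_g x \<tau>1(1) ABM(1)] integrable_indicator_reward[OF adm_g x \<tau>2(1) ABM(2)]])
  also have "\<dots> = (\<integral>\<omega>. indicator A \<omega> * stopval (disc g x) \<tau> \<omega> \<partial>M)"
    by (rule Bochner_Integration.integral_cong) (auto simp: indicator_def stopval_def \<tau>_def)
  finally show "\<exists>\<tau>. stopping_time F \<tau> \<and> (\<forall>\<omega>. ennreal t \<le> \<tau> \<omega>) \<and>
     (\<integral>\<omega>. indicator A \<omega> * disc (\<lambda>x. max (f1 x) (f2 x)) x t \<omega> \<partial>M) \<le> (\<integral>\<omega>. indicator A \<omega> * stopval (disc g x) \<tau> \<omega> \<partial>M) + e"
    using st \<tau>1(2) \<tau>2(2) by (intro exI[of _ \<tau>]) (auto simp: \<tau>_def)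
qed

lemma markov_disc:
  assumes f: "adm f" and x: "x \<in> S" and t: "0 \<le> t" and s: "0 \<le> s" and A: "A \<in> sets (F (ennreal t))"
  shows "(\<integral>\<omega>. indicator A \<omega> * disc (\<lambda>y. exp (- r * s) * P s f y) x t \<omega> \<partial>M) = (\<integral>\<omega>. indicator A \<omega> * disc f x (t + s) \<omega> \<partial>M)"
proof -
  have "(\<lambda>\<omega>. indicator A \<omega> * disc (\<lambda>y. exp (- r * s) * P s f y) x t \<omega>) =
      (\<lambda>\<omega>. exp (- r * (t + s)) * (indicator A \<omega> * P s f (X t x \<omega>)))"
  proof -
    have e: "exp (- r * (t + s)) = exp (- r * t) * exp (- r * s)" by (simp add: distrib_left flip: exp_add)
    show ?thesis unfolding disc_def e by (simp add: fun_eq_iff)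
  qed
  moreover have "(\<lambda>\<omega>. indicator A \<omega> * disc f x (t + s) \<omega>) = (\<lambda>\<omega>. exp (- r * (t + s)) * (indicator A \<omega> * f (X (t + s) x \<omega>)))"
    by (auto simp: disc_def fun_eq_iff)
  ultimately show ?thesis
    by (simp only: integral_mult_right_zero markov_adm[OF f x t s A adm_P[OF f s]])
qed

text \<open>An event of \<open>F t\<close> is also an event of \<open>F (t + s)\<close>. By the
  Markov property the integral to be reached from time \<open>t\<close> equals that of
  \<open>f\<close> at time \<open>t + s\<close>, so a stopping time that serves \<open>f\<close>
  from \<open>t + s\<close> on serves here unchanged.\<close>

lemma attainable_P:
  assumes f: "attainable f" and s: "0 \<le> s" shows "attainable (\<lambda>y. exp (- r * s) * P s f y)"
  unfolding attainable_def
proof (intro conjI ballI allI impI)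
  have a: "adm f" using f by (simp add: attainable_def)
  show "adm (\<lambda>y. exp (- r * s) * P s f y)" by (rule adm_cmult[OF adm_P[OF a s]]) simp
  fix x and t e :: real and A assume x: "x \<in> S" and t: "0 \<le> t" and A: "A \<in> sets (F (ennreal t))" and e: "0 < e"
  have ts: "0 \<le> t + s" using t s by simp
  have "ennreal t \<le> ennreal (t + s)" using s by (intro ennreal_leI) simp
  then have A': "A \<in> sets (F (ennreal (t + s)))" using A sets_F_mono by blast
  obtain \<tau> where \<tau>: "stopping_time F \<tau>" "\<And>\<omega>. ennreal (t + s) \<le> \<tau> \<omega>"
    "(\<integral>\<omega>. indicator A \<omega> * disc f x (t + s) \<omega> \<partial>M) \<le> (\<integral>\<omega>. indicator A \<omega> * stopval (disc g x) \<tau> \<omega> \<partial>M) + e"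
    using f x ts A' e unfolding attainable_def by blast
  then show "\<exists>\<tau>. stopping_time F \<tau> \<and> (\<forall>\<omega>. ennreal t \<le> \<tau> \<omega>) \<and>
     (\<integral>\<omega>. indicator A \<omega> * disc (\<lambda>y. exp (- r * s) * P s f y) x t \<omega> \<partial>M) \<le> (\<integral>\<omega>. indicator A \<omega> * stopval (disc g x) \<tau> \<omega> \<partial>M) + e"
    unfolding markov_disc[OF a x t s A]
    using order_trans[OF \<open>ennreal t \<le> ennreal (t + s)\<close> \<tau>(2)] by (intro exI[of _ \<tau>]) auto
qed

lemma attainable_le_V:
  assumes f: "attainable f" and x: "x \<in> S" shows "f x \<le> V x"
proof (rule field_le_epsilon)
  fix e :: real assume e: "0 < e"
  have a: "adm f" using f by (simp add: attainable_def)
  have sp: "space M \<in> sets (F (ennreal 0))" using sets.top[of "F (ennreal 0)"] by (simp add: space_F)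
  obtain \<tau> where \<tau>: "stopping_time F \<tau>"
    "(\<integral>\<omega>. indicator (space M) \<omega> * disc f x 0 \<omega> \<partial>M) \<le> (\<integral>\<omega>. indicator (space M) \<omega> * stopval (disc g x) \<tau> \<omega> \<partial>M) + e"
    using f x sp e unfolding attainable_def by (meson order_refl)
  have "(\<integral>\<omega>. indicator (space M) \<omega> * disc f x 0 \<omega> \<partial>M) = reward f x (\<lambda>_. 0)"
    unfolding reward_def by (rule Bochner_Integration.integral_cong) (auto simp: stopval_def)
  moreover have "(\<integral>\<omega>. indicator (space M) \<omega> * stopval (disc g x) \<tau> \<omega> \<partial>M) = reward g x \<tau>"
    unfolding reward_def by (rule Bochner_Integration.integral_cong) auto
  ultimately show "f x \<le> V x + e"
    using \<tau>(2) reward_0[OF a x] reward_le_V[OF x \<tau>(1)] by simp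
qed

section \<open>Backward induction on time grids\<close>

text \<open>Snell envelope of a discrete problem: the optimal value when stopping is allowed at the
  multiples of \<open>h\<close> from \<open>0\<close> up to \<open>k * h\<close>.\<close>

primrec W :: "real \<Rightarrow> nat \<Rightarrow> 's \<Rightarrow> real" where
  "W h 0 = g"
| "W h (Suc k) = (\<lambda>y. max (g y) (exp (- r * h) * P h (W h k) y))"

lemma attainable_W:
  assumes "0 \<le> h" shows "attainable (W h k)"
proof (induction k)
  case (Suc k)
  show ?case using attainable_max[OF attainable_g attainable_P[OF Suc assms]] by simp
qed (simp add: attainable_g)

text \<open>Mesh \<open>1 / (n + 1)\<close> and \<open>(n + 1)^2\<close> steps reach time
  \<open>n + 1\<close>: exactly the grid onto which \<open>grid n\<close> rounds.\<close>

definition U :: "nat \<Rightarrow> 's \<Rightarrow> real" where "U n = W (1 / real (Suc n)) ((Suc n)\<^sup>2)"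

lemma attainable_U: "attainable (U n)"
  unfolding U_def by (rule attainable_W) simp

lemma g_le_W: "g y \<le> W h k y"
  by (cases k) auto

text \<open>By construction \<open>W h (Suc k)\<close> dominates the discounted one-step expectation
  of \<open>W h k\<close>. Hence the discounted envelope is a supermartingale along the grid, and
  optional stopping between time \<open>0\<close> and the rounded \<open>\<tau>\<close> gives the
  bound.\<close>

lemma grid_reward_le_U:
  assumes x: "x \<in> S" and \<tau>: "stopping_time F \<tau>"
  shows "(\<integral>\<omega>. indicator {\<omega>\<in>space M. \<tau> \<omega> < \<infinity>} \<omega> * disc g x (real (grid n (\<tau> \<omega>)) / real (Suc n)) \<omega> \<partial>M) \<le> U n x"
proof -
  define h where "h = 1 / real (Suc n)"
  define K where "K = (Suc n)\<^sup>2"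
  have h: "0 \<le> h" by (simp add: h_def)
  have aW: "adm (W h k)" for k using attainable_W[OF h] by (auto simp: attainable_def)
  \<comment> \<open>After \<open>j\<close> grid steps there remain \<open>K - j\<close>; the
    expectation of \<open>N 0\<close> is \<open>U n x\<close>.\<close>
  define N where "N j = disc (W h (K - j)) x (real j * h)" for j
  have t: "0 \<le> real j * h" for j using h by simp
  have int: "integrable M (N j)" for j
    using integrable_X[OF aW x t] unfolding N_def disc_def[abs_def] by simp
  have sup: "(\<integral>\<omega>. indicator A \<omega> * N (Suc j) \<omega> \<partial>M) \<le> (\<integral>\<omega>. indicator A \<omega> * N j \<omega> \<partial>M)"
    if j: "j < K" and A: "A \<in> sets (F (ennreal (real j * h)))" for A j
  proof -
    have AM: "A \<in> sets M" using A sets_F_subset by blast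
    obtain k where k: "K - j = Suc k" using j by (cases "K - j") auto
    then have k': "K - Suc j = k" by simp
    have aPW: "adm (\<lambda>y. exp (- r * h) * P h (W h k) y)" by (rule adm_cmult[OF adm_P[OF aW h]]) simp
    have "real (Suc j) * h = real j * h + h" by (simp add: distrib_right)
    then have "(\<integral>\<omega>. indicator A \<omega> * N (Suc j) \<omega> \<partial>M) =
       (\<integral>\<omega>. indicator A \<omega> * disc (\<lambda>y. exp (- r * h) * P h (W h k) y) x (real j * h) \<omega> \<partial>M)"
      unfolding N_def k' markov_disc[OF aW x t h A] by simp
    also have "\<dots> \<le> (\<integral>\<omega>. indicator A \<omega> * N j \<omega> \<partial>M)"
      unfolding N_def
    proof (rule integral_mono[OF integrable_indicator_disc[OF aPW x t AM] integrable_indicator_disc[OF aW x t AM]])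
      fix \<omega>
      show "indicator A \<omega> * disc (\<lambda>y. exp (- r * h) * P h (W h k) y) x (real j * h) \<omega> \<le> indicator A \<omega> * disc (W h (K - j)) x (real j * h) \<omega>"
        unfolding k disc_def by (intro mult_left_mono) auto
    qed
    finally show ?thesis .
  qed
  have hj: "real j * h = real j / real (Suc n)" for j by (simp add: h_def)
  have sup': "(\<integral>\<omega>. indicator {\<omega>\<in>space M. 0 \<le> j \<and> j < grid n (\<tau> \<omega>)} \<omega> * N (Suc j) \<omega> \<partial>M) \<le>
      (\<integral>\<omega>. indicator {\<omega>\<in>space M. 0 \<le> j \<and> j < grid n (\<tau> \<omega>)} \<omega> * N j \<omega> \<partial>M)" if "j < K" for j
    using sup[OF that, of "{\<omega>\<in>space M. j < grid n (\<tau> \<omega>)}"] grid_less_sets[OF \<tau>, of j n] that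
    by (simp add: hj K_def)
  note O = discrete_optional_stopping[where N=N and \<mu>="\<lambda>_. 0" and \<nu>="\<lambda>\<omega>. grid n (\<tau> \<omega>)" and K=K,
      OF int _ grid_measurable[OF \<tau>] _ grid_le[of n, folded K_def] sup']
  have "(\<integral>\<omega>. indicator {\<omega>\<in>space M. \<tau> \<omega> < \<infinity>} \<omega> * disc g x (real (grid n (\<tau> \<omega>)) / real (Suc n)) \<omega> \<partial>M)
      \<le> (\<integral>\<omega>. N (grid n (\<tau> \<omega>)) \<omega> \<partial>M)"
  proof (rule integral_mono_AE)
    show "integrable M (\<lambda>\<omega>. N (grid n (\<tau> \<omega>)) \<omega>)" by (rule O(2)) auto
    obtain B where B: "integrable M B" "AE \<omega> in M. \<forall>t\<ge>0. \<bar>disc g x t \<omega>\<bar> \<le> B \<omega>"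
      using adm_dominated[OF adm_g x] by blast
    show "integrable M (\<lambda>\<omega>. indicator {\<omega>\<in>space M. \<tau> \<omega> < \<infinity>} \<omega> * disc g x (real (grid n (\<tau> \<omega>)) / real (Suc n)) \<omega>)"
    proof (rule Bochner_Integration.integrable_bound[OF B(1)])
      have [measurable]: "\<tau> \<in> borel_measurable M" by (rule stopping_measurable_M[OF \<tau>])
      show "(\<lambda>\<omega>. indicator {\<omega>\<in>space M. \<tau> \<omega> < \<infinity>} \<omega> * disc g x (real (grid n (\<tau> \<omega>)) / real (Suc n)) \<omega>) \<in> borel_measurable M"
        using grid_stopval_integral(2)[OF rc_process_disc[OF adm_cont[OF adm_g] x] \<tau> B, of n] by measurable
      show "AE \<omega> in M. norm (indicator {\<omega>\<in>space M. \<tau> \<omega> < \<infinity>} \<omega> * disc g x (real (grid n (\<tau> \<omega>)) / real (Suc n)) \<omega>) \<le> norm (B \<omega>)"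
        using B(2)
      proof eventually_elim
        case (elim \<omega>)
        then have "\<bar>disc g x (real (grid n (\<tau> \<omega>)) / real (Suc n)) \<omega>\<bar> \<le> B \<omega>" by simp
        then show ?case by (auto simp: indicator_def)
      qed
    qed
    show "AE \<omega> in M. indicator {\<omega>\<in>space M. \<tau> \<omega> < \<infinity>} \<omega> * disc g x (real (grid n (\<tau> \<omega>)) / real (Suc n)) \<omega> \<le> N (grid n (\<tau> \<omega>)) \<omega>"
      using disc_nonneg[OF adm_g x]
    proof eventually_elim
      case (elim \<omega>)
      let ?t = "real (grid n (\<tau> \<omega>)) / real (Suc n)"
      have "indicator {\<omega>\<in>space M. \<tau> \<omega> < \<infinity>} \<omega> * disc g x ?t \<omega> \<le> disc g x ?t \<omega>"
        using elim by (auto simp: indicator_def)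
      also have "\<dots> \<le> N (grid n (\<tau> \<omega>)) \<omega>"
        unfolding N_def hj disc_def by (intro mult_left_mono g_le_W) simp
      finally show ?case .
    qed
  qed
  also have "\<dots> \<le> (\<integral>\<omega>. N 0 \<omega> \<partial>M)" by (rule O(3)) auto
  also have "\<dots> = reward (W h K) x (\<lambda>_. 0)" unfolding N_def reward_def using stopval_const[of 0] by simp
  also have "\<dots> = U n x" using reward_0[OF aW x] by (simp add: U_def h_def K_def)
  finally show ?thesis .
qed

text \<open>Grids of mesh \<open>1 / (n + 1)\<close> are not nested, so \<open>U\<close> need not be
  monotone in \<open>n\<close>. The running maxima are, and they stay attainable.\<close>

primrec G :: "nat \<Rightarrow> 's \<Rightarrow> real" where
  "G 0 = U 0"
| "G (Suc n) = (\<lambda>y. max (G n y) (U (Suc n) y))"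

lemma attainable_G: "attainable (G n)"
  by (induction n) (auto intro: attainable_U attainable_max)

lemma adm_G: "adm (G n)"
  using attainable_G by (simp add: attainable_def)

lemma U_le_G: "U n y \<le> G n y"
  by (cases n) auto

lemma G_incseq: "incseq (\<lambda>n. G n y)"
  by (rule incseq_SucI) simp

text \<open>Any stopping time can be rounded to the grids, so its reward is a limit of numbers below
  \<open>U n x \<le> G n x\<close>; attainability keeps \<open>G n x\<close> below
  \<open>V x\<close>.\<close>

lemma G_tendsto_V:
  assumes x: "x \<in> S" shows "(\<lambda>n. G n x) \<longlonglongrightarrow> V x"
proof (rule LIMSEQ_I)
  fix e :: real assume e: "0 < e"
  have "\<exists>n. V x - e < G n x"
  proof (rule ccontr)
    assume "\<nexists>n. V x - e < G n x"
    then have G: "G n x \<le> V x - e" for n by (simp add: not_less)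
    have "V x \<le> V x - e"
    proof (rule V_least)
      fix \<tau> assume \<tau>: "stopping_time F \<tau>"
      obtain B where B: "integrable M B" "AE \<omega> in M. \<forall>t\<ge>0. \<bar>disc g x t \<omega>\<bar> \<le> B \<omega>"
        using adm_dominated[OF adm_g x] by blast
      have "(\<integral>\<omega>. indicator {\<omega>\<in>space M. \<tau> \<omega> < \<infinity>} \<omega> * disc g x (real (grid n (\<tau> \<omega>)) / real (Suc n)) \<omega> \<partial>M) \<le> V x - e" for n
        using grid_reward_le_U[OF x \<tau>, of n] U_le_G[of n x] G[of n] by linarith
      with grid_stopval_integral(1)[OF rc_process_disc[OF adm_cont[OF adm_g] x] \<tau> B]
      show "reward g x \<tau> \<le> V x - e" unfolding reward_def by (intro LIMSEQ_le_const2) auto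
    qed
    with e show False by simp
  qed
  then obtain m where m: "V x - e < G m x" ..
  have "norm (G n x - V x) < e" if "m \<le> n" for n
    using incseqD[OF G_incseq that, of x] m attainable_le_V[OF attainable_G x, of n] by simp
  then show "\<exists>m. \<forall>n\<ge>m. norm (G n x - V x) < e" by blast
qed

section \<open>Continuity and excessivity of the value function\<close>

lemma continuous_V: "continuous_on S V"
  unfolding continuous_on_sequentially
proof (safe)
  fix x xs assume x: "x \<in> S" and xs: "\<forall>n. xs n \<in> S" "xs \<longlonglongrightarrow> x"
  show "(V \<circ> xs) \<longlonglongrightarrow> V x"
  proof (rule order_tendstoI)
    fix a assume "a < V x"
    from order_tendstoD(1)[OF G_tendsto_V[OF x] this] obtain n where n: "a < G n x"
      by (auto simp: eventually_sequentially)
    have "(\<lambda>k. G n (xs k)) \<longlonglongrightarrow> G n x"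
      by (rule continuous_on_tendsto_compose[OF adm_cont[OF adm_G] xs(2) x]) (use xs in auto)
    from order_tendstoD(1)[OF this n] show "eventually (\<lambda>k. a < (V \<circ> xs) k) sequentially"
      by eventually_elim (use attainable_le_V[OF attainable_G, of "xs _" n] xs(1) in \<open>fastforce intro: less_le_trans\<close>)
  next
    fix a assume "V x < a"
    define e where "e = (a - V x) / 2"
    have e: "0 < e" using \<open>V x < a\<close> by (simp add: e_def)
    from reward_usc[OF adm_g x _ xs(2) e] xs(1)
    have "\<forall>\<^sub>F n in sequentially. \<forall>\<tau>. stopping_time F \<tau> \<longrightarrow>
         (\<exists>\<tau>'. stopping_time F \<tau>' \<and> reward g (xs n) \<tau> \<le> reward g x \<tau>' + e)" by auto
    then show "eventually (\<lambda>k. (V \<circ> xs) k < a) sequentially"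
    proof eventually_elim
      case (elim k)
      have "V (xs k) \<le> V x + e"
      proof (rule V_least)
        fix \<tau> assume "stopping_time F \<tau>"
        with elim obtain \<tau>' where "stopping_time F \<tau>'" "reward g (xs k) \<tau> \<le> reward g x \<tau>' + e" by blast
        with reward_le_V[OF x, of \<tau>'] show "reward g (xs k) \<tau> \<le> V x + e" by linarith
      qed
      also have "\<dots> < a" using \<open>V x < a\<close> by (simp add: e_def field_simps)
      finally show ?case by simp
    qed
  qed
qed

lemma adm_V: "adm V"
proof -
  obtain C where "0 \<le> C" "\<And>y. y \<in> S \<Longrightarrow> g y \<le> C * w y" using adm_bound[OF adm_g] by metis
  then show ?thesis by (intro admI[where C=C] continuous_V V_nonneg V_bound) auto
qed

text \<open>The discounted \<open>P s (G n)\<close> is itself attainable, hence below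
  \<open>V\<close>. Letting \<open>n\<close> grow under the integral, with \<open>V\<close> as
  dominating function, gives the claim.\<close>

lemma P_V_le:
  assumes s: "0 \<le> s" and x: "x \<in> S" shows "exp (- r * s) * P s V x \<le> V x"
proof -
  have "(\<lambda>n. P s (G n) x) \<longlonglongrightarrow> P s V x"
    unfolding P_def
  proof (rule integral_dominated_convergence[where w="\<lambda>\<omega>. V (X s x \<omega>)"])
    show "AE \<omega> in M. (\<lambda>n. G n (X s x \<omega>)) \<longlonglongrightarrow> V (X s x \<omega>)"
      using X_in_S[OF x] by eventually_elim (use s G_tendsto_V in auto)
    show "AE \<omega> in M. norm (G n (X s x \<omega>)) \<le> V (X s x \<omega>)" for n
      using X_in_S[OF x]
      by eventually_elim (use s attainable_le_V[OF attainable_G] adm_nonneg[OF adm_G] in auto)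
  qed (use integrable_X[OF adm_V x s] integrable_X[OF adm_G x s] in auto)
  then have "(\<lambda>n. exp (- r * s) * P s (G n) x) \<longlonglongrightarrow> exp (- r * s) * P s V x"
    by (intro tendsto_mult tendsto_const)
  then show ?thesis
    by (rule LIMSEQ_le_const2) (use attainable_le_V[OF attainable_P[OF attainable_G s] x] in auto)
qed

lemma reward_V_mono:
  "x \<in> S \<Longrightarrow> stopping_time F a \<Longrightarrow> stopping_time F b \<Longrightarrow> (\<And>\<omega>. a \<omega> \<le> b \<omega>) \<Longrightarrow> reward V x b \<le> reward V x a"
  by (rule disc_optional_stopping[OF adm_V _ adm_P[OF adm_V] P_V_le])

lemma reward_V_le: "x \<in> S \<Longrightarrow> stopping_time F \<tau> \<Longrightarrow> reward V x \<tau> \<le> V x"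
  using reward_V_mono[OF _ stopping_time_const, of x \<tau> 0] reward_0[OF adm_V] by simp

section \<open>Contact times and optimality\<close>

text \<open>The inequality is strict so that \<open>stopping_time_hit\<close> applies. The equality
  in \<open>hit0\<close> describes a closed condition, and \<open>hit0\<close> is recognised as a
  stopping time only as the limit of the times \<open>hit e\<close>.\<close>

definition hit :: "real \<Rightarrow> 's \<Rightarrow> 'a \<Rightarrow> ennreal" where
  "hit e x \<omega> = Inf (ennreal ` {t. 0 \<le> t \<and> V (X t x \<omega>) - g (X t x \<omega>) - e < 0})"

definition hit0 :: "'s \<Rightarrow> 'a \<Rightarrow> ennreal" where
  "hit0 x \<omega> = Inf (ennreal ` {t. 0 \<le> t \<and> V (X t x \<omega>) = g (X t x \<omega>)})"

lemma rc_process_gap: "x \<in> S \<Longrightarrow> rc_process (\<lambda>t \<omega>. V (X t x \<omega>) - g (X t x \<omega>) - e)"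
  using rc_process_disc_exp[of "\<lambda>y. V y - g y - e" x 0] continuous_V adm_cont[OF adm_g]
  by (simp add: continuous_on_diff)

lemma stopping_hit: "x \<in> S \<Longrightarrow> stopping_time F (hit e x)"
  unfolding hit_def[abs_def] by (rule stopping_time_hit[OF rc_process_gap])

lemma gap_before_hit:
  assumes "0 \<le> t" "ennreal t < hit e x \<omega>" shows "e \<le> V (X t x \<omega>) - g (X t x \<omega>)"
proof (rule ccontr)
  assume "\<not> e \<le> V (X t x \<omega>) - g (X t x \<omega>)"
  then have "hit e x \<omega> \<le> ennreal t"
    unfolding hit_def using assms(1) by (intro Inf_lower imageI) auto
  with assms(2) show False by simp
qed

text \<open>The infimum need not be attained. But if the gap exceeded \<open>e\<close> at the
  hitting time, right-continuity would keep it above \<open>e\<close> for a while and push the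
  infimum further.\<close>

lemma gap_at_hit:
  assumes x: "x \<in> S"
  shows "AE \<omega> in M. \<forall>t\<ge>0. hit e x \<omega> = ennreal t \<longrightarrow> V (X t x \<omega>) - g (X t x \<omega>) \<le> e"
  using rc_process_rc[OF rc_process_gap[OF x, of e]]
proof eventually_elim
  case (elim \<omega>)
  show ?case
  proof (intro allI impI)
    fix t :: real assume t: "0 \<le> t" "hit e x \<omega> = ennreal t"
    let ?Z = "\<lambda>s. V (X s x \<omega>) - g (X s x \<omega>) - e"
    show "V (X t x \<omega>) - g (X t x \<omega>) \<le> e"
    proof (rule ccontr)
      assume "\<not> V (X t x \<omega>) - g (X t x \<omega>) \<le> e"
      then have pos: "0 < ?Z t" by simp
      have "(?Z \<longlongrightarrow> ?Z t) (at_right t)" using elim t(1) by (simp add: continuous_within)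
      from order_tendstoD(1)[OF this pos] obtain b where b: "t < b" "\<And>s. t < s \<Longrightarrow> s < b \<Longrightarrow> 0 < ?Z s"
        by (auto simp: eventually_at_right_field)
      have "ennreal b \<le> hit e x \<omega>"
        unfolding hit_def
      proof (rule Inf_greatest, clarify)
        fix s assume s: "0 \<le> s" "?Z s < 0"
        have "ennreal t \<le> ennreal s"
          unfolding t(2)[symmetric] hit_def using s by (intro Inf_lower imageI) auto
        then have "t \<le> s" using s(1) by (simp add: ennreal_le_iff)
        moreover have "s \<noteq> t" using s(2) pos by auto
        ultimately have "\<not> s < b" using b(2)[of s] s(2) by auto
        then show "ennreal b \<le> ennreal s" by (intro ennreal_leI) simp
      qed
      then have "b \<le> t" using t by (simp add: ennreal_le_iff)
      with b(1) show False by simp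
    qed
  qed
qed

text \<open>A nearly optimal \<open>\<sigma>\<close> cannot stop much before \<open>hit e x\<close>: whenever it does, it gives away at least
  \<open>e exp (- r \<sigma>)\<close>.\<close>

lemma reward_V_hit:
  assumes x: "x \<in> S" and e: "0 < e" shows "reward V x (hit e x) = V x"
proof (rule antisym[OF reward_V_le[OF x stopping_hit[OF x]]], rule field_le_epsilon)
  fix \<eta> :: real assume \<eta>: "0 < \<eta>"
  obtain C where C: "0 \<le> C" "\<And>y. y \<in> S \<Longrightarrow> V y \<le> C * w y" using adm_bound[OF adm_V] by metis
  \<comment> \<open>\<open>C + 1\<close> in place of \<open>C\<close> guards against
    \<open>C = 0\<close>.\<close>
  have \<eta>': "0 < \<eta> / (2 * (C + 1))" using C \<eta> by simp
  obtain R where R: "0 \<le> R" "\<And>\<tau>. stopping_time F \<tau> \<Longrightarrow> reward (\<lambda>y. max 0 (w y - R)) x \<tau> \<le> \<eta> / (2 * (C + 1))"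
    using tail_weight[OF x \<eta>'] by blast
  \<comment> \<open>Chosen so that \<open>(1 + C * R / e) * \<delta> = \<eta> / 2\<close>:
    \<open>\<delta>\<close> is lost once through the choice of \<open>\<sigma>\<close> and
    \<open>C * R / e\<close> times through the gap estimate.\<close>
  define \<delta> where "\<delta> = \<eta> / (2 * (1 + C * R / e))"
  have \<delta>: "0 < \<delta>" unfolding \<delta>_def using \<eta> C R e by (intro divide_pos_pos mult_pos_pos add_pos_nonneg) auto
  have "\<exists>\<sigma>. stopping_time F \<sigma> \<and> V x - \<delta> < reward g x \<sigma>"
  proof (rule ccontr)
    assume "\<nexists>\<sigma>. stopping_time F \<sigma> \<and> V x - \<delta> < reward g x \<sigma>"
    then have "V x \<le> V x - \<delta>" by (intro V_least) (auto simp: not_less)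
    with \<delta> show False by simp
  qed
  then obtain \<sigma> where \<sigma>: "stopping_time F \<sigma>" "V x - \<delta> < reward g x \<sigma>" by blast
  have hs: "stopping_time F (hit e x)" by (rule stopping_hit[OF x])
  have [measurable]: "\<sigma> \<in> borel_measurable M" "hit e x \<in> borel_measurable M"
    using \<sigma> hs stopping_measurable_M by auto
  define A where "A = {\<omega>\<in>space M. \<sigma> \<omega> < hit e x \<omega>}"
  have A: "A \<in> sets M" unfolding A_def by measurable
  let ?D = "\<lambda>f \<tau> \<omega>. stopval (disc f x) \<tau> \<omega>"
  have m: "stopping_time F (\<lambda>\<omega>. min (\<sigma> \<omega>) (hit e x \<omega>))" by (rule stopping_time_min[OF \<sigma>(1) hs])
  note iV = reward_integrable[OF adm_V x] and iA = integrable_indicator_reward[OF _ x \<sigma>(1) A]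
  have cut: "adm (\<lambda>y. max 0 (w y - R))" by (rule adm_cut[OF R(1)])
  have "V x - \<delta> \<le> reward V x \<sigma>"
    using \<sigma> reward_mono[OF adm_g adm_V g_le_V x \<sigma>(1)] by simp
  also have "\<dots> \<le> reward V x (\<lambda>\<omega>. min (\<sigma> \<omega>) (hit e x \<omega>))"
    by (rule reward_V_mono[OF x m \<sigma>(1)]) simp
  also have "\<dots> \<le> (\<integral>\<omega>. ?D V (hit e x) \<omega> + indicator A \<omega> * ?D V \<sigma> \<omega> \<partial>M)"
    unfolding reward_def
  proof (rule integral_mono_AE[OF iV[OF m] Bochner_Integration.integrable_add[OF iV[OF hs] iA[OF adm_V]]])
    show "AE \<omega> in M. ?D V (\<lambda>\<omega>. min (\<sigma> \<omega>) (hit e x \<omega>)) \<omega> \<le> ?D V (hit e x) \<omega> + indicator A \<omega> * ?D V \<sigma> \<omega>"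
      using stopval_disc_nonneg[OF adm_V x, of "hit e x"] AE_space
    proof eventually_elim
      case (elim \<omega>)
      then show ?case
        by (cases "\<sigma> \<omega> < hit e x \<omega>") (auto simp: A_def stopval_def min_def not_less)
    qed
  qed
  also have "\<dots> = reward V x (hit e x) + (\<integral>\<omega>. indicator A \<omega> * ?D V \<sigma> \<omega> \<partial>M)"
    unfolding reward_def by (rule Bochner_Integration.integral_add[OF iV[OF hs] iA[OF adm_V]])
  \<comment> \<open>On \<open>A\<close> the gap \<open>V - g\<close> is at least \<open>e\<close>
    when \<open>\<sigma>\<close> stops. So
    \<open>V \<le> C * w \<le> C * R + C * max 0 (w - R)\<close>, and \<open>C * R\<close> is at
    most \<open>C * R / e\<close> times the gap. Off \<open>A\<close> the right-hand side is
    non-negative.\<close>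
  also have "(\<integral>\<omega>. indicator A \<omega> * ?D V \<sigma> \<omega> \<partial>M) \<le>
      (\<integral>\<omega>. C * R / e * (?D V \<sigma> \<omega> - ?D g \<sigma> \<omega>) + C * ?D (\<lambda>y. max 0 (w y - R)) \<sigma> \<omega> \<partial>M)"
  proof (rule integral_mono_AE[OF iA[OF adm_V]])
    show "integrable M (\<lambda>\<omega>. C * R / e * (?D V \<sigma> \<omega> - ?D g \<sigma> \<omega>) + C * ?D (\<lambda>y. max 0 (w y - R)) \<sigma> \<omega>)"
      using reward_integrable[OF _ x \<sigma>(1)] adm_V adm_g cut by auto
    show "AE \<omega> in M. indicator A \<omega> * ?D V \<sigma> \<omega> \<le> C * R / e * (?D V \<sigma> \<omega> - ?D g \<sigma> \<omega>) + C * ?D (\<lambda>y. max 0 (w y - R)) \<sigma> \<omega>"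
      using X_in_S[OF x]
    proof eventually_elim
      case (elim \<omega>)
      have c: "0 \<le> C * R / e" using C R e by simp
      show ?case
      proof (cases "\<sigma> \<omega>")
        case (real s)
        define y where "y = X s x \<omega>"
        have y: "y \<in> S" using elim real by (simp add: y_def)
        have D: "?D f \<sigma> \<omega> = exp (- r * s) * f y" for f
          using real by (simp add: stopval_def disc_def y_def)
        have gap: "0 \<le> V y - g y" using g_le_V[OF y] by simp
        have "indicator A \<omega> * V y \<le> C * R / e * (V y - g y) + C * max 0 (w y - R)"
        proof (cases "\<omega> \<in> A")
          case True
          then have "e \<le> V y - g y"
            using gap_before_hit[OF real(1), of e x \<omega>] real(2) by (simp add: A_def y_def)
          then have "C * R * 1 \<le> C * R * ((V y - g y) / e)"
            using e C R by (intro mult_left_mono) auto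
          moreover have "C * w y \<le> C * (R + max 0 (w y - R))" using C by (intro mult_left_mono) auto
          ultimately show ?thesis using C(2)[OF y] True by (simp add: distrib_left)
        next
          case False
          have "0 \<le> C * R / e * (V y - g y)" by (rule mult_nonneg_nonneg[OF c gap])
          moreover have "0 \<le> C * max 0 (w y - R)" using C by simp
          ultimately show ?thesis using False by simp
        qed
        from mult_left_mono[OF this, of "exp (- r * s)"] show ?thesis
          unfolding D by (simp add: algebra_simps)
      next
        case top
        then show ?thesis by (simp add: stopval_def)
      qed
    qed
  qed
  also have "\<dots> = C * R / e * (reward V x \<sigma> - reward g x \<sigma>) + C * reward (\<lambda>y. max 0 (w y - R)) x \<sigma>"
    unfolding reward_def using reward_integrable[OF _ x \<sigma>(1)] adm_V adm_g cut by simp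
  also have "\<dots> \<le> C * R / e * \<delta> + C * (\<eta> / (2 * (C + 1)))"
  proof (intro add_mono mult_left_mono)
    show "reward V x \<sigma> - reward g x \<sigma> \<le> \<delta>" using \<sigma> reward_V_le[OF x \<sigma>(1)] by simp
  qed (use C R e \<sigma> in auto)
  finally have "V x \<le> reward V x (hit e x) + ((1 + C * R / e) * \<delta> + C * (\<eta> / (2 * (C + 1))))"
    by (simp add: distrib_right)
  also have "(1 + C * R / e) * \<delta> = \<eta> / 2"
  proof -
    have "0 < 1 + C * R / e" using C R e by (intro add_pos_nonneg) auto
    moreover have "a * (\<eta> / (2 * a)) = \<eta> / 2" if "0 < a" for a using that by simp
    ultimately show ?thesis unfolding \<delta>_def by blast
  qed
  also have "C * (\<eta> / (2 * (C + 1))) \<le> \<eta> / 2"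
    using C \<eta> by (simp add: field_simps)
  finally show "V x \<le> reward V x (hit e x) + \<eta>" by simp
qed

lemma hit_antimono: "e \<le> e' \<Longrightarrow> hit e' x \<omega> \<le> hit e x \<omega>"
  unfolding hit_def by (rule Inf_superset_mono) auto

lemma hit_le_hit0: "0 < e \<Longrightarrow> hit e x \<omega> \<le> hit0 x \<omega>"
  unfolding hit_def hit0_def by (rule Inf_superset_mono) auto

definition hit_lim :: "'s \<Rightarrow> 'a \<Rightarrow> ennreal" where
  "hit_lim x \<omega> = (SUP k. hit (1 / real (Suc k)) x \<omega>)"

lemma hit_incseq: "incseq (\<lambda>k. hit (1 / real (Suc k)) x \<omega>)"
  by (rule incseq_SucI, rule hit_antimono) (simp add: frac_le)

lemma hit_le_lim: "hit (1 / real (Suc k)) x \<omega> \<le> hit_lim x \<omega>"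
  unfolding hit_lim_def by (rule SUP_upper) simp

lemma stopping_hit_lim: "x \<in> S \<Longrightarrow> stopping_time F (hit_lim x)"
  unfolding stopping_time_def hit_lim_def SUP_le_iff
  using stopping_hit by (auto intro!: pred_intros_countable simp: stopping_time_def)

text \<open>Quasi left-continuity makes the flow converge along the increasing times, where
  right-continuity is of no help. The gap at \<open>hit (1 / (k + 1))\<close> is at most
  \<open>1 / (k + 1)\<close>, so by continuity of \<open>V\<close> and \<open>g\<close> it vanishes
  at the limit.\<close>

lemma hit_lim_limit:
  assumes x: "x \<in> S"
  shows "AE \<omega> in M. hit_lim x \<omega> < \<infinity> \<longrightarrow>
    (\<lambda>k. stopval (disc V x) (hit (1 / real (Suc k)) x) \<omega>) \<longlonglongrightarrow> stopval (disc V x) (hit_lim x) \<omega> \<and>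
    V (X (enn2real (hit_lim x \<omega>)) x \<omega>) = g (X (enn2real (hit_lim x \<omega>)) x \<omega>)"
proof -
  have gaps: "AE \<omega> in M. \<forall>k. \<forall>t\<ge>0. hit (1 / real (Suc k)) x \<omega> = ennreal t \<longrightarrow> V (X t x \<omega>) - g (X t x \<omega>) \<le> 1 / real (Suc k)"
    unfolding AE_all_countable using gap_at_hit[OF x] by blast
  have qlc: "AE \<omega> in M. hit_lim x \<omega> < \<infinity> \<longrightarrow>
      (\<lambda>k. X (enn2real (hit (1 / real (Suc k)) x \<omega>)) x \<omega>) \<longlonglongrightarrow> X (enn2real (hit_lim x \<omega>)) x \<omega>"
    unfolding hit_lim_def by (rule X_qlc[OF x stopping_hit[OF x] hit_incseq])
  show ?thesis
    using gaps qlc X_in_S[OF x]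
  proof eventually_elim
    case (elim \<omega>)
    show ?case
    proof
      assume fin: "hit_lim x \<omega> < \<infinity>"
      define T where "T k = enn2real (hit (1 / real (Suc k)) x \<omega>)" for k
      define T0 where "T0 = enn2real (hit_lim x \<omega>)"
      have hk: "hit (1 / real (Suc k)) x \<omega> < \<infinity>" for k
        using hit_le_lim[of k x \<omega>] fin by (rule le_less_trans)
      then have hT: "hit (1 / real (Suc k)) x \<omega> = ennreal (T k)" and T: "0 \<le> T k" for k
        unfolding T_def by (simp_all add: less_top[symmetric])
      have hT0: "hit_lim x \<omega> = ennreal T0" "0 \<le> T0" using fin by (simp_all add: T0_def less_top[symmetric])
      have "(\<lambda>k. hit (1 / real (Suc k)) x \<omega>) \<longlonglongrightarrow> hit_lim x \<omega>"
        unfolding hit_lim_def by (rule LIMSEQ_SUP[OF hit_incseq])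
      then have "(\<lambda>k. ennreal (T k)) \<longlonglongrightarrow> ennreal T0" unfolding hT hT0 .
      then have TT: "T \<longlonglongrightarrow> T0" by (rule tendsto_ennrealD) (use T hT0 in auto)
      have lim: "(\<lambda>k. X (T k) x \<omega>) \<longlonglongrightarrow> X T0 x \<omega>" using elim fin by (simp add: T_def T0_def)
      have inS: "X T0 x \<omega> \<in> S" "X (T k) x \<omega> \<in> S" for k using elim T hT0 by auto
      have limf: "(\<lambda>k. f (X (T k) x \<omega>)) \<longlonglongrightarrow> f (X T0 x \<omega>)" if "continuous_on S f" for f :: "'s \<Rightarrow> real"
        by (rule continuous_on_tendsto_compose[OF that lim inS(1)]) (use inS in auto)
      have "(\<lambda>k. exp (- r * T k) * V (X (T k) x \<omega>)) \<longlonglongrightarrow> exp (- r * T0) * V (X T0 x \<omega>)"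
        by (intro tendsto_intros TT limf continuous_V)
      then have 1: "(\<lambda>k. stopval (disc V x) (hit (1 / real (Suc k)) x) \<omega>) \<longlonglongrightarrow> stopval (disc V x) (hit_lim x) \<omega>"
        using T hT0(2) by (simp add: stopval_def disc_def hT hT0(1) del: of_nat_Suc)
      have "(\<lambda>k. V (X (T k) x \<omega>) - g (X (T k) x \<omega>)) \<longlonglongrightarrow> V (X T0 x \<omega>) - g (X T0 x \<omega>)"
        by (intro tendsto_diff limf continuous_V adm_cont[OF adm_g])
      moreover have "V (X (T k) x \<omega>) - g (X (T k) x \<omega>) \<le> 1 / real (Suc k)" for k
        using elim T hT by blast
      ultimately have "V (X T0 x \<omega>) - g (X T0 x \<omega>) \<le> 0"
        by (intro LIMSEQ_le[OF _ LIMSEQ_Suc[OF lim_1_over_n]]) auto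
      then have "V (X T0 x \<omega>) = g (X T0 x \<omega>)" using g_le_V[OF inS(1)] by simp
      with 1 show "(\<lambda>k. stopval (disc V x) (hit (1 / real (Suc k)) x) \<omega>) \<longlonglongrightarrow> stopval (disc V x) (hit_lim x) \<omega> \<and>
        V (X (enn2real (hit_lim x \<omega>)) x \<omega>) = g (X (enn2real (hit_lim x \<omega>)) x \<omega>)"
        by (simp add: T0_def)
    qed
  qed
qed

text \<open>One inequality holds for every path, the other because contact already occurs at a
  finite \<open>hit_lim\<close>. By completeness \<open>hit0\<close> thereby becomes a stopping
  time.\<close>

lemma hit_lim_eq_hit0:
  assumes x: "x \<in> S" shows "AE \<omega> in M. hit_lim x \<omega> = hit0 x \<omega>"
  using hit_lim_limit[OF x]
proof eventually_elim
  case (elim \<omega>)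
  have 1: "hit_lim x \<omega> \<le> hit0 x \<omega>"
    unfolding hit_lim_def by (rule SUP_least) (simp add: hit_le_hit0)
  show ?case
  proof (cases "hit_lim x \<omega> < \<infinity>")
    case True
    let ?t = "enn2real (hit_lim x \<omega>)"
    have "hit0 x \<omega> \<le> ennreal ?t"
      unfolding hit0_def using elim True by (intro Inf_lower imageI) auto
    with True 1 show ?thesis by (simp add: less_top[symmetric])
  next
    case False
    with 1 show ?thesis by (simp add: less_top[symmetric] top_unique)
  qed
qed

lemma stopping_hit0: "x \<in> S \<Longrightarrow> stopping_time F (hit0 x)"
  by (rule stopping_time_AE_eq[OF stopping_hit_lim hit_lim_eq_hit0])

lemma reward_AE_eq:
  assumes "AE \<omega> in M. \<sigma> \<omega> = \<tau> \<omega>" "stopping_time F \<sigma>" "stopping_time F \<tau>" "adm f" "x \<in> S"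
  shows "reward f x \<sigma> = reward f x \<tau>"
  unfolding reward_def
proof (rule integral_cong_AE)
  show "AE \<omega> in M. stopval (disc f x) \<sigma> \<omega> = stopval (disc f x) \<tau> \<omega>"
    using assms(1) by eventually_elim (simp add: stopval_def)
qed (use reward_integrable[OF assms(4,5)] assms(2,3) in auto)

text \<open>Where \<open>hit_lim\<close> is infinite, the values at the increasing times need not
  tend to \<open>0\<close> path by path. A time \<open>c\<close> separates these paths off: stopping
  at or after \<open>c\<close> weighs at most \<open>C exp (- (r - \<kappa>) c) w(x)\<close>,
  uniformly in \<open>k\<close>; dominated convergence treats the rest, and finally \<open>c\<close>
  tends to infinity.\<close>

lemma reward_V_hit_lim:
  assumes x: "x \<in> S" shows "V x \<le> reward V x (hit_lim x)"
proof -
  obtain C where C: "0 \<le> C" "\<And>y. y \<in> S \<Longrightarrow> V y \<le> C * w y" using adm_bound[OF adm_V] by metis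
  let ?\<tau> = "\<lambda>k. hit (1 / real (Suc k)) x"
  let ?D = "\<lambda>f \<tau> \<omega>. stopval (disc f x) \<tau> \<omega>"
  have h: "stopping_time F (?\<tau> k)" for k by (rule stopping_hit[OF x])
  have hl: "stopping_time F (hit_lim x)" by (rule stopping_hit_lim[OF x])
  have [measurable]: "?\<tau> k \<in> borel_measurable M" "hit_lim x \<in> borel_measurable M" for k
    using stopping_measurable_M h hl by auto
  obtain B where B: "integrable M B" "AE \<omega> in M. \<forall>t\<ge>0. \<bar>disc V x t \<omega>\<bar> \<le> B \<omega>"
    using adm_dominated[OF adm_V x] by blast
  have bound: "V x \<le> reward V x (hit_lim x) + C * (exp (- (r - \<kappa>) * c) * w x)" if c: "0 \<le> c" for c
  proof -
    \<comment> \<open>A path outside \<open>A k\<close> stops at or after \<open>c\<close> and so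
      belongs to \<open>L k\<close>. A path with infinite \<open>hit_lim\<close> is outside
      \<open>A k\<close> for all large \<open>k\<close>.\<close>
    define A where "A k = {\<omega>\<in>space M. ?\<tau> k \<omega> < ennreal c \<or> hit_lim x \<omega> < \<infinity>}" for k
    define L where "L k = {\<omega>\<in>space M. ennreal c \<le> ?\<tau> k \<omega>}" for k
    have A: "A k \<in> sets M" and L: "L k \<in> sets M" for k unfolding A_def L_def by measurable
    have lim: "(\<lambda>k. \<integral>\<omega>. indicator (A k) \<omega> * ?D V (?\<tau> k) \<omega> \<partial>M) \<longlonglongrightarrow> reward V x (hit_lim x)"
      unfolding reward_def
    proof (rule integral_dominated_convergence[where w=B])
      show "AE \<omega> in M. (\<lambda>k. indicator (A k) \<omega> * ?D V (?\<tau> k) \<omega>) \<longlonglongrightarrow> ?D V (hit_lim x) \<omega>"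
        using hit_lim_limit[OF x] AE_space
      proof eventually_elim
        case (elim \<omega>)
        show ?case
        proof (cases "hit_lim x \<omega> < \<infinity>")
          case True
          then have "indicator (A k) \<omega> = (1::real)" for k using elim by (simp add: A_def)
          then show ?thesis using elim True by simp
        next
          case False
          have "(\<lambda>k. ?\<tau> k \<omega>) \<longlonglongrightarrow> hit_lim x \<omega>"
            unfolding hit_lim_def by (rule LIMSEQ_SUP[OF hit_incseq])
          moreover have "ennreal c < hit_lim x \<omega>" using False by (simp add: less_top[symmetric])
          ultimately have "eventually (\<lambda>k. ennreal c < ?\<tau> k \<omega>) sequentially" by (rule order_tendstoD)
          then have "eventually (\<lambda>k. indicator (A k) \<omega> * ?D V (?\<tau> k) \<omega> = 0) sequentially"
            by eventually_elim (use False in \<open>auto simp: A_def indicator_def\<close>)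
          then have "(\<lambda>k. indicator (A k) \<omega> * ?D V (?\<tau> k) \<omega>) \<longlonglongrightarrow> 0" by (rule tendsto_eventually)
          moreover have "?D V (hit_lim x) \<omega> = 0" using False by (simp add: stopval_def less_top[symmetric])
          ultimately show ?thesis by simp
        qed
      qed
      show "AE \<omega> in M. norm (indicator (A k) \<omega> * ?D V (?\<tau> k) \<omega>) \<le> B \<omega>" for k
        using stopval_dominated[OF B(2), of "?\<tau> k"]
        by eventually_elim (auto simp: indicator_def)
    qed (use B(1) integrable_indicator_reward[OF adm_V x h A] reward_integrable[OF adm_V x hl] in auto)
    have "V x \<le> (\<integral>\<omega>. indicator (A k) \<omega> * ?D V (?\<tau> k) \<omega> \<partial>M) + C * (exp (- (r - \<kappa>) * c) * w x)" for k
    proof -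
      have iL: "integrable M (\<lambda>\<omega>. C * (indicator (L k) \<omega> * ?D w (?\<tau> k) \<omega>))"
        using integrable_indicator_reward[OF adm_w x h L] by simp
      have "V x = (\<integral>\<omega>. ?D V (?\<tau> k) \<omega> \<partial>M)"
        using reward_V_hit[OF x, of "1 / real (Suc k)"] by (simp add: reward_def del: of_nat_Suc)
      also have "\<dots> \<le> (\<integral>\<omega>. indicator (A k) \<omega> * ?D V (?\<tau> k) \<omega> + C * (indicator (L k) \<omega> * ?D w (?\<tau> k) \<omega>) \<partial>M)"
      proof (rule integral_mono_AE[OF reward_integrable[OF adm_V x h]
            Bochner_Integration.integrable_add[OF integrable_indicator_reward[OF adm_V x h A] iL]])
        show "AE \<omega> in M. ?D V (?\<tau> k) \<omega> \<le> indicator (A k) \<omega> * ?D V (?\<tau> k) \<omega> + C * (indicator (L k) \<omega> * ?D w (?\<tau> k) \<omega>)"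
          using X_in_S[OF x] AE_space
        proof eventually_elim
          case (elim \<omega>)
          show ?case
          proof (cases "?\<tau> k \<omega>")
            case (real t)
            then have y: "X t x \<omega> \<in> S" using elim by simp
            have D: "?D f (?\<tau> k) \<omega> = exp (- r * t) * f (X t x \<omega>)" for f
              using real by (simp add: stopval_def disc_def)
            have le: "?D V (?\<tau> k) \<omega> \<le> C * ?D w (?\<tau> k) \<omega>" "0 \<le> C * ?D w (?\<tau> k) \<omega>"
              unfolding D using C(2)[OF y] C(1) w_pos[OF y] by (auto simp: mult.left_commute[of C])
            show ?thesis
            proof (cases "ennreal c \<le> ?\<tau> k \<omega>")
              case True
              then have "\<omega> \<in> L k" using elim by (simp add: L_def)
              moreover have "0 \<le> ?D V (?\<tau> k) \<omega>" unfolding D using V_nonneg[OF y] by simp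
              ultimately show ?thesis using le by (auto simp: indicator_def)
            next
              case False
              then have "\<omega> \<in> A k" "\<omega> \<notin> L k" using elim by (auto simp: A_def L_def)
              then show ?thesis by simp
            qed
          qed (simp add: stopval_def)
        qed
      qed
      also have "\<dots> = (\<integral>\<omega>. indicator (A k) \<omega> * ?D V (?\<tau> k) \<omega> \<partial>M) + C * (\<integral>\<omega>. indicator (L k) \<omega> * ?D w (?\<tau> k) \<omega> \<partial>M)"
        using Bochner_Integration.integral_add[OF integrable_indicator_reward[OF adm_V x h A] iL] by simp
      also have "\<dots> \<le> (\<integral>\<omega>. indicator (A k) \<omega> * ?D V (?\<tau> k) \<omega> \<partial>M) + C * (exp (- (r - \<kappa>) * c) * w x)"
        unfolding L_def by (intro add_left_mono mult_left_mono late_weight[OF x h c] C(1))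
      finally show ?thesis .
    qed
    then show ?thesis
      by (intro LIMSEQ_le_const[OF tendsto_add[OF lim tendsto_const]]) auto
  qed
  have "(\<lambda>n. exp (- (r - \<kappa>)) ^ n) \<longlonglongrightarrow> 0"
    using \<kappa>_less by (intro LIMSEQ_power_zero) auto
  then have "(\<lambda>n. exp (- (r - \<kappa>) * real n)) \<longlonglongrightarrow> 0" by (simp flip: exp_of_nat_mult add: mult.commute)
  then have "(\<lambda>n. reward V x (hit_lim x) + C * (exp (- (r - \<kappa>) * real n) * w x)) \<longlonglongrightarrow> reward V x (hit_lim x) + C * (0 * w x)"
    by (intro tendsto_add tendsto_mult tendsto_const)
  then have "V x \<le> reward V x (hit_lim x) + C * (0 * w x)"
    by (rule LIMSEQ_le_const) (use bound in auto)
  then show ?thesis by simp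
qed

lemma reward_V_hit0:
  assumes x: "x \<in> S" shows "reward V x (hit0 x) = V x"
  using reward_V_hit_lim[OF x] reward_V_le[OF x stopping_hit0[OF x]]
    reward_AE_eq[OF hit_lim_eq_hit0[OF x] stopping_hit_lim[OF x] stopping_hit0[OF x] adm_V x]
  by simp

lemma optimal_hit0:
  assumes x: "x \<in> S" shows "reward g x (hit0 x) = V x"
proof -
  have "reward g x (hit_lim x) = reward V x (hit_lim x)"
    unfolding reward_def
  proof (rule integral_cong_AE)
    show "AE \<omega> in M. stopval (disc g x) (hit_lim x) \<omega> = stopval (disc V x) (hit_lim x) \<omega>"
      using hit_lim_limit[OF x] by eventually_elim (auto simp: stopval_def disc_def less_top[symmetric])
  qed (use reward_integrable[OF _ x stopping_hit_lim[OF x]] adm_V adm_g in auto)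
  moreover have "reward f x (hit_lim x) = reward f x (hit0 x)" if "adm f" for f
    by (rule reward_AE_eq[OF hit_lim_eq_hit0[OF x] stopping_hit_lim[OF x] stopping_hit0[OF x] that x])
  ultimately show ?thesis using reward_V_hit0[OF x] adm_V adm_g by simp
qed

lemma reward_V_before_hit0:
  assumes x: "x \<in> S" and a: "stopping_time F a" "\<And>\<omega>. a \<omega> \<le> hit0 x \<omega>"
  shows "reward V x a = V x"
  using reward_V_mono[OF x a(1) stopping_hit0[OF x] a(2)] reward_V_le[OF x a(1)] reward_V_hit0[OF x] by simp

text \<open>All stopping times below \<open>hit0\<close> give \<open>V\<close> the same reward.
  Comparing \<open>min s hit0\<close> with the time that equals \<open>min t hit0\<close> on
  \<open>A\<close> and \<open>min s hit0\<close> off \<open>A\<close> localises this equality to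
  \<open>A\<close>.\<close>

lemma stopped_V_martingale:
  assumes x: "x \<in> S" and s: "0 \<le> s" "s \<le> t" and A: "A \<in> sets (F (ennreal s))"
  shows "(\<integral>\<omega>. indicator A \<omega> * stopval (disc V x) (\<lambda>\<omega>. min (ennreal t) (hit0 x \<omega>)) \<omega> \<partial>M) =
    (\<integral>\<omega>. indicator A \<omega> * stopval (disc V x) (\<lambda>\<omega>. min (ennreal s) (hit0 x \<omega>)) \<omega> \<partial>M)"
proof -
  let ?m = "\<lambda>t \<omega>. min (ennreal t) (hit0 x \<omega>)"
  let ?D = "\<lambda>\<tau> \<omega>. stopval (disc V x) \<tau> \<omega>"
  have m: "stopping_time F (?m u)" for u by (rule stopping_time_min[OF stopping_time_const stopping_hit0[OF x]])
  have st: "ennreal s \<le> ennreal t" using s by (intro ennreal_leI)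
  define b where "b \<omega> = (if \<omega> \<in> A then ?m t \<omega> else ?m s \<omega>)" for \<omega>
  have b: "stopping_time F b"
  proof (rule stopping_timeI)
    fix u
    show "Measurable.pred (F u) (\<lambda>\<omega>. b \<omega> \<le> u)"
    proof (cases "ennreal s \<le> u")
      case True
      then have A': "A \<in> sets (F u)" using A sets_F_mono by blast
      \<comment> \<open>Off \<open>A\<close> the inequality \<open>b \<le> s \<le> u\<close> is
        automatic.\<close>
      have "{\<omega>\<in>space M. b \<omega> \<le> u} = (A \<inter> {\<omega>\<in>space M. ?m t \<omega> \<le> u}) \<union> (space M - A)"
        using True sets.sets_into_space[OF A] by (auto simp: b_def space_F min_le_iff_disj)
      moreover have "{\<omega>\<in>space M. ?m t \<omega> \<le> u} \<in> sets (F u)"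
        using stopping_timeD[OF m] by (simp only: pred_F_iff)
      moreover have "space M - A \<in> sets (F u)" using sets.compl_sets[OF A'] by (simp add: space_F)
      ultimately show ?thesis using A' by (simp add: pred_F_iff)
    next
      case False
      then have "\<not> ennreal t \<le> u" using st by auto
      with False have "b \<omega> \<le> u \<longleftrightarrow> hit0 x \<omega> \<le> u" for \<omega>
        by (auto simp: b_def min_le_iff_disj)
      then show ?thesis using stopping_timeD[OF stopping_hit0[OF x], of u] by simp
    qed
  qed
  have AM: "A \<in> sets M" "space M - A \<in> sets M" using A sets_F_subset by auto
  note i = integrable_indicator_reward[OF adm_V x m]
  have "V x = (\<integral>\<omega>. indicator A \<omega> * ?D (?m t) \<omega> + indicator (space M - A) \<omega> * ?D (?m s) \<omega> \<partial>M)"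
  proof -
    have "V x = reward V x b"
      by (rule reward_V_before_hit0[OF x b, symmetric]) (auto simp: b_def)
    also have "\<dots> = (\<integral>\<omega>. indicator A \<omega> * ?D (?m t) \<omega> + indicator (space M - A) \<omega> * ?D (?m s) \<omega> \<partial>M)"
      unfolding reward_def by (rule Bochner_Integration.integral_cong) (auto simp: indicator_def b_def stopval_def)
    finally show ?thesis .
  qed
  moreover have "V x = (\<integral>\<omega>. indicator A \<omega> * ?D (?m s) \<omega> + indicator (space M - A) \<omega> * ?D (?m s) \<omega> \<partial>M)"
  proof -
    have "V x = reward V x (?m s)"
      by (rule reward_V_before_hit0[OF x m, symmetric]) simp
    also have "\<dots> = (\<integral>\<omega>. indicator A \<omega> * ?D (?m s) \<omega> + indicator (space M - A) \<omega> * ?D (?m s) \<omega> \<partial>M)"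
      unfolding reward_def by (rule Bochner_Integration.integral_cong) (auto simp: indicator_def)
    finally show ?thesis .
  qed
  ultimately show ?thesis
    using Bochner_Integration.integral_add[OF i[OF AM(1), of t] i[OF AM(2), of s]]
      Bochner_Integration.integral_add[OF i[OF AM(1), of s] i[OF AM(2), of s]] by simp
qed

end

section \<open>The fixed point\<close>

text \<open>\<open>J x\<close> is the range of integration in \<open>\<Lambda>\<close>, and
  \<open>J_tendsto\<close> is what continuity of \<open>\<Lambda> f\<close> asks of it. It is
  trivial for the half-line; with a finite horizon the right end point moves with the starting
  point, and continuity of the distribution function is used.\<close>

locale recursive_stopping = stopping_flow M F X S w r \<kappa> + law: real_distribution D
  for M :: "'a measure" and F :: "ennreal \<Rightarrow> 'a measure"
    and X :: "real \<Rightarrow> 's::euclidean_space \<Rightarrow> 'a \<Rightarrow> 's" and S w r \<kappa> and D :: "real measure" +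
  fixes p :: real and \<phi> \<psi> :: "'s \<Rightarrow> real" and J :: "'s \<Rightarrow> real set"
  assumes p_pos: "0 < p" and p_less_1: "p < 1"
    and adm_\<phi>: "adm \<phi>" and adm_\<psi>: "adm \<psi>"
    and J_sets: "\<And>x. x \<in> S \<Longrightarrow> J x \<in> sets borel" and J_nonneg: "\<And>x. x \<in> S \<Longrightarrow> J x \<subseteq> {0..}"
    and J_tendsto: "\<And>xs x. (\<And>n::nat. xs n \<in> S) \<Longrightarrow> x \<in> S \<Longrightarrow> xs \<longlonglongrightarrow> x \<Longrightarrow>
      AE s in D. (\<lambda>n. indicator (J (xs n)) s :: real) \<longlonglongrightarrow> indicator (J x) s"
begin

section \<open>The operator \<Lambda> and its admissibility\<close>

definition mix :: "('s \<Rightarrow> real) \<Rightarrow> 's \<Rightarrow> real" where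
  "mix f y = p * \<psi> y + (1 - p) * f y"

definition \<Lambda> :: "('s \<Rightarrow> real) \<Rightarrow> 's \<Rightarrow> real" where
  "\<Lambda> f x = (\<integral>s. indicator (J x) s * (exp (- r * s) * P s (mix f) x) \<partial>D)"

text \<open>The \<open>V\<close> of \<open>obstacle_problem\<close> with the obstacle as an
  argument, since the obstacle now varies with the function inserted.\<close>

definition optval :: "('s \<Rightarrow> real) \<Rightarrow> 's \<Rightarrow> real" where
  "optval g x = (SUP \<tau>\<in>{\<tau>. stopping_time F \<tau>}. reward g x \<tau>)"

definition obst :: "('s \<Rightarrow> real) \<Rightarrow> 's \<Rightarrow> real" where
  "obst f x = max (\<phi> x) (\<Lambda> f x)"

lemma adm_mix: "adm f \<Longrightarrow> adm (mix f)"
  unfolding mix_def[abs_def] using p_pos p_less_1 by (intro adm_add adm_cmult adm_\<psi>) auto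

text \<open>Dominated convergence along right-continuous paths. This is the source of measurability
  in \<open>s\<close> of the integrand that defines \<open>\<Lambda>\<close>.\<close>

lemma P_disc_right_continuous:
  assumes q: "adm q" and x: "x \<in> S" and t: "0 \<le> t"
  shows "continuous (at_right t) (\<lambda>s. exp (- r * s) * P s q x)"
proof -
  obtain B where B: "integrable M B" "AE \<omega> in M. \<forall>t\<ge>0. \<bar>disc q x t \<omega>\<bar> \<le> B \<omega>"
    using adm_dominated[OF q x] by blast
  have eq: "exp (- r * s) * P s q x = (\<integral>\<omega>. disc q x s \<omega> \<partial>M)" for s
    unfolding P_def disc_def by simp
  have int: "disc q x s \<in> borel_measurable M" if "0 \<le> s" for s
    using integrable_X[OF q x that] unfolding disc_def[abs_def] by simp
  have "((\<lambda>s. \<integral>\<omega>. disc q x s \<omega> \<partial>M) \<longlongrightarrow> (\<integral>\<omega>. disc q x t \<omega> \<partial>M)) (at_right t)"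
  proof (rule tendsto_at_right_sequentially[where b="t+1"])
    fix s :: "nat \<Rightarrow> real" assume s: "\<And>n. t < s n" "s \<longlonglongrightarrow> t"
    have fl: "filterlim s (at_right t) sequentially"
      by (rule tendsto_imp_filterlim_at_right[OF s(2)]) (use s(1) in auto)
    show "(\<lambda>n. \<integral>\<omega>. disc q x (s n) \<omega> \<partial>M) \<longlonglongrightarrow> (\<integral>\<omega>. disc q x t \<omega> \<partial>M)"
    proof (rule integral_dominated_convergence[OF _ _ B(1)])
      show "AE \<omega> in M. (\<lambda>n. disc q x (s n) \<omega>) \<longlonglongrightarrow> disc q x t \<omega>"
        using rc_process_rc[OF rc_process_disc[OF adm_cont[OF q] x]]
      proof eventually_elim
        case (elim \<omega>)
        then have "((\<lambda>s. disc q x s \<omega>) \<longlongrightarrow> disc q x t \<omega>) (at_right t)"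
          using t by (simp add: continuous_within)
        from filterlim_compose[OF this fl] show ?case .
      qed
      show "AE \<omega> in M. norm (disc q x (s n) \<omega>) \<le> B \<omega>" for n
        using B(2) by eventually_elim (use t s(1)[of n] in auto)
    qed (use int t s(1) order_trans[OF t less_imp_le[OF s(1)]] in auto)
  qed simp
  then show ?thesis unfolding continuous_within eq .
qed

lemma P_disc_measurable:
  assumes q: "adm q" and x: "x \<in> S"
  shows "(\<lambda>s. indicator (J x) s * (exp (- r * s) * P s q x)) \<in> borel_measurable D"
proof -
  have "(\<lambda>s. exp (- r * max 0 s) * P (max 0 s) q x) \<in> borel_measurable borel"
    by (rule borel_measurable_right_continuous) (rule P_disc_right_continuous[OF q x])
  moreover have "(indicator (J x) :: real \<Rightarrow> real) \<in> borel_measurable borel"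
    using J_sets[OF x] by simp
  ultimately have "(\<lambda>s. indicator (J x) s * (exp (- r * max 0 s) * P (max 0 s) q x)) \<in> borel_measurable borel"
    by (rule borel_measurable_times[rotated])
  also have "(\<lambda>s. indicator (J x) s * (exp (- r * max 0 s) * P (max 0 s) q x)) = (\<lambda>s. indicator (J x) s * (exp (- r * s) * P s q x))"
    using J_nonneg[OF x] by (auto simp: fun_eq_iff indicator_def)
  finally show ?thesis by (simp cong: measurable_cong_sets)
qed

lemma P_disc_bounds:
  assumes q: "adm q" and C: "0 \<le> C" "\<And>y. y \<in> S \<Longrightarrow> q y \<le> C * w y" and x: "x \<in> S"
  shows "0 \<le> indicator (J x) s * (exp (- r * s) * P s q x)" "indicator (J x) s * (exp (- r * s) * P s q x) \<le> C * w x"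
proof -
  have 0: "0 \<le> C * w x" using C w_pos[OF x] by simp
  show "0 \<le> indicator (J x) s * (exp (- r * s) * P s q x)"
    using J_nonneg[OF x] P_nonneg[OF q x] by (auto simp: indicator_def)
  show "indicator (J x) s * (exp (- r * s) * P s q x) \<le> C * w x"
    using J_nonneg[OF x] P_bound[OF q C x, of s] 0 by (cases "s \<in> J x") auto
qed

lemma P_disc_integrable:
  assumes q: "adm q" and x: "x \<in> S"
  shows "integrable D (\<lambda>s. indicator (J x) s * (exp (- r * s) * P s q x))"
proof -
  obtain C where C: "0 \<le> C" "\<And>y. y \<in> S \<Longrightarrow> q y \<le> C * w y" using adm_bound[OF q] by metis
  show ?thesis
    by (rule law.integrable_const_bound[where B="C * w x"])
      (use P_disc_bounds[OF q C x] P_disc_measurable[OF q x] in auto)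
qed

lemma \<Lambda>_nonneg:
  assumes "adm f" "x \<in> S" shows "0 \<le> \<Lambda> f x"
proof -
  obtain C where "0 \<le> C" "\<And>y. y \<in> S \<Longrightarrow> mix f y \<le> C * w y"
    using adm_bound[OF adm_mix[OF assms(1)]] by metis
  then show ?thesis
    unfolding \<Lambda>_def using P_disc_bounds(1)[OF adm_mix[OF assms(1)] _ _ assms(2)]
    by (intro Bochner_Integration.integral_nonneg) blast
qed

lemma adm_\<Lambda>:
  assumes f: "adm f" shows "adm (\<Lambda> f)"
proof -
  let ?q = "mix f"
  have q: "adm ?q" by (rule adm_mix[OF f])
  obtain C where C: "0 \<le> C" "\<And>y. y \<in> S \<Longrightarrow> ?q y \<le> C * w y" using adm_bound[OF q] by metis
  have le: "\<Lambda> f x \<le> C * w x" if x: "x \<in> S" for x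
  proof -
    have "\<Lambda> f x \<le> (\<integral>s. C * w x \<partial>D)"
      unfolding \<Lambda>_def by (rule integral_mono[OF P_disc_integrable[OF q x]]) (use P_disc_bounds[OF q C x] in auto)
    also have "\<dots> = C * w x" using law.prob_space by simp
    finally show ?thesis .
  qed
  have "continuous_on S (\<Lambda> f)"
    unfolding continuous_on_sequentially
  proof safe
    fix x xs assume x: "x \<in> S" and xs: "\<forall>n. xs n \<in> S" "xs \<longlonglongrightarrow> x"
    have "(\<lambda>n. w (xs n)) \<longlonglongrightarrow> w x"
      by (rule continuous_on_tendsto_compose[OF continuous_w xs(2) x]) (use xs in auto)
    \<comment> \<open>Along a convergent sequence of starting points \<open>w\<close> is bounded, so
      a constant dominates the integrands; \<open>D\<close> has finite mass.\<close>
    then have "Bseq (\<lambda>n. w (xs n))" by (rule convergent_imp_Bseq[OF convergentI])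
    then obtain K where K: "\<And>n. norm (w (xs n)) \<le> K" by (auto simp: Bseq_def)
    have "(\<lambda>n. \<integral>s. indicator (J (xs n)) s * (exp (- r * s) * P s ?q (xs n)) \<partial>D) \<longlonglongrightarrow>
      (\<integral>s. indicator (J x) s * (exp (- r * s) * P s ?q x) \<partial>D)"
    proof (rule integral_dominated_convergence[where w="\<lambda>_. C * K"])
      have J: "AE s in D. (\<lambda>n. indicator (J (xs n)) s :: real) \<longlonglongrightarrow> indicator (J x) s"
        using J_tendsto[OF _ x xs(2)] xs(1) by auto
      show "AE s in D. (\<lambda>n. indicator (J (xs n)) s * (exp (- r * s) * P s ?q (xs n))) \<longlonglongrightarrow>
          indicator (J x) s * (exp (- r * s) * P s ?q x)"
        using J
      proof eventually_elim
        case (elim s)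
        show ?case
        proof (cases "0 \<le> s")
          case True
          have "(\<lambda>n. P s ?q (xs n)) \<longlonglongrightarrow> P s ?q x"
            by (rule continuous_on_tendsto_compose[OF continuous_P[OF q True] xs(2) x]) (use xs in auto)
          with elim show ?thesis by (intro tendsto_mult tendsto_const)
        next
          case False
          then have "s \<notin> J x" "s \<notin> J (xs n)" for n
            using J_nonneg[OF x] J_nonneg[of "xs n"] xs(1) by auto
          then show ?thesis by simp
        qed
      qed
      show "AE s in D. norm (indicator (J (xs n)) s * (exp (- r * s) * P s ?q (xs n))) \<le> C * K" for n
      proof (rule AE_I2)
        fix s
        have xn: "xs n \<in> S" using xs by simp
        have "norm (indicator (J (xs n)) s * (exp (- r * s) * P s ?q (xs n))) \<le> C * w (xs n)"
          using P_disc_bounds[OF q C xn, of s] by (simp only: real_norm_def abs_of_nonneg)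
        also have "\<dots> \<le> C * K" using K[of n] C(1) by (intro mult_left_mono) auto
        finally show "norm (indicator (J (xs n)) s * (exp (- r * s) * P s ?q (xs n))) \<le> C * K" .
      qed
    qed (use P_disc_measurable[OF q] x xs in auto)
    then show "(\<Lambda> f \<circ> xs) \<longlonglongrightarrow> \<Lambda> f x" by (simp add: \<Lambda>_def comp_def)
  qed
  then show ?thesis by (rule admI[where C=C]) (use \<Lambda>_nonneg[OF f] le in auto)
qed

lemma P_mono_add:
  assumes "adm f" "adm h" "0 \<le> K" "\<And>y. y \<in> S \<Longrightarrow> f y \<le> h y + K * w y" "x \<in> S" "0 \<le> s"
  shows "exp (- r * s) * P s f x \<le> exp (- r * s) * P s h x + K * w x"
proof -
  have 1: "adm (\<lambda>y. h y + K * w y)" by (intro adm_add adm_cmult adm_w assms)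
  have 2: "reward f x (\<lambda>_. ennreal s) \<le> reward (\<lambda>y. h y + K * w y) x (\<lambda>_. ennreal s)"
    by (rule reward_mono[OF assms(1) 1 assms(4,5) stopping_time_const])
  also have "\<dots> = reward h x (\<lambda>_. ennreal s) + K * reward w x (\<lambda>_. ennreal s)"
    using reward_add[OF assms(2) adm_cmult[OF adm_w assms(3)] assms(5) stopping_time_const] by (simp add: reward_cmult)
  also have "\<dots> \<le> reward h x (\<lambda>_. ennreal s) + K * w x"
    by (intro add_left_mono mult_left_mono reward_w_le[OF assms(5) stopping_time_const] assms(3))
  finally show ?thesis using assms(6) by (simp add: reward_const)
qed

text \<open>\<open>\<psi>\<close> enters both sides equally, so only the share \<open>1 - p\<close>
  of the difference survives; the discounted weight and the total mass \<open>1\<close> of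
  \<open>D\<close> add no factor. The one-sided form contains monotonicity as the case
  \<open>K = 0\<close>.\<close>

lemma \<Lambda>_contraction:
  assumes f: "adm f" and h: "adm h" and K: "0 \<le> K" and le: "\<And>y. y \<in> S \<Longrightarrow> f y \<le> h y + K * w y" and x: "x \<in> S"
  shows "\<Lambda> f x \<le> \<Lambda> h x + (1 - p) * K * w x"
proof -
  have K': "0 \<le> (1 - p) * K" using K p_less_1 by simp
  have qle: "mix f y \<le> mix h y + (1 - p) * K * w y" if "y \<in> S" for y
    using mult_left_mono[OF le[OF that], of "1 - p"] p_less_1 by (simp add: mix_def algebra_simps)
  have "\<Lambda> f x \<le> (\<integral>s. indicator (J x) s * (exp (- r * s) * P s (mix h) x) + (1 - p) * K * w x \<partial>D)"
    unfolding \<Lambda>_def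
  proof (rule integral_mono)
    fix s
    show "indicator (J x) s * (exp (- r * s) * P s (mix f) x) \<le> indicator (J x) s * (exp (- r * s) * P s (mix h) x) + (1 - p) * K * w x"
    proof (cases "s \<in> J x")
      case True
      then show ?thesis
        using P_mono_add[OF adm_mix[OF f] adm_mix[OF h] K' qle x, of s] J_nonneg[OF x] by auto
    next
      case False
      then show ?thesis using K' w_pos[OF x] by simp
    qed
  qed (use P_disc_integrable[OF adm_mix[OF f] x] P_disc_integrable[OF adm_mix[OF h] x] in auto)
  also have "\<dots> = \<Lambda> h x + (1 - p) * K * w x"
    unfolding \<Lambda>_def using P_disc_integrable[OF adm_mix[OF h] x] law.prob_space by simp
  finally show ?thesis .
qed

lemma adm_obst: "adm f \<Longrightarrow> adm (obst f)"
  unfolding obst_def[abs_def] by (intro adm_max adm_\<phi> adm_\<Lambda>)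

lemma obstacle_problem: "adm g \<Longrightarrow> obstacle_problem M F X S w r \<kappa> g"
  by unfold_locales

lemma adm_optval:
  assumes "adm g" shows "adm (optval g)"
proof -
  interpret o: obstacle_problem M F X S w r \<kappa> g by (rule obstacle_problem[OF assms])
  have "optval g = o.V" by (simp add: optval_def o.V_def fun_eq_iff)
  then show ?thesis using o.adm_V by simp
qed

lemma reward_le_optval:
  assumes "adm g" "x \<in> S" "stopping_time F \<tau>" shows "reward g x \<tau> \<le> optval g x"
proof -
  interpret o: obstacle_problem M F X S w r \<kappa> g by (rule obstacle_problem[OF assms(1)])
  show ?thesis using o.reward_le_V[OF assms(2,3)] by (simp add: optval_def o.V_def)
qed

lemma optval_least: "(\<And>\<tau>. stopping_time F \<tau> \<Longrightarrow> reward g x \<tau> \<le> c) \<Longrightarrow> optval g x \<le> c"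
  unfolding optval_def using stopping_time_const[of F 0] by (intro cSUP_least) auto

section \<open>Contraction, uniqueness and existence of the fixed point\<close>

definition \<Gamma> :: "('s \<Rightarrow> real) \<Rightarrow> 's \<Rightarrow> real" where "\<Gamma> f = optval (obst f)"

lemma adm_\<Gamma>: "adm f \<Longrightarrow> adm (\<Gamma> f)"
  unfolding \<Gamma>_def by (intro adm_optval adm_obst)

text \<open>Neither the maximum with \<open>\<phi>\<close> nor the supremum over stopping times
  enlarges a one-sided perturbation by a multiple of \<open>w\<close>, thanks to
  \<open>reward_w_le\<close>.\<close>

lemma \<Gamma>_contraction:
  assumes f: "adm f" and h: "adm h" and K: "0 \<le> K" and le: "\<And>y. y \<in> S \<Longrightarrow> f y \<le> h y + K * w y" and x: "x \<in> S"
  shows "\<Gamma> f x \<le> \<Gamma> h x + (1 - p) * K * w x"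
  unfolding \<Gamma>_def
proof (rule optval_least)
  fix \<tau> assume \<tau>: "stopping_time F \<tau>"
  have K': "0 \<le> (1 - p) * K" using K p_less_1 by simp
  have 1: "adm (\<lambda>y. obst h y + (1 - p) * K * w y)" by (intro adm_add adm_cmult adm_w adm_obst h K')
  have "reward (obst f) x \<tau> \<le> reward (\<lambda>y. obst h y + (1 - p) * K * w y) x \<tau>"
  proof (rule reward_mono[OF adm_obst[OF f] 1 _ x \<tau>])
    fix y assume y: "y \<in> S"
    have "0 \<le> (1 - p) * K * w y" using K' w_pos[OF y] by simp
    then show "obst f y \<le> obst h y + (1 - p) * K * w y"
      using \<Lambda>_contraction[OF f h K le y] by (auto simp: obst_def max_def)
  qed
  also have "\<dots> = reward (obst h) x \<tau> + (1 - p) * K * reward w x \<tau>"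
    using reward_add[OF adm_obst[OF h] adm_cmult[OF adm_w K'] x \<tau>] by (simp add: reward_cmult)
  also have "\<dots> \<le> optval (obst h) x + (1 - p) * K * w x"
    by (intro add_mono mult_left_mono reward_w_le[OF x \<tau>] reward_le_optval[OF adm_obst[OF h] x \<tau>] K')
  finally show "reward (obst f) x \<tau> \<le> optval (obst h) x + (1 - p) * K * w x" .
qed

text \<open>Iterating the contraction from \<open>u \<le> C w \<le> v + C w\<close>, where
  \<open>v \<ge> 0\<close> is used, leaves the error \<open>(1 - p)^n C w\<close> after
  \<open>n\<close> rounds.\<close>

lemma fixed_points_le:
  assumes u: "adm u" and v: "adm v" and fu: "\<And>x. x \<in> S \<Longrightarrow> u x = \<Gamma> u x" and fv: "\<And>x. x \<in> S \<Longrightarrow> v x = \<Gamma> v x"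
    and x: "x \<in> S"
  shows "u x \<le> v x"
proof -
  obtain C where C: "0 \<le> C" "\<And>y. y \<in> S \<Longrightarrow> u y \<le> C * w y" using adm_bound[OF u] by metis
  have le: "u y \<le> v y + ((1 - p) ^ n * C) * w y" if "y \<in> S" for n y
    using that
  proof (induction n arbitrary: y)
    case 0
    then show ?case using C(2)[of y] adm_nonneg[OF v, of y] by simp
  next
    case (Suc n)
    have "0 \<le> (1 - p) ^ n * C" using C(1) p_less_1 by simp
    from \<Gamma>_contraction[OF u v this Suc.IH Suc.prems] show ?case
      using fu[OF Suc.prems] fv[OF Suc.prems] by (simp add: mult.assoc)
  qed
  have "(\<lambda>n. v x + ((1 - p) ^ n * C) * w x) \<longlonglongrightarrow> v x + (0 * C) * w x"
    using p_pos p_less_1 by (intro tendsto_add tendsto_mult tendsto_const LIMSEQ_power_zero) auto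
  then have "u x \<le> v x + (0 * C) * w x"
    by (rule LIMSEQ_le_const) (use le[OF x] in auto)
  then show ?thesis by simp
qed

text \<open>Picard iteration from \<open>0\<close>. It increases because \<open>0\<close> lies below
  its image and the map is monotone, so the limit can be taken as a supremum; the increments are at
  most \<open>q^n C w\<close> with \<open>q = 1 - p\<close>.\<close>

lemma fixed_point_exists:
  obtains v where "adm v" "\<And>x. x \<in> S \<Longrightarrow> v x = \<Gamma> v x"
proof -
  define u where "u n = (\<Gamma> ^^ n) (\<lambda>_. 0)" for n
  have u0: "u 0 = (\<lambda>_. 0)" and uS: "u (Suc n) = \<Gamma> (u n)" for n by (simp_all add: u_def)
  have adm0: "adm (\<lambda>_. 0)" unfolding adm_def using w_pos by (auto intro!: exI[of _ 0])
  have au: "adm (u n)" for n by (induction n) (auto simp: u0 uS adm0 adm_\<Gamma>)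
  obtain C where C: "0 \<le> C" "\<And>y. y \<in> S \<Longrightarrow> u 1 y \<le> C * w y" using adm_bound[OF au] by metis
  define q where "q = 1 - p"
  have q: "0 \<le> q" "q < 1" "1 - q = p" using p_pos p_less_1 by (auto simp: q_def)
  have step: "u n y \<le> u (Suc n) y \<and> u (Suc n) y \<le> u n y + q ^ n * C * w y" if "y \<in> S" for n y
    using that
  proof (induction n arbitrary: y)
    case 0
    then show ?case using C(2)[of y] adm_nonneg[OF au, of y 1] by (simp add: u0)
  next
    case (Suc n)
    have "0 \<le> q ^ n * C" using C(1) q by simp
    \<comment> \<open>The first instance bounds the next increment; the second, with constant
      \<open>0\<close>, is monotonicity.\<close>
    from \<Gamma>_contraction[OF au[of "Suc n"] au[of n] this _ Suc.prems]
      \<Gamma>_contraction[OF au[of n] au[of "Suc n"] order_refl _ Suc.prems] Suc.IH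
    show ?case by (simp add: uS q_def mult.assoc)
  qed
  have up: "u (n + k) y \<le> u n y + C / p * q ^ n * w y" and mono: "u n y \<le> u (n + k) y" if y: "y \<in> S" for n k y
  proof -
    \<comment> \<open>Geometric sum with \<open>1 - q = p\<close>. Keeping the exact difference of
      powers lets the induction on \<open>k\<close> close.\<close>
    have "u (n + k) y \<le> u n y + C / p * (q ^ n - q ^ (n + k)) * w y"
    proof (induction k)
      case (Suc k)
      have "q ^ (n + k) * C = C / p * (q ^ (n + k) - q ^ (n + Suc k))"
        using p_pos by (simp add: field_simps q_def)
      moreover have "u (n + Suc k) y \<le> u (n + k) y + q ^ (n + k) * C * w y"
        using step[OF y, of "n + k"] by simp
      ultimately have "u (n + Suc k) y \<le> u n y + C / p * (q ^ n - q ^ (n + k)) * w y + C / p * (q ^ (n + k) - q ^ (n + Suc k)) * w y"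
        using Suc by simp
      then show ?case by (simp add: algebra_simps)
    qed simp
    also have "\<dots> \<le> u n y + C / p * q ^ n * w y"
      using C p_pos q w_pos[OF y] by (intro add_left_mono mult_right_mono mult_left_mono) auto
    finally show "u (n + k) y \<le> u n y + C / p * q ^ n * w y" .
    show "u n y \<le> u (n + k) y"
      by (induction k) (use step[OF y] order_trans in \<open>auto\<close>)
  qed
  define v where "v y = (SUP n. u n y)" for y
  have lim: "(\<lambda>n. u n y) \<longlonglongrightarrow> v y" if y: "y \<in> S" for y
    unfolding v_def
  proof (rule LIMSEQ_incseq_SUP)
    show "bdd_above (range (\<lambda>n. u n y))" using up[OF y, of 0] by (auto intro!: bdd_aboveI2)
    show "incseq (\<lambda>n. u n y)" using step[OF y] by (intro incseq_SucI) simp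
  qed
  have uv: "u n y \<le> v y" if y: "y \<in> S" for n y
    by (rule incseq_le[OF _ lim[OF y]]) (use step[OF y] in \<open>auto intro: incseq_SucI\<close>)
  have vu: "v y \<le> u n y + C / p * q ^ n * w y" if y: "y \<in> S" for n y
    by (rule LIMSEQ_le_const2[OF lim[OF y]]) (metis up[OF y] le_add_diff_inverse)
  have w0: "w y \<noteq> 0" if "y \<in> S" for y using w_pos(1)[OF that] by simp
  \<comment> \<open>Division by the weight makes the convergence uniform on
    \<open>S\<close>.\<close>
  have "continuous_on S (\<lambda>y. v y / w y)"
  proof (rule uniform_limit_theorem[where F=sequentially and f="\<lambda>n y. u n y / w y"])
    show "\<forall>\<^sub>F n in sequentially. continuous_on S (\<lambda>y. u n y / w y)"
      by (intro always_eventually allI continuous_on_divide adm_cont[OF au] continuous_w) (simp add: w0)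
    show "uniform_limit S (\<lambda>n y. u n y / w y) (\<lambda>y. v y / w y) sequentially"
    proof (rule uniform_limitI)
      fix e :: real assume e: "0 < e"
      have "(\<lambda>n. C / p * q ^ n) \<longlonglongrightarrow> C / p * 0"
        using q by (intro tendsto_mult tendsto_const LIMSEQ_power_zero) auto
      then have "eventually (\<lambda>n. C / p * q ^ n < e) sequentially" using e by (intro order_tendstoD) auto
      then show "\<forall>\<^sub>F n in sequentially. \<forall>y\<in>S. dist (u n y / w y) (v y / w y) < e"
      proof eventually_elim
        case (elim n)
        show ?case
        proof
          fix y assume y: "y \<in> S"
          have "dist (u n y / w y) (v y / w y) = (v y - u n y) / w y"
            using uv[OF y, of n] w_pos[OF y] by (simp add: dist_real_def diff_divide_distrib[symmetric] abs_minus_commute)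
          also have "\<dots> \<le> C / p * q ^ n"
            using vu[OF y, of n] w_pos[OF y] by (subst pos_divide_le_eq) auto
          also note elim
          finally show "dist (u n y / w y) (v y / w y) < e" .
        qed
      qed
    qed
  qed simp
  then have "continuous_on S (\<lambda>y. v y / w y * w y)" by (intro continuous_on_mult continuous_w)
  also have "continuous_on S (\<lambda>y. v y / w y * w y) \<longleftrightarrow> continuous_on S v"
    by (rule continuous_on_cong) (simp_all add: w0)
  finally have "continuous_on S v" .
  moreover have "v y \<le> C / p * w y" if "y \<in> S" for y using vu[OF that, of 0] by (simp add: u0)
  moreover have "0 \<le> v y" if "y \<in> S" for y using uv[OF that, of 0] by (simp add: u0)
  ultimately have av: "adm v" by (intro admI)
  moreover have "v x = \<Gamma> v x" if x: "x \<in> S" for x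
  proof (rule LIMSEQ_unique)
    show "(\<lambda>n. u (Suc n) x) \<longlonglongrightarrow> v x" by (rule LIMSEQ_Suc[OF lim[OF x]])
    show "(\<lambda>n. u (Suc n) x) \<longlonglongrightarrow> \<Gamma> v x"
    \<comment> \<open>From above by monotonicity and \<open>u n \<le> v\<close>; from below by the
      contraction applied to the geometric error bound \<open>vu\<close>.\<close>
    proof (rule tendsto_sandwich)
      show "\<forall>\<^sub>F n in sequentially. u (Suc n) x \<le> \<Gamma> v x"
        using \<Gamma>_contraction[OF au av order_refl _ x] uv by (intro always_eventually allI) (simp add: uS)
      show "\<forall>\<^sub>F n in sequentially. \<Gamma> v x - (1 - p) * (C / p * q ^ n) * w x \<le> u (Suc n) x"
      proof (intro always_eventually allI)
        fix n
        have "0 \<le> C / p * q ^ n" using C q p_pos by simp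
        from \<Gamma>_contraction[OF av au this vu x]
        show "\<Gamma> v x - (1 - p) * (C / p * q ^ n) * w x \<le> u (Suc n) x" by (simp add: uS)
      qed
      have "(\<lambda>n. \<Gamma> v x - (1 - p) * (C / p * q ^ n) * w x) \<longlonglongrightarrow> \<Gamma> v x - (1 - p) * (C / p * 0) * w x"
        using q by (intro tendsto_diff tendsto_mult tendsto_const LIMSEQ_power_zero) auto
      then show "(\<lambda>n. \<Gamma> v x - (1 - p) * (C / p * q ^ n) * w x) \<longlonglongrightarrow> \<Gamma> v x" by simp
    qed (rule tendsto_const)
  qed
  ultimately show ?thesis using that by blast
qed

end

section \<open>Martingale properties\<close>

text \<open>At finite times \<open>enn2real\<close> carries right neighbourhoods to right
  neighbourhoods. At infinity no time lies to the right, so the default value there causes no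
  break.\<close>

lemma right_continuous_ennreal:
  fixes y :: "real \<Rightarrow> real"
  assumes y: "\<And>t. 0 \<le> t \<Longrightarrow> continuous (at_right t) y"
  defines "e \<equiv> \<lambda>t::ennreal. if t = \<infinity> then 0 else y (enn2real t)"
  shows "continuous (at t within {t<..}) e" "continuous (at t within {t<..}) (\<lambda>t. e (min t \<tau>))"
proof -
  show 1: "continuous (at t within {t<..}) e" for t
  proof (cases t)
    case (real u)
    have fin: "\<forall>\<^sub>F s in at t within {t<..}. s < \<infinity>"
      using real by (intro order_tendstoD(2)[OF tendsto_ident_at]) auto
    have gt: "\<forall>\<^sub>F s in at t within {t<..}. t < s"
      unfolding eventually_at_topological by auto
    have "filterlim enn2real (at_right u) (at t within {t<..})"
    proof (rule tendsto_imp_filterlim_at_right)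
      show "(enn2real \<longlongrightarrow> u) (at t within {t<..})"
        using tendsto_enn2real[OF _ real(1), of "\<lambda>s. s" "at t within {t<..}"] tendsto_ident_at[of t "{t<..}"] real
        by simp
      show "\<forall>\<^sub>F s in at t within {t<..}. u < enn2real s"
        using gt fin
      proof eventually_elim
        case (elim s)
        then show ?case using real by (cases s) (auto simp: ennreal_less_iff)
      qed
    qed
    moreover have "(y \<longlongrightarrow> y u) (at_right u)" using y[OF real(1)] by (simp add: continuous_within)
    ultimately have "((\<lambda>s. y (enn2real s)) \<longlongrightarrow> y u) (at t within {t<..})" by (rule filterlim_compose[rotated])
    moreover have "\<forall>\<^sub>F s in at t within {t<..}. y (enn2real s) = e s"
      using fin by eventually_elim (simp add: e_def)
    ultimately have "(e \<longlongrightarrow> y u) (at t within {t<..})" by (simp add: tendsto_cong)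
    then show ?thesis using real by (simp add: continuous_within e_def)
  next
    case top
    then have "{t<..} = {}" by auto
    then show ?thesis by simp
  qed
  have gt: "\<forall>\<^sub>F s in at t within {t<..}. t < s"
    unfolding eventually_at_topological by auto
  show "continuous (at t within {t<..}) (\<lambda>t. e (min t \<tau>))"
  proof (cases "t < \<tau>")
    case True
    then have "\<forall>\<^sub>F s in at t within {t<..}. s < \<tau>"
      by (intro order_tendstoD(2)[OF tendsto_ident_at])
    then have "\<forall>\<^sub>F s in at t within {t<..}. e s = e (min s \<tau>)"
      by eventually_elim simp
    moreover have "(e \<longlongrightarrow> e t) (at t within {t<..})" using 1 by (simp add: continuous_within)
    ultimately have "((\<lambda>s. e (min s \<tau>)) \<longlongrightarrow> e t) (at t within {t<..})" by (simp add: tendsto_cong)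
    then show ?thesis using True by (simp add: continuous_within)
  next
    case False
    have "\<forall>\<^sub>F s in at t within {t<..}. e \<tau> = e (min s \<tau>)"
      using gt by eventually_elim (use False in \<open>auto simp: min_def\<close>)
    then have "((\<lambda>s. e (min s \<tau>)) \<longlongrightarrow> e \<tau>) (at t within {t<..})"
      by (rule Lim_transform_eventually[OF tendsto_const])
    moreover have "min t \<tau> = \<tau>" using False by simp
    ultimately show ?thesis by (simp only: continuous_within)
  qed
qed

context complete_filtration
begin

lemma sigma_finite_subalgebra_F: "sigma_finite_subalgebra M (F t)"
proof -
  interpret finite_measure_subalgebra M "F t"
    by unfold_locales (rule subalgebra_F)
  show ?thesis by unfold_locales
qed

text \<open>The hypothesis is tested on the event where the conditional expectation exceeds
  \<open>h\<close>: there a non-negative function has a non-positive integral, so the event is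
  null.\<close>

lemma real_cond_exp_le:
  assumes f: "integrable M f" and h: "integrable M h" "h \<in> borel_measurable (F t)"
    and le: "\<And>A. A \<in> sets (F t) \<Longrightarrow> (\<integral>\<omega>. indicator A \<omega> * f \<omega> \<partial>M) \<le> (\<integral>\<omega>. indicator A \<omega> * h \<omega> \<partial>M)"
  shows "AE \<omega> in M. real_cond_exp M (F t) f \<omega> \<le> h \<omega>"
proof -
  interpret s: sigma_finite_subalgebra M "F t" by (rule sigma_finite_subalgebra_F)
  let ?c = "real_cond_exp M (F t) f"
  have c: "?c \<in> borel_measurable (F t)" "integrable M ?c" using s.real_cond_exp_int[OF f] by auto
  define A where "A = {\<omega>\<in>space (F t). h \<omega> < ?c \<omega>}"
  have A: "A \<in> sets (F t)" unfolding A_def using c(1) h(2) by measurable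
  then have AM: "A \<in> sets M" using sets_F_subset by blast
  have i: "integrable M (\<lambda>\<omega>. indicator A \<omega> * k \<omega>)" if "integrable M k" for k :: "'a \<Rightarrow> real"
    using integrable_mult_indicator[OF AM that] by simp
  have "(\<integral>\<omega>. indicator A \<omega> * (?c \<omega> - h \<omega>) \<partial>M) = (\<integral>\<omega>. indicator A \<omega> * ?c \<omega> \<partial>M) - (\<integral>\<omega>. indicator A \<omega> * h \<omega> \<partial>M)"
    using i[OF c(2)] i[OF h(1)] by (simp add: right_diff_distrib)
  also have "(\<integral>\<omega>. indicator A \<omega> * ?c \<omega> \<partial>M) = (\<integral>\<omega>. indicator A \<omega> * f \<omega> \<partial>M)"
    using s.real_cond_exp_intA[OF f A] by (simp add: set_lebesgue_integral_def)
  finally have "(\<integral>\<omega>. indicator A \<omega> * (?c \<omega> - h \<omega>) \<partial>M) \<le> 0" using le[OF A] by simp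
  moreover have nn: "AE \<omega> in M. 0 \<le> indicator A \<omega> * (?c \<omega> - h \<omega>)"
    by (intro AE_I2) (auto simp: A_def indicator_def)
  moreover have int: "integrable M (\<lambda>\<omega>. indicator A \<omega> * (?c \<omega> - h \<omega>))" using i c h by auto
  ultimately have "(\<integral>\<omega>. indicator A \<omega> * (?c \<omega> - h \<omega>) \<partial>M) = 0"
    using integral_nonneg_AE[OF nn] by simp
  with integral_nonneg_eq_0_iff_AE[OF int nn] have "AE \<omega> in M. indicator A \<omega> * (?c \<omega> - h \<omega>) = 0" by simp
  then show ?thesis
    using AE_space by eventually_elim (auto simp: A_def indicator_def space_F split: if_splits)
qed

end

context weighted_flow
begin

lemma disc_eval_top [simp]: "disc_eval r f y \<top> = 0"
  using disc_eval_infinity[of r f y] by (simp only: infinity_ennreal_def)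

lemma disc_eval_eq_stopval: "disc_eval r f (\<lambda>s. X s x \<omega>) (\<tau> \<omega>) = stopval (disc f x) \<tau> \<omega>"
  by (cases "\<tau> \<omega> = \<infinity>") (auto simp: stopval_def disc_def disc_eval_finite less_top[symmetric])

lemma stop_reward_eq:
  assumes "adm f" "x \<in> S" "stopping_time F \<tau>"
  shows "stop_reward M X r f x \<tau> = ennreal (reward f x \<tau>)"
  unfolding stop_reward_def disc_eval_eq_stopval reward_def
  by (rule nn_integral_eq_integral[OF reward_integrable[OF assms] stopval_disc_nonneg[OF assms(1,2)]])

lemma P_cong:
  assumes "adm f" "adm h" "\<And>y. y \<in> S \<Longrightarrow> f y = h y" "x \<in> S" "0 \<le> s" shows "P s f x = P s h x"
  unfolding P_def
  by (rule integral_cong_AE)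
    (use integrable_X[OF _ assms(4,5)] assms(1,2) X_in_S[OF assms(4)] assms(3,5) in \<open>auto elim!: eventually_mono\<close>)

lemma right_continuous_disc_eval:
  assumes f: "adm f" and x: "x \<in> S"
  shows "right_continuous_on M I (\<lambda>t \<omega>. disc_eval r f (\<lambda>s. X s x \<omega>) t)"
    "right_continuous_on M I (\<lambda>t \<omega>. disc_eval r f (\<lambda>s. X s x \<omega>) (min t (\<tau> \<omega>)))"
proof -
  have e: "(\<lambda>t. disc_eval r f (\<lambda>s. X s x \<omega>) t) = (\<lambda>t. if t = \<infinity> then 0 else disc f x (enn2real t) \<omega>)" for \<omega>
    by (auto simp: fun_eq_iff disc_def disc_eval_finite less_top[symmetric])
  show "right_continuous_on M I (\<lambda>t \<omega>. disc_eval r f (\<lambda>s. X s x \<omega>) t)"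
    unfolding right_continuous_on_def e using rc_process_rc[OF rc_process_disc[OF adm_cont[OF f] x]]
  proof eventually_elim
    case (elim \<omega>)
    show ?case
    proof
      fix t assume "t \<in> I"
      show "continuous (at t within {t<..} \<inter> I) (\<lambda>t. if t = \<infinity> then 0 else disc f x (enn2real t) \<omega>)"
        by (rule continuous_within_subset[OF right_continuous_ennreal(1)]) (use elim in auto)
    qed
  qed
  show "right_continuous_on M I (\<lambda>t \<omega>. disc_eval r f (\<lambda>s. X s x \<omega>) (min t (\<tau> \<omega>)))"
    unfolding right_continuous_on_def using rc_process_rc[OF rc_process_disc[OF adm_cont[OF f] x]]
  proof eventually_elim
    case (elim \<omega>)
    show ?case
    proof
      fix t assume "t \<in> I"
      have "(\<lambda>t. disc_eval r f (\<lambda>s. X s x \<omega>) (min t (\<tau> \<omega>))) =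
        (\<lambda>t. (\<lambda>t. if t = \<infinity> then 0 else disc f x (enn2real t) \<omega>) (min t (\<tau> \<omega>)))"
        by (rule ext) (rule fun_cong[OF e])
      moreover have "continuous (at t within {t<..} \<inter> I) (\<lambda>t. (\<lambda>t. if t = \<infinity> then 0 else disc f x (enn2real t) \<omega>) (min t (\<tau> \<omega>)))"
        by (rule continuous_within_subset[OF right_continuous_ennreal(2)]) (use elim in auto)
      ultimately show "continuous (at t within {t<..} \<inter> I) (\<lambda>t. disc_eval r f (\<lambda>s. X s x \<omega>) (min t (\<tau> \<omega>)))"
        by simp
    qed
  qed
qed

lemma nonneg_disc_eval:
  assumes f: "adm f" and x: "x \<in> S"
  shows "nonneg_on M I (\<lambda>t \<omega>. disc_eval r f (\<lambda>s. X s x \<omega>) t)"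
    "nonneg_on M I (\<lambda>t \<omega>. disc_eval r f (\<lambda>s. X s x \<omega>) (min t (\<tau> \<omega>)))"
proof -
  have *: "AE \<omega> in M. \<forall>t. 0 \<le> disc_eval r f (\<lambda>s. X s x \<omega>) t"
    using disc_nonneg[OF f x]
  proof eventually_elim
    case (elim \<omega>)
    show ?case
    proof
      fix t show "0 \<le> disc_eval r f (\<lambda>s. X s x \<omega>) t"
        using elim disc_eval_eq_stopval[of f x \<omega> "\<lambda>_. t"] by (simp add: stopval_def)
    qed
  qed
  show "nonneg_on M I (\<lambda>t \<omega>. disc_eval r f (\<lambda>s. X s x \<omega>) t)"
    "nonneg_on M I (\<lambda>t \<omega>. disc_eval r f (\<lambda>s. X s x \<omega>) (min t (\<tau> \<omega>)))"
    unfolding nonneg_on_def using * by (auto elim!: eventually_mono)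
qed

lemma supermartingale_disc_eval:
  assumes f: "adm f" and x: "x \<in> S" and sup: "super_process (disc f x)"
  shows "supermartingale_on M F {0..\<infinity>} (\<lambda>t \<omega>. disc_eval r f (\<lambda>s. X s x \<omega>) t)"
proof -
  define Y where "Y t \<omega> = disc_eval r f (\<lambda>s. X s x \<omega>) t" for t \<omega>
  have Yinf: "Y \<infinity> = (\<lambda>_. 0)" by (simp add: Y_def fun_eq_iff)
  have Yfin: "Y (ennreal t) = disc f x t" if "0 \<le> t" for t
    using that by (simp add: Y_def fun_eq_iff disc_eval_finite disc_def)
  have Yeq: "Y t = stopval (disc f x) (\<lambda>_. t)" for t
    by (simp add: Y_def fun_eq_iff disc_eval_eq_stopval[of f x _ "\<lambda>_. t"])
  have int: "integrable M (Y t)" for t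
    unfolding Yeq by (rule reward_integrable[OF f x stopping_time_const])
  have meas: "Y t \<in> borel_measurable (F t)" for t
  proof (cases t)
    case (real u)
    then show ?thesis using rc_process_measurable[OF rc_process_disc[OF adm_cont[OF f] x] real(1) order_refl] by (simp add: Yfin)
  qed (simp add: Yinf[unfolded infinity_ennreal_def])
  have nn: "AE \<omega> in M. 0 \<le> Y t \<omega>" for t unfolding Yeq by (rule stopval_disc_nonneg[OF f x])
  have le: "(\<integral>\<omega>. indicator A \<omega> * Y t \<omega> \<partial>M) \<le> (\<integral>\<omega>. indicator A \<omega> * Y s \<omega> \<partial>M)"
    if st: "s \<le> t" and A: "A \<in> sets (F s)" for s t A
  proof (cases t)
    case (real u)
    then obtain u' where u': "0 \<le> u'" "s = ennreal u'" "u' \<le> u" using st by (cases s) (auto simp: ennreal_le_iff top_unique)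
    show ?thesis
      using sup A u' real unfolding super_process_def by (simp add: Yfin)
  next
    \<comment> \<open>At infinite time the process is \<open>0\<close>, below anything
      non-negative.\<close>
    case top
    have "0 \<le> (\<integral>\<omega>. indicator A \<omega> * Y s \<omega> \<partial>M)"
      by (rule integral_nonneg_AE) (use nn[of s] in \<open>eventually_elim, simp\<close>)
    then show ?thesis using top Yinf by simp
  qed
  have "supermartingale_on M F {0..\<infinity>} Y"
    unfolding supermartingale_on_def by (intro conjI ballI impI int meas real_cond_exp_le[OF int int meas le])
  then show ?thesis unfolding Y_def[abs_def] .
qed

end

context recursive_stopping
begin

lemma value_attained:
  assumes v: "adm v" "\<And>x. x \<in> S \<Longrightarrow> v x = \<Gamma> v x" and x: "x \<in> S"
    and \<tau>: "AE \<omega> in M. \<tau> \<omega> = Inf (ennreal ` {t. 0 \<le> t \<and> v (X t x \<omega>) = obst v (X t x \<omega>)})"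
  shows "stopping_time F \<tau>" "reward (obst v) x \<tau> = v x"
    "supermartingale_on M F {0..\<infinity>} (\<lambda>t \<omega>. disc_eval r v (\<lambda>s. X s x \<omega>) t)"
    "martingale_on M F {0..<\<infinity>} (\<lambda>t \<omega>. disc_eval r v (\<lambda>s. X s x \<omega>) (min t (\<tau> \<omega>)))"
proof -
  interpret o: obstacle_problem M F X S w r \<kappa> "obst v" by (rule obstacle_problem[OF adm_obst[OF v(1)]])
  have Vv: "o.V y = v y" if "y \<in> S" for y
    using v(2)[OF that] by (simp add: \<Gamma>_def optval_def o.V_def)
  \<comment> \<open>\<open>o.V\<close> and \<open>v\<close> coincide on \<open>S\<close>, where the
    flow stays almost surely; so the two contact times agree almost surely, and completeness
    transfers the stopping property to \<open>\<tau>\<close>.\<close>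
  have AE\<tau>: "AE \<omega> in M. o.hit0 x \<omega> = \<tau> \<omega>"
    using \<tau> X_in_S[OF x]
  proof eventually_elim
    case (elim \<omega>)
    have "{t. 0 \<le> t \<and> o.V (X t x \<omega>) = obst v (X t x \<omega>)} = {t. 0 \<le> t \<and> v (X t x \<omega>) = obst v (X t x \<omega>)}"
      using elim(2) Vv by auto
    then show ?case using elim(1) by (simp add: o.hit0_def)
  qed
  show st: "stopping_time F \<tau>" by (rule stopping_time_AE_eq[OF o.stopping_hit0[OF x] AE\<tau>])
  show "reward (obst v) x \<tau> = v x"
    using o.reward_AE_eq[OF AE\<tau> o.stopping_hit0[OF x] st adm_obst[OF v(1)] x] o.optimal_hit0[OF x] Vv[OF x] by simp
  have "super_process (disc v x)"
  proof (rule super_process_disc[OF v(1) x adm_P[OF v(1)]])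
    fix s y assume "0 \<le> (s::real)" "y \<in> S"
    then show "exp (- r * s) * P s v y \<le> v y"
      using o.P_V_le[of s y] P_cong[OF o.adm_V v(1) Vv, of y s] Vv[of y] by simp
  qed
  then show "supermartingale_on M F {0..\<infinity>} (\<lambda>t \<omega>. disc_eval r v (\<lambda>s. X s x \<omega>) t)"
    by (rule supermartingale_disc_eval[OF v(1) x])
  define Z where "Z t = stopval (disc v x) (\<lambda>\<omega>. min t (\<tau> \<omega>))" for t
  have m: "stopping_time F (\<lambda>\<omega>. min t (\<tau> \<omega>))" for t
    by (rule stopping_time_min[OF stopping_time_const st])
  have int: "integrable M (Z t)" for t
    unfolding Z_def by (rule reward_integrable[OF v(1) x m])
  have meas: "Z (ennreal t) \<in> borel_measurable (F (ennreal t))" if "0 \<le> t" for t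
    unfolding Z_def by (rule stopval_min_measurable[OF rc_process_disc[OF adm_cont[OF v(1)] x] st that])
  have ZV: "AE \<omega> in M. stopval (disc o.V x) (\<lambda>\<omega>. min t (o.hit0 x \<omega>)) \<omega> = Z t \<omega>" for t
    using AE\<tau> X_in_S[OF x] by eventually_elim (auto simp: Z_def stopval_def disc_def Vv)
  have eq: "(\<integral>\<omega>. indicator A \<omega> * Z (ennreal t) \<omega> \<partial>M) = (\<integral>\<omega>. indicator A \<omega> * Z (ennreal s) \<omega> \<partial>M)"
    if st: "0 \<le> s" "s \<le> t" and A: "A \<in> sets (F (ennreal s))" for s t A
  proof -
    have AM: "A \<in> sets M" using A sets_F_subset by blast
    have m0: "stopping_time F (\<lambda>\<omega>. min (ennreal u) (o.hit0 x \<omega>))" for u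
      by (rule stopping_time_min[OF stopping_time_const o.stopping_hit0[OF x]])
    have "(\<integral>\<omega>. indicator A \<omega> * stopval (disc o.V x) (\<lambda>\<omega>. min (ennreal u) (o.hit0 x \<omega>)) \<omega> \<partial>M) = (\<integral>\<omega>. indicator A \<omega> * Z (ennreal u) \<omega> \<partial>M)" for u
    proof (rule integral_cong_AE)
      show "(\<lambda>\<omega>. indicator A \<omega> * stopval (disc o.V x) (\<lambda>\<omega>. min (ennreal u) (o.hit0 x \<omega>)) \<omega>) \<in> borel_measurable M"
        using o.integrable_indicator_reward[OF o.adm_V x m0 AM] by auto
      show "(\<lambda>\<omega>. indicator A \<omega> * Z (ennreal u) \<omega>) \<in> borel_measurable M"
        using AM borel_measurable_integrable[OF int] by measurable
      show "AE \<omega> in M. indicator A \<omega> * stopval (disc o.V x) (\<lambda>\<omega>. min (ennreal u) (o.hit0 x \<omega>)) \<omega> = indicator A \<omega> * Z (ennreal u) \<omega>"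
        using ZV[of "ennreal u"] by eventually_elim simp
    qed
    then show ?thesis using o.stopped_V_martingale[OF x st A] by simp
  qed
  have "AE \<omega> in M. real_cond_exp M (F s) (Z t) \<omega> = Z s \<omega>" if st: "s \<in> {0..<\<infinity>}" "t \<in> {0..<\<infinity>}" "s \<le> t" for s t
  proof -
    obtain s' t' where s': "s = ennreal s'" "t = ennreal t'" "0 \<le> s'" "s' \<le> t'"
      using st by (cases s; cases t) (auto simp: ennreal_le_iff)
    interpret g: sigma_finite_subalgebra M "F s" by (rule sigma_finite_subalgebra_F)
    show ?thesis
    proof (rule g.real_cond_exp_charact[OF _ int int])
      show "Z s \<in> borel_measurable (F s)" using meas s' by simp
      fix A assume "A \<in> sets (F s)"
      then show "set_lebesgue_integral M A (Z t) = set_lebesgue_integral M A (Z s)"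
        using eq[of s' t' A] s' by (simp add: set_lebesgue_integral_def)
    qed
  qed
  moreover have "Z t \<in> borel_measurable (F t)" if "t \<in> {0..<\<infinity>}" for t
    using that meas by (cases t) auto
  ultimately have "martingale_on M F {0..<\<infinity>} Z"
    unfolding martingale_on_def using int by auto
  moreover have "Z = (\<lambda>t \<omega>. disc_eval r v (\<lambda>s. X s x \<omega>) (min t (\<tau> \<omega>)))"
  proof (intro ext)
    fix t \<omega> show "Z t \<omega> = disc_eval r v (\<lambda>s. X s x \<omega>) (min t (\<tau> \<omega>))"
      using disc_eval_eq_stopval[of v x \<omega> "\<lambda>\<omega>. min t (\<tau> \<omega>)"] by (simp add: Z_def)
  qed
  ultimately show "martingale_on M F {0..<\<infinity>} (\<lambda>t \<omega>. disc_eval r v (\<lambda>s. X s x \<omega>) (min t (\<tau> \<omega>)))" by simp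
qed

end

section \<open>Verifying the assumptions for a Markov flow\<close>

context complete_filtration
begin

text \<open>A supremum over uncountably many times need not be measurable. The bound is therefore
  the supremum over rational times, and right-continuity extends it to all times. The comparison of
  integrals rests on monotonicity, which holds for the integral of a non-measurable function
  too.\<close>

lemma sup_dominated:
  fixes Y :: "real \<Rightarrow> 'a \<Rightarrow> real"
  assumes meas: "\<And>t. 0 \<le> t \<Longrightarrow> Y t \<in> borel_measurable M"
    and rc: "AE \<omega> in M. \<forall>t\<ge>0. continuous (at_right t) (\<lambda>s. Y s \<omega>)"
    and fin: "(\<integral>\<^sup>+\<omega>. (SUP t\<in>{0..}. ennreal (Y t \<omega>)) \<partial>M) < \<infinity>"
  obtains B where "integrable M B" "\<And>\<omega>. 0 \<le> B \<omega>" "AE \<omega> in M. \<forall>t\<ge>0. Y t \<omega> \<le> B \<omega>"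
    "(\<integral>\<omega>. B \<omega> \<partial>M) \<le> enn2real (\<integral>\<^sup>+\<omega>. (SUP t\<in>{0..}. ennreal (Y t \<omega>)) \<partial>M)"
proof -
  define Q where "Q \<omega> = (SUP t\<in>\<rat> \<inter> {0..}. ennreal (Y t \<omega>))" for \<omega>
  have c: "countable (\<rat> \<inter> {0..} :: real set)" by (rule countable_Int1[OF countable_rat])
  have Qm[measurable]: "Q \<in> borel_measurable M"
    unfolding Q_def[abs_def]
  proof (rule borel_measurable_SUP[OF c])
    fix t :: real assume "t \<in> \<rat> \<inter> {0..}"
    then show "(\<lambda>\<omega>. ennreal (Y t \<omega>)) \<in> borel_measurable M"
      using meas[of t] by (intro measurable_compose[OF _ measurable_ennreal]) auto
  qed
  have Qle: "(\<integral>\<^sup>+\<omega>. Q \<omega> \<partial>M) \<le> (\<integral>\<^sup>+\<omega>. (SUP t\<in>{0..}. ennreal (Y t \<omega>)) \<partial>M)"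
    unfolding Q_def by (intro nn_integral_mono SUP_subset_mono) auto
  then have Qfin: "(\<integral>\<^sup>+\<omega>. Q \<omega> \<partial>M) < \<infinity>" using fin by (rule le_less_trans)
  then have AEQ: "AE \<omega> in M. Q \<omega> \<noteq> \<infinity>" by (intro nn_integral_noteq_infinite) auto
  define B where "B \<omega> = enn2real (Q \<omega>)" for \<omega>
  have B0: "0 \<le> B \<omega>" for \<omega> by (simp add: B_def)
  have BQ: "(\<integral>\<^sup>+\<omega>. ennreal (B \<omega>) \<partial>M) = (\<integral>\<^sup>+\<omega>. Q \<omega> \<partial>M)"
    by (rule nn_integral_cong_AE) (use AEQ in \<open>eventually_elim, simp add: B_def less_top[symmetric]\<close>)
  have Bm: "B \<in> borel_measurable M" unfolding B_def[abs_def] by measurable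
  have Bi: "integrable M B"
    using Bm B0 BQ Qfin by (intro integrableI_nonneg) auto
  have "ennreal (\<integral>\<omega>. B \<omega> \<partial>M) = (\<integral>\<^sup>+\<omega>. Q \<omega> \<partial>M)"
    using nn_integral_eq_integral[OF Bi] B0 BQ by simp
  then have "(\<integral>\<omega>. B \<omega> \<partial>M) = enn2real (\<integral>\<^sup>+\<omega>. Q \<omega> \<partial>M)"
    using B0 by (metis enn2real_ennreal integral_nonneg_AE AE_I2)
  also have "\<dots> \<le> enn2real (\<integral>\<^sup>+\<omega>. (SUP t\<in>{0..}. ennreal (Y t \<omega>)) \<partial>M)"
    using Qle fin by (intro enn2real_mono) auto
  finally have Bint: "(\<integral>\<omega>. B \<omega> \<partial>M) \<le> enn2real (\<integral>\<^sup>+\<omega>. (SUP t\<in>{0..}. ennreal (Y t \<omega>)) \<partial>M)" .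
  have "AE \<omega> in M. \<forall>t\<ge>0. Y t \<omega> \<le> B \<omega>"
    using rc AEQ
  proof eventually_elim
    case (elim \<omega>)
    have rat: "Y q \<omega> \<le> B \<omega>" if "q \<in> \<rat>" "0 \<le> q" for q
    proof -
      have "ennreal (Y q \<omega>) \<le> Q \<omega>" unfolding Q_def using that by (intro SUP_upper) auto
      also have "Q \<omega> = ennreal (B \<omega>)" using elim(2) by (simp add: B_def less_top[symmetric])
      finally show ?thesis using B0 by (simp add: ennreal_le_iff)
    qed
    show ?case
    proof (intro allI impI, rule ccontr)
      fix t :: real assume t: "0 \<le> t" "\<not> Y t \<omega> \<le> B \<omega>"
      have "((\<lambda>s. Y s \<omega>) \<longlongrightarrow> Y t \<omega>) (at_right t)" using elim(1) t by (simp add: continuous_within)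
      from order_tendstoD(1)[OF this, of "B \<omega>"] t obtain b where b: "t < b" "\<And>s. t < s \<Longrightarrow> s < b \<Longrightarrow> B \<omega> < Y s \<omega>"
        by (auto simp: eventually_at_right_field)
      from Rats_dense_in_real[OF b(1)] obtain q where "q \<in> \<rat>" "t < q" "q < b" by auto
      with b(2)[of q] rat[of q] t show False by auto
    qed
  qed
  with Bi B0 Bint show ?thesis using that by blast
qed

lemma supermartingale_set_integral:
  assumes Y: "supermartingale_on M F I Y" and st: "s \<in> I" "t \<in> I" "s \<le> t" and A: "A \<in> sets (F s)"
  shows "(\<integral>\<omega>. indicator A \<omega> * Y t \<omega> \<partial>M) \<le> (\<integral>\<omega>. indicator A \<omega> * Y s \<omega> \<partial>M)"
proof -
  interpret g: sigma_finite_subalgebra M "F s" by (rule sigma_finite_subalgebra_F)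
  have AM: "A \<in> sets M" using A sets_F_subset by blast
  have i: "integrable M (Y t)" "integrable M (Y s)" using Y st by (auto simp: supermartingale_on_def)
  have ii: "integrable M (\<lambda>\<omega>. indicator A \<omega> * k \<omega>)" if "integrable M k" for k :: "'a \<Rightarrow> real"
    using integrable_mult_indicator[OF AM that] by simp
  have "(\<integral>\<omega>. indicator A \<omega> * Y t \<omega> \<partial>M) = (\<integral>\<omega>. indicator A \<omega> * real_cond_exp M (F s) (Y t) \<omega> \<partial>M)"
    using g.real_cond_exp_intA[OF i(1) A] by (simp add: set_lebesgue_integral_def)
  also have "\<dots> \<le> (\<integral>\<omega>. indicator A \<omega> * Y s \<omega> \<partial>M)"
  proof (rule integral_mono_AE[OF ii[OF g.real_cond_exp_int(1)[OF i(1)]] ii[OF i(2)]])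
    have "AE \<omega> in M. real_cond_exp M (F s) (Y t) \<omega> \<le> Y s \<omega>"
      using Y st by (auto simp: supermartingale_on_def)
    then show "AE \<omega> in M. indicator A \<omega> * real_cond_exp M (F s) (Y t) \<omega> \<le> indicator A \<omega> * Y s \<omega>"
      by eventually_elim (auto simp: indicator_def)
  qed
  finally show ?thesis .
qed

text \<open>The inequality \<open>u \<le> u^2 / (2 c) + c / 2\<close> linearises the square root. It
  is sharp at \<open>u = c\<close>, so it returns the constant \<open>c\<close> when the mean of
  \<open>u^2\<close> is at most \<open>c^2\<close>, in place of Jensen's inequality.\<close>

lemma stopval_sqrt_le:
  assumes U: "super_process U" and c: "0 < c" "(\<integral>\<omega>. U 0 \<omega> \<partial>M) \<le> c\<^sup>2" and \<tau>: "stopping_time F \<tau>"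
    and Y: "AE \<omega> in M. \<forall>t\<ge>0. Y t \<omega> \<le> sqrt (U t \<omega>)"
  shows "(\<integral>\<^sup>+\<omega>. ennreal (stopval Y \<tau> \<omega>) \<partial>M) \<le> ennreal c"
proof -
  have rc: "rc_process U" and nn: "AE \<omega> in M. \<forall>t\<ge>0. 0 \<le> U t \<omega>" using U by (auto simp: super_process_def)
  have [measurable]: "stopval U \<tau> \<in> borel_measurable M" by (rule stopval_measurable[OF rc \<tau>])
  have "(\<integral>\<^sup>+\<omega>. ennreal (stopval Y \<tau> \<omega>) \<partial>M) \<le> (\<integral>\<^sup>+\<omega>. ennreal (1 / (2 * c)) * ennreal (stopval U \<tau> \<omega>) + ennreal (c / 2) \<partial>M)"
  proof (rule nn_integral_mono_AE)
    show "AE \<omega> in M. ennreal (stopval Y \<tau> \<omega>) \<le> ennreal (1 / (2 * c)) * ennreal (stopval U \<tau> \<omega>) + ennreal (c / 2)"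
      using nn Y
    proof eventually_elim
      case (elim \<omega>)
      show ?case
      proof (cases "\<tau> \<omega> = \<infinity>")
        case False
        define t where "t = enn2real (\<tau> \<omega>)"
        define u where "u = sqrt (U t \<omega>)"
        have t: "0 \<le> t" by (simp add: t_def)
        have u: "0 \<le> u" "u\<^sup>2 = U t \<omega>" using elim(1) t by (auto simp: u_def)
        have "0 \<le> (u - c)\<^sup>2" by simp
        then have "u \<le> 1 / (2 * c) * u\<^sup>2 + c / 2"
          using c(1) by (simp add: power2_eq_square field_simps)
        then have "Y t \<omega> \<le> 1 / (2 * c) * U t \<omega> + c / 2"
          using elim(2) t u unfolding u_def[symmetric] by (metis order_trans u_def)
        then have "ennreal (Y t \<omega>) \<le> ennreal (1 / (2 * c) * U t \<omega> + c / 2)" by (rule ennreal_leI)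
        also have "\<dots> = ennreal (1 / (2 * c)) * ennreal (U t \<omega>) + ennreal (c / 2)"
          using c(1) elim(1) t by (subst ennreal_mult[symmetric]) (auto intro!: ennreal_plus)
        finally show ?thesis using False by (simp add: stopval_def t_def)
      qed (simp add: stopval_def)
    qed
  qed
  also have "\<dots> = ennreal (1 / (2 * c)) * (\<integral>\<^sup>+\<omega>. ennreal (stopval U \<tau> \<omega>) \<partial>M) + ennreal (c / 2)"
    by (subst nn_integral_add) (auto simp: nn_integral_cmult emeasure_space_1)
  also have "\<dots> \<le> ennreal (1 / (2 * c)) * ennreal (c\<^sup>2) + ennreal (c / 2)"
    by (intro add_right_mono mult_left_mono order_trans[OF super_process_stopval_le[OF U \<tau>]] ennreal_leI c(2)) simp
  also have "\<dots> = ennreal c"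
    using c(1) by (simp add: power2_eq_square flip: ennreal_mult ennreal_plus)
  finally show ?thesis .
qed

end

section \<open>Dependence of rewards on the starting point\<close>

context weighted_flow
begin

lemma reward_diff_le:
  assumes g: "adm g" and x: "x \<in> S" and y: "y \<in> S" and \<tau>: "stopping_time F \<tau>"
    and B: "integrable M B" "\<And>\<omega>. 0 \<le> B \<omega>"
    and d: "AE \<omega> in M. \<tau> \<omega> < \<infinity> \<longrightarrow> exp (- r * enn2real (\<tau> \<omega>)) * dist (X (enn2real (\<tau> \<omega>)) x \<omega>) (X (enn2real (\<tau> \<omega>)) y \<omega>) \<le> B \<omega>"
    and R: "0 \<le> R" and C: "0 \<le> C" "0 \<le> L" "0 \<le> e"
    and m: "\<And>a b. a \<in> S \<Longrightarrow> b \<in> S \<Longrightarrow> \<bar>g a - g b\<bar> \<le> e + L * dist a b + C * max 0 (w a - R)"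
  shows "\<bar>reward g y \<tau> - reward g x \<tau>\<bar> \<le> e + L * (\<integral>\<omega>. B \<omega> \<partial>M) + C * reward (\<lambda>y. max 0 (w y - R)) x \<tau>"
proof -
  let ?D = "\<lambda>f x \<omega>. stopval (disc f x) \<tau> \<omega>"
  let ?h = "\<lambda>y. max 0 (w y - R)"
  have cut: "adm ?h" by (rule adm_cut[OF R])
  note i = reward_integrable[OF _ _ \<tau>]
  have "\<bar>reward g y \<tau> - reward g x \<tau>\<bar> = \<bar>\<integral>\<omega>. ?D g y \<omega> - ?D g x \<omega> \<partial>M\<bar>"
    unfolding reward_def using i[OF g x] i[OF g y] by simp
  also have "\<dots> \<le> (\<integral>\<omega>. \<bar>?D g y \<omega> - ?D g x \<omega>\<bar> \<partial>M)"
    by (rule integral_abs_bound)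
  also have "\<dots> \<le> (\<integral>\<omega>. e + L * B \<omega> + C * ?D ?h x \<omega> \<partial>M)"
  proof (rule integral_mono_AE)
    show "integrable M (\<lambda>\<omega>. \<bar>?D g y \<omega> - ?D g x \<omega>\<bar>)" using i[OF g x] i[OF g y] by simp
    show "integrable M (\<lambda>\<omega>. e + L * B \<omega> + C * ?D ?h x \<omega>)" using i[OF cut x] B by simp
    show "AE \<omega> in M. \<bar>?D g y \<omega> - ?D g x \<omega>\<bar> \<le> e + L * B \<omega> + C * ?D ?h x \<omega>"
      using X_in_S[OF x] X_in_S[OF y] d
    proof eventually_elim
      case (elim \<omega>)
      show ?case
      proof (cases "\<tau> \<omega> = \<infinity>")
        case False
        define t where "t = enn2real (\<tau> \<omega>)"
        define a where "a = X t x \<omega>"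
        define b where "b = X t y \<omega>"
        define q where "q = exp (- r * t)"
        have t: "0 \<le> t" by (simp add: t_def)
        have ab: "a \<in> S" "b \<in> S" using elim t by (auto simp: a_def b_def)
        have q: "0 \<le> q" "q \<le> 1" using t r_positive by (auto simp: q_def)
        have "\<bar>?D g y \<omega> - ?D g x \<omega>\<bar> = \<bar>q * g b - q * g a\<bar>"
          using False by (simp add: stopval_def disc_def t_def a_def b_def q_def)
        also have "\<dots> = q * \<bar>g a - g b\<bar>"
          using q(1) by (simp add: abs_mult abs_minus_commute flip: right_diff_distrib)
        also have "\<dots> \<le> q * (e + L * dist a b + C * ?h a)" by (rule mult_left_mono[OF m[OF ab] q(1)])
        also have "\<dots> = q * e + L * (q * dist a b) + C * (q * ?h a)" by (simp add: algebra_simps)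
        also have "\<dots> \<le> e + L * B \<omega> + C * (q * ?h a)"
        proof (intro add_mono mult_left_mono order_refl)
          show "q * e \<le> e" using q C mult_right_mono[of q 1 e] by simp
          show "q * dist a b \<le> B \<omega>" using elim(3) False by (simp add: q_def t_def a_def b_def less_top[symmetric])
        qed (rule q(1) C)+
        finally show ?thesis using False by (simp add: stopval_def disc_def t_def a_def q_def)
      next
        case True
        then show ?thesis using C B(2)[of \<omega>] by (simp add: stopval_def)
      qed
    qed
  qed
  also have "\<dots> = e + L * (\<integral>\<omega>. B \<omega> \<partial>M) + C * reward ?h x \<tau>"
    unfolding reward_def using i[OF cut x] B prob_space by simp
  finally show ?thesis .
qed

text \<open>\<open>\<delta>\<close> depends on \<open>g\<close>, \<open>x\<close> and
  \<open>e\<close> but not on the stopping time: uniform integrability of the weight gives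
  \<open>R\<close>, then the modulus of continuity gives \<open>L\<close>. The two paths are
  compared only at the stopping time itself, which suits flows absorbed at different
  moments.\<close>

lemma reward_close:
  assumes g: "adm g" and x: "x \<in> S" and e: "0 < e"
  obtains \<delta> where "0 < \<delta>"
    "\<And>y \<tau> B. y \<in> S \<Longrightarrow> stopping_time F \<tau> \<Longrightarrow> integrable M B \<Longrightarrow> (\<And>\<omega>. 0 \<le> B \<omega>) \<Longrightarrow>
      (AE \<omega> in M. \<tau> \<omega> < \<infinity> \<longrightarrow> exp (- r * enn2real (\<tau> \<omega>)) * dist (X (enn2real (\<tau> \<omega>)) x \<omega>) (X (enn2real (\<tau> \<omega>)) y \<omega>) \<le> B \<omega>) \<Longrightarrow>
      (\<integral>\<omega>. B \<omega> \<partial>M) \<le> \<delta> \<Longrightarrow> \<bar>reward g y \<tau> - reward g x \<tau>\<bar> \<le> e"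
proof -
  have e3: "0 < e / 3" using e by simp
  obtain C where C: "0 \<le> C"
    "\<And>e R. 0 < e \<Longrightarrow> 0 \<le> R \<Longrightarrow> \<exists>L\<ge>0. \<forall>x\<in>S. \<forall>y\<in>S. \<bar>g x - g y\<bar> \<le> e + L * dist x y + C * max 0 (w x - R)"
    using adm_modulus[OF g] by blast
  have "0 < e / (3 * (C + 1))" using e C by simp
  then obtain R where R: "0 \<le> R" "\<And>\<tau>. stopping_time F \<tau> \<Longrightarrow> reward (\<lambda>y. max 0 (w y - R)) x \<tau> \<le> e / (3 * (C + 1))"
    using tail_weight[OF x] by metis
  obtain L where L: "0 \<le> L" "\<forall>x\<in>S. \<forall>y\<in>S. \<bar>g x - g y\<bar> \<le> e / 3 + L * dist x y + C * max 0 (w x - R)"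
    using C(2)[OF e3 R(1)] by blast
  have tail: "C * reward (\<lambda>y. max 0 (w y - R)) x \<tau> \<le> e / 3" if "stopping_time F \<tau>" for \<tau>
  proof -
    have "C * reward (\<lambda>y. max 0 (w y - R)) x \<tau> \<le> C * (e / (3 * (C + 1)))"
      by (rule mult_left_mono[OF R(2)[OF that] C(1)])
    also have "\<dots> \<le> e / 3" using C(1) e by (simp add: field_simps)
    finally show ?thesis .
  qed
  note * = R(1) C(1) L(1) L(2)[rule_format] tail
  show ?thesis
  proof (rule that[of "e / (3 * (L + 1))"])
    show "0 < e / (3 * (L + 1))" using e *(3) by simp
    fix y \<tau> B assume y: "y \<in> S" and \<tau>: "stopping_time F \<tau>" and B: "integrable M B" "\<And>\<omega>. 0 \<le> B \<omega>"
      and d: "AE \<omega> in M. \<tau> \<omega> < \<infinity> \<longrightarrow> exp (- r * enn2real (\<tau> \<omega>)) * dist (X (enn2real (\<tau> \<omega>)) x \<omega>) (X (enn2real (\<tau> \<omega>)) y \<omega>) \<le> B \<omega>"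
      and le: "(\<integral>\<omega>. B \<omega> \<partial>M) \<le> e / (3 * (L + 1))"
    have "\<bar>reward g y \<tau> - reward g x \<tau>\<bar> \<le> e / 3 + L * (\<integral>\<omega>. B \<omega> \<partial>M) + C * reward (\<lambda>y. max 0 (w y - R)) x \<tau>"
      by (rule reward_diff_le[OF g x y \<tau> B d *(1-3) _ *(4)]) (use e in auto)
    also have "\<dots> \<le> e / 3 + L * (e / (3 * (L + 1))) + e / 3"
      by (intro add_mono mult_left_mono le *(3) *(5)[OF \<tau>] order_refl)
    also have "L * (e / (3 * (L + 1))) \<le> e / 3"
      using *(3) e by (simp add: field_simps)
    finally show "\<bar>reward g y \<tau> - reward g x \<tau>\<bar> \<le> e" by simp
  qed
qed

end

section \<open>The function space, its weight and fixed points in it\<close>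

lemma A_space_iff:
  "f \<in> A_space S nrm \<longleftrightarrow> f \<in> extensional S \<and> continuous_on S f \<and> (\<forall>x\<in>S. 0 \<le> f x) \<and>
    (\<exists>C. \<forall>x\<in>S. f x \<le> C * sqrt (1 + (nrm x)\<^sup>2))"
proof -
  have pos: "0 < 1 + (nrm x)\<^sup>2" for x by (simp add: add_pos_nonneg)
  have eq: "bdd_above ((\<lambda>x. \<bar>f x\<bar>\<^sup>2 / (1 + (nrm x)\<^sup>2)) ` S) \<longleftrightarrow> (\<exists>C. \<forall>x\<in>S. f x \<le> C * sqrt (1 + (nrm x)\<^sup>2))"
    if nn: "\<forall>x\<in>S. 0 \<le> f x"
  proof
    assume "bdd_above ((\<lambda>x. \<bar>f x\<bar>\<^sup>2 / (1 + (nrm x)\<^sup>2)) ` S)"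
    then obtain K where K: "\<And>x. x \<in> S \<Longrightarrow> \<bar>f x\<bar>\<^sup>2 / (1 + (nrm x)\<^sup>2) \<le> K"
      by (auto simp: bdd_above_def)
    have "f x \<le> sqrt K * sqrt (1 + (nrm x)\<^sup>2)" if x: "x \<in> S" for x
    proof -
      have "(f x)\<^sup>2 \<le> K * (1 + (nrm x)\<^sup>2)"
        using K[OF x] pos[of x] by (simp add: pos_divide_le_eq)
      then have "f x \<le> sqrt (K * (1 + (nrm x)\<^sup>2))" by (rule real_le_rsqrt)
      then show ?thesis by (simp add: real_sqrt_mult)
    qed
    then show "\<exists>C. \<forall>x\<in>S. f x \<le> C * sqrt (1 + (nrm x)\<^sup>2)" by blast
  next
    assume "\<exists>C. \<forall>x\<in>S. f x \<le> C * sqrt (1 + (nrm x)\<^sup>2)"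
    then obtain C where C: "\<And>x. x \<in> S \<Longrightarrow> f x \<le> C * sqrt (1 + (nrm x)\<^sup>2)" by blast
    have "\<bar>f x\<bar>\<^sup>2 / (1 + (nrm x)\<^sup>2) \<le> C\<^sup>2" if x: "x \<in> S" for x
    proof -
      have "(f x)\<^sup>2 \<le> (C * sqrt (1 + (nrm x)\<^sup>2))\<^sup>2"
        using C[OF x] nn x by (intro power_mono) auto
      also have "\<dots> = C\<^sup>2 * (1 + (nrm x)\<^sup>2)" using pos[of x] by (simp add: power_mult_distrib)
      finally show ?thesis using pos[of x] by (simp add: pos_divide_le_eq)
    qed
    then show "bdd_above ((\<lambda>x. \<bar>f x\<bar>\<^sup>2 / (1 + (nrm x)\<^sup>2)) ` S)" by (rule bdd_aboveI2)
  qed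
  show ?thesis
  proof (cases "\<forall>x\<in>S. 0 \<le> f x")
    case True
    show ?thesis unfolding A_space_def PiE_iff mem_Collect_eq eq[OF True] using True by auto
  qed (auto simp: A_space_def PiE_iff)
qed

text \<open>\<open>sqrt (1 + a^2)\<close> is the Euclidean norm of the pair \<open>(1, a)\<close>,
  so this is the reverse triangle inequality.\<close>

lemma sqrt_1_lipschitz: "\<bar>sqrt (1 + a\<^sup>2) - sqrt (1 + b\<^sup>2)\<bar> \<le> \<bar>a - b\<bar>" for a b :: real
proof -
  have "\<bar>norm (1::real, a) - norm (1::real, b)\<bar> \<le> norm ((1::real, a) - (1, b))" by (rule norm_triangle_ineq3)
  then show ?thesis by (simp add: norm_Pair)
qed

lemma sqrt_1_ge: "1 \<le> sqrt (1 + a\<^sup>2)" "\<bar>a\<bar> \<le> sqrt (1 + a\<^sup>2)" "sqrt (1 + a\<^sup>2) \<le> 1 + \<bar>a\<bar>" for a :: real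
proof -
  show "sqrt (1 + a\<^sup>2) \<le> 1 + \<bar>a\<bar>" using sqrt_1_lipschitz[of a 0] by simp
  have "sqrt (\<bar>a\<bar>\<^sup>2) \<le> sqrt (1 + a\<^sup>2)" by (intro real_sqrt_le_mono) simp
  then show "\<bar>a\<bar> \<le> sqrt (1 + a\<^sup>2)" by simp
qed simp

context recursive_stopping
begin

lemma \<Gamma>_cong:
  assumes "adm f" "adm h" "\<And>y. y \<in> S \<Longrightarrow> f y = h y" "x \<in> S" shows "\<Gamma> f x = \<Gamma> h x"
  using \<Gamma>_contraction[OF assms(1,2) order_refl _ assms(4)] \<Gamma>_contraction[OF assms(2,1) order_refl _ assms(4)] assms(3)
  by (intro antisym) auto

lemma SUP_stop_reward:
  assumes g: "adm g" and x: "x \<in> S"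
  shows "(SUP \<tau>\<in>{\<tau>. stopping_time F \<tau>}. stop_reward M X r g x \<tau>) = ennreal (optval g x)"
proof (rule antisym)
  show "(SUP \<tau>\<in>{\<tau>. stopping_time F \<tau>}. stop_reward M X r g x \<tau>) \<le> ennreal (optval g x)"
    by (rule SUP_least) (auto simp: stop_reward_eq[OF g x] intro!: ennreal_leI reward_le_optval[OF g x])
  show "ennreal (optval g x) \<le> (SUP \<tau>\<in>{\<tau>. stopping_time F \<tau>}. stop_reward M X r g x \<tau>)" (is "_ \<le> ?s")
  proof (cases "?s")
    case (real s)
    have "optval g x \<le> s"
    proof (rule optval_least)
      fix \<tau> assume \<tau>: "stopping_time F \<tau>"
      have "ennreal (reward g x \<tau>) \<le> ?s"
        unfolding stop_reward_eq[OF g x \<tau>, symmetric] using \<tau> by (intro SUP_upper) simp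
      then show "reward g x \<tau> \<le> s" using real by (simp add: ennreal_le_iff)
    qed
    then show ?thesis unfolding real(2) by (rule ennreal_leI)
  next
    case top
    then show ?thesis by (simp only: top_greatest)
  qed
qed

lemma optval_equation_iff:
  assumes v: "adm v"
  shows "(\<forall>x\<in>S. ennreal (v x) = (SUP \<tau>\<in>{\<tau>. stopping_time F \<tau>}. stop_reward M X r (obst v) x \<tau>)) \<longleftrightarrow>
    (\<forall>x\<in>S. v x = \<Gamma> v x)"
  using adm_nonneg[OF v] adm_nonneg[OF adm_\<Gamma>[OF v]] SUP_stop_reward[OF adm_obst[OF v]] by (auto simp: \<Gamma>_def)

text \<open>Uniqueness as a function requires cutting the fixed point to \<open>S\<close>. Values
  outside \<open>S\<close> affect neither admissibility nor, by \<open>\<Gamma>_cong\<close>, the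
  fixed point equation.\<close>

lemma ex1_fixed_point:
  assumes "\<And>x. x \<in> S \<Longrightarrow> w x = sqrt (1 + (nrm x)\<^sup>2)"
  shows "\<exists>!v. v \<in> A_space S nrm \<and> (\<forall>x\<in>S. v x = \<Gamma> v x)"
proof -
  have A: "f \<in> A_space S nrm \<longleftrightarrow> f \<in> extensional S \<and> adm f" for f
    unfolding A_space_iff adm_def using assms by auto
  obtain u where u: "adm u" "\<And>x. x \<in> S \<Longrightarrow> u x = \<Gamma> u x" by (rule fixed_point_exists) blast
  define v where "v = restrict u S"
  have "continuous_on S v \<longleftrightarrow> continuous_on S u" by (rule continuous_on_cong) (auto simp: v_def)
  then have av: "adm v" using u(1) by (simp add: adm_def v_def)
  have fv: "v x = \<Gamma> v x" if x: "x \<in> S" for x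
    using \<Gamma>_cong[OF av u(1) _ x] u(2)[OF x] x by (simp add: v_def)
  show ?thesis
  proof (rule ex1I[of _ v])
    show "v \<in> A_space S nrm \<and> (\<forall>x\<in>S. v x = \<Gamma> v x)" using av fv by (simp add: A v_def)
    fix v' assume v': "v' \<in> A_space S nrm \<and> (\<forall>x\<in>S. v' x = \<Gamma> v' x)"
    then have av': "adm v'" and "v' \<in> extensional S" by (auto simp: A)
    then show "v' = v"
      using fixed_points_le[OF av' av] fixed_points_le[OF av av'] v' fv
      by (intro extensionalityI[of v' S v] antisym) (auto simp: v_def)
  qed
qed

lemma obstacle_eq_obst: "obstacle M X D r p \<phi> \<psi> J f = obst f"
  by (simp add: fun_eq_iff obstacle_def obst_def Lambda_def \<Lambda>_def set_lebesgue_integral_def P_def mix_def)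

end

section \<open>From the strong Markov property to transitions between fixed times\<close>

context markov_flow
begin

sublocale complete_filtration M F
  by unfold_locales (fact F_complete, fact F_right_continuous, fact F_infinity_eq)

lemma X_measurable: "0 \<le> t \<Longrightarrow> X t x \<in> borel_measurable M"
  by (rule measurable_F_M[OF X_adapted])

text \<open>The strong Markov property at a constant time, for the functional that reads the path at
  time \<open>s\<close>. Its right-hand side equals a conditional expectation almost surely, and
  completeness then makes it measurable; measurable dependence of expectations on the starting point
  is not among the assumptions.\<close>

lemma markov_bounded:
  fixes f :: "real^'d \<Rightarrow> real"
  assumes f: "f \<in> borel_measurable borel" and bdd: "bounded (range f)" and t: "0 \<le> t" and s: "0 \<le> s"
  shows "(\<lambda>\<omega>. expectation (\<lambda>\<omega>'. f (X s (X t x \<omega>) \<omega>'))) \<in> borel_measurable M"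
    "A \<in> sets (F (ennreal t)) \<Longrightarrow>
      (\<integral>\<omega>. indicator A \<omega> * f (X (t + s) x \<omega>) \<partial>M) = (\<integral>\<omega>. indicator A \<omega> * expectation (\<lambda>\<omega>'. f (X s (X t x \<omega>) \<omega>')) \<partial>M)"
proof -
  define \<tau> where "\<tau> = (\<lambda>_::'a. ennreal t)"
  have st: "stopping_time F \<tau>" unfolding \<tau>_def by (rule stopping_time_const)
  let ?\<Phi> = "\<lambda>u::real \<Rightarrow> real^'d. f (u s)"
  have \<Phi>: "?\<Phi> \<in> borel_measurable (\<Pi>\<^sub>M s\<in>{0::real..}. (borel :: (real^'d) measure))"
    using measurable_compose[OF measurable_component_singleton[of s "{0..}" "\<lambda>_. borel"] f] s by simp
  have "bounded (range ?\<Phi>)" by (rule bounded_subset[OF bdd]) auto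
  note sm = X_strong_markov[OF st \<Phi> this, of x]
  let ?h = "\<lambda>\<omega>. expectation (\<lambda>\<omega>'. f (X s (X t x \<omega>) \<omega>'))"
  let ?c = "real_cond_exp M (pre_sigma \<tau>) (\<lambda>\<omega>. f (X (t + s) x \<omega>))"
  have c: "AE \<omega> in M. ?c \<omega> = ?h \<omega>"
    using sm s t by (simp add: \<tau>_def restrict_def)
  have sub: "subalgebra M (pre_sigma \<tau>)"
    unfolding subalgebra_def
  proof
    show "space (pre_sigma \<tau>) = space M" by (rule space_pre_sigma)
    show "sets (pre_sigma \<tau>) \<subseteq> sets M"
    proof
      fix B assume "B \<in> sets (pre_sigma \<tau>)"
      from sets_pre_sigmaD[OF st this, of "\<infinity>"] show "B \<in> sets M" using F_top by (simp add: \<tau>_def)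
    qed
  qed
  interpret g: finite_measure_subalgebra M "pre_sigma \<tau>" by unfold_locales (rule sub)
  obtain K where K: "\<And>y. norm (f y) \<le> K" using bdd by (auto simp: bounded_iff)
  have int: "integrable M (\<lambda>\<omega>. f (X (t + s) x \<omega>))"
  proof (rule integrable_const_bound[where B=K])
    show "(\<lambda>\<omega>. f (X (t + s) x \<omega>)) \<in> borel_measurable M"
      using measurable_compose[OF X_measurable f, of "t + s"] s t by simp
  qed (use K in auto)
  have cm: "?c \<in> borel_measurable M" using borel_measurable_integrable[OF g.real_cond_exp_int(1)[OF int]] .
  show hm: "?h \<in> borel_measurable M"
    by (rule measurable_AE_eq_M[OF cm c])
  assume A: "A \<in> sets (F (ennreal t))"
  have A': "A \<in> sets (pre_sigma \<tau>)"
  proof (rule sets_pre_sigmaI[OF st])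
    fix u show "{\<omega> \<in> A. \<tau> \<omega> \<le> u} \<in> sets (F u)"
      using A sets_F_mono[of "ennreal t" u] by (cases "ennreal t \<le> u") (auto simp: \<tau>_def)
  qed
  have AM: "A \<in> sets M" using A sets_F_subset by blast
  have "(\<integral>\<omega>. indicator A \<omega> * f (X (t + s) x \<omega>) \<partial>M) = (\<integral>\<omega>. indicator A \<omega> * ?c \<omega> \<partial>M)"
    using g.real_cond_exp_intA[OF int A'] by (simp add: set_lebesgue_integral_def)
  also have "\<dots> = (\<integral>\<omega>. indicator A \<omega> * ?h \<omega> \<partial>M)"
    by (rule integral_cong_AE) (use AM cm hm c in \<open>auto elim!: eventually_mono\<close>)
  finally show "(\<integral>\<omega>. indicator A \<omega> * f (X (t + s) x \<omega>) \<partial>M) = (\<integral>\<omega>. indicator A \<omega> * ?h \<omega> \<partial>M)" .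
qed

lemma SUP_min_of_nat: "(SUP n. min a (of_nat n)) = (a::ennreal)"
proof -
  have "(SUP n. inf a (of_nat n :: ennreal)) = inf a (SUP n. of_nat n)" by (rule inf_SUP[symmetric])
  then show ?thesis by (simp add: ennreal_SUP_of_nat_eq_top inf_min)
qed

text \<open>Bounded truncations \<open>min f n\<close> and monotone convergence, on both sides and
  inside the inner expectation.\<close>

lemma markov_nn:
  assumes t: "0 \<le> t" and s: "0 \<le> s" and A: "A \<in> sets (F (ennreal t))"
    and f: "f \<in> borel_measurable borel"
  shows "(\<integral>\<^sup>+\<omega>. indicator A \<omega> * f (X (t + s) x \<omega>) \<partial>M)
        = (\<integral>\<^sup>+\<omega>. indicator A \<omega> * (\<integral>\<^sup>+\<omega>'. f (X s (X t x \<omega>) \<omega>') \<partial>M) \<partial>M)"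
proof -
  define k where "k n y = enn2real (min (f y) (of_nat n))" for n y
  have kf: "ennreal (k n y) = min (f y) (of_nat n)" for n y
    unfolding k_def by (rule ennreal_enn2real) (rule le_less_trans[OF min.cobounded2 of_nat_less_top])
  have km: "k n \<in> borel_measurable borel" for n unfolding k_def[abs_def] using f by measurable
  have k0: "0 \<le> k n y" for n y by (simp add: k_def)
  have kn: "k n y \<le> real n" for n y
  proof -
    have "ennreal (k n y) \<le> ennreal (real n)" unfolding kf by (simp add: ennreal_of_nat_eq_real_of_nat)
    then show ?thesis by (simp add: ennreal_le_iff)
  qed
  have kb: "bounded (range (k n))" for n
    using k0 kn by (auto simp: bounded_iff intro!: exI[of _ "real n"])
  have AM: "A \<in> sets M" using A sets_F_subset by blast
  have Xm: "X s y \<in> borel_measurable M" "X (t + s) y \<in> borel_measurable M" for y using X_measurable s t by auto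
  have fX: "(\<lambda>\<omega>. f (X s y \<omega>)) \<in> borel_measurable M" for y by (rule measurable_compose[OF Xm(1) f])
  have kX: "integrable M (\<lambda>\<omega>. k n (X u y \<omega>))" if "0 \<le> u" for n u y
    using k0 kn by (intro integrable_const_bound[where B="real n"] AE_I2 measurable_compose[OF X_measurable[OF that] km]) auto
  let ?h = "\<lambda>n \<omega>. expectation (\<lambda>\<omega>'. k n (X s (X t x \<omega>) \<omega>'))"
  have hn: "ennreal (?h n \<omega>) = (\<integral>\<^sup>+\<omega>'. min (f (X s (X t x \<omega>) \<omega>')) (of_nat n) \<partial>M)" for n \<omega>
    using nn_integral_eq_integral[OF kX[OF s, of n "X t x \<omega>"]] k0 by (simp add: kf)
  have h0: "0 \<le> ?h n \<omega>" for n \<omega> using k0 by (intro Bochner_Integration.integral_nonneg)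
  have hle: "?h n \<omega> \<le> real n" for n \<omega>
    using integral_mono[OF kX[OF s], of "\<lambda>_. real n"] kn prob_space by simp
  note hm = markov_bounded(1)[OF km kb t s]
  have eqn: "(\<integral>\<^sup>+\<omega>. indicator A \<omega> * min (f (X (t + s) x \<omega>)) (of_nat n) \<partial>M) = (\<integral>\<^sup>+\<omega>. indicator A \<omega> * ennreal (?h n \<omega>) \<partial>M)" for n
  proof -
    have i1: "integrable M (\<lambda>\<omega>. indicator A \<omega> * k n (X (t + s) x \<omega>))"
      using integrable_mult_indicator[OF AM kX, of "t + s"] s t by simp
    have "integrable M (?h n)"
      using h0 hle hm by (intro integrable_const_bound[where B="real n"] AE_I2) auto
    from integrable_mult_indicator[OF AM this]
    have i2: "integrable M (\<lambda>\<omega>. indicator A \<omega> * ?h n \<omega>)" by simp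
    have "(\<integral>\<^sup>+\<omega>. indicator A \<omega> * min (f (X (t + s) x \<omega>)) (of_nat n) \<partial>M) = (\<integral>\<^sup>+\<omega>. ennreal (indicator A \<omega> * k n (X (t + s) x \<omega>)) \<partial>M)"
      by (rule nn_integral_cong) (auto simp: indicator_def kf)
    also have "\<dots> = ennreal (\<integral>\<omega>. indicator A \<omega> * k n (X (t + s) x \<omega>) \<partial>M)"
      by (rule nn_integral_eq_integral[OF i1]) (use k0 in auto)
    also have "\<dots> = ennreal (\<integral>\<omega>. indicator A \<omega> * ?h n \<omega> \<partial>M)"
      using markov_bounded(2)[OF km kb t s A] by simp
    also have "\<dots> = (\<integral>\<^sup>+\<omega>. ennreal (indicator A \<omega> * ?h n \<omega>) \<partial>M)"
      by (rule nn_integral_eq_integral[OF i2, symmetric]) (use h0 in auto)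
    also have "\<dots> = (\<integral>\<^sup>+\<omega>. indicator A \<omega> * ennreal (?h n \<omega>) \<partial>M)"
      by (rule nn_integral_cong) (auto simp: indicator_def)
    finally show ?thesis .
  qed
  have min_mono: "min a (of_nat m) \<le> min a (of_nat n)" if "m \<le> n" for a :: ennreal and m n
    using that by (intro min.mono) auto
  have ind: "indicator A \<omega> * (SUP n. c n) = (SUP n. indicator A \<omega> * c n)" for \<omega> and c :: "nat \<Rightarrow> ennreal"
    by (rule SUP_mult_left_ennreal)
  have "(\<integral>\<^sup>+\<omega>. indicator A \<omega> * f (X (t + s) x \<omega>) \<partial>M) = (\<integral>\<^sup>+\<omega>. (SUP n. indicator A \<omega> * min (f (X (t + s) x \<omega>)) (of_nat n)) \<partial>M)"
    by (simp only: ind[symmetric] SUP_min_of_nat)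
  also have "\<dots> = (SUP n. \<integral>\<^sup>+\<omega>. indicator A \<omega> * min (f (X (t + s) x \<omega>)) (of_nat n) \<partial>M)"
  proof (rule nn_integral_monotone_convergence_SUP)
    show "incseq (\<lambda>n \<omega>. indicator A \<omega> * min (f (X (t + s) x \<omega>)) (of_nat n))"
      by (auto simp: incseq_def le_fun_def intro!: mult_left_mono min_mono)
    show "(\<lambda>\<omega>. indicator A \<omega> * min (f (X (t + s) x \<omega>)) (of_nat n)) \<in> borel_measurable M" for n
      using AM measurable_compose[OF Xm(2) f] by measurable
  qed
  also have "\<dots> = (SUP n. \<integral>\<^sup>+\<omega>. indicator A \<omega> * ennreal (?h n \<omega>) \<partial>M)" by (simp only: eqn)
  also have "\<dots> = (\<integral>\<^sup>+\<omega>. (SUP n. indicator A \<omega> * ennreal (?h n \<omega>)) \<partial>M)"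
  proof (rule nn_integral_monotone_convergence_SUP[symmetric])
    have "ennreal (?h m \<omega>) \<le> ennreal (?h n \<omega>)" if "m \<le> n" for m n \<omega>
      unfolding hn using that by (intro nn_integral_mono min_mono)
    then show "incseq (\<lambda>n \<omega>. indicator A \<omega> * ennreal (?h n \<omega>))"
      by (auto simp: incseq_def le_fun_def intro!: mult_left_mono)
    show "(\<lambda>\<omega>. indicator A \<omega> * ennreal (?h n \<omega>)) \<in> borel_measurable M" for n
      using AM hm by measurable
  qed
  also have "\<dots> = (\<integral>\<^sup>+\<omega>. indicator A \<omega> * (\<integral>\<^sup>+\<omega>'. f (X s (X t x \<omega>) \<omega>') \<partial>M) \<partial>M)"
  proof (rule nn_integral_cong)
    fix \<omega>
    have "(SUP n. ennreal (?h n \<omega>)) = (\<integral>\<^sup>+\<omega>'. (SUP n. min (f (X s (X t x \<omega>) \<omega>')) (of_nat n)) \<partial>M)"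
      unfolding hn
    proof (rule nn_integral_monotone_convergence_SUP[symmetric])
      show "incseq (\<lambda>n \<omega>'. min (f (X s (X t x \<omega>) \<omega>')) (of_nat n))"
        unfolding incseq_def le_fun_def by (intro allI impI min_mono)
      show "(\<lambda>\<omega>'. min (f (X s (X t x \<omega>) \<omega>')) (of_nat n)) \<in> borel_measurable M" for n
        using fX[of "X t x \<omega>"] by measurable
    qed
    then show "(SUP n. indicator A \<omega> * ennreal (?h n \<omega>)) = indicator A \<omega> * (\<integral>\<^sup>+\<omega>'. f (X s (X t x \<omega>) \<omega>') \<partial>M)"
      by (simp only: ind[symmetric] SUP_min_of_nat)
  qed
  finally show ?thesis .
qed

lemma rc_process_exp:
  fixes h :: "real^'d \<Rightarrow> real"
  assumes h: "continuous_on UNIV h" shows "rc_process (\<lambda>t \<omega>. exp (- c * t) * h (X t x \<omega>))"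
  unfolding rc_process_def
proof (intro conjI allI impI)
  show "(\<lambda>\<omega>. exp (- c * t) * h (X t x \<omega>)) \<in> borel_measurable (F (ennreal t))" if "0 \<le> t" for t
    using measurable_compose[OF X_adapted[OF that] borel_measurable_continuous_onI[OF h]] by measurable
  show "AE \<omega> in M. \<forall>t\<ge>0. continuous (at_right t) (\<lambda>s. exp (- c * s) * h (X s x \<omega>))"
    using X_right_continuous[of x]
  proof eventually_elim
    case (elim \<omega>)
    show ?case
    proof (intro allI impI)
      fix t :: real assume t: "0 \<le> t"
      have "((\<lambda>s. X s x \<omega>) \<longlongrightarrow> X t x \<omega>) (at_right t)" using elim t by (simp add: continuous_within)
      from continuous_on_tendsto_compose[OF h this]
      have "((\<lambda>s. h (X s x \<omega>)) \<longlongrightarrow> h (X t x \<omega>)) (at_right t)" by simp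
      then show "continuous (at_right t) (\<lambda>s. exp (- c * s) * h (X s x \<omega>))"
        unfolding continuous_within by (intro tendsto_intros)
    qed
  qed
qed

end

subsection \<open>Infinite horizon\<close>

context infinite_horizon
begin

definition weight :: "real^'d \<Rightarrow> real" where "weight x = sqrt (1 + (norm x)\<^sup>2)"

lemma continuous_weight: "continuous_on UNIV weight"
  unfolding weight_def[abs_def] by (intro continuous_intros)

lemma weighted_flow_inf:
  obtains \<kappa> where "weighted_flow M F X UNIV weight r \<kappa>"
proof -
  obtain \<rho> where \<rho>: "0 < \<rho>" "\<rho> < 1" and sm: "\<And>x. supermartingale_on M F {..<\<infinity>}
        (\<lambda>t \<omega>. exp (- 2 * r * (1 - \<rho>) * enn2real t) * (1 + (norm (X (enn2real t) x \<omega>))\<^sup>2))"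
    using growth_supermartingale by auto
  \<comment> \<open>Half the rate in the growth assumption, because the weight is the square root of
    the process bounded there.\<close>
  define \<kappa> where "\<kappa> = r * (1 - \<rho>)"
  define U where "U x t \<omega> = exp (- (2 * \<kappa>) * t) * (1 + (norm (X t x \<omega>))\<^sup>2)" for x t \<omega>
  have sm: "supermartingale_on M F {..<\<infinity>} (\<lambda>t. U x (enn2real t))" for x
    using sm[of x] by (simp add: U_def[abs_def] \<kappa>_def mult.assoc)
  have rcU: "rc_process (U x)" for x
    unfolding U_def[abs_def] by (rule rc_process_exp) (intro continuous_intros)
  have superU: "super_process (U x)" for x
    unfolding super_process_def
  proof (intro conjI allI ballI impI)
    show "integrable M (U x t)" if "0 \<le> t" for t
      using sm[of x] that unfolding supermartingale_on_def by (auto dest: bspec[of _ _ "ennreal t"])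
    fix s t :: real and A assume "A \<in> sets (F (ennreal s))" "0 \<le> s" "s \<le> t"
    then show "(\<integral>\<omega>. indicator A \<omega> * U x t \<omega> \<partial>M) \<le> (\<integral>\<omega>. indicator A \<omega> * U x s \<omega> \<partial>M)"
      using supermartingale_set_integral[OF sm[of x], of "ennreal s" "ennreal t" A]
      by (simp add: ennreal_leI)
  qed (use rcU in \<open>auto simp: U_def\<close>)
  have U0: "(\<integral>\<omega>. U x 0 \<omega> \<partial>M) = (weight x)\<^sup>2" for x
  proof -
    have "(\<integral>\<omega>. U x 0 \<omega> \<partial>M) = (\<integral>\<omega>. (weight x)\<^sup>2 \<partial>M)"
    proof (rule integral_cong_AE)
      show "U x 0 \<in> borel_measurable M" using superU[of x] by (auto simp: super_process_def)
      show "AE \<omega> in M. U x 0 \<omega> = (weight x)\<^sup>2"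
        using X_start[of x] by eventually_elim (simp add: U_def weight_def add_nonneg_nonneg)
    qed simp
    then show ?thesis using prob_space by simp
  qed
  have "weighted_flow M F X UNIV weight r \<kappa>"
  proof unfold_locales
    show "continuous_on UNIV weight" by (rule continuous_weight)
    show "1 \<le> weight x" for x by (simp add: weight_def)
    show "\<bar>weight x - weight y\<bar> \<le> dist x y" for x y
      unfolding weight_def using sqrt_1_lipschitz[of "norm x" "norm y"] norm_triangle_ineq3[of x y]
      by (simp add: dist_norm)
    show "bounded {x\<in>UNIV. weight x \<le> R}" for R
    proof -
      have "norm y \<le> weight y" for y using sqrt_1_ge(2)[of "norm y"] by (simp add: weight_def)
      then have "norm y \<le> R" if "weight y \<le> R" for y using that order_trans by blast
      then show ?thesis by (auto simp: bounded_iff)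
    qed
    show "0 \<le> \<kappa>" "\<kappa> < r" using \<rho> r_pos by (auto simp: \<kappa>_def)
    show "AE \<omega> in M. X 0 x \<omega> = x" for x by (rule X_start)
    show "AE \<omega> in M. \<forall>t\<ge>0. continuous (at_right t) (\<lambda>s. X s x \<omega>)" for x by (rule X_right_continuous)
    show "AE \<omega> in M. (SUP n. \<tau> n \<omega>) < \<infinity> \<longrightarrow>
          (\<lambda>n. X (enn2real (\<tau> n \<omega>)) x \<omega>) \<longlonglongrightarrow> X (enn2real (SUP n. \<tau> n \<omega>)) x \<omega>"
      if "\<And>n::nat. stopping_time F (\<tau> n)" "\<And>\<omega>. incseq (\<lambda>n. \<tau> n \<omega>)" for x \<tau>
      by (rule X_quasi_left_continuous[OF that])
    show "(\<integral>\<^sup>+\<omega>. indicator A \<omega> * f (X (t + s) x \<omega>) \<partial>M)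
        = (\<integral>\<^sup>+\<omega>. indicator A \<omega> * (\<integral>\<^sup>+\<omega>'. f (X s (X t x \<omega>) \<omega>') \<partial>M) \<partial>M)"
      if "0 \<le> t" "0 \<le> s" "A \<in> sets (F (ennreal t))" "f \<in> borel_measurable borel" for x t s A f
      by (rule markov_nn[OF that])
    show "\<exists>B. integrable M B \<and> (AE \<omega> in M. \<forall>t\<ge>0. exp (- r * t) * weight (X t x \<omega>) \<le> B \<omega>)" for x
    proof -
      let ?Y = "\<lambda>t \<omega>. exp (- r * t) * norm (X t x \<omega>)"
      have rc: "rc_process ?Y" by (rule rc_process_exp) (intro continuous_intros)
      obtain B where B: "integrable M B" "AE \<omega> in M. \<forall>t\<ge>0. ?Y t \<omega> \<le> B \<omega>"
      proof (rule sup_dominated[of ?Y])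
        show "?Y t \<in> borel_measurable M" if "0 \<le> t" for t
          by (rule measurable_F_M[OF rc_process_measurable[OF rc that order_refl]])
        show "AE \<omega> in M. \<forall>t\<ge>0. continuous (at_right t) (\<lambda>s. ?Y s \<omega>)" by (rule rc_process_rc[OF rc])
        show "(\<integral>\<^sup>+\<omega>. (SUP t\<in>{0..}. ennreal (?Y t \<omega>)) \<partial>M) < \<infinity>"
          using sup_integrable[of "{x}"] by simp
      qed blast
      have "AE \<omega> in M. \<forall>t\<ge>0. exp (- r * t) * weight (X t x \<omega>) \<le> 1 + B \<omega>"
        using B(2)
      proof eventually_elim
        case (elim \<omega>)
        show ?case
        proof (intro allI impI)
          fix t :: real assume t: "0 \<le> t"
          have "exp (- r * t) * weight (X t x \<omega>) \<le> exp (- r * t) * (1 + norm (X t x \<omega>))"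
            unfolding weight_def using sqrt_1_ge(3)[of "norm (X t x \<omega>)"] by (intro mult_left_mono) auto
          also have "\<dots> = exp (- r * t) + ?Y t \<omega>" by (simp add: distrib_left)
          also have "\<dots> \<le> 1 + B \<omega>" using elim t r_pos by (intro add_mono) auto
          finally show "exp (- r * t) * weight (X t x \<omega>) \<le> 1 + B \<omega>" .
        qed
      qed
      then show ?thesis using B(1) by (intro exI[of _ "\<lambda>\<omega>. 1 + B \<omega>"]) auto
    qed
    show "(\<integral>\<^sup>+\<omega>. ennreal (stopval (\<lambda>t \<omega>. exp (- \<kappa> * t) * weight (X t x \<omega>)) \<tau> \<omega>) \<partial>M) \<le> ennreal (weight x)"
      if \<tau>: "stopping_time F \<tau>" for x \<tau>
    proof (rule stopval_sqrt_le[OF superU _ _ \<tau>])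
      show "0 < weight x" by (simp add: weight_def add_pos_nonneg)
      show "(\<integral>\<omega>. U x 0 \<omega> \<partial>M) \<le> (weight x)\<^sup>2" by (simp add: U0)
      have "sqrt (exp (- (2 * \<kappa>) * t)) = exp (- \<kappa> * t)" for t
        by (rule real_sqrt_unique) (simp_all flip: exp_of_nat_mult)
      then show "AE \<omega> in M. \<forall>t\<ge>0. exp (- \<kappa> * t) * weight (X t x \<omega>) \<le> sqrt (U x t \<omega>)"
        by (intro AE_I2) (simp add: U_def weight_def real_sqrt_mult)
    qed
  qed (use X_adapted in auto)
  then show ?thesis by (rule that)
qed

lemma recursive_stopping_inf:
  obtains \<kappa> where "recursive_stopping M F X UNIV weight r \<kappa> D p \<phi> \<psi> J_inf"
proof -
  obtain \<kappa> where "weighted_flow M F X UNIV weight r \<kappa>" by (rule weighted_flow_inf)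
  then interpret wf: weighted_flow M F X UNIV weight r \<kappa> .
  \<comment> \<open>The estimate holds for all stopping times at once, with the same
    \<open>\<tau>\<close> on both sides. Constant times give continuity of \<open>P s f\<close>,
    arbitrary ones give \<open>reward_usc\<close>.\<close>
  have close: "\<forall>\<^sub>F n in sequentially. \<forall>\<tau>. stopping_time F \<tau> \<longrightarrow> \<bar>wf.reward g (xs n) \<tau> - wf.reward g x \<tau>\<bar> \<le> e"
    if g: "wf.adm g" and xs: "xs \<longlonglongrightarrow> x" and e: "0 < e" for g xs x e
  proof -
    obtain \<delta> where \<delta>: "0 < \<delta>"
      "\<And>y \<tau> B. y \<in> UNIV \<Longrightarrow> stopping_time F \<tau> \<Longrightarrow> integrable M B \<Longrightarrow> (\<And>\<omega>. 0 \<le> B \<omega>) \<Longrightarrow>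
      (AE \<omega> in M. \<tau> \<omega> < \<infinity> \<longrightarrow> exp (- r * enn2real (\<tau> \<omega>)) * dist (X (enn2real (\<tau> \<omega>)) x \<omega>) (X (enn2real (\<tau> \<omega>)) y \<omega>) \<le> B \<omega>) \<Longrightarrow>
      (\<integral>\<omega>. B \<omega> \<partial>M) \<le> \<delta> \<Longrightarrow> \<bar>wf.reward g y \<tau> - wf.reward g x \<tau>\<bar> \<le> e"
      using wf.reward_close[OF g UNIV_I e] by blast
    let ?Y = "\<lambda>n t \<omega>. exp (- r * t) * norm (X t (xs n) \<omega> - X t x \<omega>)"
    have "\<forall>\<^sub>F n in sequentially. (\<integral>\<^sup>+\<omega>. (SUP t\<in>{0..}. ennreal (?Y n t \<omega>)) \<partial>M) < ennreal \<delta>"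
      by (rule order_tendstoD(2)[OF flow_L1_continuous[OF xs]]) (use \<delta> in simp)
    then show ?thesis
    proof eventually_elim
      case (elim n)
      obtain B where B: "integrable M B" "\<And>\<omega>. 0 \<le> B \<omega>" "AE \<omega> in M. \<forall>t\<ge>0. ?Y n t \<omega> \<le> B \<omega>"
        "(\<integral>\<omega>. B \<omega> \<partial>M) \<le> enn2real (\<integral>\<^sup>+\<omega>. (SUP t\<in>{0..}. ennreal (?Y n t \<omega>)) \<partial>M)"
      proof (rule sup_dominated[of "?Y n"])
        show "?Y n t \<in> borel_measurable M" if "0 \<le> t" for t
          using X_measurable[OF that, of "xs n"] X_measurable[OF that, of x] by measurable
        show "AE \<omega> in M. \<forall>t\<ge>0. continuous (at_right t) (\<lambda>s. ?Y n s \<omega>)"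
          using X_right_continuous[of x] X_right_continuous[of "xs n"]
        proof eventually_elim
          case (elim \<omega>)
          then show ?case by (auto intro!: continuous_intros)
        qed
        show "(\<integral>\<^sup>+\<omega>. (SUP t\<in>{0..}. ennreal (?Y n t \<omega>)) \<partial>M) < \<infinity>"
          using elim by (rule less_trans) simp
      qed blast
      have "enn2real (\<integral>\<^sup>+\<omega>. (SUP t\<in>{0..}. ennreal (?Y n t \<omega>)) \<partial>M) \<le> \<delta>"
        using elim \<delta>(1) by (intro enn2real_leI) auto
      with B(4) have "(\<integral>\<omega>. B \<omega> \<partial>M) \<le> \<delta>" by simp
      moreover have "AE \<omega> in M. \<tau> \<omega> < \<infinity> \<longrightarrow> exp (- r * enn2real (\<tau> \<omega>)) *
          dist (X (enn2real (\<tau> \<omega>)) x \<omega>) (X (enn2real (\<tau> \<omega>)) (xs n) \<omega>) \<le> B \<omega>" for \<tau> :: "'a \<Rightarrow> ennreal"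
        using B(3) by eventually_elim (simp add: dist_norm norm_minus_commute)
      ultimately show ?case using \<delta>(2)[OF UNIV_I _ B(1,2)] by blast
    qed
  qed
  have "recursive_stopping M F X UNIV weight r \<kappa> D p \<phi> \<psi> J_inf"
  proof unfold_locales
    show "continuous_on UNIV (wf.P s f)" if f: "wf.adm f" and s: "0 \<le> s" for f s
      unfolding continuous_on_sequentially
    proof safe
      fix x xs assume xs: "xs \<longlonglongrightarrow> (x::real^'d)"
      have "(\<lambda>n. wf.reward f (xs n) (\<lambda>_. ennreal s)) \<longlonglongrightarrow> wf.reward f x (\<lambda>_. ennreal s)"
      proof (rule tendstoI)
        fix e :: real assume e: "0 < e"
        then have "0 < e / 2" by simp
        from close[OF f xs this]
        show "\<forall>\<^sub>F n in sequentially. dist (wf.reward f (xs n) (\<lambda>_. ennreal s)) (wf.reward f x (\<lambda>_. ennreal s)) < e"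
        proof eventually_elim
          case (elim n)
          from elim[rule_format, OF stopping_time_const, of "ennreal s"] e show ?case by (simp add: dist_real_def)
        qed
      qed
      then have "(\<lambda>n. exp (r * s) * wf.reward f (xs n) (\<lambda>_. ennreal s)) \<longlonglongrightarrow> exp (r * s) * wf.reward f x (\<lambda>_. ennreal s)"
        by (intro tendsto_mult tendsto_const)
      then show "(wf.P s f \<circ> xs) \<longlonglongrightarrow> wf.P s f x"
        using s by (simp add: wf.reward_const comp_def mult.assoc[symmetric] flip: exp_add)
    qed
    show "\<forall>\<^sub>F n in sequentially. \<forall>\<tau>. stopping_time F \<tau> \<longrightarrow>
         (\<exists>\<tau>'. stopping_time F \<tau>' \<and> wf.reward g (xs n) \<tau> \<le> wf.reward g x \<tau>' + e)"
      if "wf.adm g" "xs \<longlonglongrightarrow> x" "0 < e" for g xs x e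
      using close[OF that]
    proof eventually_elim
      case (elim n)
      show ?case
      proof (intro allI impI)
        fix \<tau> assume "stopping_time F \<tau>"
        with elim show "\<exists>\<tau>'. stopping_time F \<tau>' \<and> wf.reward g (xs n) \<tau> \<le> wf.reward g x \<tau>' + e"
          by (intro exI[of _ \<tau>]) fastforce
      qed
    qed
    show "0 < p" "p < 1" by (rule p_pos, rule p_less_1)
    show "wf.adm \<phi>" "wf.adm \<psi>"
      using phi_in psi_in unfolding A_space_iff wf.adm_def weight_def by auto
  qed auto
  then show ?thesis by (rule that)
qed

lemma infinite_horizon_result:
  shows "\<exists>!v. v \<in> A_inf \<and> value_eq_inf M F X D r p \<phi> \<psi> v"
    and "v \<in> A_inf \<Longrightarrow> value_eq_inf M F X D r p \<phi> \<psi> v \<Longrightarrow>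
        let g = obstacle M X D r p \<phi> \<psi> J_inf v;
            \<tau>s = tau_star X v g J_inf x;
            Y = (\<lambda>t \<omega>. disc_eval r v (\<lambda>s. X s x \<omega>) t);
            Z = (\<lambda>t \<omega>. disc_eval r v (\<lambda>s. X s x \<omega>) (min t (\<tau>s \<omega>)))
        in optimal_in M X r g x (stops_inf F) \<tau>s \<and>
           supermartingale_on M F {0..\<infinity>} Y \<and>
           right_continuous_on M {0..\<infinity>} Y \<and> nonneg_on M {0..\<infinity>} Y \<and>
           martingale_on M F {0..<\<infinity>} Z \<and>
           right_continuous_on M {0..<\<infinity>} Z \<and> nonneg_on M {0..<\<infinity>} Z" (is "_ \<Longrightarrow> _ \<Longrightarrow> ?claim")
proof -
  obtain \<kappa> where "recursive_stopping M F X UNIV weight r \<kappa> D p \<phi> \<psi> J_inf" by (rule recursive_stopping_inf)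
  then interpret rs: recursive_stopping M F X UNIV weight r \<kappa> D p \<phi> \<psi> J_inf .
  have adm: "rs.adm v" if "v \<in> A_inf" for v
    using that unfolding A_space_iff rs.adm_def weight_def by auto
  have eq: "value_eq_inf M F X D r p \<phi> \<psi> v \<longleftrightarrow> (\<forall>x\<in>UNIV. v x = rs.\<Gamma> v x)" if "v \<in> A_inf" for v
    using rs.optval_equation_iff[OF adm[OF that]] unfolding value_eq_inf_def rs.obstacle_eq_obst by simp
  have "(v \<in> A_inf \<and> value_eq_inf M F X D r p \<phi> \<psi> v) \<longleftrightarrow> (v \<in> A_inf \<and> (\<forall>x\<in>UNIV. v x = rs.\<Gamma> v x))" for v
    using eq by blast
  then show "\<exists>!v. v \<in> A_inf \<and> value_eq_inf M F X D r p \<phi> \<psi> v"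
    using rs.ex1_fixed_point[of norm] unfolding weight_def by simp
  assume v: "v \<in> A_inf" "value_eq_inf M F X D r p \<phi> \<psi> v"
  have av: "rs.adm v" and fv: "\<And>x. x \<in> UNIV \<Longrightarrow> v x = rs.\<Gamma> v x" using v eq adm by auto
  define \<tau> where "\<tau> = tau_star X v (rs.obst v) J_inf x"
  have \<tau>: "AE \<omega> in M. \<tau> \<omega> = Inf (ennreal ` {t. 0 \<le> t \<and> v (X t x \<omega>) = rs.obst v (X t x \<omega>)})"
    by (simp add: \<tau>_def tau_star_def)
  note va = rs.value_attained[OF av fv UNIV_I \<tau>]
  have "optimal_in M X r (rs.obst v) x (stops_inf F) \<tau>"
    unfolding optimal_in_def
    using rs.SUP_stop_reward[OF rs.adm_obst[OF av] UNIV_I, of x] rs.stop_reward_eq[OF rs.adm_obst[OF av] UNIV_I va(1), of x] va(1,2) fv[of x]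
    by (simp add: rs.\<Gamma>_def)
  then show ?claim
    unfolding Let_def rs.obstacle_eq_obst \<tau>_def[symmetric]
    by (intro conjI va(3,4) rs.right_continuous_disc_eval[OF av UNIV_I] rs.nonneg_disc_eval[OF av UNIV_I])
qed

end

lemma SUP_min_le: "(SUP t\<in>{0..}. h (min t T)) \<le> (SUP s\<in>{0..T}. h s :: ennreal)" if "0 \<le> (T::real)"
  using that by (intro SUP_least SUP_upper) auto

lemma enn2real_min: "x < \<infinity> \<Longrightarrow> 0 \<le> a \<Longrightarrow> enn2real (min x (ennreal a)) = min (enn2real x) a"
  by (cases x) (auto simp: min_def ennreal_le_iff)

lemma spatial_norm_le: "spatial_norm i z \<le> norm z"
  unfolding spatial_norm_def norm_vec_def L2_set_def by (auto intro!: real_sqrt_le_mono sum_mono2)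

lemma norm_le_spatial: "norm z \<le> \<bar>z $ i\<bar> + spatial_norm i z"
proof -
  have "(norm z)\<^sup>2 = (z $ i)\<^sup>2 + (spatial_norm i z)\<^sup>2"
    unfolding spatial_norm_def norm_vec_def L2_set_def
    by (simp add: sum_nonneg sum.remove[of UNIV i])
  also have "\<dots> \<le> (\<bar>z $ i\<bar> + spatial_norm i z)\<^sup>2"
    by (simp add: power2_sum spatial_norm_def)
  finally show ?thesis by (rule power2_le_imp_le) (simp add: spatial_norm_def)
qed

lemma spatial_norm_diff: "\<bar>spatial_norm i x - spatial_norm i y\<bar> \<le> spatial_norm i (x - y)"
proof -
  have *: "spatial_norm i x \<le> spatial_norm i (x - y) + spatial_norm i y" for x y
    using L2_set_triangle_ineq[of "\<lambda>j. (x - y) $ j" "\<lambda>j. y $ j" "UNIV - {i}"]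
    by (simp add: spatial_norm_def)
  have "spatial_norm i (y - x) = spatial_norm i (x - y)"
    by (simp add: spatial_norm_def L2_set_def power2_commute)
  with *[of x y] *[of y x] show ?thesis by simp
qed

lemma continuous_spatial_norm: "continuous_on A (spatial_norm i)"
  unfolding spatial_norm_def[abs_def] L2_set_def by (intro continuous_intros)

lemma right_continuous_on_cong:
  assumes "\<And>\<omega> t. t \<in> I \<Longrightarrow> Y t \<omega> = Y' t \<omega>" "right_continuous_on M I Y'"
  shows "right_continuous_on M I Y"
  using assms(2) unfolding right_continuous_on_def
proof eventually_elim
  case (elim \<omega>)
  show ?case
  proof
    fix t assume t: "t \<in> I"
    have "((\<lambda>s. Y' s \<omega>) \<longlongrightarrow> Y' t \<omega>) (at t within {t<..} \<inter> I)"
      using elim t by (simp add: continuous_within)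
    then have "((\<lambda>s. Y s \<omega>) \<longlongrightarrow> Y' t \<omega>) (at t within {t<..} \<inter> I)"
      by (rule Lim_transform_eventually) (use assms(1) in \<open>auto simp: eventually_at_topological\<close>)
    then show "continuous (at t within {t<..} \<inter> I) (\<lambda>s. Y s \<omega>)"
      using assms(1)[OF t] by (simp add: continuous_within)
  qed
qed

lemma supermartingale_on_subset:
  assumes Y: "supermartingale_on M F I Y" and sub: "I' \<subseteq> I" and eq: "\<And>t. t \<in> I' \<Longrightarrow> Y' t = Y t"
  shows "supermartingale_on M F I' Y'"
  unfolding supermartingale_on_def
proof (intro conjI ballI impI)
  fix t assume t: "t \<in> I'"
  show "Y' t \<in> borel_measurable (F t)" "integrable M (Y' t)"
    unfolding eq[OF t] using Y t sub by (auto simp: supermartingale_on_def)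
  fix s assume s: "s \<in> I'" and "t \<le> s"
  then show "AE \<omega> in M. real_cond_exp M (F t) (Y' s) \<omega> \<le> Y' t \<omega>"
    unfolding eq[OF t] eq[OF s] using Y t sub by (auto simp: supermartingale_on_def)
qed

lemma martingale_on_subset:
  assumes Y: "martingale_on M F I Y" and sub: "I' \<subseteq> I" and eq: "\<And>t. t \<in> I' \<Longrightarrow> Y' t = Y t"
  shows "martingale_on M F I' Y'"
  unfolding martingale_on_def
proof (intro conjI ballI impI)
  fix t assume t: "t \<in> I'"
  show "Y' t \<in> borel_measurable (F t)" "integrable M (Y' t)"
    unfolding eq[OF t] using Y t sub by (auto simp: martingale_on_def)
  fix s assume s: "s \<in> I'" and "t \<le> s"
  then show "AE \<omega> in M. real_cond_exp M (F t) (Y' s) \<omega> = Y' t \<omega>"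
    unfolding eq[OF t] eq[OF s] using Y t sub by (auto simp: martingale_on_def)
qed

subsection \<open>Finite horizon\<close>

context finite_horizon
begin

definition weight :: "real^'d \<Rightarrow> real" where "weight z = sqrt (1 + (spatial_norm i z)\<^sup>2)"

text \<open>The flow is absorbed when the time coordinate reaches \<open>T\<close>. Since waiting after absorption only discounts
  the reward further, unrestricted stopping of the absorbed flow has the same value as stopping
  before \<open>T\<close>.\<close>

definition Xa :: "real \<Rightarrow> real^'d \<Rightarrow> 'a \<Rightarrow> real^'d" where "Xa s z = X (min s (T - z $ i)) z"

lemma horizon_bounds: "z \<in> strip T i \<Longrightarrow> 0 \<le> T - z $ i" "z \<in> strip T i \<Longrightarrow> T - z $ i \<le> T"
  by (auto simp: strip_def)

lemma Xa_eq: "s \<le> T - z $ i \<Longrightarrow> Xa s z = X s z"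
  by (simp add: Xa_def min_def)

lemma closed_strip: "closed (strip T i)"
  unfolding strip_def by (intro closed_Collect_conj closed_Collect_le continuous_intros)

lemma weight_lipschitz: "\<bar>weight x - weight y\<bar> \<le> dist x y"
  unfolding weight_def
  using sqrt_1_lipschitz[of "spatial_norm i x" "spatial_norm i y"] spatial_norm_diff[of i x y] spatial_norm_le[of i "x - y"]
  by (simp add: dist_norm)

lemma weight_le_norm: "weight z \<le> 1 + norm z"
  unfolding weight_def using sqrt_1_ge(3)[of "spatial_norm i z"] spatial_norm_le[of i z]
  by (simp add: spatial_norm_def)

lemma weight_levels_bounded: "bounded {z\<in>strip T i. weight z \<le> R}"
  unfolding bounded_iff
proof (intro exI ballI)
  fix z assume z: "z \<in> {z\<in>strip T i. weight z \<le> R}"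
  have "spatial_norm i z \<le> weight z"
    using sqrt_1_ge(2)[of "spatial_norm i z"] by (simp add: weight_def spatial_norm_def)
  then show "norm z \<le> T + R" using z norm_le_spatial[of z i] by (auto simp: strip_def)
qed

text \<open>Freezing \<open>Y\<close> at \<open>T\<close> turns the supremum over
  \<open>[0,T]\<close> into one over all times, to which \<open>sup_dominated\<close>
  applies.\<close>

lemma stopped_dominated:
  assumes rc: "rc_process Y" and fin: "(\<integral>\<^sup>+\<omega>. (SUP s\<in>{0..T}. ennreal (Y s \<omega>)) \<partial>M) < \<infinity>"
  obtains B where "integrable M B" "\<And>\<omega>. 0 \<le> B \<omega>" "AE \<omega> in M. \<forall>t. 0 \<le> t \<and> t \<le> T \<longrightarrow> Y t \<omega> \<le> B \<omega>"
    "(\<integral>\<omega>. B \<omega> \<partial>M) \<le> enn2real (\<integral>\<^sup>+\<omega>. (SUP s\<in>{0..T}. ennreal (Y s \<omega>)) \<partial>M)"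
proof -
  have rc': "rc_process (\<lambda>t. Y (min t T))" by (rule rc_process_stopped[OF rc T_nonneg])
  have le: "(\<integral>\<^sup>+\<omega>. (SUP t\<in>{0..}. ennreal (Y (min t T) \<omega>)) \<partial>M) \<le> (\<integral>\<^sup>+\<omega>. (SUP s\<in>{0..T}. ennreal (Y s \<omega>)) \<partial>M)"
    by (intro nn_integral_mono SUP_min_le[OF T_nonneg, of "\<lambda>t. ennreal (Y t _)"])
  obtain B where B: "integrable M B" "\<And>\<omega>. 0 \<le> B \<omega>" "AE \<omega> in M. \<forall>t\<ge>0. Y (min t T) \<omega> \<le> B \<omega>"
    "(\<integral>\<omega>. B \<omega> \<partial>M) \<le> enn2real (\<integral>\<^sup>+\<omega>. (SUP t\<in>{0..}. ennreal (Y (min t T) \<omega>)) \<partial>M)"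
  proof (rule sup_dominated[of "\<lambda>t. Y (min t T)"])
    show "Y (min t T) \<in> borel_measurable M" if "0 \<le> t" for t
      by (rule measurable_F_M[OF rc_process_measurable[OF rc' that order_refl]])
    show "AE \<omega> in M. \<forall>t\<ge>0. continuous (at_right t) (\<lambda>s. Y (min s T) \<omega>)" by (rule rc_process_rc[OF rc'])
    show "(\<integral>\<^sup>+\<omega>. (SUP t\<in>{0..}. ennreal (Y (min t T) \<omega>)) \<partial>M) < \<infinity>" using le fin by (rule le_less_trans)
  qed blast
  have "AE \<omega> in M. \<forall>t. 0 \<le> t \<and> t \<le> T \<longrightarrow> Y t \<omega> \<le> B \<omega>"
    using B(3)
  proof eventually_elim
    case (elim \<omega>)
    show ?case
    proof (intro allI impI)
      fix t assume t: "0 \<le> t \<and> t \<le> T"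
      then have "min t T = t" by simp
      with elim t show "Y t \<omega> \<le> B \<omega>" by metis
    qed
  qed
  moreover have "(\<integral>\<omega>. B \<omega> \<partial>M) \<le> enn2real (\<integral>\<^sup>+\<omega>. (SUP s\<in>{0..T}. ennreal (Y s \<omega>)) \<partial>M)"
    using B(4) enn2real_mono[OF le fin[unfolded infinity_ennreal_def]] by linarith
  ultimately show ?thesis using that B(1,2) by blast
qed

lemma norm_dominated:
  assumes z: "z \<in> strip T i"
  obtains B where "integrable M B" "\<And>\<omega>. 0 \<le> B \<omega>" "AE \<omega> in M. \<forall>t. 0 \<le> t \<and> t \<le> T \<longrightarrow> norm (X t z \<omega>) \<le> B \<omega>"
proof -
  let ?Y = "\<lambda>t \<omega>. exp (- r * t) * norm (X t z \<omega>)"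
  have "rc_process ?Y" by (rule rc_process_exp) (intro continuous_intros)
  moreover have "(\<integral>\<^sup>+\<omega>. (SUP s\<in>{0..T}. ennreal (?Y s \<omega>)) \<partial>M) < \<infinity>" using sup_integrable[of "{z}"] z by simp
  ultimately obtain B where B: "integrable M B" "\<And>\<omega>. 0 \<le> B \<omega>" "AE \<omega> in M. \<forall>t. 0 \<le> t \<and> t \<le> T \<longrightarrow> ?Y t \<omega> \<le> B \<omega>"
    by (rule stopped_dominated) blast
  have "AE \<omega> in M. \<forall>t. 0 \<le> t \<and> t \<le> T \<longrightarrow> norm (X t z \<omega>) \<le> exp (r * T) * B \<omega>"
    using B(3)
  proof eventually_elim
    case (elim \<omega>)
    show ?case
    proof (intro allI impI)
      fix t assume t: "0 \<le> t \<and> t \<le> T"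
      have "norm (X t z \<omega>) = exp (r * t) * ?Y t \<omega>" by (simp add: mult.assoc[symmetric] flip: exp_add)
      also have "\<dots> \<le> exp (r * T) * B \<omega>"
        using t elim r_pos by (intro mult_mono) auto
      finally show "norm (X t z \<omega>) \<le> exp (r * T) * B \<omega>" .
    qed
  qed
  then show ?thesis using that[of "\<lambda>\<omega>. exp (r * T) * B \<omega>"] B(1,2) by auto
qed

lemma weighted_flow_fin:
  obtains \<kappa> where "weighted_flow M F Xa (strip T i) weight r \<kappa>"
proof -
  obtain \<rho> where \<rho>: "0 < \<rho>" "\<rho> < 1" and sm: "\<And>z. z \<in> strip T i \<Longrightarrow> supermartingale_on M F {..ennreal T}
        (\<lambda>s \<omega>. exp (- 2 * r * (1 - \<rho>) * enn2real s) * (1 + (spatial_norm i (X (enn2real s) z \<omega>))\<^sup>2))"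
    using growth_supermartingale by auto
  define \<kappa> where "\<kappa> = r * (1 - \<rho>)"
  define U where "U z t \<omega> = exp (- (2 * \<kappa>) * t) * (1 + (spatial_norm i (X t z \<omega>))\<^sup>2)" for z t \<omega>
  define a where "a z = T - z $ i" for z :: "real^'d"
  have a: "0 \<le> a z" "a z \<le> T" if "z \<in> strip T i" for z using horizon_bounds[OF that] by (auto simp: a_def)
  have sm: "supermartingale_on M F {..ennreal T} (\<lambda>t. U z (enn2real t))" if "z \<in> strip T i" for z
    using sm[OF that] by (simp add: U_def[abs_def] \<kappa>_def mult.assoc)
  have rcU: "rc_process (U z)" for z
    unfolding U_def[abs_def] by (rule rc_process_exp) (intro continuous_intros continuous_spatial_norm)
  \<comment> \<open>Stopped at the deterministic lifetime \<open>a z\<close>, the squared weight is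
    a supermartingale on the whole half-line, although the assumption ends at
    \<open>T\<close>.\<close>
  have superU: "super_process (\<lambda>t. U z (min t (a z)))" if z: "z \<in> strip T i" for z
    unfolding super_process_def
  proof (intro conjI allI ballI impI)
    show "rc_process (\<lambda>t. U z (min t (a z)))" by (rule rc_process_stopped[OF rcU a(1)[OF z]])
    show "integrable M (U z (min t (a z)))" if "0 \<le> t" for t
      using sm[OF z] that a[OF z] unfolding supermartingale_on_def
      by (auto dest!: bspec[of _ _ "ennreal (min t (a z))"] intro!: ennreal_leI simp: min_le_iff_disj)
    fix s t :: real and A assume st: "A \<in> sets (F (ennreal s))" "0 \<le> s" "s \<le> t"
    show "(\<integral>\<omega>. indicator A \<omega> * U z (min t (a z)) \<omega> \<partial>M) \<le> (\<integral>\<omega>. indicator A \<omega> * U z (min s (a z)) \<omega> \<partial>M)"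
    proof (cases "s \<le> a z")
      case True
      then have "ennreal s \<le> ennreal T" "ennreal (min t (a z)) \<le> ennreal T" "ennreal s \<le> ennreal (min t (a z))"
        using a[OF z] st by (auto intro!: ennreal_leI)
      from supermartingale_set_integral[OF sm[OF z], of "ennreal s" "ennreal (min t (a z))" A] this st True a[OF z]
      show ?thesis by (simp add: min_absorb1)
    next
      case False
      then have "min t (a z) = a z" "min s (a z) = a z" using st by auto
      then show ?thesis by simp
    qed
  qed (auto simp: U_def)
  have U0: "(\<integral>\<omega>. U z (min 0 (a z)) \<omega> \<partial>M) = (weight z)\<^sup>2" if z: "z \<in> strip T i" for z
  proof -
    have m: "min 0 (a z) = 0" using a[OF z] by simp
    have "(\<integral>\<omega>. U z 0 \<omega> \<partial>M) = (\<integral>\<omega>. (weight z)\<^sup>2 \<partial>M)"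
    proof (rule integral_cong_AE)
      show "U z 0 \<in> borel_measurable M"
        by (rule measurable_F_M[OF rc_process_measurable[OF rcU order_refl order_refl]])
      show "AE \<omega> in M. U z 0 \<omega> = (weight z)\<^sup>2"
        using X_start[of z] by eventually_elim (simp add: U_def weight_def add_nonneg_nonneg)
    qed simp
    then show ?thesis using prob_space m by simp
  qed
  have "weighted_flow M F Xa (strip T i) weight r \<kappa>"
  proof unfold_locales
    show "closed (strip T i)" by (rule closed_strip)
    show "continuous_on (strip T i) weight"
      unfolding weight_def[abs_def] by (intro continuous_intros continuous_spatial_norm)
    show "1 \<le> weight x" for x by (simp add: weight_def)
    show "\<bar>weight x - weight y\<bar> \<le> dist x y" for x y by (rule weight_lipschitz)
    show "bounded {x\<in>strip T i. weight x \<le> R}" for R by (rule weight_levels_bounded)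
    show "0 \<le> \<kappa>" "\<kappa> < r" using \<rho> r_pos by (auto simp: \<kappa>_def)
    fix z assume z: "z \<in> strip T i"
    note az = a[OF z]
    have Xa: "Xa t z = X (min t (a z)) z" for t by (simp add: Xa_def a_def)
    have time: "AE \<omega> in M. \<forall>s\<ge>0. X s z \<omega> $ i = z $ i + s" by (rule time_coordinate[OF z])
    show "Xa t z \<in> borel_measurable (F (ennreal t))" if t: "0 \<le> t" for t
    proof -
      have "X (min t (a z)) z \<in> borel_measurable (F (ennreal (min t (a z))))" using t az by (intro X_adapted) simp
      then show ?thesis unfolding Xa by (rule measurable_F_mono) (auto intro!: ennreal_leI)
    qed
    show "AE \<omega> in M. Xa 0 z \<omega> = z" using X_start[of z] az by (simp add: Xa)
    show "AE \<omega> in M. \<forall>t\<ge>0. Xa t z \<omega> \<in> strip T i"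
      using time
    proof eventually_elim
      case (elim \<omega>)
      show ?case
      proof (intro allI impI)
        fix t :: real assume "0 \<le> t"
        then have "X (min t (a z)) z \<omega> $ i = z $ i + min t (a z)" using elim az by simp
        moreover have "0 \<le> z $ i" using z by (simp add: strip_def)
        ultimately show "Xa t z \<omega> \<in> strip T i" using \<open>0 \<le> t\<close> az by (auto simp: Xa strip_def a_def)
      qed
    qed
    show "AE \<omega> in M. \<forall>t\<ge>0. continuous (at_right t) (\<lambda>s. Xa s z \<omega>)"
      using X_right_continuous[of z] unfolding Xa
      by eventually_elim (use continuous_at_right_min[where y="\<lambda>s. X s z _"] in blast)
    show "AE \<omega> in M. (SUP n. \<tau> n \<omega>) < \<infinity> \<longrightarrow>
          (\<lambda>n. Xa (enn2real (\<tau> n \<omega>)) z \<omega>) \<longlonglongrightarrow> Xa (enn2real (SUP n. \<tau> n \<omega>)) z \<omega>"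
      if \<tau>: "\<And>n::nat. stopping_time F (\<tau> n)" "\<And>\<omega>. incseq (\<lambda>n. \<tau> n \<omega>)" for \<tau>
    proof -
      \<comment> \<open>Absorption amounts to stopping at \<open>a z\<close>, so quasi
        left-continuity of the original flow is applied to the truncated times.\<close>
      let ?m = "\<lambda>n \<omega>. min (\<tau> n \<omega>) (ennreal (a z))"
      have "AE \<omega> in M. (SUP n. ?m n \<omega>) < \<infinity> \<longrightarrow>
          (\<lambda>n. X (enn2real (?m n \<omega>)) z \<omega>) \<longlonglongrightarrow> X (enn2real (SUP n. ?m n \<omega>)) z \<omega>"
      proof (rule X_quasi_left_continuous)
        show "stopping_time F (?m n)" for n by (rule stopping_time_min[OF \<tau>(1) stopping_time_const])
        show "incseq (\<lambda>n. ?m n \<omega>)" for \<omega> using \<tau>(2)[of \<omega>] unfolding incseq_def by (intro allI impI min.mono) auto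
      qed
      then show ?thesis
      proof eventually_elim
        case (elim \<omega>)
        show ?case
        proof
          assume fin: "(SUP n. \<tau> n \<omega>) < \<infinity>"
          have finn: "\<tau> n \<omega> < \<infinity>" for n by (rule le_less_trans[OF _ fin]) (rule SUP_upper, simp)
          have "(SUP n. ?m n \<omega>) = min (SUP n. \<tau> n \<omega>) (ennreal (a z))"
            unfolding inf_min[symmetric] by (simp add: SUP_inf)
          moreover have "min (SUP n. \<tau> n \<omega>) (ennreal (a z)) < \<infinity>" by (rule le_less_trans[OF min.cobounded1 fin])
          ultimately show "(\<lambda>n. Xa (enn2real (\<tau> n \<omega>)) z \<omega>) \<longlonglongrightarrow> Xa (enn2real (SUP n. \<tau> n \<omega>)) z \<omega>"
            using elim by (simp only: Xa enn2real_min[OF finn az(1)] enn2real_min[OF fin az(1)])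
        qed
      qed
    qed
    show "(\<integral>\<^sup>+\<omega>. indicator A \<omega> * f (Xa (t + s) z \<omega>) \<partial>M)
        = (\<integral>\<^sup>+\<omega>. indicator A \<omega> * (\<integral>\<^sup>+\<omega>'. f (Xa s (Xa t z \<omega>) \<omega>') \<partial>M) \<partial>M)"
      if t: "0 \<le> t" and s: "0 \<le> s" and A: "A \<in> sets (F (ennreal t))" and f: "f \<in> borel_measurable borel" for t s A f
    proof (cases "t < a z")
      case True
      \<comment> \<open>From \<open>X t z\<close> the remaining lifetime is \<open>a z - t\<close>,
        because the time coordinate has advanced by exactly \<open>t\<close>; the flow restarted
        there moves for \<open>s'\<close> units of time.\<close>
      define s' where "s' = min s (a z - t)"
      have s': "0 \<le> s'" "min (t + s) (a z) = t + s'" using s True by (auto simp: s'_def)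
      have "(\<integral>\<^sup>+\<omega>. indicator A \<omega> * f (Xa (t + s) z \<omega>) \<partial>M)
        = (\<integral>\<^sup>+\<omega>. indicator A \<omega> * (\<integral>\<^sup>+\<omega>'. f (X s' (X t z \<omega>) \<omega>') \<partial>M) \<partial>M)"
        unfolding Xa s'(2) by (rule markov_nn[OF t s'(1) A f])
      also have "\<dots> = (\<integral>\<^sup>+\<omega>. indicator A \<omega> * (\<integral>\<^sup>+\<omega>'. f (Xa s (Xa t z \<omega>) \<omega>') \<partial>M) \<partial>M)"
      proof (rule nn_integral_cong_AE)
        show "AE \<omega> in M. indicator A \<omega> * (\<integral>\<^sup>+\<omega>'. f (X s' (X t z \<omega>) \<omega>') \<partial>M) = indicator A \<omega> * (\<integral>\<^sup>+\<omega>'. f (Xa s (Xa t z \<omega>) \<omega>') \<partial>M)"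
          using time
        proof eventually_elim
          case (elim \<omega>)
          have "Xa t z = X t z" using True by (simp add: Xa)
          moreover have "T - X t z \<omega> $ i = a z - t" using elim t by (simp add: a_def)
          ultimately show ?case by (simp add: Xa_def s'_def)
        qed
      qed
      finally show ?thesis .
    next
      \<comment> \<open>After absorption the time coordinate is \<open>T\<close>, the lifetime from
        there is \<open>0\<close>, and the restarted absorbed flow does not move.\<close>
      case False
      then have m: "min (t + s) (a z) = a z" "min t (a z) = a z" using s by auto
      show ?thesis
      proof (rule nn_integral_cong_AE)
        show "AE \<omega> in M. indicator A \<omega> * f (Xa (t + s) z \<omega>) = indicator A \<omega> * (\<integral>\<^sup>+\<omega>'. f (Xa s (Xa t z \<omega>) \<omega>') \<partial>M)"
          using time
        proof eventually_elim
          case (elim \<omega>)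
          define y where "y = X (a z) z \<omega>"
          have "y $ i = T" using elim az by (simp add: y_def a_def)
          then have "Xa s y = X 0 y" using s by (simp add: Xa_def)
          then have "(\<integral>\<^sup>+\<omega>'. f (Xa s y \<omega>') \<partial>M) = (\<integral>\<^sup>+\<omega>'. f y \<partial>M)"
            by (intro nn_integral_cong_AE) (use X_start[of y] in \<open>eventually_elim, simp\<close>)
          then have "(\<integral>\<^sup>+\<omega>'. f (Xa s y \<omega>') \<partial>M) = f y" by (simp add: emeasure_space_1)
          then show ?case by (simp add: Xa m y_def)
        qed
      qed
    qed
    show "\<exists>B. integrable M B \<and> (AE \<omega> in M. \<forall>t\<ge>0. exp (- r * t) * weight (Xa t z \<omega>) \<le> B \<omega>)"
    proof -
      obtain B where B: "integrable M B" "AE \<omega> in M. \<forall>t. 0 \<le> t \<and> t \<le> T \<longrightarrow> norm (X t z \<omega>) \<le> B \<omega>"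
        using norm_dominated[OF z] by blast
      have "AE \<omega> in M. \<forall>t\<ge>0. exp (- r * t) * weight (Xa t z \<omega>) \<le> 1 + B \<omega>"
        using B(2)
      proof eventually_elim
        case (elim \<omega>)
        show ?case
        proof (intro allI impI)
          fix t :: real assume t: "0 \<le> t"
          have w0: "0 \<le> weight (Xa t z \<omega>)" by (simp add: weight_def add_nonneg_nonneg)
          have "exp (- r * t) * weight (Xa t z \<omega>) \<le> 1 * weight (Xa t z \<omega>)"
            using t r_pos w0 by (intro mult_right_mono) auto
          also have "\<dots> \<le> 1 + norm (Xa t z \<omega>)" using weight_le_norm by simp
          also have "\<dots> \<le> 1 + B \<omega>" using elim t az by (simp add: Xa min_le_iff_disj)
          finally show "exp (- r * t) * weight (Xa t z \<omega>) \<le> 1 + B \<omega>" .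
        qed
      qed
      then show ?thesis using B(1) by (intro exI[of _ "\<lambda>\<omega>. 1 + B \<omega>"]) auto
    qed
    show "(\<integral>\<^sup>+\<omega>. ennreal (stopval (\<lambda>t \<omega>. exp (- \<kappa> * t) * weight (Xa t z \<omega>)) \<tau> \<omega>) \<partial>M) \<le> ennreal (weight z)"
      if \<tau>: "stopping_time F \<tau>" for \<tau>
    proof (rule stopval_sqrt_le[OF superU[OF z] _ _ \<tau>])
      show "0 < weight z" by (simp add: weight_def add_pos_nonneg)
      show "(\<integral>\<omega>. U z (min 0 (a z)) \<omega> \<partial>M) \<le> (weight z)\<^sup>2" by (simp only: U0[OF z])
      have e: "sqrt (exp (- (2 * \<kappa>) * t)) = exp (- \<kappa> * t)" for t
        by (rule real_sqrt_unique) (simp_all flip: exp_of_nat_mult)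
      \<comment> \<open>The exponential factor keeps falling after absorption while \<open>U\<close>
        is frozen; as \<open>\<kappa> \<ge> 0\<close>, the inequality goes the right way.\<close>
      have "exp (- \<kappa> * t) * weight (Xa t z \<omega>) \<le> sqrt (U z (min t (a z)) \<omega>)" for t \<omega>
      proof -
        have "sqrt (U z (min t (a z)) \<omega>) = exp (- \<kappa> * min t (a z)) * weight (Xa t z \<omega>)"
          unfolding U_def real_sqrt_mult e by (simp add: weight_def Xa)
        moreover have "exp (- \<kappa> * t) \<le> exp (- \<kappa> * min t (a z))"
          using \<rho> r_pos by (simp add: \<kappa>_def mult_left_mono)
        moreover have "0 \<le> weight (Xa t z \<omega>)" by (simp add: weight_def add_nonneg_nonneg)
        ultimately show ?thesis by (simp add: mult_right_mono)
      qed
      then show "AE \<omega> in M. \<forall>t\<ge>0. exp (- \<kappa> * t) * weight (Xa t z \<omega>) \<le> sqrt (U z (min t (a z)) \<omega>)"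
        by (intro AE_I2) blast
    qed
  qed
  then show ?thesis by (rule that)
qed

text \<open>Quasi left-continuity along increasing deterministic times excludes a jump at a fixed
  time almost surely. With right-continuity and domination this gives continuity in mean from both
  sides. It serves to compare flows whose lifetimes differ.\<close>

lemma X_L1_continuous_time:
  assumes z: "z \<in> strip T i" and u: "0 \<le> u" "u \<le> T" and us: "\<And>n::nat. 0 \<le> us n" "\<And>n. us n \<le> T" "us \<longlonglongrightarrow> u"
  shows "(\<lambda>n. \<integral>\<omega>. norm (X (us n) z \<omega> - X u z \<omega>) \<partial>M) \<longlonglongrightarrow> 0"
proof -
  obtain B where B: "integrable M B" "AE \<omega> in M. \<forall>t. 0 \<le> t \<and> t \<le> T \<longrightarrow> norm (X t z \<omega>) \<le> B \<omega>"
    using norm_dominated[OF z] by blast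
  define m where "m v = (\<integral>\<omega>. norm (X v z \<omega> - X u z \<omega>) \<partial>M)" for v
  have conv: "(\<lambda>n. m (s n)) \<longlonglongrightarrow> 0"
    if s: "\<And>n. 0 \<le> s n" "\<And>n. s n \<le> T" and lim: "AE \<omega> in M. (\<lambda>n. X (s n) z \<omega>) \<longlonglongrightarrow> X u z \<omega>" for s :: "nat \<Rightarrow> real"
  proof -
    have "(\<lambda>n. m (s n)) \<longlonglongrightarrow> (\<integral>\<omega>. 0 \<partial>M)"
      unfolding m_def
    proof (rule integral_dominated_convergence[where w="\<lambda>\<omega>. 2 * B \<omega>"])
      show "(\<lambda>\<omega>. norm (X (s n) z \<omega> - X u z \<omega>)) \<in> borel_measurable M" for n
        using X_measurable[OF s(1)[of n], of z] X_measurable[OF u(1), of z] by measurable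
      show "AE \<omega> in M. (\<lambda>n. norm (X (s n) z \<omega> - X u z \<omega>)) \<longlonglongrightarrow> 0"
        using lim by eventually_elim (rule tendsto_norm_zero, simp add: LIM_zero)
      show "AE \<omega> in M. norm (norm (X (s n) z \<omega> - X u z \<omega>)) \<le> 2 * B \<omega>" for n
        using B(2)
      proof eventually_elim
        case (elim \<omega>)
        have "norm (X (s n) z \<omega>) \<le> B \<omega>" "norm (X u z \<omega>) \<le> B \<omega>" using elim s u by auto
        then show ?case using norm_triangle_ineq4[of "X (s n) z \<omega>" "X u z \<omega>"] by simp
      qed
    qed (use B(1) in auto)
    then show ?thesis by simp
  qed
  have left: "(m \<longlongrightarrow> 0) (at_left u)" if "0 < u"
  proof (rule tendsto_at_left_sequentially[OF that])
    fix s :: "nat \<Rightarrow> real" assume s: "\<And>n. s n < u" "\<And>n. 0 < s n" "incseq s" "s \<longlonglongrightarrow> u"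
    have inc: "incseq (\<lambda>n. ennreal (s n))" using s(3) by (auto simp: incseq_def intro!: ennreal_leI)
    have sup: "(SUP n. ennreal (s n)) = ennreal u"
      by (rule LIMSEQ_unique[OF LIMSEQ_SUP[OF inc] tendsto_ennrealI[OF s(4)]])
    have "AE \<omega> in M. (SUP n. ennreal (s n)) < \<infinity> \<longrightarrow>
          (\<lambda>n. X (enn2real (ennreal (s n))) z \<omega>) \<longlonglongrightarrow> X (enn2real (SUP n. ennreal (s n))) z \<omega>"
      by (rule X_quasi_left_continuous[where \<tau>="\<lambda>n _. ennreal (s n)", OF stopping_time_const inc])
    then have "AE \<omega> in M. (\<lambda>n. X (s n) z \<omega>) \<longlonglongrightarrow> X u z \<omega>"
      unfolding sup using less_imp_le[OF s(2)] u by simp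
    then show "(\<lambda>n. m (s n)) \<longlonglongrightarrow> 0"
      using less_imp_le[OF s(2)] less_imp_le[OF s(1)] u(2) by (intro conv) (auto intro: order_trans)
  qed
  have right: "(m \<longlongrightarrow> 0) (at_right u)" if "u < T"
  proof (rule tendsto_at_right_sequentially[OF that])
    fix s :: "nat \<Rightarrow> real" assume s: "\<And>n. u < s n" "\<And>n. s n < T" "decseq s" "s \<longlonglongrightarrow> u"
    have fl: "filterlim s (at_right u) sequentially"
      by (rule tendsto_imp_filterlim_at_right[OF s(4)]) (use s(1) in auto)
    have "AE \<omega> in M. (\<lambda>n. X (s n) z \<omega>) \<longlonglongrightarrow> X u z \<omega>"
      using X_right_continuous[of z]
    proof eventually_elim
      case (elim \<omega>)
      then have "((\<lambda>s. X s z \<omega>) \<longlongrightarrow> X u z \<omega>) (at_right u)" using u by (simp add: continuous_within)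
      from filterlim_compose[OF this fl] show ?case .
    qed
    then show "(\<lambda>n. m (s n)) \<longlonglongrightarrow> 0"
      using less_imp_le[OF s(2)] less_imp_le[OF s(1)] u(1) by (intro conv) (auto intro: order_trans)
  qed
  have m0: "m u = 0" by (simp add: m_def)
  have m_nonneg: "0 \<le> m v" for v unfolding m_def by (rule Bochner_Integration.integral_nonneg) simp
  have "(\<lambda>n. m (us n)) \<longlonglongrightarrow> 0"
  proof (rule tendstoI)
    fix e :: real assume e: "0 < e"
    have "\<exists>b<u. \<forall>v. b < v \<longrightarrow> v < u \<longrightarrow> 0 \<le> v \<longrightarrow> m v < e"
    proof (cases "0 < u")
      case True
      from order_tendstoD(2)[OF left[OF True] e] show ?thesis
        by (auto simp: eventually_at_left_field)
    next
      case False
      then show ?thesis using u by (intro exI[of _ "u - 1"]) auto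
    qed
    then obtain b where b: "b < u" "\<And>v. b < v \<Longrightarrow> v < u \<Longrightarrow> 0 \<le> v \<Longrightarrow> m v < e" by blast
    have "\<exists>c>u. \<forall>v. u < v \<longrightarrow> v < c \<longrightarrow> v \<le> T \<longrightarrow> m v < e"
    proof (cases "u < T")
      case True
      from order_tendstoD(2)[OF right[OF True] e] show ?thesis
        by (auto simp: eventually_at_right_field)
    next
      case False
      then show ?thesis using u by (intro exI[of _ "u + 1"]) auto
    qed
    then obtain c where c: "u < c" "\<And>v. u < v \<Longrightarrow> v < c \<Longrightarrow> v \<le> T \<Longrightarrow> m v < e" by blast
    show "\<forall>\<^sub>F n in sequentially. dist (m (us n)) 0 < e"
      using order_tendstoD(1)[OF us(3) b(1)] order_tendstoD(2)[OF us(3) c(1)]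
    proof eventually_elim
      case (elim n)
      have "m (us n) < e"
        using elim b(2)[of "us n"] c(2)[of "us n"] us(1,2)[of n] m0 e by (cases "us n" u rule: linorder_cases) auto
      then show ?case using m_nonneg[of "us n"] by (simp add: dist_real_def)
    qed
  qed
  then show ?thesis by (simp add: m_def)
qed

lemma rc_process_overshoot:
  assumes a: "0 \<le> a"
  shows "rc_process (\<lambda>u \<omega>. norm (X u z \<omega> - X (min u a) z \<omega>))"
  unfolding rc_process_def
proof (intro conjI allI impI)
  fix t :: real assume t: "0 \<le> t"
  have 1: "X t z \<in> borel_measurable (F (ennreal t))" by (rule X_adapted[OF t])
  have 2: "X (min t a) z \<in> borel_measurable (F (ennreal t))"
    using t a by (intro measurable_F_mono[OF X_adapted]) (auto intro!: ennreal_leI)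
  show "(\<lambda>\<omega>. norm (X t z \<omega> - X (min t a) z \<omega>)) \<in> borel_measurable (F (ennreal t))"
    using 1 2 by measurable
next
  show "AE \<omega> in M. \<forall>t\<ge>0. continuous (at_right t) (\<lambda>u. norm (X u z \<omega> - X (min u a) z \<omega>))"
    using X_right_continuous[of z]
  proof eventually_elim
    case (elim \<omega>)
    then show ?case
      using continuous_at_right_min[where y="\<lambda>s. X s z \<omega>" and a=a] by (auto intro!: continuous_intros)
  qed
qed

text \<open>A nearby starting point may have a longer lifetime than \<open>z\<close>, so stopping
  for it may come after the flow from \<open>z\<close> is absorbed. The bound on the motion in
  between is uniform over stopping times: counterexamples with \<open>h = 1 / (k + 1)\<close> would
  contradict right-continuity at \<open>a\<close>, by dominated convergence.\<close>

lemma overshoot_small: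
  assumes z: "z \<in> strip T i" and \<delta>: "0 < \<delta>"
  defines "a \<equiv> T - z $ i"
  obtains h where "0 < h" "\<And>\<tau>. stopping_time F \<tau> \<Longrightarrow> (\<And>\<omega>. \<tau> \<omega> \<le> ennreal (a + h)) \<Longrightarrow> (\<And>\<omega>. \<tau> \<omega> \<le> ennreal T) \<Longrightarrow>
    integrable M (stopval (\<lambda>u \<omega>. norm (X u z \<omega> - X (min u a) z \<omega>)) \<tau>) \<and>
    (\<integral>\<omega>. stopval (\<lambda>u \<omega>. norm (X u z \<omega> - X (min u a) z \<omega>)) \<tau> \<omega> \<partial>M) \<le> \<delta>"
proof -
  let ?N = "\<lambda>u \<omega>. norm (X u z \<omega> - X (min u a) z \<omega>)"
  have a: "0 \<le> a" "a \<le> T" using horizon_bounds[OF z] by (auto simp: a_def)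
  have rc: "rc_process ?N" by (rule rc_process_overshoot[OF a(1)])
  obtain B where B: "integrable M B" "\<And>\<omega>. 0 \<le> B \<omega>" "AE \<omega> in M. \<forall>t. 0 \<le> t \<and> t \<le> T \<longrightarrow> norm (X t z \<omega>) \<le> B \<omega>"
    using norm_dominated[OF z] by blast
  have bound: "AE \<omega> in M. norm (stopval ?N \<tau> \<omega>) \<le> 2 * B \<omega>" if \<tau>: "\<And>\<omega>. \<tau> \<omega> \<le> ennreal T" for \<tau>
    using B(3)
  proof eventually_elim
    case (elim \<omega>)
    define t where "t = enn2real (\<tau> \<omega>)"
    have "0 \<le> t" "t \<le> T" using \<tau>[of \<omega>] T_nonneg by (auto simp: t_def enn2real_leI)
    then have "norm (X t z \<omega>) \<le> B \<omega>" "norm (X (min t a) z \<omega>) \<le> B \<omega>" using elim a by auto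
    then show ?case
      using norm_triangle_ineq4[of "X t z \<omega>" "X (min t a) z \<omega>"] B(2)[of \<omega>] by (auto simp: stopval_def t_def)
  qed
  have int: "integrable M (stopval ?N \<tau>)" if "stopping_time F \<tau>" "\<And>\<omega>. \<tau> \<omega> \<le> ennreal T" for \<tau>
  proof (rule Bochner_Integration.integrable_bound)
    show "integrable M (\<lambda>\<omega>. 2 * B \<omega>)" using B(1) by simp
    show "stopval ?N \<tau> \<in> borel_measurable M" by (rule stopval_measurable[OF rc that(1)])
    show "AE \<omega> in M. norm (stopval ?N \<tau> \<omega>) \<le> norm (2 * B \<omega>)"
      using bound[of \<tau>, OF that(2)] by eventually_elim auto
  qed
  have "\<exists>h>0. \<forall>\<tau>. stopping_time F \<tau> \<longrightarrow> (\<forall>\<omega>. \<tau> \<omega> \<le> ennreal (a + h)) \<longrightarrow> (\<forall>\<omega>. \<tau> \<omega> \<le> ennreal T) \<longrightarrow>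
      (\<integral>\<omega>. stopval ?N \<tau> \<omega> \<partial>M) \<le> \<delta>"
  proof (rule ccontr)
    assume neg: "\<not> ?thesis"
    have "\<forall>k::nat. \<exists>\<tau>. stopping_time F \<tau> \<and> (\<forall>\<omega>. \<tau> \<omega> \<le> ennreal (a + 1 / real (Suc k))) \<and> (\<forall>\<omega>. \<tau> \<omega> \<le> ennreal T) \<and>
      \<delta> < (\<integral>\<omega>. stopval ?N \<tau> \<omega> \<partial>M)"
    proof
      fix k :: nat
      have "0 < 1 / real (Suc k)" by simp
      with neg show "\<exists>\<tau>. stopping_time F \<tau> \<and> (\<forall>\<omega>. \<tau> \<omega> \<le> ennreal (a + 1 / real (Suc k))) \<and> (\<forall>\<omega>. \<tau> \<omega> \<le> ennreal T) \<and>
        \<delta> < (\<integral>\<omega>. stopval ?N \<tau> \<omega> \<partial>M)"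
        unfolding not_ex not_all not_imp not_le de_Morgan_conj by blast
    qed
    from choice[OF this] obtain \<tau> where *: "\<forall>k::nat. stopping_time F (\<tau> k) \<and> (\<forall>\<omega>. \<tau> k \<omega> \<le> ennreal (a + 1 / real (Suc k))) \<and>
      (\<forall>\<omega>. \<tau> k \<omega> \<le> ennreal T) \<and> \<delta> < (\<integral>\<omega>. stopval ?N (\<tau> k) \<omega> \<partial>M)" ..
    then have \<tau>: "stopping_time F (\<tau> k)" "\<tau> k \<omega> \<le> ennreal (a + 1 / real (Suc k))"
      "\<tau> k \<omega> \<le> ennreal T" "\<delta> < (\<integral>\<omega>. stopval ?N (\<tau> k) \<omega> \<partial>M)" for k \<omega> by blast+
    have "(\<lambda>k. \<integral>\<omega>. stopval ?N (\<tau> k) \<omega> \<partial>M) \<longlonglongrightarrow> (\<integral>\<omega>. 0 \<partial>M)"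
    proof (rule integral_dominated_convergence[where w="\<lambda>\<omega>. 2 * B \<omega>"])
      show "AE \<omega> in M. norm (stopval ?N (\<tau> k) \<omega>) \<le> 2 * B \<omega>" for k by (rule bound[OF \<tau>(3)])
      show "AE \<omega> in M. (\<lambda>k. stopval ?N (\<tau> k) \<omega>) \<longlonglongrightarrow> 0"
        using X_right_continuous[of z]
      proof eventually_elim
        case (elim \<omega>)
        show ?case
        proof (rule tendstoI)
          fix e :: real assume e: "0 < e"
          have "((\<lambda>s. X s z \<omega>) \<longlongrightarrow> X a z \<omega>) (at_right a)" using elim a by (simp add: continuous_within)
          from tendstoD[OF this e] obtain b where b: "a < b" "\<And>s. a < s \<Longrightarrow> s < b \<Longrightarrow> dist (X s z \<omega>) (X a z \<omega>) < e"
            by (auto simp: eventually_at_right_field)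
          have "(\<lambda>k. a + 1 / real (Suc k)) \<longlonglongrightarrow> a + 0"
            by (intro tendsto_intros LIMSEQ_Suc[OF lim_1_over_n])
          from order_tendstoD(2)[OF this, of b] b(1)
          have "\<forall>\<^sub>F k in sequentially. a + 1 / real (Suc k) < b" by simp
          then show "\<forall>\<^sub>F k in sequentially. dist (stopval ?N (\<tau> k) \<omega>) 0 < e"
          proof eventually_elim
            case (elim k)
            define t where "t = enn2real (\<tau> k \<omega>)"
            have "0 \<le> a + 1 / real (Suc k)" using a(1) by (intro add_nonneg_nonneg) auto
            then have "t \<le> a + 1 / real (Suc k)" unfolding t_def by (intro enn2real_leI \<tau>(2))
            then have t: "t < b" using elim by simp
            have "\<tau> k \<omega> \<noteq> \<infinity>" using \<tau>(3)[of k \<omega>] by (auto simp: top_unique)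
            then have s: "stopval ?N (\<tau> k) \<omega> = ?N t \<omega>" by (simp add: stopval_def t_def)
            have "?N t \<omega> < e"
            proof (cases "a < t")
              case True
              then show ?thesis using b(2)[OF True t] by (simp add: dist_norm)
            qed (use e in simp)
            then show ?case unfolding s by simp
          qed
        qed
      qed
    qed (use int[OF \<tau>(1,3)] B(1) in auto)
    then have "(\<lambda>k. \<integral>\<omega>. stopval ?N (\<tau> k) \<omega> \<partial>M) \<longlonglongrightarrow> 0" by simp
    from order_tendstoD(2)[OF this \<delta>] obtain k where "(\<integral>\<omega>. stopval ?N (\<tau> k) \<omega> \<partial>M) < \<delta>"
      by (auto simp: eventually_sequentially)
    with \<tau>(4)[of k] show False by simp
  qed
  then obtain h where h: "0 < h" "\<And>\<tau>. stopping_time F \<tau> \<Longrightarrow> (\<And>\<omega>. \<tau> \<omega> \<le> ennreal (a + h)) \<Longrightarrow> (\<And>\<omega>. \<tau> \<omega> \<le> ennreal T) \<Longrightarrow>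
      (\<integral>\<omega>. stopval ?N \<tau> \<omega> \<partial>M) \<le> \<delta>" by blast
  show ?thesis by (rule that[OF h(1)]) (intro conjI int h(2))
qed

lemma flow_L1_dominated:
  assumes zs: "\<And>n. zs n \<in> strip T i" and z: "z \<in> strip T i" and lim: "zs \<longlonglongrightarrow> z" and \<delta>: "0 < \<delta>"
  shows "\<forall>\<^sub>F n in sequentially. \<exists>B. integrable M B \<and> (\<forall>\<omega>. 0 \<le> B \<omega>) \<and>
    (AE \<omega> in M. \<forall>t. 0 \<le> t \<and> t \<le> T \<longrightarrow> exp (- r * t) * norm (X t (zs n) \<omega> - X t z \<omega>) \<le> B \<omega>) \<and> (\<integral>\<omega>. B \<omega> \<partial>M) \<le> \<delta>"
proof -
  let ?Y = "\<lambda>n t \<omega>. exp (- r * t) * norm (X t (zs n) \<omega> - X t z \<omega>)"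
  have "\<forall>\<^sub>F n in sequentially. (\<integral>\<^sup>+\<omega>. (SUP t\<in>{0..T}. ennreal (?Y n t \<omega>)) \<partial>M) < ennreal \<delta>"
    by (rule order_tendstoD(2)[OF flow_L1_continuous[OF zs z lim]]) (use \<delta> in simp)
  then show ?thesis
  proof eventually_elim
    case (elim n)
    have rc: "rc_process (?Y n)"
      unfolding rc_process_def
    proof (intro conjI allI impI)
      show "?Y n t \<in> borel_measurable (F (ennreal t))" if "0 \<le> t" for t
        using X_adapted[OF that, of "zs n"] X_adapted[OF that, of z] by measurable
      show "AE \<omega> in M. \<forall>t\<ge>0. continuous (at_right t) (\<lambda>s. ?Y n s \<omega>)"
        using X_right_continuous[of z] X_right_continuous[of "zs n"]
        by eventually_elim (auto intro!: continuous_intros)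
    qed
    have fin: "(\<integral>\<^sup>+\<omega>. (SUP t\<in>{0..T}. ennreal (?Y n t \<omega>)) \<partial>M) < \<infinity>"
      using elim by (rule less_trans) simp
    obtain B where B: "integrable M B" "\<And>\<omega>. 0 \<le> B \<omega>" "AE \<omega> in M. \<forall>t. 0 \<le> t \<and> t \<le> T \<longrightarrow> ?Y n t \<omega> \<le> B \<omega>"
      "(\<integral>\<omega>. B \<omega> \<partial>M) \<le> enn2real (\<integral>\<^sup>+\<omega>. (SUP t\<in>{0..T}. ennreal (?Y n t \<omega>)) \<partial>M)"
      by (rule stopped_dominated[OF rc fin]) blast
    have "enn2real (\<integral>\<^sup>+\<omega>. (SUP t\<in>{0..T}. ennreal (?Y n t \<omega>)) \<partial>M) \<le> \<delta>"
      using elim \<delta> by (intro enn2real_leI) auto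
    with B show ?case by (intro exI[of _ B]) auto
  qed
qed

text \<open>The left limit of the distribution function at \<open>a\<close> is the mass of the open
  half-line below \<open>a\<close>, and continuity identifies it with \<open>cdf D a\<close>. The
  point \<open>0\<close> is excluded because an atom is allowed there.\<close>

lemma D_atomless:
  assumes "0 < a" "a \<le> T" shows "measure D {a} = 0"
proof -
  have "continuous_on {0..a} (cdf D)" by (rule continuous_on_subset[OF cdf_continuous]) (use assms in auto)
  then have "(cdf D \<longlongrightarrow> cdf D a) (at a within {0..a})" using assms by (simp add: continuous_on)
  then have 1: "(cdf D \<longlongrightarrow> cdf D a) (at_left a)" using at_within_Icc_at_left[OF assms(1)] by simp
  have "measure D {..<a} = cdf D a"
    by (rule tendsto_unique[OF _ law.cdf_at_left 1]) simp
  then have "measure D {..a} = measure D {..<a}" by (simp add: cdf_def)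
  moreover have "measure D {..a} = measure D {..<a} + measure D {a}"
  proof -
    have "{..a} = {..<a} \<union> {a}" by auto
    then show ?thesis using law.finite_measure_Union[of "{..<a}" "{a}"] by simp
  qed
  ultimately show ?thesis by simp
qed

lemma recursive_stopping_fin:
  obtains \<kappa> where "recursive_stopping M F Xa (strip T i) weight r \<kappa> D p \<phi> \<psi> (J_fin T i)"
proof -
  obtain \<kappa> where "weighted_flow M F Xa (strip T i) weight r \<kappa>" by (rule weighted_flow_fin)
  then interpret wf: weighted_flow M F Xa "strip T i" weight r \<kappa> .
  define a where "a z = T - z $ i" for z :: "real^'d"
  have a: "0 \<le> a z" "a z \<le> T" if "z \<in> strip T i" for z using horizon_bounds[OF that] by (auto simp: a_def)
  have Xa: "Xa t z = X (min t (a z)) z" for t z by (simp add: Xa_def a_def)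
  have alim: "(\<lambda>n. a (zs n)) \<longlonglongrightarrow> a z" if "zs \<longlonglongrightarrow> z" for zs z
    unfolding a_def by (intro tendsto_intros tendsto_vec_nth that)
  have "recursive_stopping M F Xa (strip T i) weight r \<kappa> D p \<phi> \<psi> (J_fin T i)"
  proof unfold_locales
    show "continuous_on (strip T i) (wf.P s f)" if f: "wf.adm f" and s: "0 \<le> s" for f s
      unfolding continuous_on_sequentially
    proof safe
      fix z zs assume z: "z \<in> strip T i" and zs: "\<forall>n. zs n \<in> strip T i" and lim: "zs \<longlonglongrightarrow> z"
      \<comment> \<open>At time \<open>s\<close> the absorbed flows from \<open>zs n\<close> and
        \<open>z\<close> are the original ones at times \<open>u n\<close> and \<open>u0\<close>.
        Their distance splits into a change of time for the flow from \<open>z\<close> and a change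
        of starting point at the common time \<open>u n\<close>.\<close>
      define u where "u n = min s (a (zs n))" for n
      define u0 where "u0 = min s (a z)"
      have u: "0 \<le> u n" "u n \<le> T" "u n \<le> s" for n using s a[of "zs n"] zs by (auto simp: u_def min_le_iff_disj)
      have u0: "0 \<le> u0" "u0 \<le> T" using s a[OF z] by (auto simp: u0_def min_le_iff_disj)
      have ulim: "u \<longlonglongrightarrow> u0" unfolding u_def[abs_def] u0_def by (intro tendsto_min tendsto_const alim lim)
      have "(\<lambda>n. wf.reward f (zs n) (\<lambda>_. ennreal s)) \<longlonglongrightarrow> wf.reward f z (\<lambda>_. ennreal s)"
      proof (rule tendstoI)
        fix e :: real assume e: "0 < e"
        then have e2: "0 < e / 2" by simp
        obtain \<delta> where \<delta>: "0 < \<delta>"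
          "\<And>y \<tau> B. y \<in> strip T i \<Longrightarrow> stopping_time F \<tau> \<Longrightarrow> integrable M B \<Longrightarrow> (\<And>\<omega>. 0 \<le> B \<omega>) \<Longrightarrow>
          (AE \<omega> in M. \<tau> \<omega> < \<infinity> \<longrightarrow> exp (- r * enn2real (\<tau> \<omega>)) * dist (Xa (enn2real (\<tau> \<omega>)) z \<omega>) (Xa (enn2real (\<tau> \<omega>)) y \<omega>) \<le> B \<omega>) \<Longrightarrow>
          (\<integral>\<omega>. B \<omega> \<partial>M) \<le> \<delta> \<Longrightarrow> \<bar>wf.reward f y \<tau> - wf.reward f z \<tau>\<bar> \<le> e / 2"
          using wf.reward_close[OF f z e2] by blast
        have d2: "0 < \<delta> / 2" using \<delta> by simp
        have ev1: "\<forall>\<^sub>F n in sequentially. (\<integral>\<omega>. norm (X (u n) z \<omega> - X u0 z \<omega>) \<partial>M) < \<delta> / 2"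
          by (rule order_tendstoD(2)[OF X_L1_continuous_time[OF z u0 u(1,2) ulim] d2])
        show "\<forall>\<^sub>F n in sequentially. dist (wf.reward f (zs n) (\<lambda>_. ennreal s)) (wf.reward f z (\<lambda>_. ennreal s)) < e"
          using flow_L1_dominated[OF zs[rule_format] z lim d2] ev1
        proof eventually_elim
          case (elim n)
          then obtain B where B: "integrable M B" "\<And>\<omega>. 0 \<le> B \<omega>"
            "AE \<omega> in M. \<forall>t. 0 \<le> t \<and> t \<le> T \<longrightarrow> exp (- r * t) * norm (X t (zs n) \<omega> - X t z \<omega>) \<le> B \<omega>"
            "(\<integral>\<omega>. B \<omega> \<partial>M) \<le> \<delta> / 2" by blast
          let ?N = "\<lambda>\<omega>. norm (X (u n) z \<omega> - X u0 z \<omega>)"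
          have iN: "integrable M ?N"
          proof -
            obtain K where K: "integrable M K" "AE \<omega> in M. \<forall>t. 0 \<le> t \<and> t \<le> T \<longrightarrow> norm (X t z \<omega>) \<le> K \<omega>"
              using norm_dominated[OF z] by blast
            have "AE \<omega> in M. norm (X t z \<omega>) \<le> norm (K \<omega>)" if "0 \<le> t" "t \<le> T" for t
              using K(2) by eventually_elim (use that in fastforce)
            then have "integrable M (X t z)" if "0 \<le> t" "t \<le> T" for t
              using that Bochner_Integration.integrable_bound[OF K(1) X_measurable[OF that(1)]] by simp
            then show ?thesis
              using u u0 by (intro integrable_norm Bochner_Integration.integrable_diff) blast+
          qed
          have "\<bar>wf.reward f (zs n) (\<lambda>_. ennreal s) - wf.reward f z (\<lambda>_. ennreal s)\<bar> \<le> e / 2"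
          proof (rule \<delta>(2)[OF _ stopping_time_const, of _ "\<lambda>\<omega>. ?N \<omega> + B \<omega>"])
            show "zs n \<in> strip T i" using zs by simp
            show "integrable M (\<lambda>\<omega>. ?N \<omega> + B \<omega>)" using iN B(1) by simp
            show "0 \<le> ?N \<omega> + B \<omega>" for \<omega> using B(2)[of \<omega>] by simp
            show "(\<integral>\<omega>. ?N \<omega> + B \<omega> \<partial>M) \<le> \<delta>" using iN B(1,4) elim by simp
            show "AE \<omega> in M. ennreal s < \<infinity> \<longrightarrow> exp (- r * enn2real (ennreal s)) *
               dist (Xa (enn2real (ennreal s)) z \<omega>) (Xa (enn2real (ennreal s)) (zs n) \<omega>) \<le> ?N \<omega> + B \<omega>"
              using B(3)
            proof eventually_elim
              case (elim \<omega>)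
              have e1: "exp (- r * s) \<le> 1" "exp (- r * s) \<le> exp (- r * u n)" using s r_pos u(3)[of n] by auto
              have "exp (- r * s) * dist (Xa s z \<omega>) (Xa s (zs n) \<omega>)
                  \<le> exp (- r * s) * (?N \<omega> + norm (X (u n) (zs n) \<omega> - X (u n) z \<omega>))"
                using dist_triangle[of "X u0 z \<omega>" "X (u n) (zs n) \<omega>" "X (u n) z \<omega>"]
                by (intro mult_left_mono) (auto simp: Xa u_def u0_def dist_norm norm_minus_commute)
              also have "\<dots> = exp (- r * s) * ?N \<omega> + exp (- r * s) * norm (X (u n) (zs n) \<omega> - X (u n) z \<omega>)"
                by (rule distrib_left)
              also have "\<dots> \<le> 1 * ?N \<omega> + exp (- r * u n) * norm (X (u n) (zs n) \<omega> - X (u n) z \<omega>)"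
                using e1 by (intro add_mono mult_right_mono) auto
              also have "\<dots> \<le> ?N \<omega> + B \<omega>" using elim u by auto
              finally show ?case using s by simp
            qed
          qed
          then show ?case using e by (simp add: dist_real_def)
        qed
      qed
      then have "(\<lambda>n. exp (r * s) * wf.reward f (zs n) (\<lambda>_. ennreal s)) \<longlonglongrightarrow> exp (r * s) * wf.reward f z (\<lambda>_. ennreal s)"
        by (intro tendsto_mult tendsto_const)
      then show "(wf.P s f \<circ> zs) \<longlonglongrightarrow> wf.P s f z"
        using s by (simp add: wf.reward_const comp_def mult.assoc[symmetric] flip: exp_add)
    qed
    show "\<forall>\<^sub>F n in sequentially. \<forall>\<tau>. stopping_time F \<tau> \<longrightarrow>
         (\<exists>\<tau>'. stopping_time F \<tau>' \<and> wf.reward g (zs n) \<tau> \<le> wf.reward g z \<tau>' + e)"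
      if g: "wf.adm g" and z: "z \<in> strip T i" and zs: "\<And>n. zs n \<in> strip T i" and lim: "zs \<longlonglongrightarrow> z" and e: "0 < e" for g zs z e
    proof -
      obtain \<delta> where \<delta>: "0 < \<delta>"
          "\<And>y \<tau> B. y \<in> strip T i \<Longrightarrow> stopping_time F \<tau> \<Longrightarrow> integrable M B \<Longrightarrow> (\<And>\<omega>. 0 \<le> B \<omega>) \<Longrightarrow>
          (AE \<omega> in M. \<tau> \<omega> < \<infinity> \<longrightarrow> exp (- r * enn2real (\<tau> \<omega>)) * dist (Xa (enn2real (\<tau> \<omega>)) z \<omega>) (Xa (enn2real (\<tau> \<omega>)) y \<omega>) \<le> B \<omega>) \<Longrightarrow>
          (\<integral>\<omega>. B \<omega> \<partial>M) \<le> \<delta> \<Longrightarrow> \<bar>wf.reward g y \<tau> - wf.reward g z \<tau>\<bar> \<le> e"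
        using wf.reward_close[OF g z e] by blast
      have d2: "0 < \<delta> / 2" using \<delta> by simp
      let ?N = "\<lambda>u \<omega>. norm (X u z \<omega> - X (min u (a z)) z \<omega>)"
      obtain h where h: "0 < h" "\<And>\<tau>. stopping_time F \<tau> \<Longrightarrow> (\<And>\<omega>. \<tau> \<omega> \<le> ennreal (a z + h)) \<Longrightarrow> (\<And>\<omega>. \<tau> \<omega> \<le> ennreal T) \<Longrightarrow>
          integrable M (stopval ?N \<tau>) \<and> (\<integral>\<omega>. stopval ?N \<tau> \<omega> \<partial>M) \<le> \<delta> / 2"
        by (rule overshoot_small[OF z d2, folded a_def]) blast
      have "a z < a z + h" using h by simp
      from flow_L1_dominated[OF zs z lim d2] order_tendstoD(2)[OF alim[OF lim] this]
      show ?thesis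
      proof eventually_elim
        case (elim n)
        then obtain B where B: "integrable M B" "\<And>\<omega>. 0 \<le> B \<omega>"
            "AE \<omega> in M. \<forall>t. 0 \<le> t \<and> t \<le> T \<longrightarrow> exp (- r * t) * norm (X t (zs n) \<omega> - X t z \<omega>) \<le> B \<omega>"
            "(\<integral>\<omega>. B \<omega> \<partial>M) \<le> \<delta> / 2" by blast
        note an = a[OF zs[of n]]
        show ?case
        proof (intro allI impI)
          fix \<tau> assume \<tau>: "stopping_time F \<tau>"
          \<comment> \<open>Up to the lifetime of \<open>zs n\<close> the flow from
            \<open>zs n\<close> is not yet absorbed, so its distance to the absorbed flow from
            \<open>z\<close> splits into the distance of the original flows and the overshoot of
            \<open>z\<close> beyond its own lifetime.\<close>
          define \<tau>' where "\<tau>' \<omega> = min (\<tau> \<omega>) (ennreal (a (zs n)))" for \<omega>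
          have st: "stopping_time F \<tau>'" unfolding \<tau>'_def[abs_def] by (rule stopping_time_min[OF \<tau> stopping_time_const])
          have le: "\<tau>' \<omega> \<le> ennreal (a (zs n))" for \<omega> by (simp add: \<tau>'_def)
          have N: "integrable M (stopval ?N \<tau>')" "(\<integral>\<omega>. stopval ?N \<tau>' \<omega> \<partial>M) \<le> \<delta> / 2"
            using h(2)[OF st] order_trans[OF le ennreal_leI] elim(2) an by auto
          have "wf.reward g (zs n) \<tau> \<le> wf.reward g (zs n) \<tau>'"
            unfolding wf.reward_def
          proof (rule integral_mono_AE[OF wf.reward_integrable[OF g zs \<tau>] wf.reward_integrable[OF g zs st]])
            show "AE \<omega> in M. stopval (wf.disc g (zs n)) \<tau> \<omega> \<le> stopval (wf.disc g (zs n)) \<tau>' \<omega>"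
              using wf.X_in_S[OF zs[of n]]
            proof eventually_elim
              case (elim \<omega>)
              show ?case
              proof (cases "\<tau> \<omega> \<le> ennreal (a (zs n))")
                case True
                then show ?thesis by (simp add: stopval_def \<tau>'_def min_absorb1)
              next
                case False
                then have \<tau>'a: "\<tau>' \<omega> = ennreal (a (zs n))" by (simp add: \<tau>'_def min_def)
                have gn: "0 \<le> g (Xa (a (zs n)) (zs n) \<omega>)" using elim an wf.adm_nonneg[OF g] by auto
                have s': "stopval (wf.disc g (zs n)) \<tau>' \<omega> = exp (- r * a (zs n)) * g (Xa (a (zs n)) (zs n) \<omega>)"
                  using an by (simp add: stopval_def \<tau>'a wf.disc_def)
                show ?thesis
                proof (cases "\<tau> \<omega>")
                  case (real t)
                  then have "a (zs n) \<le> t" using False an by (simp add: ennreal_le_iff)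
                  then have "stopval (wf.disc g (zs n)) \<tau> \<omega> = exp (- r * t) * g (Xa (a (zs n)) (zs n) \<omega>)"
                    using real by (simp add: stopval_def wf.disc_def Xa)
                  then show ?thesis unfolding s' using \<open>a (zs n) \<le> t\<close> r_pos gn by (simp add: mult_right_mono)
                next
                  case top
                  then show ?thesis unfolding s' using gn by (simp add: stopval_def)
                qed
              qed
            qed
          qed
          moreover have "\<bar>wf.reward g (zs n) \<tau>' - wf.reward g z \<tau>'\<bar> \<le> e"
          proof (rule \<delta>(2)[OF zs st, of "\<lambda>\<omega>. stopval ?N \<tau>' \<omega> + B \<omega>"])
            show "integrable M (\<lambda>\<omega>. stopval ?N \<tau>' \<omega> + B \<omega>)" using N B(1) by simp
            show "0 \<le> stopval ?N \<tau>' \<omega> + B \<omega>" for \<omega> using B(2)[of \<omega>] by (simp add: stopval_def)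
            show "(\<integral>\<omega>. stopval ?N \<tau>' \<omega> + B \<omega> \<partial>M) \<le> \<delta>" using N B(1,4) by simp
            show "AE \<omega> in M. \<tau>' \<omega> < \<infinity> \<longrightarrow> exp (- r * enn2real (\<tau>' \<omega>)) *
               dist (Xa (enn2real (\<tau>' \<omega>)) z \<omega>) (Xa (enn2real (\<tau>' \<omega>)) (zs n) \<omega>) \<le> stopval ?N \<tau>' \<omega> + B \<omega>"
              using B(3)
            proof eventually_elim
              case (elim \<omega>)
              show ?case
              proof
                assume fin: "\<tau>' \<omega> < \<infinity>"
                define t where "t = enn2real (\<tau>' \<omega>)"
                have ta: "t \<le> a (zs n)" unfolding t_def by (rule enn2real_leI[OF an(1) le])
                have t: "0 \<le> t" "t \<le> a (zs n)" "t \<le> T" using ta an by (auto simp: t_def)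
                have e1: "exp (- r * t) \<le> 1" using t r_pos by simp
                have "exp (- r * t) * dist (Xa t z \<omega>) (Xa t (zs n) \<omega>)
                  \<le> exp (- r * t) * (?N t \<omega> + norm (X t (zs n) \<omega> - X t z \<omega>))"
                  using dist_triangle[of "X (min t (a z)) z \<omega>" "X t (zs n) \<omega>" "X t z \<omega>"] t(2)
                  by (intro mult_left_mono) (auto simp: Xa dist_norm norm_minus_commute)
                also have "\<dots> = exp (- r * t) * ?N t \<omega> + exp (- r * t) * norm (X t (zs n) \<omega> - X t z \<omega>)"
                  by (rule distrib_left)
                also have "\<dots> \<le> 1 * ?N t \<omega> + B \<omega>"
                  using e1 elim t by (intro add_mono mult_right_mono) auto
                also have "\<dots> = stopval ?N \<tau>' \<omega> + B \<omega>" using fin by (simp add: stopval_def t_def)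
                finally show "exp (- r * enn2real (\<tau>' \<omega>)) *
                  dist (Xa (enn2real (\<tau>' \<omega>)) z \<omega>) (Xa (enn2real (\<tau>' \<omega>)) (zs n) \<omega>) \<le> stopval ?N \<tau>' \<omega> + B \<omega>"
                  by (simp add: t_def)
              qed
            qed
          qed
          ultimately show "\<exists>\<tau>'. stopping_time F \<tau>' \<and> wf.reward g (zs n) \<tau> \<le> wf.reward g z \<tau>' + e"
            using st by (intro exI[of _ \<tau>']) auto
        qed
      qed
    qed
    show "0 < p" "p < 1" by (rule p_pos, rule p_less_1)
    show "wf.adm \<phi>" "wf.adm \<psi>"
      using phi_in psi_in unfolding A_space_iff wf.adm_def weight_def by auto
    show "AE s in D. (\<lambda>n. indicator (J_fin T i (zs n)) s :: real) \<longlonglongrightarrow> indicator (J_fin T i z) s"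
      if zs: "\<And>n. zs n \<in> strip T i" and z: "z \<in> strip T i" and lim: "zs \<longlonglongrightarrow> z" for zs z
    proof -
      \<comment> \<open>The indicators can fail to converge only at the moving end point
        \<open>s = a z\<close>. This point is null if positive; if it is \<open>0\<close>, then
        \<open>s = 0\<close> lies in all the intervals.\<close>
      have "AE s in D. s = a z \<longrightarrow> a z = 0"
      proof (cases "a z = 0")
        case False
        then have "measure D {a z} = 0" using a[OF z] by (intro D_atomless) auto
        then have "emeasure D {a z} = 0" by (simp add: law.emeasure_eq_measure)
        then have "{a z} \<in> null_sets D" by (simp add: null_sets_def)
        from AE_not_in[OF this] show ?thesis by eventually_elim simp
      qed simp
      then show ?thesis
        using D_nonneg
      proof eventually_elim
        case (elim s)
        have "\<forall>\<^sub>F n in sequentially. (indicator (J_fin T i z) s :: real) = indicator (J_fin T i (zs n)) s"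
        proof (cases s "a z" rule: linorder_cases)
          case less
          from order_tendstoD(1)[OF alim[OF lim] this] show ?thesis
            by eventually_elim (use less elim in \<open>auto simp: indicator_def a_def\<close>)
        next
          case greater
          from order_tendstoD(2)[OF alim[OF lim] this] show ?thesis
            by eventually_elim (use greater elim in \<open>auto simp: indicator_def a_def\<close>)
        next
          case equal
          then have "s = 0" "a z = 0" using elim by auto
          then show ?thesis using a(1)[OF zs] by (simp add: indicator_def a_def)
        qed
        then show ?case by (rule Lim_transform_eventually[OF tendsto_const])
      qed
    qed
  qed auto
  then show ?thesis by (rule that)
qed

text \<open>The integral runs only over times up to absorption, where both flows coincide.\<close>

lemma obstacle_absorbed: "obstacle M X D r p \<phi> \<psi> (J_fin T i) f z = obstacle M Xa D r p \<phi> \<psi> (J_fin T i) f z"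
proof -
  have "(LINT s:J_fin T i z|D. exp (- r * s) * (LINT \<omega>|M. p * \<psi> (X s z \<omega>) + (1 - p) * f (X s z \<omega>))) =
      (LINT s:J_fin T i z|D. exp (- r * s) * (LINT \<omega>|M. p * \<psi> (Xa s z \<omega>) + (1 - p) * f (Xa s z \<omega>)))"
    unfolding set_lebesgue_integral_def
    by (rule Bochner_Integration.integral_cong) (auto simp: indicator_def Xa_eq)
  then show ?thesis by (simp add: obstacle_def Lambda_def)
qed

lemma disc_eval_absorbed:
  assumes "z \<in> strip T i" "t \<le> ennreal (T - z $ i)"
  shows "disc_eval r f (\<lambda>s. X s z \<omega>) t = disc_eval r f (\<lambda>s. Xa s z \<omega>) t"
proof -
  have "t < \<infinity>" using assms(2) by (auto simp: less_top[symmetric] top_unique)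
  moreover have "enn2real t \<le> T - z $ i"
    using assms horizon_bounds[of z] by (intro enn2real_leI) auto
  ultimately show ?thesis by (simp add: disc_eval_finite Xa_eq)
qed

lemma finite_horizon_result:
  shows "\<exists>!v. v \<in> A_fin T i \<and> value_eq_fin M F X D r p \<phi> \<psi> T i v"
    and "v \<in> A_fin T i \<Longrightarrow> value_eq_fin M F X D r p \<phi> \<psi> T i v \<Longrightarrow> z \<in> strip T i \<Longrightarrow>
        let g = obstacle M X D r p \<phi> \<psi> (J_fin T i) v;
            \<tau>s = tau_star X v g (J_fin T i) z;
            Y = (\<lambda>s \<omega>. disc_eval r v (\<lambda>u. X u z \<omega>) s);
            Z = (\<lambda>s \<omega>. disc_eval r v (\<lambda>u. X u z \<omega>) (min s (\<tau>s \<omega>)));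
            I = {0..ennreal (T - z $ i)}
        in optimal_in M X r g z (stops_fin M F T i z) \<tau>s \<and>
           supermartingale_on M F I Y \<and>
           right_continuous_on M I Y \<and> nonneg_on M I Y \<and>
           martingale_on M F I Z \<and>
           right_continuous_on M I Z \<and> nonneg_on M I Z" (is "_ \<Longrightarrow> _ \<Longrightarrow> _ \<Longrightarrow> ?claim")
proof -
  obtain \<kappa> where "recursive_stopping M F Xa (strip T i) weight r \<kappa> D p \<phi> \<psi> (J_fin T i)" by (rule recursive_stopping_fin)
  then interpret rs: recursive_stopping M F Xa "strip T i" weight r \<kappa> D p \<phi> \<psi> "J_fin T i" .
  have adm: "rs.adm v" if "v \<in> A_fin T i" for v
    using that unfolding A_space_iff rs.adm_def weight_def by auto
  have obst: "obstacle M X D r p \<phi> \<psi> (J_fin T i) f = rs.obst f" for f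
    using obstacle_absorbed rs.obstacle_eq_obst by (metis ext)
  have stop_le: "stop_reward M X r g z \<tau> = stop_reward M Xa r g z \<tau>"
    if z: "z \<in> strip T i" and \<tau>: "AE \<omega> in M. \<tau> \<omega> \<le> ennreal (T - z $ i)" for g z \<tau>
    unfolding stop_reward_def
    by (rule nn_integral_cong_AE) (use \<tau> in \<open>eventually_elim, simp add: disc_eval_absorbed[OF z]\<close>)
  have cap: "stop_reward M Xa r g z \<tau> \<le> stop_reward M Xa r g z (\<lambda>\<omega>. min (\<tau> \<omega>) (ennreal (T - z $ i)))"
    if g: "rs.adm g" and z: "z \<in> strip T i" for g z \<tau>
    unfolding stop_reward_def
  proof (rule nn_integral_mono_AE)
    show "AE \<omega> in M. ennreal (disc_eval r g (\<lambda>s. Xa s z \<omega>) (\<tau> \<omega>)) \<le> ennreal (disc_eval r g (\<lambda>s. Xa s z \<omega>) (min (\<tau> \<omega>) (ennreal (T - z $ i))))"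
      using rs.X_in_S[OF z]
    proof eventually_elim
      case (elim \<omega>)
      define a where "a = T - z $ i"
      have a: "0 \<le> a" using horizon_bounds[OF z] by (simp add: a_def)
      show ?case
      proof (cases "\<tau> \<omega> \<le> ennreal a")
        case True
        then show ?thesis by (simp add: a_def min_absorb1)
      next
        case False
        have ga: "0 \<le> g (Xa a z \<omega>)" using elim a rs.adm_nonneg[OF g] by auto
        have m: "min (\<tau> \<omega>) (ennreal a) = ennreal a" using False by simp
        have "disc_eval r g (\<lambda>s. Xa s z \<omega>) (\<tau> \<omega>) \<le> exp (- r * a) * g (Xa a z \<omega>)"
        proof (cases "\<tau> \<omega>")
          case (real t)
          then have "a \<le> t" using False a by (simp add: ennreal_le_iff)
          moreover from this have "Xa t z \<omega> = Xa a z \<omega>" by (simp add: Xa_def a_def)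
          ultimately show ?thesis using real ga r_pos by (simp add: disc_eval_finite mult_right_mono)
        next
          case top
          then show ?thesis using ga by simp
        qed
        then show ?thesis using a unfolding a_def[symmetric] m by (simp add: disc_eval_finite ennreal_leI)
      qed
    qed
  qed
  have SUP: "(SUP \<tau>\<in>stops_fin M F T i z. stop_reward M X r g z \<tau>) = ennreal (rs.optval g z)"
    if g: "rs.adm g" and z: "z \<in> strip T i" for g z
  proof (rule antisym)
    show "(SUP \<tau>\<in>stops_fin M F T i z. stop_reward M X r g z \<tau>) \<le> ennreal (rs.optval g z)"
      unfolding rs.SUP_stop_reward[OF g z, symmetric]
      by (rule SUP_mono) (use stop_le[OF z] in \<open>auto intro!: eq_refl\<close>)
    show "ennreal (rs.optval g z) \<le> (SUP \<tau>\<in>stops_fin M F T i z. stop_reward M X r g z \<tau>)"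
      unfolding rs.SUP_stop_reward[OF g z, symmetric]
    proof (rule SUP_mono)
      fix \<tau> assume "\<tau> \<in> stops_inf F"
      then have st: "stopping_time F (\<lambda>\<omega>. min (\<tau> \<omega>) (ennreal (T - z $ i)))"
        by (auto intro!: stopping_time_min stopping_time_const)
      have "stop_reward M Xa r g z \<tau> \<le> stop_reward M X r g z (\<lambda>\<omega>. min (\<tau> \<omega>) (ennreal (T - z $ i)))"
        using cap[OF g z, of \<tau>] stop_le[OF z, of "\<lambda>\<omega>. min (\<tau> \<omega>) (ennreal (T - z $ i))" g] by simp
      then show "\<exists>\<sigma>\<in>stops_fin M F T i z. stop_reward M Xa r g z \<tau> \<le> stop_reward M X r g z \<sigma>"
        using st by (intro bexI[of _ "\<lambda>\<omega>. min (\<tau> \<omega>) (ennreal (T - z $ i))"]) auto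
    qed
  qed
  have eq: "value_eq_fin M F X D r p \<phi> \<psi> T i v \<longleftrightarrow> (\<forall>x\<in>strip T i. v x = rs.\<Gamma> v x)" if "v \<in> A_fin T i" for v
    using rs.optval_equation_iff[OF adm[OF that]] rs.SUP_stop_reward[OF rs.adm_obst[OF adm[OF that]]] SUP[OF rs.adm_obst[OF adm[OF that]]]
    unfolding value_eq_fin_def obst by simp
  have "(v \<in> A_fin T i \<and> value_eq_fin M F X D r p \<phi> \<psi> T i v) \<longleftrightarrow> (v \<in> A_fin T i \<and> (\<forall>x\<in>strip T i. v x = rs.\<Gamma> v x))" for v
    using eq by blast
  then show "\<exists>!v. v \<in> A_fin T i \<and> value_eq_fin M F X D r p \<phi> \<psi> T i v"
    using rs.ex1_fixed_point[of "spatial_norm i"] unfolding weight_def by simp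
  assume v: "v \<in> A_fin T i" "value_eq_fin M F X D r p \<phi> \<psi> T i v" and z: "z \<in> strip T i"
  have av: "rs.adm v" and fv: "\<And>x. x \<in> strip T i \<Longrightarrow> v x = rs.\<Gamma> v x" using v eq adm by auto
  have ao: "rs.adm (rs.obst v)" by (rule rs.adm_obst[OF av])
  \<comment> \<open>From a state with time coordinate \<open>T\<close> the absorbed flow never
    moves, so stopping at once is optimal and contact takes place. Hence \<open>tau_star\<close>
    does not exceed the lifetime almost surely, which makes it admissible.\<close>
  have terminal: "v y = rs.obst v y" if y: "y \<in> strip T i" "y $ i = T" for y
  proof (rule antisym)
    have "rs.optval (rs.obst v) y \<le> rs.obst v y"
    proof (rule rs.optval_least)
      fix \<tau> assume \<tau>: "stopping_time F \<tau>"
      have "rs.reward (rs.obst v) y \<tau> \<le> (\<integral>\<omega>. rs.obst v y \<partial>M)"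
        unfolding rs.reward_def
      proof (rule integral_mono_AE[OF rs.reward_integrable[OF ao y(1) \<tau>]])
        show "AE \<omega> in M. stopval (rs.disc (rs.obst v) y) \<tau> \<omega> \<le> rs.obst v y"
          using X_start[of y]
        proof eventually_elim
          case (elim \<omega>)
          have "Xa t y \<omega> = y" if "0 \<le> t" for t using elim that y(2) by (simp add: Xa_def)
          then show ?case
            using rs.adm_nonneg[OF ao y(1)] r_pos mult_right_mono[of "exp (- r * enn2real (\<tau> \<omega>))" 1 "rs.obst v y"]
            by (simp add: stopval_def rs.disc_def)
        qed
      qed simp
      then show "rs.reward (rs.obst v) y \<tau> \<le> rs.obst v y" using prob_space by simp
    qed
    then show "v y \<le> rs.obst v y" using fv[OF y(1)] by (simp add: rs.\<Gamma>_def)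
    interpret o: obstacle_problem M F Xa "strip T i" weight r \<kappa> "rs.obst v" by (rule rs.obstacle_problem[OF ao])
    show "rs.obst v y \<le> v y" using o.g_le_V[OF y(1)] fv[OF y(1)] by (simp add: rs.\<Gamma>_def rs.optval_def o.V_def)
  qed
  define a where "a = T - z $ i"
  have a: "0 \<le> a" using horizon_bounds[OF z] by (simp add: a_def)
  define \<tau> where "\<tau> = tau_star X v (rs.obst v) (J_fin T i) z"
  have at_a: "AE \<omega> in M. v (X a z \<omega>) = rs.obst v (X a z \<omega>)"
    using time_coordinate[OF z] rs.X_in_S[OF z]
  proof eventually_elim
    case (elim \<omega>)
    have "X a z \<omega> \<in> strip T i" using elim(2)[rule_format, OF a] Xa_eq[of a z] by (simp add: a_def)
    moreover have "X a z \<omega> $ i = T" using elim(1) a by (simp add: a_def)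
    ultimately show ?case by (rule terminal)
  qed
  have \<tau>: "AE \<omega> in M. \<tau> \<omega> = Inf (ennreal ` {t. 0 \<le> t \<and> v (Xa t z \<omega>) = rs.obst v (Xa t z \<omega>)})"
    using at_a
  proof eventually_elim
    case (elim \<omega>)
    show ?case
      unfolding \<tau>_def tau_star_def
    proof (rule antisym)
      show "Inf (ennreal ` {s \<in> J_fin T i z. v (X s z \<omega>) = rs.obst v (X s z \<omega>)}) \<le>
        Inf (ennreal ` {t. 0 \<le> t \<and> v (Xa t z \<omega>) = rs.obst v (Xa t z \<omega>)})"
      proof (rule Inf_greatest, clarify)
        fix t assume t: "0 \<le> t" "v (Xa t z \<omega>) = rs.obst v (Xa t z \<omega>)"
        \<comment> \<open>A contact of the absorbed flow after absorption is already a contact at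
          the lifetime \<open>a\<close>.\<close>
        have "Inf (ennreal ` {s \<in> J_fin T i z. v (X s z \<omega>) = rs.obst v (X s z \<omega>)}) \<le> ennreal (min t a)"
          using t a by (intro Inf_lower imageI) (auto simp: Xa_def a_def)
        also have "\<dots> \<le> ennreal t" by (intro ennreal_leI) simp
        finally show "Inf (ennreal ` {s \<in> J_fin T i z. v (X s z \<omega>) = rs.obst v (X s z \<omega>)}) \<le> ennreal t" .
      qed
      show "Inf (ennreal ` {t. 0 \<le> t \<and> v (Xa t z \<omega>) = rs.obst v (Xa t z \<omega>)}) \<le>
        Inf (ennreal ` {s \<in> J_fin T i z. v (X s z \<omega>) = rs.obst v (X s z \<omega>)})"
        by (rule Inf_superset_mono) (auto simp: Xa_eq)
    qed
  qed
  have \<tau>_le: "AE \<omega> in M. \<tau> \<omega> \<le> ennreal (T - z $ i)"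
    using at_a
  proof eventually_elim
    case (elim \<omega>)
    then show ?case
      unfolding \<tau>_def tau_star_def using a by (intro Inf_lower imageI) (auto simp: a_def)
  qed
  note va = rs.value_attained[OF av fv z \<tau>]
  let ?I = "{0..ennreal (T - z $ i)}"
  let ?Y = "\<lambda>s \<omega>. disc_eval r v (\<lambda>u. X u z \<omega>) s" and ?Ya = "\<lambda>s \<omega>. disc_eval r v (\<lambda>u. Xa u z \<omega>) s"
  let ?Z = "\<lambda>s \<omega>. disc_eval r v (\<lambda>u. X u z \<omega>) (min s (\<tau> \<omega>))"
    and ?Za = "\<lambda>s \<omega>. disc_eval r v (\<lambda>u. Xa u z \<omega>) (min s (\<tau> \<omega>))"
  have Y: "?Y s \<omega> = ?Ya s \<omega>" and Z: "?Z s \<omega> = ?Za s \<omega>" if "s \<in> ?I" for s \<omega>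
    using that by (auto intro!: disc_eval_absorbed[OF z] simp: min_le_iff_disj)
  have Yf: "?Y s = ?Ya s" and Zf: "?Z s = ?Za s" if "s \<in> ?I" for s
    using Y[OF that] Z[OF that] by auto
  have I: "s \<in> {0..<\<infinity>}" if "s \<in> ?I" for s using that by (auto simp: less_top[symmetric] top_unique)
  have "optimal_in M X r (rs.obst v) z (stops_fin M F T i z) \<tau>"
    unfolding optimal_in_def SUP[OF ao z]
    using stop_le[OF z \<tau>_le, of "rs.obst v"] rs.stop_reward_eq[OF ao z va(1)] va(1,2) fv[OF z] \<tau>_le
    by (simp add: rs.\<Gamma>_def)
  moreover have "supermartingale_on M F ?I ?Y"
    by (rule supermartingale_on_subset[OF va(3) _ Yf]) auto
  moreover have "martingale_on M F ?I ?Z"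
    by (rule martingale_on_subset[OF va(4) _ Zf]) (use I in blast)+
  moreover have "right_continuous_on M ?I ?Y"
    by (rule right_continuous_on_cong[OF Y rs.right_continuous_disc_eval(1)[OF av z]])
  moreover have "right_continuous_on M ?I ?Z"
    by (rule right_continuous_on_cong[OF Z rs.right_continuous_disc_eval(2)[OF av z]])
  moreover have "nonneg_on M ?I ?Y"
    using rs.nonneg_disc_eval(1)[OF av z, of ?I] Y unfolding nonneg_on_def by (auto elim!: eventually_mono)
  moreover have "nonneg_on M ?I ?Z"
    using rs.nonneg_disc_eval(2)[OF av z, of ?I \<tau>] Z unfolding nonneg_on_def by (auto elim!: eventually_mono)
  ultimately show ?claim
    unfolding Let_def obst \<tau>_def[symmetric] by (intro conjI)
qed

end

theorem theorem3p1:
  fixes M :: "'a measure" and F :: "ennreal \<Rightarrow> 'a measure"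
    and X :: "real \<Rightarrow> real^'d \<Rightarrow> 'a \<Rightarrow> real^'d" and D :: "real measure"
    and r p T :: real and i :: 'd and \<phi> \<psi> :: "real^'d \<Rightarrow> real"
  shows
   "(infinite_horizon M F X D r p \<phi> \<psi> \<longrightarrow>
      (\<exists>!v. v \<in> A_inf \<and> value_eq_inf M F X D r p \<phi> \<psi> v) \<and>
      (\<forall>v. v \<in> A_inf \<and> value_eq_inf M F X D r p \<phi> \<psi> v \<longrightarrow>
        (\<forall>x. let g = obstacle M X D r p \<phi> \<psi> J_inf v;
                 \<tau>s = tau_star X v g J_inf x;
                 Y = (\<lambda>t \<omega>. disc_eval r v (\<lambda>s. X s x \<omega>) t);
                 Z = (\<lambda>t \<omega>. disc_eval r v (\<lambda>s. X s x \<omega>) (min t (\<tau>s \<omega>)))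
             in optimal_in M X r g x (stops_inf F) \<tau>s \<and>
                supermartingale_on M F {0..\<infinity>} Y \<and>
                right_continuous_on M {0..\<infinity>} Y \<and> nonneg_on M {0..\<infinity>} Y \<and>
                martingale_on M F {0..<\<infinity>} Z \<and>
                right_continuous_on M {0..<\<infinity>} Z \<and> nonneg_on M {0..<\<infinity>} Z)))
    \<and>
    (finite_horizon M F X D r p \<phi> \<psi> T i \<longrightarrow>
      (\<exists>!v. v \<in> A_fin T i \<and> value_eq_fin M F X D r p \<phi> \<psi> T i v) \<and>
      (\<forall>v. v \<in> A_fin T i \<and> value_eq_fin M F X D r p \<phi> \<psi> T i v \<longrightarrow>
        (\<forall>z\<in>strip T i.
             let g = obstacle M X D r p \<phi> \<psi> (J_fin T i) v;
                 \<tau>s = tau_star X v g (J_fin T i) z;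
                 Y = (\<lambda>s \<omega>. disc_eval r v (\<lambda>u. X u z \<omega>) s);
                 Z = (\<lambda>s \<omega>. disc_eval r v (\<lambda>u. X u z \<omega>) (min s (\<tau>s \<omega>)));
                 I = {0..ennreal (T - z $ i)}
             in optimal_in M X r g z (stops_fin M F T i z) \<tau>s \<and>
                supermartingale_on M F I Y \<and>
                right_continuous_on M I Y \<and> nonneg_on M I Y \<and>
                martingale_on M F I Z \<and>
                right_continuous_on M I Z \<and> nonneg_on M I Z)))"
  by (intro conjI impI allI ballI; (elim conjE)?;
      rule infinite_horizon.infinite_horizon_result finite_horizon.finite_horizon_result; assumption)

end
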